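(* For each real $p \ge 1$ there is a constant $K_p > 0$ such that with probability $1$, for all sufficiently large $n$, \[ W_p(\mu_n, \nu) \le K_p \frac{\sqrt{\log n}}{n^{1/4}} \quad\text{when } 1 \le p \le 2, \] and \[ W_p(\mu_n, \nu) \le K_p \left(\frac{\log n}{n}\right)^{1/(2p)} \quad\text{when } p > 2, \] where $\mu_n$ is the empirical spectral measure of $\frac{1}{\sqrt n}G_n$, $G_n$ is an $n\times n$ complex Ginibre matrix, and $\nu$ is the uniform probability measure on the closed unit disc of $\mathbb{C}$.
   Context: For each $n\ge1$, $G_n$ is an $n\times n$ random matrix with i.i.d. standard complex Gaussian entries (each entry has density $\frac1\pi e^{-|z|^2}$ on $\mathbb{C}$; equivalently $G_n$ has density proportional to $e^{-\operatorname{tr}(GG^* )}$). The matrices $G_n$, $n\ge 1$, are defined on a common probability space; no assumption is made on their joint distribution for different $n$. The empirical spectral measure is $\mu_n = \frac1n\sum_{k=1}^n \delta_{\lambda_k}$, where $\lambda_1,\dots,\lambda_n$ are the eigenvalues of $\frac{1}{\sqrt n}G_n$ (with multiplicity). $\nu$ is the uniform probability measure on $D=\{z\in\mathbb{C} : |z|\le 1\}$. For probability measures $\mu,\rho$ on $\mathbb{C}$ and $p\ge1$, $W_p(\mu,\rho)=\left(\inf_{\pi\in\Pi(\mu,\rho)}\int |w-z|^p\,d\pi(w,z)\right)^{1/p}$, where $\Pi(\mu,\rho)$ is the set of probability measures on $\mathbb{C}\times\mathbb{C}$ with marginals $\mu$ and $\rho$. *)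

theory Defs
  imports
    "HOL-Probability.Probability"
    "HOL-Computational_Algebra.Fundamental_Theorem_Algebra"
    "Jordan_Normal_Form.Char_Poly"
begin

definition std_complex_gaussian_density :: "complex \<Rightarrow> ennreal" where
  "std_complex_gaussian_density z = ennreal (exp (- (cmod z)\<^sup>2) / pi)"

definition ginibre_matrix :: "'a measure \<Rightarrow> nat \<Rightarrow> ('a \<Rightarrow> complex mat) \<Rightarrow> bool" where
  "ginibre_matrix M n G \<longleftrightarrow>
     prob_space M \<and>
     (\<forall>\<omega>\<in>space M. G \<omega> \<in> carrier_mat n n) \<and>
     (\<forall>i<n. \<forall>j<n. distributed M lborel (\<lambda>\<omega>. G \<omega> $$ (i, j)) std_complex_gaussian_density) \<and>
     prob_space.indep_vars M (\<lambda>_. borel) (\<lambda>ij \<omega>. G \<omega> $$ ij) ({..<n} \<times> {..<n})"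

text \<open>Eigenvalues are repeated according to algebraic multiplicity.\<close>

definition eigenvalues_mset :: "complex mat \<Rightarrow> complex multiset" where
  "eigenvalues_mset A = proots (char_poly A)"

text \<open>
  The push-forward along the identity only replaces the discrete sigma-algebra carried by a
  PMF with the Borel one. The definition is meaningful for square matrices of dimension at
  least 1, for which there is at least one eigenvalue.
\<close>

definition empirical_spectral_measure :: "complex mat \<Rightarrow> complex measure" where
  "empirical_spectral_measure A =
     distr (measure_pmf (pmf_of_multiset (eigenvalues_mset A))) borel (\<lambda>z. z)"

lemma size_eigenvalues_mset:
  assumes "A \<in> carrier_mat n n"
  shows "size (eigenvalues_mset A) = n"
  using degree_monic_char_poly[OF assms]
  by (simp add: eigenvalues_mset_def size_proots_complex)

lemma measure_empirical_spectral_measure: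
  assumes A: "A \<in> carrier_mat n n" and n: "n \<ge> 1" and S: "S \<in> sets borel"
  shows "measure (empirical_spectral_measure A) S =
           real (size (filter_mset (\<lambda>z. z \<in> S) (eigenvalues_mset A))) / real n"
proof -
  let ?E = "eigenvalues_mset A"
  have ne: "?E \<noteq> {#}" using size_eigenvalues_mset[OF A] n by auto
  have "measure (empirical_spectral_measure A) S = measure (measure_pmf (pmf_of_multiset ?E)) S"
    unfolding empirical_spectral_measure_def using S by (subst measure_distr) auto
  also have "\<dots> = measure (measure_pmf (pmf_of_multiset ?E)) (S \<inter> set_pmf (pmf_of_multiset ?E))"
    by (rule measure_Int_set_pmf[symmetric])
  also have "\<dots> = (\<Sum>z\<in>S \<inter> set_mset ?E. pmf (pmf_of_multiset ?E) z)"
    using ne by (subst measure_measure_pmf_finite) auto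
  also have "\<dots> = (\<Sum>z\<in>S \<inter> set_mset ?E. real (count ?E z) / real n)"
    using ne size_eigenvalues_mset[OF A] by simp
  also have "\<dots> = real (\<Sum>z\<in>S \<inter> set_mset ?E. count ?E z) / real n"
    by (simp add: sum_divide_distrib)
  also have "(\<Sum>z\<in>S \<inter> set_mset ?E. count ?E z) = size (filter_mset (\<lambda>z. z \<in> S) ?E)"
    unfolding size_multiset_overloaded_eq by (intro sum.cong) auto
  finally show ?thesis .
qed

definition uniform_disc_measure :: "complex measure" where
  "uniform_disc_measure = uniform_measure lborel (cball 0 1)"

definition couplings ::
    "complex measure \<Rightarrow> complex measure \<Rightarrow> (complex \<times> complex) measure set" where
  "couplings \<mu> \<rho> =
     {\<pi>. prob_space \<pi> \<and> sets \<pi> = sets borel \<and> distr \<pi> borel fst = \<mu> \<and> distr \<pi> borel snd = \<rho>}"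

definition transport_cost :: "real \<Rightarrow> complex measure \<Rightarrow> complex measure \<Rightarrow> ennreal" where
  "transport_cost p \<mu> \<rho> =
     (INF \<pi>\<in>couplings \<mu> \<rho>. \<integral>\<^sup>+(w, z). ennreal (cmod (w - z) powr p) \<partial>\<pi>)"

text \<open>
  The distance takes values in the extended nonnegative reals. The infinite case is separated
  because the conversion to real numbers maps infinity to 0.
\<close>

definition wasserstein :: "real \<Rightarrow> complex measure \<Rightarrow> complex measure \<Rightarrow> ennreal" where
  "wasserstein p \<mu> \<rho> =
     (if transport_cost p \<mu> \<rho> = \<infinity> then \<infinity>
      else ennreal (enn2real (transport_cost p \<mu> \<rho>) powr (1 / p)))"

end

theory Submission
  imports Defs
begin

text \<open>
  The eigenvalues are controlled through their logarithmic potential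
  \<open>log_potential L u = (\<Sum>l\<in>#L. ln |u - l|)\<close>, the logarithm of the modulus of the characteristic polynomial at
  \<open>u\<close>. It is compared with \<open>n\<close> times \<open>log_avg 1\<close>, the potential of the uniform measure on the disc.

  Two pointwise moments are enough, those of \<open>|det (z - G)|\<close> for the exponents \<open>2\<close> and \<open>-1\<close>. The Gaussian columns
  are integrated out one at a time: given the other columns, the Gram determinant is multiplied
  by a noncentral gamma variable (\<open>nn_integral_gdet_column\<close>). After rescaling, the two moments are at most
  \<open>exp (2 n log_avg 1)\<close> and \<open>exp (- n log_avg 1)\<close> times a factor polynomial in \<open>n\<close> (\<open>gin_moment_upper\<close>,
  \<open>gin_moment_lower\<close>). If \<open>\<xi>\<close> denotes the difference of the two potentials, it follows that the integral of
  \<open>exp (2 \<xi>) + exp (- \<xi>)\<close> over a large disc has polynomial mean, and by the Borel-Cantelli lemma it is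
  almost surely at most \<open>n\<^sup>3\<close> for large \<open>n\<close> (\<open>AE_eventually_potential_defect\<close>). This one event bounds the integral of
  \<open>|\<xi>|\<close> over every region of area \<open>s\<close> by a multiple of \<open>s ln n\<close>, up to a negligible term
  (\<open>nn_integral_potential_le\<close>). A further exponential moment shows that all eigenvalues of the normalised matrix
  lie in the disc of radius 4 (\<open>AE_eventually_eigenvalues_bounded\<close>).

  To count eigenvalues in a region \<open>E\<close>, its indicator function is mollified at scale \<open>\<eta>\<close> with the difference of two disc
  averages of the logarithm. By Newton's theorem the result is itself the potential of a bounded charge
  carried by the boundary layer of \<open>E\<close> of width about \<open>\<eta>\<close>, so its sum over the eigenvalues is the integral of
  \<open>log_potential\<close> against this charge (\<open>sum_smooth_ind\<close>). Hence the number of eigenvalues in \<open>E\<close> differs from \<open>n / \<pi>\<close> times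
  the area of the part of \<open>E\<close> in the unit disc by at most a multiple of \<open>n \<eta>\<close>, if the boundary of \<open>E\<close> has bounded length and
  \<open>\<eta>\<^sup>2 = ln n / n\<close> (\<open>count_le_area\<close>, \<open>spiral_discrepancy\<close>).

  Finally the unit disc is cut into \<open>J\<^sup>2\<close> polar cells of equal area, numbered along a spiral. Initial segments of the
  numbering have boundaries of bounded length, so their masses under the two measures differ by at most a multiple of
  \<open>\<eta>\<close>. The quantile coupling with respect to this numbering (\<open>ex_quantile_coupling\<close>) moves mass only between cells whose
  numbers differ by at most a multiple of \<open>J\<^sup>2 \<eta> + 1\<close>. With \<open>J\<^sup>2 \<approx> 1 / \<eta>\<close> such cells are at distance of order \<open>sqrt \<eta>\<close>. The
  eigenvalues outside the disc, a fraction of order at most \<open>\<eta>\<close>, are moved over a bounded distance. The transport cost is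
  therefore at most of order \<open>sqrt \<eta> powr p + \<eta>\<close>, and the two regimes of the theorem correspond to the dominating summand.
\<close>

section \<open>Lebesgue measure on the complex plane\<close>

lemma lborel_complex_eq_distr:
  "lborel = distr (lborel \<Otimes>\<^sub>M lborel) borel (\<lambda>(x,y). Complex x y)"
proof (rule lborel_eqI)
  fix l u :: complex assume le: "\<And>b. b \<in> Basis \<Longrightarrow> l \<bullet> b \<le> u \<bullet> b"
  have le': "Re l \<le> Re u" "Im l \<le> Im u"
    using le[of 1] le[of \<i>] by (auto simp: Basis_complex_def)
  have "(\<lambda>(x,y). Complex x y) -` box l u = {Re l<..<Re u} \<times> {Im l<..<Im u}"
    by (auto simp: box_def Basis_complex_def)
  then show "emeasure (distr (lborel \<Otimes>\<^sub>M lborel) borel (\<lambda>(x,y). Complex x y)) (box l u) = (\<Prod>b\<in>Basis. (u - l) \<bullet> b)"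
    using le' by (subst emeasure_distr)
      (auto simp: space_pair_measure lborel.emeasure_pair_measure_Times Basis_complex_def ennreal_mult
         borel_prod split_beta' Complex_eq)
qed auto

lemma nn_integral_lborel_complex:
  assumes f[measurable]: "f \<in> borel_measurable borel"
  shows "(\<integral>\<^sup>+z. f z \<partial>lborel) = (\<integral>\<^sup>+x. \<integral>\<^sup>+y. f (Complex x y) \<partial>lborel \<partial>lborel)"
    and "(\<integral>\<^sup>+z. f z \<partial>lborel) = (\<integral>\<^sup>+y. \<integral>\<^sup>+x. f (Complex x y) \<partial>lborel \<partial>lborel)"
proof -
  have m: "(\<lambda>p. Complex (fst p) (snd p)) \<in> borel_measurable (borel \<Otimes>\<^sub>M borel)"
    unfolding Complex_eq by measurable
  have [measurable]: "(\<lambda>p. f (Complex (fst p) (snd p))) \<in> borel_measurable (borel \<Otimes>\<^sub>M borel)"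
    by (rule measurable_compose[OF m f])
  have "(\<integral>\<^sup>+z. f z \<partial>lborel) = (\<integral>\<^sup>+p. f (Complex (fst p) (snd p)) \<partial>(lborel \<Otimes>\<^sub>M lborel))"
    by (subst lborel_complex_eq_distr, subst nn_integral_distr)
       (use m in \<open>auto simp: split_beta'\<close>)
  also have "\<dots> = (\<integral>\<^sup>+x. \<integral>\<^sup>+y. f (Complex x y) \<partial>lborel \<partial>lborel)"
    by (subst lborel.nn_integral_fst[symmetric]) auto
  finally show 1: "(\<integral>\<^sup>+z. f z \<partial>lborel) = (\<integral>\<^sup>+x. \<integral>\<^sup>+y. f (Complex x y) \<partial>lborel \<partial>lborel)" .
  show "(\<integral>\<^sup>+z. f z \<partial>lborel) = (\<integral>\<^sup>+y. \<integral>\<^sup>+x. f (Complex x y) \<partial>lborel \<partial>lborel)"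
    unfolding 1 by (rule lborel_pair.Fubini'[symmetric]) auto
qed

lemma nn_integral_lborel_translate:
  fixes f :: "'a::euclidean_space \<Rightarrow> ennreal"
  assumes [measurable]: "f \<in> borel_measurable borel"
  shows "(\<integral>\<^sup>+z. f (c + z) \<partial>lborel) = (\<integral>\<^sup>+z. f z \<partial>lborel)"
  by (subst (2) lborel_distr_plus[symmetric, of c]) (simp add: nn_integral_distr)

lemma nn_integral_lborel_shear:
  fixes f :: "complex \<Rightarrow> ennreal" and p :: real
  assumes f[measurable]: "f \<in> borel_measurable borel"
  shows "(\<integral>\<^sup>+z. f (Complex (Re z + p * Im z) (Im z)) \<partial>lborel) = (\<integral>\<^sup>+z. f z \<partial>lborel)"
    and "(\<integral>\<^sup>+z. f (Complex (Re z) (Im z + p * Re z)) \<partial>lborel) = (\<integral>\<^sup>+z. f z \<partial>lborel)"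
proof -
  have [measurable]: "(\<lambda>x. f (Complex (g x) (h x))) \<in> borel_measurable borel"
    if [measurable]: "g \<in> borel_measurable borel" "h \<in> borel_measurable borel" for g h :: "'x::topological_space \<Rightarrow> real"
    unfolding Complex_eq by measurable
  have "(\<integral>\<^sup>+x. f (Complex (x + p * y) y) \<partial>lborel) = (\<integral>\<^sup>+x. f (Complex x y) \<partial>lborel)" for y
    using nn_integral_lborel_translate[of "\<lambda>x. f (Complex x y)" "p*y"] by (simp add: add.commute)
  then show "(\<integral>\<^sup>+z. f (Complex (Re z + p * Im z) (Im z)) \<partial>lborel) = (\<integral>\<^sup>+z. f z \<partial>lborel)"
    by (subst (1 2) nn_integral_lborel_complex(2)) auto
  have "(\<integral>\<^sup>+y. f (Complex x (y + p * x)) \<partial>lborel) = (\<integral>\<^sup>+y. f (Complex x y) \<partial>lborel)" for x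
    using nn_integral_lborel_translate[of "\<lambda>y. f (Complex x y)" "p*x"] by (simp add: add.commute)
  then show "(\<integral>\<^sup>+z. f (Complex (Re z) (Im z + p * Re z)) \<partial>lborel) = (\<integral>\<^sup>+z. f z \<partial>lborel)"
    by (subst (1 2) nn_integral_lborel_complex(1)) auto
qed

text \<open>A rotation by an angle with nonzero sine is a product of three shears.\<close>

lemma nn_integral_lborel_rotate:
  fixes f :: "complex \<Rightarrow> ennreal" and a :: complex
  assumes f[measurable]: "f \<in> borel_measurable borel" and a: "cmod a = 1"
  shows "(\<integral>\<^sup>+z. f (a * z) \<partial>lborel) = (\<integral>\<^sup>+z. f z \<partial>lborel)"
proof -
  have gen: "(\<integral>\<^sup>+z. g (b * z) \<partial>lborel) = (\<integral>\<^sup>+z. g z \<partial>lborel)"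
    if g[measurable]: "g \<in> borel_measurable borel" and b: "cmod b = 1" "Im b \<noteq> 0" for g :: "complex \<Rightarrow> ennreal" and b
  proof -
    let ?p = "(Re b - 1) / Im b"
    let ?X = "\<lambda>z. Complex (Re z + ?p * Im z) (Im z)" and ?Y = "\<lambda>z. Complex (Re z) (Im z + Im b * Re z)"
    have [measurable]: "?X \<in> borel_measurable borel" "?Y \<in> borel_measurable borel"
      unfolding Complex_eq by measurable
    have sq: "(Re b)\<^sup>2 + (Im b)\<^sup>2 = 1" using b(1) by (simp add: cmod_def)
    have "b * z = ?X (?Y (?X z))" for z
    proof (rule complex_eqI)
      have e: "(1 - Re b) * (1 + Re b) = Im b * Im b"
        using sq by (simp add: algebra_simps power2_eq_square)
      show "Im (b * z) = Im (?X (?Y (?X z)))" using b by (simp add: field_simps)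
      have "Re (?X (?Y (?X z))) = Re z * Re b + Im z * ((Re b - 1) * (1 + Re b) / Im b)"
        using b by (simp add: field_simps)
      also have "(Re b - 1) * (1 + Re b) / Im b = - Im b"
        using e b by (simp add: field_simps)
      finally show "Re (b * z) = Re (?X (?Y (?X z)))" by simp
    qed
    then have "(\<integral>\<^sup>+z. g (b * z) \<partial>lborel) = (\<integral>\<^sup>+z. g (?X (?Y (?X z))) \<partial>lborel)" by simp
    also have "\<dots> = (\<integral>\<^sup>+z. g (?X (?Y z)) \<partial>lborel)"
      by (rule nn_integral_lborel_shear(1)[of "\<lambda>z. g (?X (?Y z))"]) measurable
    also have "\<dots> = (\<integral>\<^sup>+z. g (?X z) \<partial>lborel)"
      by (rule nn_integral_lborel_shear(2)[of "\<lambda>z. g (?X z)"]) measurable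
    also have "\<dots> = (\<integral>\<^sup>+z. g z \<partial>lborel)"
      by (rule nn_integral_lborel_shear(1)) measurable
    finally show ?thesis .
  qed
  show ?thesis
  proof (cases "Im a = 0")
    case True
    then have i: "Im (a * \<i>) \<noteq> 0" using a by (auto simp: cmod_def)
    have "(\<integral>\<^sup>+z. f (a * z) \<partial>lborel) = (\<integral>\<^sup>+z. f ((a * \<i>) * (-\<i> * z)) \<partial>lborel)"
      by (simp add: algebra_simps)
    also have "\<dots> = (\<integral>\<^sup>+z. f ((a * \<i>) * z) \<partial>lborel)"
      by (rule gen[of "\<lambda>z. f ((a * \<i>) * z)"]) auto
    also have "\<dots> = (\<integral>\<^sup>+z. f z \<partial>lborel)"
      using i a by (intro gen) (auto simp: norm_mult)
    finally show ?thesis .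
  qed (rule gen[OF f a])
qed

lemma nn_integral_lborel_scale_complex:
  fixes f :: "complex \<Rightarrow> ennreal" and r :: real
  assumes f[measurable]: "f \<in> borel_measurable borel" and r: "r > 0"
  shows "(\<integral>\<^sup>+z. f z \<partial>lborel) = ennreal (r\<^sup>2) * (\<integral>\<^sup>+z. f (of_real r * z) \<partial>lborel)"
  using r by (subst lborel_affine[of r 0])
    (simp_all add: nn_integral_density nn_integral_distr nn_integral_cmult scaleR_conv_of_real ennreal_power)

lemma nn_integral_lborel_mult_complex:
  fixes f :: "complex \<Rightarrow> ennreal" and a :: complex
  assumes f[measurable]: "f \<in> borel_measurable borel" and a: "a \<noteq> 0"
  shows "ennreal ((cmod a)\<^sup>2) * (\<integral>\<^sup>+z. f (a * z) \<partial>lborel) = (\<integral>\<^sup>+z. f z \<partial>lborel)"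
proof -
  have "(\<integral>\<^sup>+z. f (a * z) \<partial>lborel) = (\<integral>\<^sup>+z. f (of_real (cmod a) * (sgn a * z)) \<partial>lborel)"
    by (simp add: mult.assoc[symmetric] sgn_eq a)
  also have "\<dots> = (\<integral>\<^sup>+z. f (of_real (cmod a) * z) \<partial>lborel)"
    using a by (intro nn_integral_lborel_rotate) (auto simp: norm_sgn)
  finally show ?thesis using nn_integral_lborel_scale_complex[OF f, of "cmod a"] a by simp
qed

lemma distr_lborel_rotate:
  assumes "cmod a = 1" shows "distr lborel borel ((*) a) = (lborel :: complex measure)"
proof (rule measure_eqI)
  fix X assume "X \<in> sets (distr lborel borel ((*) a))"
  then have X[measurable]: "X \<in> sets borel" by simp
  have "emeasure (distr lborel borel ((*) a)) X = (\<integral>\<^sup>+z. indicator X (a * z) \<partial>lborel)"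
    using nn_integral_distr[of "(*) a" lborel borel "indicator X"] by simp
  also have "\<dots> = emeasure lborel X"
    using assms by (subst nn_integral_lborel_rotate) auto
  finally show "emeasure (distr lborel borel ((*) a)) X = emeasure lborel X" .
qed simp

lemma emeasure_lborel_disc:
  assumes "r \<ge> 0"
  shows "emeasure lborel (cball (z::complex) r) = ennreal (pi * r\<^sup>2)"
    and "emeasure lborel (ball (z::complex) r) = ennreal (pi * r\<^sup>2)"
  using assms by (auto simp: emeasure_cball emeasure_ball eval_unit_ball_vol)

text \<open>The image of Lebesgue measure under \<open>z \<mapsto> |z|\<^sup>2\<close> is \<open>\<pi>\<close> times Lebesgue measure on the
  half-line, since the disc of squared radius \<open>t\<close> has area \<open>\<pi> t\<close>; this replaces polar coordinates.\<close>

lemma distr_lborel_norm_square: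
  "distr lborel borel (\<lambda>z::complex. (cmod z)\<^sup>2) = density lborel (\<lambda>t::real. ennreal pi * indicator {0..} t)"
proof -
  let ?M = "distr lborel borel (\<lambda>z::complex. (cmod z)\<^sup>2)"
  let ?N = "density lborel (\<lambda>t::real. ennreal pi * indicator {0..} t)"
  have MN: "emeasure ?M {..x} = emeasure ?N {..x} \<and> emeasure ?M {..x} \<noteq> \<infinity>" for x
  proof (cases "x \<ge> 0")
    case True
    have "(\<lambda>z::complex. (cmod z)\<^sup>2) -` {..x} = cball 0 (sqrt x)"
      by (auto simp: dist_norm intro: real_le_rsqrt dest: sqrt_ge_absD) (use True real_sqrt_pow2_iff in \<open>smt (verit) norm_ge_zero power_mono\<close>)
    then have "emeasure ?M {..x} = ennreal (pi * x)"
      using True by (subst emeasure_distr) (auto simp: emeasure_lborel_disc)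
    moreover have "emeasure ?N {..x} = (\<integral>\<^sup>+t. ennreal pi * indicator {0..x} t \<partial>lborel)"
      by (subst emeasure_density) (auto intro!: nn_integral_cong split: split_indicator)
    then have "emeasure ?N {..x} = ennreal (pi * x)"
      using True by (simp add: nn_integral_cmult_indicator ennreal_mult)
    ultimately show ?thesis by simp
  next
    case False
    then have "(\<lambda>z::complex. (cmod z)\<^sup>2) -` {..x} = {}"
      by auto (smt (verit) zero_le_power2)
    then have "emeasure ?M {..x} = 0" by (subst emeasure_distr) auto
    moreover have "(\<integral>\<^sup>+t. ennreal pi * indicator {0..} t * indicator {..x} t \<partial>lborel) = (\<integral>\<^sup>+t. 0 \<partial>(lborel::real measure))"
      using False by (intro nn_integral_cong) (auto split: split_indicator)
    then have "emeasure ?N {..x} = 0" by (subst emeasure_density) auto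
    ultimately show ?thesis by simp
  qed
  show eq: "?M = ?N"
  proof (rule measure_eqI_generator_eq[where E="range atMost" and A="\<lambda>n::nat. {..real n}" and \<Omega>=UNIV])
    show "Int_stable (range (atMost :: real \<Rightarrow> _))" by (auto simp: Int_stable_def)
    show "sets ?M = sigma_sets UNIV (range atMost)"
      by (simp add: borel_eq_atMost)
    show "sets ?N = sigma_sets UNIV (range atMost)"
      using borel_eq_atMost[where 'a=real] by (metis sets_density sets_lborel sets_measure_of subset_UNIV Pow_UNIV)
    show "(\<Union>i. {..real i}) = UNIV" by (auto intro: real_arch_simple)
    show "emeasure ?M {..real i} \<noteq> \<infinity>" for i using MN[of "real i"] by blast
  qed (use MN in auto)
qed

lemma nn_integral_lborel_radial:
  fixes f :: "real \<Rightarrow> ennreal"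
  assumes f[measurable]: "f \<in> borel_measurable borel"
  shows "(\<integral>\<^sup>+z. f ((cmod z)\<^sup>2) \<partial>lborel) = ennreal pi * (\<integral>\<^sup>+t. f t * indicator {0..} t \<partial>lborel)"
proof -
  let ?M = "distr lborel borel (\<lambda>z::complex. (cmod z)\<^sup>2)"
  let ?N = "density lborel (\<lambda>t::real. ennreal pi * indicator {0..} t)"
  have "(\<integral>\<^sup>+z. f ((cmod z)\<^sup>2) \<partial>lborel) = (\<integral>\<^sup>+t. f t \<partial>?M)"
    by (simp add: nn_integral_distr)
  also have "\<dots> = (\<integral>\<^sup>+t. f t \<partial>?N)" by (simp only: distr_lborel_norm_square)
  also have "\<dots> = (\<integral>\<^sup>+t. ennreal pi * (f t * indicator {0..} t) \<partial>lborel)"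
    by (subst nn_integral_density) (auto intro!: nn_integral_cong split: split_indicator simp: mult_ac)
  finally show ?thesis by (simp add: nn_integral_cmult)
qed

lemma lborel_integral_rotate:
  fixes f :: "complex \<Rightarrow> real"
  assumes "f \<in> borel_measurable borel" "cmod a = 1"
  shows "(LINT z|lborel. f (a * z)) = (LINT z|lborel. f z)"
  by (subst (2) distr_lborel_rotate[OF assms(2), symmetric], subst integral_distr) (use assms in auto)

section \<open>Averages of the logarithmic kernel over discs\<close>

lemma nn_integral_inverse_norm_unit_disc:
  "(\<integral>\<^sup>+z. ennreal (1 / cmod z) * indicator (ball 0 1) z \<partial>lborel) \<le> ennreal (2 * pi)"
proof -
  have "(\<integral>\<^sup>+z. ennreal (1 / cmod z) * indicator (ball 0 1) z \<partial>lborel)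
     \<le> (\<integral>\<^sup>+z. ennreal (1 / sqrt ((cmod z)\<^sup>2)) * indicator {0..1} ((cmod z)\<^sup>2) \<partial>lborel)"
    by (intro nn_integral_mono) (auto split: split_indicator simp: power_le_one)
  also have "\<dots> = ennreal pi * (\<integral>\<^sup>+t. ennreal (1 / sqrt t) * indicator {0..1} t \<partial>lborel)"
    by (subst nn_integral_lborel_radial[where f="\<lambda>t. ennreal (1 / sqrt t) * indicator {0..1} t"])
       (auto intro!: arg_cong[where f="\<lambda>x. ennreal pi * x"] nn_integral_cong split: split_indicator)
  also have "(\<integral>\<^sup>+t. ennreal (1 / sqrt t) * indicator {0..1} t \<partial>lborel) = ennreal 2"
  proof -
    have "((\<lambda>t. 1 / sqrt t) has_integral (2 * sqrt 1 - 2 * sqrt 0)) {0..1}"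
      by (rule fundamental_theorem_of_calculus_interior)
         (auto intro!: continuous_intros derivative_eq_intros
           simp: has_real_derivative_iff_has_vector_derivative[symmetric] field_simps)
    then have "((\<lambda>t. 1 / sqrt t) has_integral 2) {0..1}" by simp
    from nn_integral_has_integral_lebesgue'[OF _ this] show ?thesis
      by (simp add: nn_integral_completion)
  qed
  also have "ennreal pi * ennreal 2 = ennreal (2 * pi)"
    by (subst ennreal_mult[symmetric]) (auto simp: mult.commute)
  finally show ?thesis .
qed

lemma nn_integral_inverse_norm_le:
  fixes b :: complex
  assumes S[measurable]: "S \<in> sets borel"
  shows "(\<integral>\<^sup>+z. ennreal (1 / cmod (z - b)) * indicator S z \<partial>lborel) \<le> ennreal (2 * pi) + emeasure lborel S"
proof -
  have [measurable]: "ball (0::complex) 1 \<in> sets borel" by simp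
  have "(\<integral>\<^sup>+z. ennreal (1 / cmod (z - b)) * indicator S z \<partial>lborel)
     = (\<integral>\<^sup>+z. ennreal (1 / cmod z) * indicator S (b + z) \<partial>lborel)"
    by (subst nn_integral_lborel_translate[symmetric, where c=b]) auto
  also have "\<dots> \<le> (\<integral>\<^sup>+z. ennreal (1 / cmod z) * indicator (ball 0 1) z + indicator S (b + z) \<partial>lborel)"
    by (intro nn_integral_mono) (auto split: split_indicator simp: divide_le_eq_1 not_less)
  also have "\<dots> = (\<integral>\<^sup>+z. ennreal (1 / cmod z) * indicator (ball 0 1) z \<partial>lborel) + (\<integral>\<^sup>+z. indicator S (b + z) \<partial>lborel)"
    by (intro nn_integral_add) auto
  also have "(\<integral>\<^sup>+z. indicator S (b + z) \<partial>lborel) = emeasure lborel S"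
    by (subst nn_integral_lborel_translate) auto
  finally show ?thesis using nn_integral_inverse_norm_unit_disc
    by (meson add_right_mono order_trans)
qed

lemma abs_ln_le_add_inverse: "\<bar>ln x\<bar> \<le> x + 1 / x" if "x \<ge> 0" for x :: real
proof (cases "x = 0")
  case False
  then have x: "x > 0" using that by simp
  have "ln x \<le> x - 1" "ln (1/x) \<le> 1/x - 1" using x by (auto intro!: ln_le_minus_one simp del: ln_divide_pos)
  moreover have "1 / x > 0" "ln (1 / x) = - ln x" using x by (simp_all add: ln_div)
  ultimately show ?thesis using x by linarith
qed simp

text \<open>The logarithmic kernel is locally integrable because \<open>1/|z|\<close> is.\<close>

lemma set_integrable_ln_norm_diff:
  fixes b :: complex
  assumes S: "S \<in> sets borel" "bounded S"
  shows "set_integrable lborel S (\<lambda>z. ln (cmod (z - b)))"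
proof -
  obtain r where r: "\<And>z. z \<in> S \<Longrightarrow> cmod z \<le> r" using S by (auto simp: bounded_iff)
  have fin: "emeasure lborel S < \<infinity>" using emeasure_bounded_finite[OF S(2)] .
  have m[measurable]: "S \<in> sets borel" by fact
  have "(\<integral>\<^sup>+z. ennreal (norm (indicator S z *\<^sub>R ln (cmod (z - b)))) \<partial>lborel)
     \<le> (\<integral>\<^sup>+z. ennreal (\<bar>r\<bar> + cmod b) * indicator S z + ennreal (1 / cmod (z - b)) * indicator S z \<partial>lborel)"
  proof (intro nn_integral_mono)
    fix z
    have "\<bar>ln (cmod (z - b))\<bar> \<le> (\<bar>r\<bar> + cmod b) + 1 / cmod (z - b)" if "z \<in> S"
      using abs_ln_le_add_inverse[of "cmod (z - b)"] r[OF that] norm_triangle_ineq4[of z b] by simp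
    then show "ennreal (norm (indicator S z *\<^sub>R ln (cmod (z - b))))
      \<le> ennreal (\<bar>r\<bar> + cmod b) * indicator S z + ennreal (1 / cmod (z - b)) * indicator S z"
      by (auto split: split_indicator simp del: ennreal_plus simp: ennreal_plus[symmetric])
  qed
  also have "\<dots> = ennreal (\<bar>r\<bar> + cmod b) * emeasure lborel S + (\<integral>\<^sup>+z. ennreal (1 / cmod (z - b)) * indicator S z \<partial>lborel)"
    by (subst nn_integral_add) (auto simp: nn_integral_cmult_indicator)
  also have "\<dots> < \<infinity>"
  proof -
    have "(\<integral>\<^sup>+z. ennreal (1 / cmod (z - b)) * indicator S z \<partial>lborel) < \<infinity>"
      by (rule order_le_less_trans[OF nn_integral_inverse_norm_le[OF m]]) (use fin in auto)
    then show ?thesis using fin by (simp add: ennreal_mult_less_top)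
  qed
  finally have "(\<integral>\<^sup>+z. ennreal (norm (indicator S z *\<^sub>R ln (cmod (z - b)))) \<partial>lborel) < \<infinity>" .
  then show ?thesis unfolding set_integrable_def
    by (intro integrableI_bounded) auto
qed

text \<open>Rotating by a root of \<open>-1\<close> and using \<open>(1 - y) (1 + y) = 1 - y\<^sup>2\<close> shows that the integral for the
  exponent \<open>2 ^ k\<close> doubles with each \<open>k\<close>. As it stays bounded, it vanishes. This is the mean value
  property of \<open>ln |1 - x|\<close>, for the arguments \<open>x = z / b\<close> and \<open>x = b / z\<close>.\<close>

lemma rotation_average_ln_zero:
  fixes x :: "complex \<Rightarrow> complex"
  assumes S[measurable]: "S \<in> sets borel" and fin: "emeasure lborel S < \<infinity>"
    and rot: "\<And>w z. cmod w = 1 \<Longrightarrow> w * z \<in> S \<longleftrightarrow> z \<in> S"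
    and x[measurable]: "x \<in> borel_measurable borel"
    and \<rho>: "\<rho> < 1" "\<And>z. z \<in> S \<Longrightarrow> cmod (x z) \<le> \<rho>"
    and root: "\<And>k. \<exists>w. cmod w = 1 \<and> (\<forall>z. x (w * z) ^ (2 ^ k) = - (x z ^ (2 ^ k)))"
  shows "(LINT z:S|lborel. ln (cmod (1 - x z))) = 0"
proof (cases "S = {}")
  case False
  then have \<rho>0: "\<rho> \<ge> 0" using \<rho>(2) by (meson equals0I norm_ge_zero order_trans)
  define I where "I k = (LINT z|lborel. indicator S z * ln (cmod (1 - x z ^ (2 ^ k))))" for k :: nat
  define B where "B = ln 2 - ln (1 - \<rho>)"
  have bd: "\<bar>ln (cmod (1 - y))\<bar> \<le> B" "1 - y \<noteq> 0" if "cmod y \<le> \<rho>" for y :: complex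
  proof -
    have l: "1 - \<rho> \<le> cmod (1 - y)" using that norm_triangle_ineq2[of 1 y] by simp
    have u: "cmod (1 - y) \<le> 2" using that \<rho> norm_triangle_ineq4[of 1 y] by simp
    have "ln (1 - \<rho>) \<le> ln (cmod (1 - y))" "ln (cmod (1 - y)) \<le> ln 2"
      using l u \<rho> by (subst ln_le_cancel_iff; linarith)+
    moreover have "ln (1 - \<rho>) \<le> 0" "ln (2::real) \<ge> 0" using \<rho> \<rho>0 by auto
    ultimately show "\<bar>ln (cmod (1 - y))\<bar> \<le> B" unfolding B_def by linarith
    show "1 - y \<noteq> 0" using l \<rho> by auto
  qed
  have pw: "cmod (x z ^ (2 ^ k)) \<le> \<rho>" if "z \<in> S" for z k
  proof -
    have "cmod (x z ^ (2 ^ k)) \<le> \<rho> ^ (2 ^ k)" using \<rho>(2)[OF that] by (simp add: norm_power power_mono)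
    also have "\<dots> \<le> \<rho> ^ 1" using \<rho> \<rho>0 by (intro power_decreasing) auto
    finally show ?thesis by simp
  qed
  have int: "integrable lborel (\<lambda>z. indicator S z * ln (cmod (1 + c * x z ^ (2 ^ k))))" if "cmod c = 1" for k c
  proof (rule Bochner_Integration.integrable_bound)
    show "integrable lborel (\<lambda>z. B * indicator S z)"
      using fin by (intro integrable_mult_right) auto
    show "AE z in lborel. norm (indicator S z * ln (cmod (1 + c * x z ^ (2 ^ k)))) \<le> norm (B * indicator S z)"
      using bd(1)[of "- (c * x z ^ (2 ^ k))" for z] pw that
      by (intro AE_I2) (auto split: split_indicator simp: norm_mult intro!: order_trans[OF _ abs_ge_self])
  qed auto
  have dbl: "I (Suc k) = 2 * I k" for k
  proof -
    obtain w where w: "cmod w = 1" "\<And>z. x (w * z) ^ (2 ^ k) = - (x z ^ (2 ^ k))" using root[of k] by auto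
    have "I k = (LINT z|lborel. indicator S (w * z) * ln (cmod (1 - x (w * z) ^ (2 ^ k))))"
      unfolding I_def using w by (subst lborel_integral_rotate[of "\<lambda>z. indicator S z * ln (cmod (1 - x z ^ (2 ^ k)))" w]) auto
    also have "\<dots> = (LINT z|lborel. indicator S z * ln (cmod (1 + x z ^ (2 ^ k))))"
      using w rot by (auto intro!: Bochner_Integration.integral_cong split: split_indicator)
    finally have "I k + I k = (LINT z|lborel. indicator S z * ln (cmod (1 - x z ^ (2 ^ k)))) + (LINT z|lborel. indicator S z * ln (cmod (1 + x z ^ (2 ^ k))))"
      unfolding I_def by simp
    also have "\<dots> = (LINT z|lborel. indicator S z * ln (cmod (1 - x z ^ (2 ^ k))) + indicator S z * ln (cmod (1 + x z ^ (2 ^ k))))"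
      using int[of "-1" k] int[of 1 k] by (intro Bochner_Integration.integral_add[symmetric]) auto
    also have "\<dots> = I (Suc k)"
      unfolding I_def
    proof (intro Bochner_Integration.integral_cong refl)
      fix z
      have "ln (cmod (1 - x z ^ (2 ^ k))) + ln (cmod (1 + x z ^ (2 ^ k))) = ln (cmod (1 - x z ^ (2 ^ Suc k)))" if "z \<in> S"
      proof -
        have "1 - x z ^ (2 ^ k) \<noteq> 0" "1 + x z ^ (2 ^ k) \<noteq> 0"
          using bd(2)[of "x z ^ (2 ^ k)"] bd(2)[of "- (x z ^ (2 ^ k))"] pw[OF that] by auto
        then have "ln (cmod (1 - x z ^ (2 ^ k))) + ln (cmod (1 + x z ^ (2 ^ k))) = ln (cmod ((1 - x z ^ (2 ^ k)) * (1 + x z ^ (2 ^ k))))"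
          by (simp add: norm_mult ln_mult_pos)
        also have "(1 - x z ^ (2 ^ k)) * (1 + x z ^ (2 ^ k)) = 1 - x z ^ (2 ^ Suc k)"
          by (simp add: algebra_simps power_mult power2_eq_square power_add[symmetric] mult_2)
        finally show ?thesis .
      qed
      then show "indicator S z * ln (cmod (1 - x z ^ (2 ^ k))) + indicator S z * ln (cmod (1 + x z ^ (2 ^ k))) = indicator S z * ln (cmod (1 - x z ^ (2 ^ Suc k)))"
        by (auto split: split_indicator)
    qed
    finally show ?thesis by simp
  qed
  have Ik: "I k = 2 ^ k * I 0" for k by (induction k) (auto simp: dbl)
  define M where "M = B * measure lborel S"
  have IM: "\<bar>I k\<bar> \<le> M" for k
  proof -
    have "\<bar>I k\<bar> \<le> (LINT z|lborel. \<bar>indicator S z * ln (cmod (1 - x z ^ (2 ^ k)))\<bar>)"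
      unfolding I_def by (rule integral_abs_bound)
    also have "\<dots> \<le> (LINT z|lborel. B * indicator S z)"
      using int[of "-1" k] fin bd(1) pw
      by (intro integral_mono integrable_mult_right) (auto split: split_indicator intro: integrable_abs)
    also have "\<dots> = M" unfolding M_def by simp
    finally show ?thesis .
  qed
  have "I 0 = 0"
  proof (rule ccontr)
    assume "I 0 \<noteq> 0"
    then obtain k where "M / \<bar>I 0\<bar> < 2 ^ k" using real_arch_pow[of 2 "M / \<bar>I 0\<bar>"] by auto
    then have "M < \<bar>I k\<bar>" using \<open>I 0 \<noteq> 0\<close> unfolding Ik[of k] by (simp add: field_simps abs_mult)
    then show False using IM[of k] by simp
  qed
  then show ?thesis unfolding I_def set_lebesgue_integral_def by simp
qed (simp add: set_lebesgue_integral_def)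

lemma cis_root_minus_one: "cis (pi / 2 ^ k) ^ (2 ^ k) = -1"
proof -
  have "cis (pi / 2 ^ k) ^ (2 ^ k) = cis (real (2 ^ k) * (pi / 2 ^ k))" by (rule Complex.DeMoivre)
  then show ?thesis by simp
qed

lemma disc_average_ln_outside:
  fixes b :: complex
  assumes a: "0 < a" "a \<le> cmod b"
  shows "(LINT z:ball 0 a|lborel. ln (cmod (z - b))) = pi * a\<^sup>2 * ln (cmod b)"
proof -
  have b: "b \<noteq> 0" using a by auto
  define s where "s n = a * (1 - 1 / (real n + 1))" for n
  have s: "s n < a" "s n \<ge> 0" for n using a by (auto simp: s_def field_simps)
  have incs: "incseq s" using a by (auto simp: s_def incseq_def field_simps)
  have slim: "s \<longlonglongrightarrow> a" unfolding s_def by real_asymp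
  have U: "(\<Union>n. ball (0::complex) (s n)) = ball 0 a"
  proof (rule equalityI; rule subsetI)
    fix z :: complex assume "z \<in> ball 0 a"
    then obtain n where "cmod z < s n" using order_tendstoD(1)[OF slim, of "cmod z"] by (auto simp: eventually_sequentially)
    then show "z \<in> (\<Union>n. ball 0 (s n))" by auto
  qed (use s in \<open>auto intro: less_trans\<close>)
  have eq: "ln (cmod (z - b)) - ln (cmod b) = ln (cmod (1 - z / b))" if "z \<in> ball 0 a" for z
  proof -
    have "z - b \<noteq> 0" using that a by auto
    moreover have "1 - z / b = - ((z - b) / b)" using b by (simp add: field_simps)
    ultimately show ?thesis using b by (simp add: norm_divide ln_div)
  qed
  have ind: "integrable lborel (indicat_real (ball (0::complex) a))"
    by (rule integrable_real_indicator) (simp, rule emeasure_lborel_ball_finite)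
  have int: "set_integrable lborel (ball 0 a) (\<lambda>z. ln (cmod (z - b)) - ln (cmod b))"
    by (intro set_integral_diff set_integrable_ln_norm_diff) (auto simp: ind set_integrable_def)
  have "(\<lambda>n. LINT z:ball 0 (s n)|lborel. ln (cmod (z - b)) - ln (cmod b)) \<longlonglongrightarrow> (LINT z:(\<Union>n. ball 0 (s n))|lborel. ln (cmod (z - b)) - ln (cmod b))"
    using int by (intro set_integral_cont_up) (auto simp: incseq_def U intro: order_less_le_trans[OF _ incseqD[OF incs]])
  moreover have "(LINT z:ball 0 (s n)|lborel. ln (cmod (z - b)) - ln (cmod b)) = 0" for n
  proof -
    have "(LINT z:ball 0 (s n)|lborel. ln (cmod (z - b)) - ln (cmod b)) = (LINT z:ball 0 (s n)|lborel. ln (cmod (1 - z / b)))"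
      using s(1)[of n] by (intro set_lebesgue_integral_cong) (auto intro!: eq)
    also have "\<dots> = 0"
    proof (rule rotation_average_ln_zero[where \<rho>="s n / a"])
      show "\<exists>w. cmod w = 1 \<and> (\<forall>z. (w * z / b) ^ 2 ^ k = - ((z / b) ^ 2 ^ k))" for k
        by (rule exI[of _ "cis (pi / 2 ^ k)"]) (simp add: power_mult_distrib power_divide cis_root_minus_one)
      show "cmod (z / b) \<le> s n / a" if "z \<in> ball 0 (s n)" for z
        using that a s[of n] by (auto simp: norm_divide intro!: frac_le)
      show "emeasure lborel (ball (0::complex) (s n)) < \<infinity>" by (rule emeasure_lborel_ball_finite)
    qed (use s[of n] a in \<open>auto simp: norm_mult\<close>)
    finally show ?thesis .
  qed
  ultimately have "(LINT z:ball 0 a|lborel. ln (cmod (z - b)) - ln (cmod b)) = 0"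
    unfolding U by (simp add: LIMSEQ_const_iff)
  moreover have "(LINT z:ball 0 a|lborel. ln (cmod (z - b)) - ln (cmod b)) = (LINT z:ball 0 a|lborel. ln (cmod (z - b))) - (LINT z:ball (0::complex) a|lborel. ln (cmod b))"
    by (intro set_integral_diff(2) set_integrable_ln_norm_diff) (auto simp: ind set_integrable_def)
  moreover have "(LINT z:ball (0::complex) a|lborel. ln (cmod b)) = pi * a\<^sup>2 * ln (cmod b)"
    using a by (simp add: set_lebesgue_integral_def measure_def emeasure_lborel_disc)
  ultimately show ?thesis by simp
qed

lemma annulus_integral_ln_norm:
  assumes r: "0 < r" "r < a"
  shows "(LINT z:{z. r < cmod z \<and> cmod z < a}|lborel. ln (cmod z)) = pi * (a\<^sup>2 * ln a - a\<^sup>2 / 2 - (r\<^sup>2 * ln r - r\<^sup>2 / 2))"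
proof -
  let ?f = "\<lambda>t. indicator {r\<^sup>2<..<a\<^sup>2} t * (ln t / 2)"
  have "(LINT z:{z. r < cmod z \<and> cmod z < a}|lborel. ln (cmod z)) = (LINT z|lborel. ?f ((cmod z)\<^sup>2))"
    unfolding set_lebesgue_integral_def
  proof (intro Bochner_Integration.integral_cong refl)
    fix z :: complex
    have "r\<^sup>2 < (cmod z)\<^sup>2 \<longleftrightarrow> r < cmod z" "(cmod z)\<^sup>2 < a\<^sup>2 \<longleftrightarrow> cmod z < a"
      using r by (auto intro: power_strict_mono dest: power_less_imp_less_base)
    moreover have "ln ((cmod z)\<^sup>2) = 2 * ln (cmod z)" if "r < cmod z" using that r by (simp add: ln_realpow)
    ultimately show "indicat_real {z. r < cmod z \<and> cmod z < a} z *\<^sub>R ln (cmod z) = ?f ((cmod z)\<^sup>2)"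
      by (auto split: split_indicator)
  qed
  also have "\<dots> = (LINT t|distr lborel borel (\<lambda>z::complex. (cmod z)\<^sup>2). ?f t)"
    by (rule integral_distr[symmetric]) auto
  also have "\<dots> = (LINT t|density lborel (\<lambda>t. ennreal (pi * indicator {0..} t)). ?f t)"
    unfolding distr_lborel_norm_square by (intro arg_cong2[where f=lebesgue_integral] refl density_cong) (auto split: split_indicator)
  also have "\<dots> = (LINT t|lborel. (pi * indicator {0..} t) * ?f t)"
    by (subst integral_real_density) (auto split: split_indicator)
  also have "\<dots> = (LINT t|lborel. indicator {r\<^sup>2..a\<^sup>2} t *\<^sub>R (pi * (ln t / 2)))"
  proof (rule integral_cong_AE)
    have "AE t in lborel. t \<noteq> r\<^sup>2 \<and> t \<noteq> a\<^sup>2" by (auto intro: AE_lborel_singleton)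
    then show "AE t in lborel. (pi * indicator {0..} t) * ?f t = indicator {r\<^sup>2..a\<^sup>2} t *\<^sub>R (pi * (ln t / 2))"
      by eventually_elim (auto split: split_indicator, smt (verit) zero_le_power2)
  qed auto
  also have "\<dots> = pi / 2 * (a\<^sup>2 * ln (a\<^sup>2) - a\<^sup>2) - pi / 2 * (r\<^sup>2 * ln (r\<^sup>2) - r\<^sup>2)"
  proof (rule integral_FTC_atLeastAtMost)
    show "r\<^sup>2 \<le> a\<^sup>2" using r by (intro power_mono) auto
    have pos: "t > 0" if "r\<^sup>2 \<le> t" for t using that r by (meson order_less_le_trans zero_less_power)
    show "((\<lambda>t. pi / 2 * (t * ln t - t)) has_vector_derivative pi * (ln t / 2)) (at t within {r\<^sup>2..a\<^sup>2})"
      if "r\<^sup>2 \<le> t" "t \<le> a\<^sup>2" for t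
      using pos[OF that(1)] unfolding has_real_derivative_iff_has_vector_derivative[symmetric]
      by (auto intro!: derivative_eq_intros simp: field_simps)
    show "continuous_on {r\<^sup>2..a\<^sup>2} (\<lambda>t. pi * (ln t / 2))"
      using pos by (force intro!: continuous_intros)
  qed
  also have "\<dots> = pi * (a\<^sup>2 * ln a - a\<^sup>2 / 2 - (r\<^sup>2 * ln r - r\<^sup>2 / 2))"
    using r by (simp add: ln_realpow algebra_simps)
  finally show ?thesis .
qed

lemma annulus_integral_ln_norm_diff:
  fixes b :: complex
  assumes b: "b \<noteq> 0" "cmod b < a"
  shows "(LINT z:{z. cmod b < cmod z \<and> cmod z < a}|lborel. ln (cmod (z - b)) - ln (cmod z)) = 0"
proof -
  let ?A = "\<lambda>s. {z::complex. s < cmod z \<and> cmod z < a}"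
  have Am[measurable]: "?A s \<in> sets borel" for s by measurable
  have Ab: "bounded (?A s)" for s by (auto simp: bounded_iff intro!: exI[of _ a])
  have fin: "emeasure lborel (?A s) < \<infinity>" for s using emeasure_bounded_finite[OF Ab] .
  define s where "s n = cmod b * (1 + 1 / (real n + 1))" for n
  have s: "s n > cmod b" for n using b by (auto simp: s_def field_simps)
  have decs: "s n \<le> s m" if "m \<le> n" for m n using b that by (auto simp: s_def field_simps)
  have slim: "s \<longlonglongrightarrow> cmod b" unfolding s_def by real_asymp
  have U: "(\<Union>n. ?A (s n)) = ?A (cmod b)"
  proof (rule equalityI; rule subsetI)
    fix z :: complex assume "z \<in> ?A (cmod b)"
    moreover then obtain n where "s n < cmod z" using order_tendstoD(2)[OF slim, of "cmod z"] by (auto simp: eventually_sequentially)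
    ultimately show "z \<in> (\<Union>n. ?A (s n))" by auto
  qed (use s in \<open>auto intro: less_trans\<close>)
  have eq: "ln (cmod (z - b)) - ln (cmod z) = ln (cmod (1 - b / z))" if "cmod b < cmod z" for z
  proof -
    have "z - b \<noteq> 0" "z \<noteq> 0" using that by auto
    moreover have "1 - b / z = (z - b) / z" using \<open>z \<noteq> 0\<close> by (simp add: field_simps)
    ultimately show ?thesis by (simp add: norm_divide ln_div)
  qed
  have int: "set_integrable lborel (?A s) (\<lambda>z. ln (cmod (z - b)) - ln (cmod z))" for s
    using set_integrable_ln_norm_diff[OF Am Ab, of s b] set_integrable_ln_norm_diff[OF Am Ab, of s 0]
    by (intro set_integral_diff) auto
  have "(\<lambda>n. LINT z:?A (s n)|lborel. ln (cmod (z - b)) - ln (cmod z)) \<longlonglongrightarrow> (LINT z:(\<Union>n. ?A (s n))|lborel. ln (cmod (z - b)) - ln (cmod z))"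
    using int[of "cmod b"] decs by (intro set_integral_cont_up) (auto simp: incseq_def U intro: order_le_less_trans)
  moreover have "(LINT z:?A (s n)|lborel. ln (cmod (z - b)) - ln (cmod z)) = 0" for n
  proof -
    have "(LINT z:?A (s n)|lborel. ln (cmod (z - b)) - ln (cmod z)) = (LINT z:?A (s n)|lborel. ln (cmod (1 - b / z)))"
      using s[of n] by (intro set_lebesgue_integral_cong) (auto intro!: eq)
    also have "\<dots> = 0"
    proof (rule rotation_average_ln_zero[where \<rho>="cmod b / s n"])
      show "\<exists>w. cmod w = 1 \<and> (\<forall>z. (b / (w * z)) ^ 2 ^ k = - ((b / z) ^ 2 ^ k))" for k
      proof (rule exI[of _ "cis (pi / 2 ^ k)"])
        show "cmod (cis (pi / 2 ^ k)) = 1 \<and> (\<forall>z. (b / (cis (pi / 2 ^ k) * z)) ^ 2 ^ k = - ((b / z) ^ 2 ^ k))"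
          by (simp add: power_mult_distrib power_divide cis_root_minus_one)
      qed
      show "cmod (b / z) \<le> cmod b / s n" if "z \<in> ?A (s n)" for z
      proof -
        have "s n > 0" using s[of n] norm_ge_zero[of b] by linarith
        moreover have "s n \<le> cmod z" "cmod z > 0" using that \<open>s n > 0\<close> by auto
        ultimately show ?thesis by (simp add: norm_divide frac_le)
      qed
      show "cmod b / s n < 1" using s[of n] b by (smt (verit) divide_less_eq_1 zero_less_norm_iff)
      show "emeasure lborel (?A (s n)) < \<infinity>" by (rule fin)
    qed (auto simp: norm_mult)
    finally show ?thesis .
  qed
  ultimately show ?thesis unfolding U by (simp add: LIMSEQ_const_iff)
qed

definition log_avg :: "real \<Rightarrow> real \<Rightarrow> real" where
  "log_avg a r = (if a \<le> r then ln r else ln a - 1 / 2 + r\<^sup>2 / (2 * a\<^sup>2))"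

text \<open>Newton's theorem: a disc attracts like its centre outside, and inside only the smaller
  concentric disc and the logarithmic mean of the surrounding annulus matter.\<close>

lemma disc_average_ln:
  fixes b :: complex
  assumes a: "0 < a" and b: "b \<noteq> 0"
  shows "(LINT z:ball 0 a|lborel. ln (cmod (z - b))) = pi * a\<^sup>2 * log_avg a (cmod b)"
proof (cases "a \<le> cmod b")
  case True
  then show ?thesis using disc_average_ln_outside[OF a] by (simp add: log_avg_def)
next
  case False
  let ?A = "{z::complex. cmod b < cmod z \<and> cmod z < a}"
  let ?B = "ball (0::complex) (cmod b)"
  have [measurable]: "ball (0::complex) r \<in> sets borel" for r by simp
  have Am[measurable]: "?A \<in> sets borel" by measurable
  have Ab: "bounded ?A" by (auto simp: bounded_iff intro!: exI[of _ a])
  have iA: "set_integrable lborel ?A (\<lambda>z. ln (cmod (z - b)))" "set_integrable lborel ?A (\<lambda>z. ln (cmod z))"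
    using set_integrable_ln_norm_diff[OF Am Ab, of b] set_integrable_ln_norm_diff[OF Am Ab, of 0] by auto
  have iB: "set_integrable lborel ?B (\<lambda>z. ln (cmod (z - b)))"
    by (intro set_integrable_ln_norm_diff) auto
  have null: "AE z in lborel. cmod z \<noteq> cmod b"
  proof (rule AE_I)
    have "cball (0::complex) (cmod b) = ball 0 (cmod b) \<union> (cball 0 (cmod b) - ball 0 (cmod b))" by auto
    show "emeasure lborel (cball (0::complex) (cmod b) - ball 0 (cmod b)) = 0"
      by (subst emeasure_Diff) (auto simp: emeasure_lborel_disc)
  qed auto
  have "(LINT z:ball 0 a|lborel. ln (cmod (z - b))) = (LINT z:?B \<union> ?A|lborel. ln (cmod (z - b)))"
    unfolding set_lebesgue_integral_def
  proof (rule integral_cong_AE)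
    show "AE z in lborel. indicator (ball 0 a) z *\<^sub>R ln (cmod (z - b)) = indicator (?B \<union> ?A) z *\<^sub>R ln (cmod (z - b))"
      using null by eventually_elim (use False in \<open>auto split: split_indicator\<close>)
  qed auto
  also have "\<dots> = (LINT z:?B|lborel. ln (cmod (z - b))) + (LINT z:?A|lborel. ln (cmod (z - b)))"
    by (rule set_integral_Un) (use iA iB in auto)
  also have "(LINT z:?B|lborel. ln (cmod (z - b))) = pi * (cmod b)\<^sup>2 * ln (cmod b)"
    using b by (intro disc_average_ln_outside) auto
  also have "(LINT z:?A|lborel. ln (cmod (z - b))) = (LINT z:?A|lborel. ln (cmod (z - b)) - ln (cmod z)) + (LINT z:?A|lborel. ln (cmod z))"
    using iA by (subst set_integral_diff(2)) auto
  also have "\<dots> = pi * (a\<^sup>2 * ln a - a\<^sup>2 / 2 - ((cmod b)\<^sup>2 * ln (cmod b) - (cmod b)\<^sup>2 / 2))"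
    using annulus_integral_ln_norm_diff[OF b, of a] annulus_integral_ln_norm[of "cmod b" a] False b by simp
  finally have "(LINT z:ball 0 a|lborel. ln (cmod (z - b))) = pi * (a\<^sup>2 * ln a - a\<^sup>2 / 2 + (cmod b)\<^sup>2 / 2)"
    by (simp add: algebra_simps)
  also have "a\<^sup>2 * ln a - a\<^sup>2 / 2 + (cmod b)\<^sup>2 / 2 = a\<^sup>2 * log_avg a (cmod b)"
    using False a by (simp add: log_avg_def field_simps)
  finally show ?thesis by (simp add: mult.assoc)
qed

section \<open>Complex Gaussian vectors and plane rotations\<close>

definition gauss :: "complex measure" where
  "gauss = density lborel std_complex_gaussian_density"

lemma sets_gauss [simp, measurable_cong]: "sets gauss = sets borel"
  and space_gauss [simp]: "space gauss = UNIV"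
  by (auto simp: gauss_def)

lemma std_complex_gaussian_density_measurable [measurable]:
  "std_complex_gaussian_density \<in> borel_measurable borel"
  unfolding std_complex_gaussian_density_def by measurable

lemma nn_integral_gauss:
  assumes [measurable]: "f \<in> borel_measurable borel"
  shows "(\<integral>\<^sup>+z. f z \<partial>gauss) = (\<integral>\<^sup>+z. std_complex_gaussian_density z * f z \<partial>lborel)"
  unfolding gauss_def by (subst nn_integral_density) auto

lemma nn_integral_lborel_affine_complex:
  fixes f :: "complex \<Rightarrow> ennreal"
  assumes [measurable]: "f \<in> borel_measurable borel" and a: "a \<noteq> 0"
  shows "ennreal ((cmod a)\<^sup>2) * (\<integral>\<^sup>+z. f (a * z + b) \<partial>lborel) = (\<integral>\<^sup>+z. f z \<partial>lborel)"
  using nn_integral_lborel_mult_complex[of "\<lambda>z. f (z + b)" a] nn_integral_lborel_translate[of f b] a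
  by (simp add: add.commute)

lemma nn_integral_exp_norm_square:
  assumes s: "s > 0"
  shows "(\<integral>\<^sup>+z. ennreal (exp (- s * (cmod z)\<^sup>2)) \<partial>lborel) = ennreal (pi / s)"
proof -
  have "(\<integral>\<^sup>+z. ennreal (exp (- s * (cmod z)\<^sup>2)) \<partial>lborel)
      = ennreal ((cmod (of_real (1 / sqrt s)))\<^sup>2) * (\<integral>\<^sup>+z. ennreal (exp (- s * (cmod (of_real (1 / sqrt s) * z))\<^sup>2)) \<partial>lborel)"
    using s by (intro nn_integral_lborel_mult_complex[symmetric]) auto
  also have "(cmod (of_real (1 / sqrt s)))\<^sup>2 = 1 / s" using s by (simp add: power_divide norm_divide)
  also have "(\<integral>\<^sup>+z. ennreal (exp (- s * (cmod (of_real (1 / sqrt s) * z))\<^sup>2)) \<partial>lborel) = (\<integral>\<^sup>+z. ennreal (exp (- ((cmod z)\<^sup>2))) \<partial>lborel)"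
    using s by (simp add: norm_mult norm_divide power_mult_distrib power_divide)
  also have "\<dots> = ennreal pi * (\<integral>\<^sup>+t. ennreal (exp (- t)) * indicator {0..} t \<partial>lborel)"
    by (rule nn_integral_lborel_radial) auto
  also have "(\<integral>\<^sup>+t. ennreal (exp (- t)) * indicator {0..} t \<partial>lborel) = 1"
    using nn_intergal_power_times_exp_Ici[of 0] by simp
  finally show ?thesis using s by (simp add: ennreal_mult'[symmetric])
qed

text \<open>Complete the square in \<open>t |b - g|\<^sup>2 + |g|\<^sup>2\<close>.\<close>

lemma nn_integral_gauss_exp:
  assumes t: "t > - 1"
  shows "(\<integral>\<^sup>+g. ennreal (exp (- t * (cmod (b - g))\<^sup>2)) \<partial>gauss) = ennreal (exp (- t / (1 + t) * (cmod b)\<^sup>2) / (1 + t))"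
proof -
  let ?C = "ennreal (exp (- t / (1 + t) * (cmod b)\<^sup>2) / pi)"
  define c where "c = of_real (t / (1 + t)) * b"
  have sq: "t * (cmod (b - g))\<^sup>2 + (cmod g)\<^sup>2 = (1 + t) * (cmod (g + - c))\<^sup>2 + t / (1 + t) * (cmod b)\<^sup>2" for g
  proof -
    have p: "1 + t \<noteq> 0" using t by simp
    have r: "t * (x - y)\<^sup>2 + y\<^sup>2 = (1 + t) * (y + - (t / (1 + t) * x))\<^sup>2 + t / (1 + t) * x\<^sup>2" for x y :: real
    proof -
      define q where "q = 1 / (1 + t)"
      have "(1 + t) * q = 1" using p by (simp add: q_def)
      moreover have "(1 + t) * (y + - (t * q * x))\<^sup>2 + t * q * x\<^sup>2
        = (1 + t) * y\<^sup>2 - ((1 + t) * q) * (2 * t * x * y) + ((1 + t) * q) * (t\<^sup>2 * q * x\<^sup>2) + t * q * x\<^sup>2"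
        by (simp add: power2_eq_square algebra_simps)
      moreover have "t\<^sup>2 * q * x\<^sup>2 + t * q * x\<^sup>2 = ((1 + t) * q) * (t * x\<^sup>2)"
        by (simp add: power2_eq_square algebra_simps)
      ultimately have "t * (x - y)\<^sup>2 + y\<^sup>2 = (1 + t) * (y + - (t * q * x))\<^sup>2 + t * q * x\<^sup>2"
        by (simp add: power2_eq_square algebra_simps)
      then show ?thesis by (simp add: q_def)
    qed
    show ?thesis using r[of "Re b" "Re g"] r[of "Im b" "Im g"]
      unfolding cmod_power2 c_def by (simp add: algebra_simps)
  qed
  have "(\<integral>\<^sup>+g. ennreal (exp (- t * (cmod (b - g))\<^sup>2)) \<partial>gauss)
     = (\<integral>\<^sup>+g. ?C * ennreal (exp (- (1 + t) * (cmod (g + - c))\<^sup>2)) \<partial>lborel)"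
  proof (subst nn_integral_gauss)
    show "(\<integral>\<^sup>+g. std_complex_gaussian_density g * ennreal (exp (- t * (cmod (b - g))\<^sup>2)) \<partial>lborel)
       = (\<integral>\<^sup>+g. ?C * ennreal (exp (- (1 + t) * (cmod (g + - c))\<^sup>2)) \<partial>lborel)"
    proof (intro nn_integral_cong)
      fix g
      have "exp (- (cmod g)\<^sup>2) * exp (- t * (cmod (b - g))\<^sup>2) = exp (- t / (1 + t) * (cmod b)\<^sup>2) * exp (- (1 + t) * (cmod (g + - c))\<^sup>2)"
        unfolding exp_add[symmetric] using sq[of g] by (intro arg_cong[where f=exp]) (simp add: algebra_simps)
      then show "std_complex_gaussian_density g * ennreal (exp (- t * (cmod (b - g))\<^sup>2)) = ?C * ennreal (exp (- (1 + t) * (cmod (g + - c))\<^sup>2))"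
        unfolding std_complex_gaussian_density_def by (simp add: ennreal_mult'[symmetric])
    qed
  qed auto
  also have "\<dots> = ?C * (\<integral>\<^sup>+g. ennreal (exp (- (1 + t) * (cmod (g + - c))\<^sup>2)) \<partial>lborel)"
    by (rule nn_integral_cmult) auto
  also have "(\<integral>\<^sup>+g. ennreal (exp (- (1 + t) * (cmod (g + - c))\<^sup>2)) \<partial>lborel) = (\<integral>\<^sup>+g. ennreal (exp (- (1 + t) * (cmod g)\<^sup>2)) \<partial>lborel)"
    using nn_integral_lborel_translate[of "\<lambda>g. ennreal (exp (- (1 + t) * (cmod g)\<^sup>2))" "-c"] by (simp add: add.commute)
  also have "\<dots> = ennreal (pi / (1 + t))" using t by (intro nn_integral_exp_norm_square) auto
  finally show ?thesis using t by (simp add: ennreal_mult'[symmetric])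
qed

lemma prob_space_gauss: "prob_space gauss"
proof
  show "emeasure gauss (space gauss) = 1"
    using nn_integral_gauss_exp[of 0 0] by simp
qed

interpretation gauss: prob_space gauss by (rule prob_space_gauss)

interpretation gauss_prod: product_prob_space "\<lambda>_. gauss" UNIV ..

lemma nn_integral_gauss_norm_square:
  "(\<integral>\<^sup>+g. ennreal ((cmod (b - g))\<^sup>2) \<partial>gauss) = ennreal (1 + (cmod b)\<^sup>2)"
proof -
  let ?I = "\<lambda>b. \<integral>\<^sup>+g. ennreal ((cmod (b - g))\<^sup>2) \<partial>gauss"
  have sym: "?I b = (\<integral>\<^sup>+g. ennreal ((cmod (b + g))\<^sup>2) \<partial>gauss)"
    using nn_integral_lborel_rotate[of "\<lambda>g. std_complex_gaussian_density g * ennreal ((cmod (b - g))\<^sup>2)" "-1"]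
    by (simp add: nn_integral_gauss std_complex_gaussian_density_def)
  have one: "(\<integral>\<^sup>+g. ennreal ((cmod g)\<^sup>2) \<partial>gauss) = 1"
  proof -
    have "(\<integral>\<^sup>+g. ennreal ((cmod g)\<^sup>2) \<partial>gauss) = (\<integral>\<^sup>+g. (\<lambda>t. ennreal (t * exp (- t) / pi)) ((cmod g)\<^sup>2) \<partial>lborel)"
      by (simp add: nn_integral_gauss std_complex_gaussian_density_def ennreal_mult'[symmetric] mult.commute)
    also have "\<dots> = ennreal pi * (\<integral>\<^sup>+t. ennreal (t * exp (- t) / pi) * indicator {0..} t \<partial>lborel)"
      by (rule nn_integral_lborel_radial) auto
    also have "\<dots> = (\<integral>\<^sup>+t. ennreal pi * (ennreal (t * exp (- t) / pi) * indicator {0..} t) \<partial>lborel)"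
      by (subst nn_integral_cmult) auto
    also have "\<dots> = (\<integral>\<^sup>+t. ennreal (t ^ 1 * exp (- t)) * indicator {0..} t \<partial>lborel)"
      by (intro nn_integral_cong) (auto split: split_indicator simp: ennreal_mult'[symmetric])
    also have "\<dots> = 1" using nn_intergal_power_times_exp_Ici[of 1] by simp
    finally show ?thesis .
  qed
  have "?I b + ?I b = (\<integral>\<^sup>+g. ennreal ((cmod (b - g))\<^sup>2) + ennreal ((cmod (b + g))\<^sup>2) \<partial>gauss)"
    by (subst (2) sym, rule nn_integral_add[symmetric]) auto
  also have "\<dots> = (\<integral>\<^sup>+g. ennreal (2 * (cmod b)\<^sup>2) + 2 * ennreal ((cmod g)\<^sup>2) \<partial>gauss)"
  proof (intro nn_integral_cong)
    fix g
    have "(cmod (b - g))\<^sup>2 + (cmod (b + g))\<^sup>2 = 2 * (cmod b)\<^sup>2 + 2 * (cmod g)\<^sup>2"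
      unfolding cmod_power2 by (simp add: power2_eq_square algebra_simps)
    moreover have "2 * ennreal ((cmod g)\<^sup>2) = ennreal (2 * (cmod g)\<^sup>2)" by (simp add: ennreal_mult)
    ultimately show "ennreal ((cmod (b - g))\<^sup>2) + ennreal ((cmod (b + g))\<^sup>2) = ennreal (2 * (cmod b)\<^sup>2) + 2 * ennreal ((cmod g)\<^sup>2)"
      by (simp add: ennreal_plus[symmetric] del: ennreal_plus)
  qed
  also have "\<dots> = ennreal (2 * (cmod b)\<^sup>2) + 2 * 1"
    by (subst nn_integral_add) (auto simp: nn_integral_cmult one gauss.emeasure_space_1[simplified])
  also have "\<dots> = ennreal (1 + (cmod b)\<^sup>2) + ennreal (1 + (cmod b)\<^sup>2)"
    by (simp add: ennreal_plus[symmetric] ennreal_numeral[symmetric] del: ennreal_plus ennreal_numeral)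
  finally have "2 * ?I b = 2 * ennreal (1 + (cmod b)\<^sup>2)" by (simp add: mult_2)
  then show ?thesis by (subst (asm) ennreal_mult_cancel_left) auto
qed

subsection \<open>Invariance under plane rotations\<close>

definition givens :: "'i \<Rightarrow> 'i \<Rightarrow> complex \<Rightarrow> complex \<Rightarrow> ('i \<Rightarrow> complex) \<Rightarrow> 'i \<Rightarrow> complex" where
  "givens i j c s x = x(i := c * x i + s * x j, j := cnj c * x j - cnj s * x i)"

lemma norm_square_rotation:
  assumes "(cmod c)\<^sup>2 + (cmod s)\<^sup>2 = 1"
  shows "cnj (c * u + s * v) * (c * u' + s * v') + cnj (cnj c * v - cnj s * u) * (cnj c * v' - cnj s * u')
     = cnj u * u' + cnj v * v'"
proof -
  have cs: "cnj c * c + cnj s * s = 1"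
    using assms by (metis complex_norm_square mult.commute of_real_1 of_real_add)
  have "cnj (c * u + s * v) * (c * u' + s * v') + cnj (cnj c * v - cnj s * u) * (cnj c * v' - cnj s * u')
     = (cnj c * c + cnj s * s) * (cnj u * u' + cnj v * v')"
    by (simp add: algebra_simps)
  then show ?thesis using cs by simp
qed

text \<open>A rotation of a coordinate pair is a lower triangular substitution after an upper triangular one,
  and the two Jacobians cancel.\<close>

lemma nn_integral_lborel_pair_rotate:
  fixes F :: "complex \<Rightarrow> complex \<Rightarrow> ennreal"
  assumes F[measurable]: "case_prod F \<in> borel_measurable (borel \<Otimes>\<^sub>M borel)"
    and cs: "(cmod c)\<^sup>2 + (cmod s)\<^sup>2 = 1"
  shows "(\<integral>\<^sup>+v. \<integral>\<^sup>+u. F (c * u + s * v) (cnj c * v - cnj s * u) \<partial>lborel \<partial>lborel) = (\<integral>\<^sup>+v. \<integral>\<^sup>+u. F u v \<partial>lborel \<partial>lborel)"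
proof (cases "c = 0")
  case True
  then have s: "cmod s = 1" using cs by (simp add: power2_eq_1_iff) (smt (verit) norm_ge_zero)
  have "(\<integral>\<^sup>+v. \<integral>\<^sup>+u. F (c * u + s * v) (cnj c * v - cnj s * u) \<partial>lborel \<partial>lborel) = (\<integral>\<^sup>+v. \<integral>\<^sup>+u. F (s * v) (- cnj s * u) \<partial>lborel \<partial>lborel)"
    using True by simp
  also have "\<dots> = (\<integral>\<^sup>+v. \<integral>\<^sup>+u. F (s * v) u \<partial>lborel \<partial>lborel)"
    using s by (intro nn_integral_cong nn_integral_lborel_rotate) auto
  also have "\<dots> = (\<integral>\<^sup>+v. \<integral>\<^sup>+u. F v u \<partial>lborel \<partial>lborel)"
    using s by (intro nn_integral_lborel_rotate[of "\<lambda>v. \<integral>\<^sup>+u. F v u \<partial>lborel"]) auto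
  also have "\<dots> = (\<integral>\<^sup>+v. \<integral>\<^sup>+u. F u v \<partial>lborel \<partial>lborel)"
    by (rule lborel_pair.Fubini') auto
  finally show ?thesis .
next
  case False
  let ?r = "ennreal ((cmod c)\<^sup>2)"
  have r: "?r \<noteq> 0" "?r \<noteq> \<top>" using False by auto
  have cs': "cnj s * s + c * cnj c = 1"
    using cs by (metis complex_norm_square add.commute mult.commute of_real_1 of_real_add)
  have e: "cnj c * v - cnj s * u = (v - cnj s * (c * u + s * v)) / c" for u v
  proof -
    have "v - cnj s * (c * u + s * v) = (1 - cnj s * s) * v - cnj s * c * u" by (simp add: algebra_simps)
    also have "1 - cnj s * s = c * cnj c" using cs' by (simp add: algebra_simps)
    finally show ?thesis using False by (simp add: field_simps)
  qed
  have 1: "?r * (\<integral>\<^sup>+u. F (c * u + s * v) (cnj c * v - cnj s * u) \<partial>lborel) = (\<integral>\<^sup>+u. F u ((v - cnj s * u) / c) \<partial>lborel)" for v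
    using False unfolding e
    by (intro nn_integral_lborel_affine_complex[of "\<lambda>u. F u ((v - cnj s * u) / c)"]) auto
  have 2: "(\<integral>\<^sup>+v. F u ((v - cnj s * u) / c) \<partial>lborel) = ?r * (\<integral>\<^sup>+v. F u v \<partial>lborel)" for u
  proof -
    have "ennreal ((cmod (1 / c))\<^sup>2) * (\<integral>\<^sup>+v. F u (1 / c * v + (- cnj s * u / c)) \<partial>lborel) = (\<integral>\<^sup>+v. F u v \<partial>lborel)"
      using False by (intro nn_integral_lborel_affine_complex) auto
    then have "?r * (ennreal ((cmod (1 / c))\<^sup>2) * (\<integral>\<^sup>+v. F u (1 / c * v + (- cnj s * u / c)) \<partial>lborel)) = ?r * (\<integral>\<^sup>+v. F u v \<partial>lborel)" by simp
    moreover have "?r * ennreal ((cmod (1 / c))\<^sup>2) = 1"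
      using False by (simp add: ennreal_mult'[symmetric] norm_divide power_divide)
    ultimately show ?thesis by (simp add: mult.assoc[symmetric] diff_divide_distrib)
  qed
  have "?r * (\<integral>\<^sup>+v. \<integral>\<^sup>+u. F (c * u + s * v) (cnj c * v - cnj s * u) \<partial>lborel \<partial>lborel)
     = (\<integral>\<^sup>+v. \<integral>\<^sup>+u. F u ((v - cnj s * u) / c) \<partial>lborel \<partial>lborel)"
    by (subst nn_integral_cmult[symmetric]) (auto simp: 1)
  also have "\<dots> = (\<integral>\<^sup>+u. \<integral>\<^sup>+v. F u ((v - cnj s * u) / c) \<partial>lborel \<partial>lborel)"
    by (rule lborel_pair.Fubini') auto
  also have "\<dots> = ?r * (\<integral>\<^sup>+u. \<integral>\<^sup>+v. F u v \<partial>lborel \<partial>lborel)"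
    unfolding 2 by (rule nn_integral_cmult) auto
  also have "(\<integral>\<^sup>+u. \<integral>\<^sup>+v. F u v \<partial>lborel \<partial>lborel) = (\<integral>\<^sup>+v. \<integral>\<^sup>+u. F u v \<partial>lborel \<partial>lborel)"
    by (rule lborel_pair.Fubini') auto
  finally show ?thesis using r by (simp add: ennreal_mult_cancel_left)
qed

lemma nn_integral_gauss_pair_rotate:
  fixes F :: "complex \<Rightarrow> complex \<Rightarrow> ennreal"
  assumes F[measurable]: "case_prod F \<in> borel_measurable (borel \<Otimes>\<^sub>M borel)"
    and cs: "(cmod c)\<^sup>2 + (cmod s)\<^sup>2 = 1"
  shows "(\<integral>\<^sup>+v. \<integral>\<^sup>+u. F (c * u + s * v) (cnj c * v - cnj s * u) \<partial>gauss \<partial>gauss) = (\<integral>\<^sup>+v. \<integral>\<^sup>+u. F u v \<partial>gauss \<partial>gauss)"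
proof -
  let ?d = std_complex_gaussian_density
  have [measurable]: "(\<lambda>x. F (f x) (g x)) \<in> borel_measurable M"
    if [measurable]: "f \<in> borel_measurable M" "g \<in> borel_measurable M" for f g and M :: "'x measure"
    using measurable_compose[OF measurable_Pair[OF that] F] by simp
  have d: "?d u * ?d v = ?d (c * u + s * v) * ?d (cnj c * v - cnj s * u)" for u v
  proof -
    have "of_real ((cmod (c * u + s * v))\<^sup>2 + (cmod (cnj c * v - cnj s * u))\<^sup>2) = (of_real ((cmod u)\<^sup>2 + (cmod v)\<^sup>2) :: complex)"
      using norm_square_rotation[OF cs, of u v u v]
      unfolding of_real_add complex_norm_square by (simp only: mult.commute)
    then have "(cmod (c * u + s * v))\<^sup>2 + (cmod (cnj c * v - cnj s * u))\<^sup>2 = (cmod u)\<^sup>2 + (cmod v)\<^sup>2"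
      by (simp only: of_real_eq_iff)
    then have "exp (- (cmod u)\<^sup>2) * exp (- (cmod v)\<^sup>2) = exp (- (cmod (c * u + s * v))\<^sup>2) * exp (- (cmod (cnj c * v - cnj s * u))\<^sup>2)"
      unfolding exp_add[symmetric] by (intro arg_cong[where f=exp]) linarith
    then show ?thesis unfolding std_complex_gaussian_density_def
      by (simp add: ennreal_mult'[symmetric])
  qed
  have pull: "(\<integral>\<^sup>+v. \<integral>\<^sup>+u. G u v \<partial>gauss \<partial>gauss) = (\<integral>\<^sup>+v. \<integral>\<^sup>+u. ?d u * ?d v * G u v \<partial>lborel \<partial>lborel)"
    if G[measurable]: "case_prod G \<in> borel_measurable (borel \<Otimes>\<^sub>M borel)" for G
  proof -
    have "(\<integral>\<^sup>+v. \<integral>\<^sup>+u. G u v \<partial>gauss \<partial>gauss) = (\<integral>\<^sup>+v. ?d v * (\<integral>\<^sup>+u. ?d u * G u v \<partial>lborel) \<partial>lborel)"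
      by (simp add: nn_integral_gauss)
    also have "\<dots> = (\<integral>\<^sup>+v. \<integral>\<^sup>+u. ?d u * ?d v * G u v \<partial>lborel \<partial>lborel)"
      by (intro nn_integral_cong, subst nn_integral_cmult[symmetric]) (auto simp: mult_ac)
    finally show ?thesis .
  qed
  have "(\<integral>\<^sup>+v. \<integral>\<^sup>+u. F (c * u + s * v) (cnj c * v - cnj s * u) \<partial>gauss \<partial>gauss)
     = (\<integral>\<^sup>+v. \<integral>\<^sup>+u. (\<lambda>u v. ?d u * ?d v * F u v) (c * u + s * v) (cnj c * v - cnj s * u) \<partial>lborel \<partial>lborel)"
    unfolding d[symmetric] by (rule pull) measurable
  also have "\<dots> = (\<integral>\<^sup>+v. \<integral>\<^sup>+u. ?d u * ?d v * F u v \<partial>lborel \<partial>lborel)"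
    by (rule nn_integral_lborel_pair_rotate[OF _ cs]) measurable
  also have "\<dots> = (\<integral>\<^sup>+v. \<integral>\<^sup>+u. F u v \<partial>gauss \<partial>gauss)"
    by (rule pull[OF F, symmetric])
  finally show ?thesis .
qed

lemma measurable_merge_upd2:
  assumes f: "f \<in> borel_measurable (Pi\<^sub>M (insert i (insert j K)) (\<lambda>_. gauss))"
    and K: "i \<notin> insert j K" "j \<notin> K" and x: "x \<in> space (Pi\<^sub>M K (\<lambda>_. gauss))"
  shows "(\<lambda>(u, v). f (x(j := v, i := u))) \<in> borel_measurable (borel \<Otimes>\<^sub>M borel)"
proof -
  have "(\<lambda>p. x(j := snd p, i := fst p)) \<in> measurable (borel \<Otimes>\<^sub>M borel) (Pi\<^sub>M (insert i (insert j K)) (\<lambda>_. gauss))"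
  proof (rule measurable_PiM_single')
    fix k assume "k \<in> insert i (insert j K)"
    then show "(\<lambda>p. (x(j := snd p, i := fst p)) k) \<in> measurable (borel \<Otimes>\<^sub>M borel) gauss"
      by (cases "k = i"; cases "k = j") auto
  qed (use x in \<open>auto simp: space_PiM PiE_def extensional_def\<close>)
  from measurable_compose[OF this f] show ?thesis by (simp add: split_beta')
qed

lemma nn_integral_PiM_givens:
  fixes i :: 'i
  assumes I: "finite I" "i \<in> I" "j \<in> I" "i \<noteq> j" and cs: "(cmod c)\<^sup>2 + (cmod s)\<^sup>2 = 1"
    and f: "f \<in> borel_measurable (Pi\<^sub>M I (\<lambda>_. gauss))"
  shows "givens i j c s \<in> measurable (Pi\<^sub>M I (\<lambda>_. gauss)) (Pi\<^sub>M I (\<lambda>_. gauss))"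
    and "(\<integral>\<^sup>+x. f (givens i j c s x) \<partial>Pi\<^sub>M I (\<lambda>_. gauss)) = (\<integral>\<^sup>+x. f x \<partial>Pi\<^sub>M I (\<lambda>_. gauss))"
proof -
  let ?P = "\<lambda>I :: 'i set. Pi\<^sub>M I (\<lambda>_. gauss)"
  show m: "givens i j c s \<in> measurable (?P I) (?P I)"
  proof (rule measurable_PiM_single')
    fix k assume "k \<in> I"
    then show "(\<lambda>x. givens i j c s x k) \<in> measurable (?P I) gauss"
      using I unfolding givens_def by (cases "k = i"; cases "k = j") (simp_all, measurable)
  qed (use I in \<open>auto simp: space_PiM PiE_def extensional_def givens_def\<close>)
  define K where "K = I - {i, j}"
  have IK: "I = insert i (insert j K)" and K: "finite K" "i \<notin> insert j K" "j \<notin> K" "finite (insert j K)"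
    using I by (auto simp: K_def)
  have pull: "(\<integral>\<^sup>+x. g x \<partial>?P I) = (\<integral>\<^sup>+x. \<integral>\<^sup>+v. \<integral>\<^sup>+u. g (x(j := v, i := u)) \<partial>gauss \<partial>gauss \<partial>?P K)"
    if g: "g \<in> borel_measurable (?P I)" for g
  proof -
    have "(\<integral>\<^sup>+x. g x \<partial>?P I) = (\<integral>\<^sup>+y. \<integral>\<^sup>+u. g (y(i := u)) \<partial>gauss \<partial>?P (insert j K))"
      unfolding IK using K g by (intro gauss_prod.product_nn_integral_insert) (auto simp: IK)
    also have "\<dots> = (\<integral>\<^sup>+x. \<integral>\<^sup>+v. \<integral>\<^sup>+u. g (x(j := v, i := u)) \<partial>gauss \<partial>gauss \<partial>?P K)"
    proof (rule gauss_prod.product_nn_integral_insert)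
      have "(\<lambda>(y, u). g (y(i := u))) \<in> borel_measurable (?P (insert j K) \<Otimes>\<^sub>M gauss)"
        using measurable_compose[OF measurable_add_dim[of i "insert j K" "\<lambda>_. gauss"], of g borel] g
        by (simp add: IK split_beta')
      then show "(\<lambda>y. \<integral>\<^sup>+u. g (y(i := u)) \<partial>gauss) \<in> borel_measurable (?P (insert j K))"
        by (rule gauss.borel_measurable_nn_integral)
    qed (use K in auto)
    finally show ?thesis .
  qed
  have "(\<integral>\<^sup>+x. f (givens i j c s x) \<partial>?P I) = (\<integral>\<^sup>+x. \<integral>\<^sup>+v. \<integral>\<^sup>+u. f (givens i j c s (x(j := v, i := u))) \<partial>gauss \<partial>gauss \<partial>?P K)"
    using measurable_compose[OF m f] by (rule pull)
  also have "\<dots> = (\<integral>\<^sup>+x. \<integral>\<^sup>+v. \<integral>\<^sup>+u. f (x(j := v, i := u)) \<partial>gauss \<partial>gauss \<partial>?P K)"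
  proof (rule nn_integral_cong)
    fix x assume x: "x \<in> space (?P K)"
    have "(\<integral>\<^sup>+v. \<integral>\<^sup>+u. f (givens i j c s (x(j := v, i := u))) \<partial>gauss \<partial>gauss)
      = (\<integral>\<^sup>+v. \<integral>\<^sup>+u. f (x(j := cnj c * v - cnj s * u, i := c * u + s * v)) \<partial>gauss \<partial>gauss)"
      using I(4) by (intro nn_integral_cong arg_cong[where f=f]) (auto simp: givens_def fun_eq_iff)
    also have "\<dots> = (\<integral>\<^sup>+v. \<integral>\<^sup>+u. f (x(j := v, i := u)) \<partial>gauss \<partial>gauss)"
      using measurable_merge_upd2[OF f[unfolded IK] K(2,3) x] cs
      by (intro nn_integral_gauss_pair_rotate[of "\<lambda>u v. f (x(j := v, i := u))"]) auto
    finally show "(\<integral>\<^sup>+v. \<integral>\<^sup>+u. f (givens i j c s (x(j := v, i := u))) \<partial>gauss \<partial>gauss) = (\<integral>\<^sup>+v. \<integral>\<^sup>+u. f (x(j := v, i := u)) \<partial>gauss \<partial>gauss)" .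
  qed
  also have "\<dots> = (\<integral>\<^sup>+x. f x \<partial>?P I)" using f by (rule pull[symmetric])
  finally show "(\<integral>\<^sup>+x. f (givens i j c s x) \<partial>?P I) = (\<integral>\<^sup>+x. f x \<partial>?P I)" .
qed

text \<open>The linear isometries generated by rotations of coordinate pairs in \<open>S\<close>.\<close>

inductive_set rotations :: "'i set \<Rightarrow> (('i \<Rightarrow> complex) \<Rightarrow> ('i \<Rightarrow> complex)) set" for S where
  rotations_id: "(\<lambda>x. x) \<in> rotations S"
| rotations_givens: "T \<in> rotations S \<Longrightarrow> i \<in> S \<Longrightarrow> j \<in> S \<Longrightarrow> i \<noteq> j \<Longrightarrow> (cmod c)\<^sup>2 + (cmod s)\<^sup>2 = 1 \<Longrightarrow>
    (\<lambda>x. givens i j c s (T x)) \<in> rotations S"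

lemma rotations_mono: "T \<in> rotations S \<Longrightarrow> S \<subseteq> S' \<Longrightarrow> T \<in> rotations S'"
  by (induction rule: rotations.induct) (auto intro: rotations.intros)

lemma rotations_comp: "T' \<in> rotations S \<Longrightarrow> T \<in> rotations S \<Longrightarrow> (\<lambda>x. T' (T x)) \<in> rotations S"
  by (induction rule: rotations.induct) (auto intro: rotations.intros)

lemma rotations_fixed: "T \<in> rotations S \<Longrightarrow> (\<And>i. i \<in> S \<Longrightarrow> x i = 0) \<Longrightarrow> T x = x"
  by (induction rule: rotations.induct) (auto simp: givens_def fun_eq_iff)

lemma rotations_linear: "T \<in> rotations S \<Longrightarrow> T (\<lambda>i. a * x i + b * y i) k = a * T x k + b * T y k"
  by (induction arbitrary: k rule: rotations.induct) (auto simp: givens_def algebra_simps)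

lemma rotations_diff: "T \<in> rotations S \<Longrightarrow> T (\<lambda>i. x i - y i) k = T x k - T y k"
  using rotations_linear[of T S 1 x "-1" y k] by simp

lemma rotations_inner:
  assumes "T \<in> rotations S" "finite R" "S \<subseteq> R"
  shows "(\<Sum>i\<in>R. cnj (T x i) * T y i) = (\<Sum>i\<in>R. cnj (x i) * y i)"
  using assms(1)
proof (induction)
  case (rotations_givens T i j c s)
  have ij: "i \<in> R" "j \<in> R - {i}" using rotations_givens assms by auto
  have split: "(\<Sum>k\<in>R. f k) = (f i + f j) + (\<Sum>k\<in>R - {i} - {j}. f k)" for f :: "_ \<Rightarrow> complex"
    using assms(2) ij by (simp add: sum.remove[of R i] sum.remove[of "R - {i}" j] add.assoc)
  let ?g = "givens i j c s"
  have "(\<Sum>k\<in>R. cnj (?g (T x) k) * ?g (T y) k) = (\<Sum>k\<in>R. cnj (T x k) * T y k)"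
    unfolding split using rotations_givens.hyps norm_square_rotation[of c s "T x i" "T x j" "T y i" "T y j"]
    by (auto simp: givens_def intro!: arg_cong2[where f="(+)"] sum.cong)
  then show ?case using rotations_givens.IH by simp
qed simp

lemma rotations_norm:
  assumes "T \<in> rotations S" "finite R" "S \<subseteq> R"
  shows "(\<Sum>i\<in>R. (cmod (T x i))\<^sup>2) = (\<Sum>i\<in>R. (cmod (x i))\<^sup>2)"
proof -
  have "of_real (\<Sum>i\<in>R. (cmod (T x i))\<^sup>2) = (of_real (\<Sum>i\<in>R. (cmod (x i))\<^sup>2) :: complex)"
    using rotations_inner[OF assms, of x x] unfolding of_real_sum complex_norm_square by (simp only: mult.commute)
  then show ?thesis by (simp only: of_real_eq_iff)
qed

lemma nn_integral_PiM_rotations: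
  assumes T: "T \<in> rotations S" and I: "finite I" "S \<subseteq> I"
    and f: "f \<in> borel_measurable (Pi\<^sub>M I (\<lambda>_. gauss))"
  shows "(\<lambda>x. f (T x)) \<in> borel_measurable (Pi\<^sub>M I (\<lambda>_. gauss))"
    and "(\<integral>\<^sup>+x. f (T x) \<partial>Pi\<^sub>M I (\<lambda>_. gauss)) = (\<integral>\<^sup>+x. f x \<partial>Pi\<^sub>M I (\<lambda>_. gauss))"
proof -
  have "(\<lambda>x. f (T x)) \<in> borel_measurable (Pi\<^sub>M I (\<lambda>_. gauss)) \<and> (\<integral>\<^sup>+x. f (T x) \<partial>Pi\<^sub>M I (\<lambda>_. gauss)) = (\<integral>\<^sup>+x. f x \<partial>Pi\<^sub>M I (\<lambda>_. gauss))"
    using T f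
  proof (induction arbitrary: f)
    case (rotations_givens T i j c s)
    note g = nn_integral_PiM_givens[of I i j c s f]
    have ij: "i \<in> I" "j \<in> I" using rotations_givens I by auto
    have "(\<lambda>x. f (givens i j c s x)) \<in> borel_measurable (Pi\<^sub>M I (\<lambda>_. gauss))"
      by (rule measurable_compose[OF g(1)]) (use rotations_givens I ij in auto)
    from rotations_givens.IH[OF this] show ?case using g(2) rotations_givens I ij by auto
  qed simp
  then show "(\<lambda>x. f (T x)) \<in> borel_measurable (Pi\<^sub>M I (\<lambda>_. gauss))"
    and "(\<integral>\<^sup>+x. f (T x) \<partial>Pi\<^sub>M I (\<lambda>_. gauss)) = (\<integral>\<^sup>+x. f x \<partial>Pi\<^sub>M I (\<lambda>_. gauss))" by auto
qed

lemma ex_rotation_annihilate: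
  assumes S: "finite S" "k \<in> S"
  shows "\<exists>T\<in>rotations S. \<forall>i\<in>S - {k}. T x i = 0"
proof -
  have "\<exists>T\<in>rotations S. \<forall>i\<in>F. T x i = 0" if "finite F" "F \<subseteq> S - {k}" for F
    using that
  proof (induction F)
    case empty then show ?case using rotations_id by auto
  next
    case (insert i F)
    then obtain T where T: "T \<in> rotations S" "\<forall>i\<in>F. T x i = 0" by auto
    define r where "r = sqrt ((cmod (T x k))\<^sup>2 + (cmod (T x i))\<^sup>2)"
    show ?case
    proof (cases "r = 0")
      case True
      then have "T x i = 0" by (simp add: r_def sum_power2_eq_zero_iff)
      then show ?thesis using T by auto
    next
      case False
      let ?c = "cnj (T x k) / of_real r" and ?s = "cnj (T x i) / of_real r"
      have r2: "r\<^sup>2 = (cmod (T x k))\<^sup>2 + (cmod (T x i))\<^sup>2" by (simp add: r_def)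
      have "(cmod ?c)\<^sup>2 + (cmod ?s)\<^sup>2 = ((cmod (T x k))\<^sup>2 + (cmod (T x i))\<^sup>2) / r\<^sup>2"
        by (simp add: norm_divide power_divide add_divide_distrib)
      also have "\<dots> = 1" using False by (simp flip: r2)
      finally have cs: "(cmod ?c)\<^sup>2 + (cmod ?s)\<^sup>2 = 1" .
      have "(\<lambda>x. givens k i ?c ?s (T x)) \<in> rotations S"
        using T insert.prems S cs by (intro rotations_givens) auto
      moreover have "givens k i ?c ?s (T x) l = 0" if "l \<in> insert i F" for l
      proof (cases "l = i")
        case True then show ?thesis using insert.prems by (auto simp: givens_def)
      next
        case False then show ?thesis using that insert.prems T by (auto simp: givens_def)
      qed
      ultimately show ?thesis
        by (intro bexI[of _ "\<lambda>x. givens k i ?c ?s (T x)"]) blast+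
    qed
  qed
  from this[of "S - {k}"] S show ?thesis by auto
qed

section \<open>Gram determinants of the columns of a matrix\<close>

text \<open>Columns are functions of the row index, and only the rows in \<open>R\<close> enter. Deleting a row is then
  just the removal of an element of \<open>R\<close>, without any relabelling.\<close>

definition gram :: "nat set \<Rightarrow> nat \<Rightarrow> (nat \<Rightarrow> nat \<Rightarrow> complex) \<Rightarrow> complex mat" where
  "gram R k c = mat k k (\<lambda>(a, b). \<Sum>i\<in>R. cnj (c a i) * c b i)"

definition gdet :: "nat set \<Rightarrow> nat \<Rightarrow> (nat \<Rightarrow> nat \<Rightarrow> complex) \<Rightarrow> real" where
  "gdet R k c = cmod (det (gram R k c))"

lemma gram_carrier [simp]: "gram R k c \<in> carrier_mat k k"
  by (simp add: gram_def)

lemma gdet_nonneg [simp]: "gdet R k c \<ge> 0"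
  by (simp add: gdet_def)

lemma gdet_0 [simp]: "gdet R 0 c = 1"
  by (simp add: gdet_def gram_def det_def)

lemma gdet_cong:
  assumes "\<And>j i. j < k \<Longrightarrow> i \<in> R \<Longrightarrow> c j i = c' j i"
  shows "gdet R k c = gdet R k c'"
proof -
  have "gram R k c = gram R k c'" by (auto simp: gram_def assms intro!: eq_matI sum.cong)
  then show ?thesis by (simp add: gdet_def)
qed

lemma gdet_square:
  assumes R: "finite R" "{..<k} \<subseteq> R" and z: "\<And>j i. j < k \<Longrightarrow> i \<in> R \<Longrightarrow> k \<le> i \<Longrightarrow> c j i = 0"
  shows "gdet R k c = (cmod (det (mat k k (\<lambda>(i, j). c j i))))\<^sup>2"
proof -
  interpret cnj: comm_ring_hom cnj by unfold_locales auto
  let ?M = "mat k k (\<lambda>(i, j). c j i)"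
  have "gram R k c = map_mat cnj (transpose_mat ?M) * ?M"
  proof (rule eq_matI)
    fix a b assume "a < dim_row (map_mat cnj (transpose_mat ?M) * ?M)" "b < dim_col (map_mat cnj (transpose_mat ?M) * ?M)"
    then have ab: "a < k" "b < k" by auto
    have "(\<Sum>i\<in>R. cnj (c a i) * c b i) = (\<Sum>i\<in>{..<k}. cnj (c a i) * c b i)"
      using R z ab by (intro sum.mono_neutral_right) (auto simp: not_less)
    then show "gram R k c $$ (a, b) = (map_mat cnj (transpose_mat ?M) * ?M) $$ (a, b)"
      using ab by (simp add: gram_def scalar_prod_def atLeast0LessThan)
  qed (auto simp: gram_def)
  then have "det (gram R k c) = cnj (det ?M) * det ?M"
    by (simp add: det_mult[of _ k] det_transpose[of _ k])
  then show ?thesis by (simp add: gdet_def norm_mult power2_eq_square)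
qed

lemma gdet_triangular:
  assumes R: "finite R" "{..<k} \<subseteq> R" and z: "\<And>j i. j < k \<Longrightarrow> i \<in> R \<Longrightarrow> j < i \<Longrightarrow> c j i = 0"
  shows "gdet R k c = (\<Prod>j<k. (cmod (c j j))\<^sup>2)"
proof -
  let ?M = "mat k k (\<lambda>(i, j). c j i)"
  have "det ?M = prod_list (diag_mat ?M)"
    using R by (intro det_upper_triangular[of _ k]) (auto simp: upper_triangular_def intro!: z)
  also have "\<dots> = (\<Prod>j<k. c j j)" by (simp add: prod_list_diag_prod atLeast0LessThan)
  finally show ?thesis using gdet_square[of R k c] R z
    by (simp add: prod_norm[symmetric] prod_power_distrib)
qed

lemma gdet_rotation:
  assumes "T \<in> rotations S" "finite R" "S \<subseteq> R"
  shows "gdet R k (\<lambda>j. T (c j)) = gdet R k c"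
  unfolding gdet_def gram_def using rotations_inner[OF assms] by simp

text \<open>A QR decomposition by plane rotations.\<close>

lemma ex_rotation_triangular:
  fixes R :: "nat set"
  assumes R: "finite R" "{..<k} \<subseteq> R"
  shows "\<exists>T\<in>rotations R. \<forall>j<k. \<forall>i\<in>R. j < i \<longrightarrow> T (c j) i = 0"
  using R(2)
proof (induction k)
  case 0 then show ?case using rotations_id by auto
next
  case (Suc k)
  have "{..<k} \<subseteq> R" using Suc.prems by auto
  with Suc.IH obtain T where T: "T \<in> rotations R" "\<And>j i. j < k \<Longrightarrow> i \<in> R \<Longrightarrow> j < i \<Longrightarrow> T (c j) i = 0"
    by blast
  let ?S = "{i\<in>R. k \<le> i}"
  obtain T' where T': "T' \<in> rotations ?S" "\<forall>i\<in>?S - {k}. T' (T (c k)) i = 0"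
    using ex_rotation_annihilate[of ?S k "T (c k)"] R(1) Suc.prems by auto
  have "(\<lambda>x. T' (T x)) \<in> rotations R"
    by (rule rotations_comp[OF rotations_mono[OF T'(1)] T(1)]) auto
  moreover have "T' (T (c j)) i = 0" if "j < Suc k" "i \<in> R" "j < i" for j i
  proof (cases "j = k")
    case True then show ?thesis using T' that by auto
  next
    case False
    then have "T' (T (c j)) = T (c j)" using that T by (intro rotations_fixed[OF T'(1)]) auto
    then show ?thesis using T that False by auto
  qed
  ultimately show ?case by (intro bexI[of _ "\<lambda>x. T' (T x)"]) auto
qed

text \<open>The last column contributes its squared distance from the span of the others, read off after
  these have been brought to triangular form.\<close>

lemma gdet_Suc:
  assumes R: "finite R" "{..<Suc k} \<subseteq> R" and T: "T \<in> rotations R"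
    and z: "\<And>j i. j < k \<Longrightarrow> i \<in> R \<Longrightarrow> j < i \<Longrightarrow> T (c j) i = 0"
  shows "gdet R (Suc k) c = gdet R k c * (\<Sum>i | i \<in> R \<and> k \<le> i. (cmod (T (c k) i))\<^sup>2)"
proof -
  let ?S = "{i\<in>R. k \<le> i}"
  have k: "k \<in> ?S" using R by auto
  obtain T' where T': "T' \<in> rotations ?S" "\<forall>i\<in>?S - {k}. T' (T (c k)) i = 0"
    using ex_rotation_annihilate[of ?S k "T (c k)"] R k by auto
  have fixed: "T' (T (c j)) = T (c j)" if "j < k" for j
    using that z by (intro rotations_fixed[OF T'(1)]) auto
  have "gdet R (Suc k) c = gdet R (Suc k) (\<lambda>j. T' (T (c j)))"
    by (rule gdet_rotation[OF rotations_comp[OF rotations_mono[OF T'(1)] T] R(1), symmetric]) auto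
  also have "\<dots> = (\<Prod>j<Suc k. (cmod (T' (T (c j)) j))\<^sup>2)"
    using R T' z by (intro gdet_triangular) (auto simp: less_Suc_eq fixed)
  also have "\<dots> = (\<Prod>j<k. (cmod (T (c j) j))\<^sup>2) * (cmod (T' (T (c k)) k))\<^sup>2"
    by (simp add: fixed)
  also have "(\<Prod>j<k. (cmod (T (c j) j))\<^sup>2) = gdet R k c"
  proof -
    have "gdet R k c = gdet R k (\<lambda>j. T (c j))" using gdet_rotation[OF T R(1)] by simp
    also have "\<dots> = (\<Prod>j<k. (cmod (T (c j) j))\<^sup>2)"
      using R z by (intro gdet_triangular) auto
    finally show ?thesis by simp
  qed
  also have "(cmod (T' (T (c k)) k))\<^sup>2 = (\<Sum>i\<in>?S. (cmod (T' (T (c k)) i))\<^sup>2)"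
    using T'(2) R k by (subst sum.remove[of ?S k]) auto
  also have "\<dots> = (\<Sum>i\<in>?S. (cmod (T (c k) i))\<^sup>2)"
    using R by (intro rotations_norm[OF T'(1)]) auto
  finally show ?thesis .
qed

definition unit_col :: "nat \<Rightarrow> nat \<Rightarrow> complex" where
  "unit_col k = (\<lambda>i. if i = k then 1 else 0)"

text \<open>Appending the \<open>k\<close>-th unit vector to the columns amounts to deleting row \<open>k\<close>: triangularise the
  columns on the other rows and expand the determinant along the unit column.\<close>

lemma gdet_unit_col:
  assumes R: "finite R" "{..<Suc k} \<subseteq> R"
  shows "gdet R (Suc k) (c(k := unit_col k)) = gdet (R - {k}) k c"
proof -
  let ?R = "R - {k}"
  have R': "finite ?R" "{..<k} \<subseteq> ?R" using R by auto
  obtain T where T: "T \<in> rotations ?R" "\<And>j i. j < k \<Longrightarrow> i \<in> ?R \<Longrightarrow> j < i \<Longrightarrow> T (c j) i = 0"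
    using ex_rotation_triangular[OF R', of c] by auto
  define c' where "c' = (\<lambda>j. T ((c(k := unit_col k)) j))"
  have ck: "c' k = unit_col k" unfolding c'_def by (simp, rule rotations_fixed[OF T(1)]) (auto simp: unit_col_def)
  have cj: "c' j = T (c j)" if "j < k" for j using that by (simp add: c'_def)
  let ?M = "mat (Suc k) (Suc k) (\<lambda>(i, j). c' j i)"
  have "gdet R (Suc k) (c(k := unit_col k)) = gdet R (Suc k) c'"
    unfolding c'_def by (rule gdet_rotation[OF T(1) R(1), symmetric]) auto
  also have "\<dots> = (cmod (det ?M))\<^sup>2"
    using R T by (intro gdet_square) (auto simp: less_Suc_eq ck cj unit_col_def)
  also have "det ?M = (\<Sum>i<Suc k. ?M $$ (i, k) * cofactor ?M i k)"
    by (rule laplace_expansion_column) auto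
  also have "\<dots> = cofactor ?M k k"
    by (simp add: ck unit_col_def)
  also have "\<dots> = det (mat_delete ?M k k)" by (simp add: cofactor_def)
  also have "mat_delete ?M k k = mat k k (\<lambda>(i, j). T (c j) i)"
    by (rule eq_matI) (auto simp: mat_delete_def cj)
  also have "(cmod (det (mat k k (\<lambda>(i, j). T (c j) i))))\<^sup>2 = gdet ?R k (\<lambda>j. T (c j))"
    using R' T by (intro gdet_square[symmetric]) auto
  also have "\<dots> = gdet ?R k c" using gdet_rotation[OF T(1) R'(1)] by auto
  finally show ?thesis .
qed

section \<open>Integrating out one Gaussian column\<close>

lemma gauss_PiM_measurable_compose:
  assumes "i \<in> I" "f \<in> borel_measurable borel"
  shows "(\<lambda>x. f (x i)) \<in> borel_measurable (Pi\<^sub>M I (\<lambda>_. gauss))"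
  using measurable_compose[OF measurable_component_singleton[of i I "\<lambda>_. gauss"], of f borel] assms by simp

lemma nn_integral_PiM_gauss_component:
  assumes I: "finite I" "i \<in> I" and f[measurable]: "f \<in> borel_measurable borel"
  shows "(\<integral>\<^sup>+x. f (x i) \<partial>Pi\<^sub>M I (\<lambda>_. gauss)) = (\<integral>\<^sup>+z. f z \<partial>gauss)"
proof -
  have "(\<integral>\<^sup>+x. f (x i) \<partial>Pi\<^sub>M I (\<lambda>_. gauss)) = (\<integral>\<^sup>+x. (\<Prod>j\<in>I. (if j = i then f (x j) else 1)) \<partial>Pi\<^sub>M I (\<lambda>_. gauss))"
    using I by (simp add: prod.delta)
  also have "\<dots> = (\<Prod>j\<in>I. \<integral>\<^sup>+z. (if j = i then f z else 1) \<partial>gauss)"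
    using I by (intro gauss_prod.product_nn_integral_prod) auto
  also have "\<dots> = (\<Prod>j\<in>I. (if j = i then (\<integral>\<^sup>+z. f z \<partial>gauss) else 1))"
    using gauss.emeasure_space_1 by (intro prod.cong) auto
  also have "\<dots> = (\<integral>\<^sup>+z. f z \<partial>gauss)" using I by (simp add: prod.delta)
  finally show ?thesis .
qed

text \<open>For a Gaussian vector \<open>x\<close>, the random variable \<open>\<Sum>i\<in>S. |b i - x i|\<^sup>2\<close> has a noncentral gamma
  distribution with shape \<open>card S\<close> and noncentrality \<open>\<Sum>i\<in>S. |b i|\<^sup>2\<close>.\<close>

lemma nn_integral_noncentral_sum:
  assumes I: "finite I" "S \<subseteq> I"
  shows "(\<integral>\<^sup>+x. ennreal (\<Sum>i\<in>S. (cmod (b i - x i))\<^sup>2) \<partial>Pi\<^sub>M I (\<lambda>_. gauss)) = ennreal (real (card S) + (\<Sum>i\<in>S. (cmod (b i))\<^sup>2))"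
proof -
  have fS: "finite S" using I finite_subset by auto
  have "(\<integral>\<^sup>+x. ennreal (\<Sum>i\<in>S. (cmod (b i - x i))\<^sup>2) \<partial>Pi\<^sub>M I (\<lambda>_. gauss)) = (\<integral>\<^sup>+x. (\<Sum>i\<in>S. ennreal ((cmod (b i - x i))\<^sup>2)) \<partial>Pi\<^sub>M I (\<lambda>_. gauss))"
    by (simp add: sum_ennreal)
  also have "\<dots> = (\<Sum>i\<in>S. \<integral>\<^sup>+x. ennreal ((cmod (b i - x i))\<^sup>2) \<partial>Pi\<^sub>M I (\<lambda>_. gauss))"
  proof (rule nn_integral_sum)
    fix i assume "i \<in> S"
    then show "(\<lambda>x. ennreal ((cmod (b i - x i))\<^sup>2)) \<in> borel_measurable (Pi\<^sub>M I (\<lambda>_. gauss))"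
      using I by (intro gauss_PiM_measurable_compose[where f="\<lambda>z. ennreal ((cmod (b i - z))\<^sup>2)"]) auto
  qed
  also have "\<dots> = (\<Sum>i\<in>S. ennreal (1 + (cmod (b i))\<^sup>2))"
    using I by (intro sum.cong refl, subst nn_integral_PiM_gauss_component[where f="\<lambda>z. ennreal ((cmod (b _ - z))\<^sup>2)"])
       (auto simp: nn_integral_gauss_norm_square)
  also have "\<dots> = ennreal (\<Sum>i\<in>S. 1 + (cmod (b i))\<^sup>2)"
    by (intro sum_ennreal) auto
  finally show ?thesis by (simp add: sum.distrib)
qed

lemma nn_integral_noncentral_exp:
  assumes I: "finite I" "S \<subseteq> I" and t: "t > -1"
  shows "(\<integral>\<^sup>+x. ennreal (exp (- t * (\<Sum>i\<in>S. (cmod (b i - x i))\<^sup>2))) \<partial>Pi\<^sub>M I (\<lambda>_. gauss))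
    = ennreal (exp (- t / (1 + t) * (\<Sum>i\<in>S. (cmod (b i))\<^sup>2)) / (1 + t) ^ card S)"
proof -
  have fS: "finite S" using I finite_subset by auto
  let ?f = "\<lambda>i z. if i \<in> S then ennreal (exp (- t * (cmod (b i - z))\<^sup>2)) else 1"
  have "(\<integral>\<^sup>+x. ennreal (exp (- t * (\<Sum>i\<in>S. (cmod (b i - x i))\<^sup>2))) \<partial>Pi\<^sub>M I (\<lambda>_. gauss))
     = (\<integral>\<^sup>+x. (\<Prod>i\<in>I. ?f i (x i)) \<partial>Pi\<^sub>M I (\<lambda>_. gauss))"
  proof (rule nn_integral_cong)
    fix x
    have "ennreal (exp (- t * (\<Sum>i\<in>S. (cmod (b i - x i))\<^sup>2))) = (\<Prod>i\<in>S. ennreal (exp (- t * (cmod (b i - x i))\<^sup>2)))"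
      using fS by (simp add: sum_distrib_left exp_sum prod_ennreal)
    also have "\<dots> = (\<Prod>i\<in>I. ?f i (x i))"
      using I by (intro prod.mono_neutral_cong_left) auto
    finally show "ennreal (exp (- t * (\<Sum>i\<in>S. (cmod (b i - x i))\<^sup>2))) = (\<Prod>i\<in>I. ?f i (x i))" .
  qed
  also have "\<dots> = (\<Prod>i\<in>I. \<integral>\<^sup>+z. ?f i z \<partial>gauss)"
    using I by (intro gauss_prod.product_nn_integral_prod) auto
  also have "\<dots> = (\<Prod>i\<in>S. ennreal (exp (- t / (1 + t) * (cmod (b i))\<^sup>2) / (1 + t)))"
    using I gauss.emeasure_space_1
    by (intro prod.mono_neutral_cong_right) (auto simp: nn_integral_gauss_exp[OF t, simplified])
  also have "\<dots> = ennreal (\<Prod>i\<in>S. exp (- t / (1 + t) * (cmod (b i))\<^sup>2) / (1 + t))"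
    using t by (intro prod_ennreal) auto
  also have "(\<Prod>i\<in>S. exp (- t / (1 + t) * (cmod (b i))\<^sup>2) / (1 + t)) = exp (- t / (1 + t) * (\<Sum>i\<in>S. (cmod (b i))\<^sup>2)) / (1 + t) ^ card S"
    unfolding sum_distrib_left exp_sum[OF fS] prod_dividef by simp
  finally show ?thesis .
qed

lemma ennreal_inverse_antimono: "a \<le> b \<Longrightarrow> inverse b \<le> inverse (a :: ennreal)"
proof (cases "a = 0 \<or> b = \<top>")
  case False
  assume ab: "a \<le> b"
  obtain x where x: "a = ennreal x" "x > 0"
    using False ab by (cases a) (auto simp: top_unique order_less_le)
  obtain y where y: "b = ennreal y" "y \<ge> 0" using False by (cases b) auto
  with ab False have "y > 0" by (cases "y = 0") auto
  with ab x y show ?thesis by (simp add: inverse_ennreal)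
qed auto

lemma nn_integral_exp_inverse:
  assumes "X \<ge> 0"
  shows "(\<integral>\<^sup>+t. ennreal (exp (- t * X)) * indicator {0..} t \<partial>lborel) = inverse (ennreal X)"
proof (cases "X = 0")
  case True
  have "emeasure lborel {0::real..} = \<top>"
  proof (rule ccontr)
    assume "emeasure lborel {0::real..} \<noteq> \<top>"
    then obtain n where n: "emeasure lborel {0::real..} < of_nat n" using ennreal_Ex_less_of_nat by (auto simp: less_top)
    have "of_nat n \<le> emeasure lborel {0::real..}"
      using emeasure_mono[of "{0..real n}" "{0..}" lborel] by (simp add: ennreal_of_nat_eq_real_of_nat)
    then show False using n by simp
  qed
  then show ?thesis using True by simp
next
  case False
  then have X: "X > 0" using assms by simp
  have "(\<integral>\<^sup>+t. ennreal (exp (- t * X)) * indicator {0..} t \<partial>lborel) = ennreal (0 - (- exp (- 0 * X) / X))"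
  proof (rule nn_integral_FTC_atLeast)
    show "((\<lambda>t. - exp (- t * X) / X) has_real_derivative exp (- t * X)) (at t)" for t
      using X by (auto intro!: derivative_eq_intros)
    show "((\<lambda>t. - exp (- t * X) / X) \<longlongrightarrow> 0) at_top" using X by real_asymp
  qed auto
  then show ?thesis using X by (simp add: inverse_ennreal inverse_eq_divide)
qed

text \<open>The factor \<open>1 + t\<close> to the power \<open>-(m - 2)\<close> is absorbed into the exponential by \<open>1 / (1 + t) \<le> exp (- t / (1 + t))\<close>, and the
  remaining square is the derivative of \<open>t / (1 + t)\<close>, so that the integral becomes elementary.\<close>

lemma nn_integral_laplace_bound:
  assumes m: "m \<ge> 3" and \<beta>: "\<beta> \<ge> 0"
  shows "(\<integral>\<^sup>+t. ennreal (exp (- t / (1 + t) * \<beta>) / (1 + t) ^ m) * indicator {0..} t \<partial>lborel) \<le> ennreal (1 / (real m - 2 + \<beta>))"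
proof -
  define q where "q = real m - 2 + \<beta>"
  have q: "q > 0" using assms by (simp add: q_def)
  have "(\<integral>\<^sup>+t. ennreal (exp (- t / (1 + t) * \<beta>) / (1 + t) ^ m) * indicator {0..} t \<partial>lborel)
     \<le> (\<integral>\<^sup>+t. ennreal (exp (- (t / (1 + t)) * q) / (1 + t) ^ 2) * indicator {0..} t \<partial>lborel)"
  proof (intro nn_integral_mono)
    fix t :: real
    have "exp (- t / (1 + t) * \<beta>) / (1 + t) ^ m \<le> exp (- (t / (1 + t)) * q) / (1 + t) ^ 2" if t: "t \<ge> 0"
    proof -
      have "1 / (1 + t) \<le> exp (- (t / (1 + t)))"
        using exp_ge_add_one_self[of "- (t / (1 + t))"] t by (simp add: field_simps)
      then have "(1 / (1 + t)) ^ (m - 2) \<le> exp (- (t / (1 + t))) ^ (m - 2)"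
        using t by (intro power_mono) auto
      also have "\<dots> = exp (- (t / (1 + t)) * (real m - 2))"
        using m by (simp add: exp_of_nat_mult[symmetric] of_nat_diff mult.commute)
      finally have *: "(1 / (1 + t)) ^ (m - 2) \<le> exp (- (t / (1 + t)) * (real m - 2))" .
      have "m = m - 2 + 2" using m by simp
      then have "(1 + t) ^ m = (1 + t) ^ (m - 2 + 2)" by (rule arg_cong)
      then have "(1 + t) ^ m = (1 + t) ^ (m - 2) * (1 + t) ^ 2" unfolding power_add .
      then have "exp (- t / (1 + t) * \<beta>) / (1 + t) ^ m = exp (- (t / (1 + t)) * \<beta>) * (1 / (1 + t)) ^ (m - 2) / (1 + t) ^ 2"
        by (simp add: power_divide)
      also have "\<dots> \<le> exp (- (t / (1 + t)) * \<beta>) * exp (- (t / (1 + t)) * (real m - 2)) / (1 + t) ^ 2"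
        using * by (intro divide_right_mono mult_left_mono) auto
      also have "exp (- (t / (1 + t)) * \<beta>) * exp (- (t / (1 + t)) * (real m - 2)) = exp (- (t / (1 + t)) * q)"
        unfolding exp_add[symmetric] q_def by (simp add: algebra_simps add_divide_distrib)
      finally show ?thesis .
    qed
    then show "ennreal (exp (- t / (1 + t) * \<beta>) / (1 + t) ^ m) * indicator {0..} t \<le> ennreal (exp (- (t / (1 + t)) * q) / (1 + t) ^ 2) * indicator {0..} t"
      by (auto split: split_indicator intro: ennreal_leI)
  qed
  also have "\<dots> = ennreal (- exp (- 1 * q) / q - (- exp (- (0 / (1 + 0)) * q) / q))"
  proof (rule nn_integral_FTC_atLeast)
    show "((\<lambda>t. - exp (- (t / (1 + t)) * q) / q) has_real_derivative exp (- (t / (1 + t)) * q) / (1 + t) ^ 2) (at t)" if "0 \<le> t" for t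
    proof -
      have "q * (1 + t) - t * q = q" by (simp add: algebra_simps)
      then show ?thesis using q that
        by (auto intro!: derivative_eq_intros simp: power2_eq_square add_divide_distrib[symmetric] diff_divide_distrib[symmetric])
    qed
    have "((\<lambda>t::real. t / (1 + t)) \<longlongrightarrow> 1) at_top" by real_asymp
    then show "((\<lambda>t. - exp (- (t / (1 + t)) * q) / q) \<longlongrightarrow> - exp (- 1 * q) / q) at_top"
      using q by (intro tendsto_intros) auto
  qed auto
  also have "\<dots> \<le> ennreal (1 / q)"
    using q by (intro ennreal_leI) (simp add: field_simps)
  finally show ?thesis by (simp add: q_def)
qed

text \<open>Integrate the Laplace transform, as \<open>1 / X\<close> is the integral of \<open>exp (- t X)\<close> over \<open>t \<ge> 0\<close>.\<close>

lemma nn_integral_noncentral_inverse: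
  assumes I: "finite I" "S \<subseteq> I" and m: "card S \<ge> 3"
  shows "(\<integral>\<^sup>+x. inverse (ennreal (\<Sum>i\<in>S. (cmod (b i - x i))\<^sup>2)) \<partial>Pi\<^sub>M I (\<lambda>_. gauss))
    \<le> ennreal (1 / (real (card S) - 2 + (\<Sum>i\<in>S. (cmod (b i))\<^sup>2)))"
proof -
  let ?P = "Pi\<^sub>M I (\<lambda>_. gauss)" and ?X = "\<lambda>x. \<Sum>i\<in>S. (cmod (b i - x i))\<^sup>2"
  interpret P: prob_space ?P by (intro prob_space_PiM prob_space_gauss)
  interpret pair_sigma_finite ?P lborel ..
  have X[measurable]: "?X \<in> borel_measurable ?P"
  proof (rule borel_measurable_sum)
    fix i assume "i \<in> S"
    then show "(\<lambda>x. (cmod (b i - x i))\<^sup>2) \<in> borel_measurable ?P"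
      using I by (intro gauss_PiM_measurable_compose[where f="\<lambda>z. (cmod (b i - z))\<^sup>2"]) auto
  qed
  have "(\<integral>\<^sup>+x. inverse (ennreal (?X x)) \<partial>?P) = (\<integral>\<^sup>+x. \<integral>\<^sup>+t. ennreal (exp (- t * ?X x)) * indicator {0..} t \<partial>lborel \<partial>?P)"
    by (subst nn_integral_exp_inverse) (auto intro: sum_nonneg)
  also have "\<dots> = (\<integral>\<^sup>+t. \<integral>\<^sup>+x. ennreal (exp (- t * ?X x)) * indicator {0..} t \<partial>?P \<partial>lborel)"
    by (rule Fubini'[symmetric]) measurable
  also have "\<dots> = (\<integral>\<^sup>+t. ennreal (exp (- t / (1 + t) * (\<Sum>i\<in>S. (cmod (b i))\<^sup>2)) / (1 + t) ^ card S) * indicator {0..} t \<partial>lborel)"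
  proof (rule nn_integral_cong)
    fix t :: real
    show "(\<integral>\<^sup>+x. ennreal (exp (- t * ?X x)) * indicator {0..} t \<partial>?P) = ennreal (exp (- t / (1 + t) * (\<Sum>i\<in>S. (cmod (b i))\<^sup>2)) / (1 + t) ^ card S) * indicator {0..} t"
      using nn_integral_noncentral_exp[OF I, of t b]
      by (cases "t \<ge> 0") (auto simp: nn_integral_multc)
  qed
  also have "\<dots> \<le> ennreal (1 / (real (card S) - 2 + (\<Sum>i\<in>S. (cmod (b i))\<^sup>2)))"
    using m by (intro nn_integral_laplace_bound sum_nonneg) auto
  finally show ?thesis .
qed

lemma nn_integral_gauss_inverse_norm:
  "(\<integral>\<^sup>+z. inverse (ennreal (cmod (b - z))) \<partial>gauss) \<le> 3"
proof -
  let ?d = std_complex_gaussian_density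
  have [measurable]: "ball b 1 \<in> sets borel" by simp
  have d: "?d z \<le> ennreal (1 / pi)" for z
    unfolding std_complex_gaussian_density_def by (intro ennreal_leI divide_right_mono) auto
  have "(\<integral>\<^sup>+z. inverse (ennreal (cmod (b - z))) \<partial>gauss) = (\<integral>\<^sup>+z. ?d z * inverse (ennreal (cmod (b - z))) \<partial>lborel)"
    by (rule nn_integral_gauss) measurable
  also have "\<dots> \<le> (\<integral>\<^sup>+z. ennreal (1 / pi) * (ennreal (1 / cmod (z - b)) * indicator (ball b 1) z) + ?d z \<partial>lborel)"
  proof (rule nn_integral_mono_AE)
    have "AE z in lborel. z \<noteq> b" by (rule AE_lborel_singleton)
    then show "AE z in lborel. ?d z * inverse (ennreal (cmod (b - z))) \<le> ennreal (1 / pi) * (ennreal (1 / cmod (z - b)) * indicator (ball b 1) z) + ?d z"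
    proof eventually_elim
      case (elim z)
      then have i: "inverse (ennreal (cmod (b - z))) = ennreal (1 / cmod (z - b))"
        by (simp add: inverse_ennreal inverse_eq_divide norm_minus_commute)
      show ?case
      proof (cases "z \<in> ball b 1")
        case True
        have "?d z * inverse (ennreal (cmod (b - z))) \<le> ennreal (1 / pi) * ennreal (1 / cmod (z - b))"
          unfolding i by (intro mult_right_mono d) auto
        also have "\<dots> \<le> ennreal (1 / pi) * ennreal (1 / cmod (z - b)) + ?d z" by simp
        finally show ?thesis using True by simp
      next
        case False
        then have "1 / cmod (z - b) \<le> 1" by (simp add: dist_norm norm_minus_commute divide_le_eq_1)
        then have "?d z * inverse (ennreal (cmod (b - z))) \<le> ?d z * 1"
          unfolding i by (intro mult_left_mono) auto
        then show ?thesis using False by simp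
      qed
    qed
  qed
  also have "\<dots> = ennreal (1 / pi) * (\<integral>\<^sup>+z. ennreal (1 / cmod (z - b)) * indicator (ball b 1) z \<partial>lborel) + (\<integral>\<^sup>+z. ?d z \<partial>lborel)"
    by (subst nn_integral_add) (auto simp: nn_integral_cmult)
  also have "(\<integral>\<^sup>+z. ?d z \<partial>lborel) = 1"
    using gauss.emeasure_space_1 nn_integral_gauss[of "\<lambda>_. 1"] by simp
  also have "(\<integral>\<^sup>+z. ennreal (1 / cmod (z - b)) * indicator (ball b 1) z \<partial>lborel) \<le> ennreal (2 * pi)"
  proof -
    have "(\<integral>\<^sup>+z. ennreal (1 / cmod (z - b)) * indicator (ball b 1) z \<partial>lborel) = (\<integral>\<^sup>+z. ennreal (1 / cmod z) * indicator (ball b 1) (b + z) \<partial>lborel)"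
      by (subst nn_integral_lborel_translate[symmetric, where c=b]) auto
    also have "\<dots> = (\<integral>\<^sup>+z. ennreal (1 / cmod z) * indicator (ball 0 1) z \<partial>lborel)"
      by (intro nn_integral_cong) (auto split: split_indicator simp: dist_norm)
    finally show ?thesis using nn_integral_inverse_norm_unit_disc by simp
  qed
  finally have "(\<integral>\<^sup>+z. inverse (ennreal (cmod (b - z))) \<partial>gauss) \<le> ennreal (1 / pi) * ennreal (2 * pi) + 1"
    by (auto simp: mult_left_mono add_right_mono)
  also have "ennreal (1 / pi) * ennreal (2 * pi) = 2" by (subst ennreal_mult[symmetric]) auto
  finally show ?thesis by simp
qed

text \<open>One coordinate already suffices, since \<open>1 / |z|\<close> is integrable in the plane.\<close>

lemma nn_integral_noncentral_inverse_sqrt: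
  assumes I: "finite I" "S \<subseteq> I" and k: "k \<in> S"
  shows "(\<integral>\<^sup>+x. inverse (ennreal (sqrt (\<Sum>i\<in>S. (cmod (b i - x i))\<^sup>2))) \<partial>Pi\<^sub>M I (\<lambda>_. gauss)) \<le> 3"
proof -
  have fS: "finite S" using I finite_subset by auto
  have "(\<integral>\<^sup>+x. inverse (ennreal (sqrt (\<Sum>i\<in>S. (cmod (b i - x i))\<^sup>2))) \<partial>Pi\<^sub>M I (\<lambda>_. gauss))
     \<le> (\<integral>\<^sup>+x. inverse (ennreal (cmod (b k - x k))) \<partial>Pi\<^sub>M I (\<lambda>_. gauss))"
  proof (intro nn_integral_mono)
    fix x
    have "(cmod (b k - x k))\<^sup>2 \<le> (\<Sum>i\<in>S. (cmod (b i - x i))\<^sup>2)"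
      using fS k by (intro member_le_sum) auto
    then have "cmod (b k - x k) \<le> sqrt (\<Sum>i\<in>S. (cmod (b i - x i))\<^sup>2)" by (rule real_le_rsqrt)
    then show "inverse (ennreal (sqrt (\<Sum>i\<in>S. (cmod (b i - x i))\<^sup>2))) \<le> inverse (ennreal (cmod (b k - x k)))"
      by (intro ennreal_inverse_antimono ennreal_leI)
  qed
  also have "\<dots> = (\<integral>\<^sup>+z. inverse (ennreal (cmod (b k - z))) \<partial>gauss)"
    using I k by (intro nn_integral_PiM_gauss_component[where f="\<lambda>z. inverse (ennreal (cmod (b k - z)))"]) auto
  also have "\<dots> \<le> 3" by (rule nn_integral_gauss_inverse_norm)
  finally show ?thesis .
qed

definition scaled_unit :: "complex \<Rightarrow> nat \<Rightarrow> nat \<Rightarrow> complex" where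
  "scaled_unit z k = (\<lambda>i. if i = k then z else 0)"

text \<open>In the coordinates that triangularise the earlier columns, the \<open>k\<close>-th column of \<open>z - g\<close> is a Gaussian vector
  with a new centre \<open>b\<close>. The noncentrality is the Gram determinant with row \<open>k\<close> deleted, up to the factor
  \<open>|z|\<^sup>2\<close>, because the centre before the rotation is a multiple of the \<open>k\<close>-th unit vector.\<close>

lemma gdet_shifted_column:
  assumes R: "finite R" "{..<Suc k} \<subseteq> R"
  obtains T b where "T \<in> rotations R"
    "\<And>x. gdet R (Suc k) (c(k := (\<lambda>i. scaled_unit z k i - x i))) = gdet R k c * (\<Sum>i | i \<in> R \<and> k \<le> i. (cmod (b i - T x i))\<^sup>2)"
    "gdet R k c * (\<Sum>i | i \<in> R \<and> k \<le> i. (cmod (b i))\<^sup>2) = (cmod z)\<^sup>2 * gdet (R - {k}) k c"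
proof -
  have "{..<k} \<subseteq> R" using R by auto
  then obtain T where T: "T \<in> rotations R" "\<And>j i. j < k \<Longrightarrow> i \<in> R \<Longrightarrow> j < i \<Longrightarrow> T (c j) i = 0"
    using ex_rotation_triangular[OF R(1), of k c] by auto
  define b where "b = T (scaled_unit z k)"
  have *: "gdet R (Suc k) (c(k := v)) = gdet R k c * (\<Sum>i | i \<in> R \<and> k \<le> i. (cmod (T v i))\<^sup>2)" for v
  proof -
    have "gdet R (Suc k) (c(k := v)) = gdet R k (c(k := v)) * (\<Sum>i | i \<in> R \<and> k \<le> i. (cmod (T ((c(k := v)) k) i))\<^sup>2)"
      using T by (intro gdet_Suc R) auto
    also have "gdet R k (c(k := v)) = gdet R k c" by (rule gdet_cong) auto
    finally show ?thesis by (simp only: fun_upd_same)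
  qed
  have lin: "b i = z * T (unit_col k) i" for i
    using rotations_linear[OF T(1), of z "unit_col k" 0 "unit_col k" i]
    by (simp add: b_def scaled_unit_def unit_col_def if_distrib[of "\<lambda>x. z * x"] cong: if_cong)
  have "gdet R k c * (\<Sum>i | i \<in> R \<and> k \<le> i. (cmod (b i))\<^sup>2) = (cmod z)\<^sup>2 * gdet (R - {k}) k c"
    unfolding gdet_unit_col[OF R, of c, symmetric] * lin
    by (simp add: norm_mult power_mult_distrib sum_distrib_left[symmetric])
  with that[of T b] T(1) * show ?thesis by (simp add: b_def rotations_diff)
qed

lemma card_tail:
  assumes "finite R" "{..<k} \<subseteq> R"
  shows "card {i\<in>R. k \<le> i} = card R - k"
proof -
  have "{i\<in>R. k \<le> i} = R - {..<k}" by auto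
  then show ?thesis using assms by (simp add: card_Diff_subset)
qed

lemma noncentral_measurable:
  assumes "S \<subseteq> I"
  shows "(\<lambda>x. \<Sum>i\<in>S. (cmod (b i - x i))\<^sup>2) \<in> borel_measurable (Pi\<^sub>M I (\<lambda>_. gauss))"
proof (rule borel_measurable_sum)
  fix i assume "i \<in> S"
  then show "(\<lambda>x. (cmod (b i - x i))\<^sup>2) \<in> borel_measurable (Pi\<^sub>M I (\<lambda>_. gauss))"
    using assms by (intro gauss_PiM_measurable_compose[where f="\<lambda>z. (cmod (b i - z))\<^sup>2"]) auto
qed

text \<open>The law of the column is invariant under the rotation in \<open>gdet_shifted_column\<close>, so the moments of a noncentral
  gamma variable with shape \<open>card R - k\<close> apply.\<close>

lemma nn_integral_gdet_column:
  assumes I: "finite I" "R \<subseteq> I" and R: "{..<Suc k} \<subseteq> R"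
  shows "(\<integral>\<^sup>+x. ennreal (gdet R (Suc k) (c(k := (\<lambda>i. scaled_unit z k i - x i)))) \<partial>Pi\<^sub>M I (\<lambda>_. gauss))
    = ennreal (real (card R - k) * gdet R k c + (cmod z)\<^sup>2 * gdet (R - {k}) k c)"
    (is ?upper)
    and "card R - k \<ge> 3 \<Longrightarrow>
    (\<integral>\<^sup>+x. inverse (ennreal (gdet R (Suc k) (c(k := (\<lambda>i. scaled_unit z k i - x i))))) \<partial>Pi\<^sub>M I (\<lambda>_. gauss))
    \<le> inverse (ennreal ((real (card R - k) - 2) * gdet R k c + (cmod z)\<^sup>2 * gdet (R - {k}) k c))"
    (is "_ \<Longrightarrow> ?lower")
    and "(\<integral>\<^sup>+x. inverse (ennreal (sqrt (gdet R (Suc k) (c(k := (\<lambda>i. scaled_unit z k i - x i)))))) \<partial>Pi\<^sub>M I (\<lambda>_. gauss))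
    \<le> 3 * inverse (ennreal (sqrt (gdet R k c)))"
    (is ?sqrt)
proof -
  let ?P = "Pi\<^sub>M I (\<lambda>_. gauss)" and ?D = "gdet R k c" and ?S = "{i\<in>R. k \<le> i}" and ?m = "card R - k"
  have fR: "finite R" using I finite_subset by auto
  have SI: "?S \<subseteq> I" using I by auto
  have m: "card ?S = ?m" using R by (intro card_tail fR) auto
  obtain T b where T: "T \<in> rotations R"
    and D: "\<And>x. gdet R (Suc k) (c(k := (\<lambda>i. scaled_unit z k i - x i))) = ?D * (\<Sum>i\<in>?S. (cmod (b i - T x i))\<^sup>2)"
    and b: "?D * (\<Sum>i\<in>?S. (cmod (b i))\<^sup>2) = (cmod z)\<^sup>2 * gdet (R - {k}) k c"
    using gdet_shifted_column[OF fR R, of c z] by blast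
  let ?X = "\<lambda>x. \<Sum>i\<in>?S. (cmod (b i - x i))\<^sup>2" and ?\<beta> = "\<Sum>i\<in>?S. (cmod (b i))\<^sup>2"
  have X0: "?X x \<ge> 0" for x by (intro sum_nonneg) auto
  have \<beta>0: "?\<beta> \<ge> 0" by (intro sum_nonneg) auto
  note [measurable] = noncentral_measurable[OF SI, of b]
  have rot: "(\<integral>\<^sup>+x. h (?X (T x)) \<partial>?P) = (\<integral>\<^sup>+x. h (?X x) \<partial>?P)" if [measurable]: "h \<in> borel_measurable borel" for h
    using nn_integral_PiM_rotations(2)[OF T I(1,2), of "\<lambda>x. h (?X x)"] by simp
  have "(\<integral>\<^sup>+x. ennreal (gdet R (Suc k) (c(k := (\<lambda>i. scaled_unit z k i - x i)))) \<partial>?P) = (\<integral>\<^sup>+x. ennreal (?D * ?X x) \<partial>?P)"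
    unfolding D by (rule rot[of "\<lambda>t. ennreal (?D * t)"]) measurable
  also have "\<dots> = ennreal ?D * (\<integral>\<^sup>+x. ennreal (?X x) \<partial>?P)"
    by (subst nn_integral_cmult[symmetric]) (simp_all add: ennreal_mult X0)
  also have "\<dots> = ennreal (?D * (real ?m + ?\<beta>))"
    unfolding nn_integral_noncentral_sum[OF I(1) SI] m using \<beta>0 by (simp add: ennreal_mult)
  also have "?D * (real ?m + ?\<beta>) = real ?m * ?D + (cmod z)\<^sup>2 * gdet (R - {k}) k c"
    using b by (simp add: algebra_simps)
  finally show ?upper .
  show ?lower if m3: "?m \<ge> 3"
  proof -
    have "(\<integral>\<^sup>+x. inverse (ennreal (gdet R (Suc k) (c(k := (\<lambda>i. scaled_unit z k i - x i))))) \<partial>?P) = (\<integral>\<^sup>+x. inverse (ennreal (?D * ?X x)) \<partial>?P)"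
      unfolding D by (rule rot[of "\<lambda>t. inverse (ennreal (?D * t))"]) measurable
    also have "\<dots> = (\<integral>\<^sup>+x. inverse (ennreal ?D) * inverse (ennreal (?X x)) \<partial>?P)"
      by (intro nn_integral_cong) (simp add: ennreal_mult X0 ennreal_inverse_mult)
    also have "\<dots> = inverse (ennreal ?D) * (\<integral>\<^sup>+x. inverse (ennreal (?X x)) \<partial>?P)"
      by (rule nn_integral_cmult) measurable
    also have "\<dots> \<le> inverse (ennreal ?D) * ennreal (1 / (real ?m - 2 + ?\<beta>))"
      using nn_integral_noncentral_inverse[OF I(1) SI, of b] m m3 by (intro mult_left_mono) auto
    also have "\<dots> = inverse (ennreal (?D * (real ?m - 2 + ?\<beta>)))"
    proof -
      have "real ?m - 2 + ?\<beta> > 0" using m3 \<beta>0 by linarith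
      then show ?thesis by (simp add: ennreal_mult ennreal_inverse_mult inverse_ennreal inverse_eq_divide)
    qed
    also have "?D * (real ?m - 2 + ?\<beta>) = (real ?m - 2) * ?D + (cmod z)\<^sup>2 * gdet (R - {k}) k c"
      using b by (simp add: algebra_simps)
    finally show ?thesis .
  qed
  have "(\<integral>\<^sup>+x. inverse (ennreal (sqrt (gdet R (Suc k) (c(k := (\<lambda>i. scaled_unit z k i - x i)))))) \<partial>?P) = (\<integral>\<^sup>+x. inverse (ennreal (sqrt (?D * ?X x))) \<partial>?P)"
    unfolding D by (rule rot[of "\<lambda>t. inverse (ennreal (sqrt (?D * t)))"]) measurable
  also have "\<dots> = (\<integral>\<^sup>+x. inverse (ennreal (sqrt ?D)) * inverse (ennreal (sqrt (?X x))) \<partial>?P)"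
    by (intro nn_integral_cong) (simp add: ennreal_mult X0 real_sqrt_mult ennreal_inverse_mult)
  also have "\<dots> = inverse (ennreal (sqrt ?D)) * (\<integral>\<^sup>+x. inverse (ennreal (sqrt (?X x))) \<partial>?P)"
    by (rule nn_integral_cmult) measurable
  also have "\<dots> \<le> inverse (ennreal (sqrt ?D)) * 3"
    using R nn_integral_noncentral_inverse_sqrt[OF I(1) SI, of k b] by (intro mult_left_mono) auto
  finally show ?sqrt by (simp add: mult.commute)
qed

section \<open>Moments of the characteristic polynomial\<close>

lemma borel_measurable_det:
  fixes A :: "'b \<Rightarrow> complex mat"
  assumes "\<And>x. A x \<in> carrier_mat n n" and "\<And>i j. i < n \<Longrightarrow> j < n \<Longrightarrow> (\<lambda>x. A x $$ (i, j)) \<in> borel_measurable M"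
  shows "(\<lambda>x. det (A x)) \<in> borel_measurable M"
proof -
  have "(\<lambda>x. \<Sum>p\<in>{p. p permutes {0..<n}}. signof p * (\<Prod>i = 0..<n. A x $$ (i, p i))) \<in> borel_measurable M"
    using assms(2) by (intro borel_measurable_sum borel_measurable_times borel_measurable_const borel_measurable_prod)
      (auto dest: permutes_in_image)
  then show ?thesis using assms(1) by (simp add: det_def'[of _ n])
qed

lemma borel_measurable_gdet:
  assumes "finite R" "\<And>i j. i \<in> R \<Longrightarrow> j < k \<Longrightarrow> (\<lambda>x. c x j i) \<in> borel_measurable M"
  shows "(\<lambda>x. gdet R k (c x)) \<in> borel_measurable M"
  unfolding gdet_def
proof -
  have [measurable]: "cnj \<in> borel_measurable borel" by (intro borel_measurable_continuous_onI continuous_intros)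
  have "(\<lambda>x. gram R k (c x) $$ (a, b)) \<in> borel_measurable M" if "a < k" "b < k" for a b
  proof -
  have "(\<lambda>x. \<Sum>i\<in>R. cnj (c x a i) * c x b i) \<in> borel_measurable M"
    using assms that by (intro borel_measurable_sum borel_measurable_times measurable_compose[OF _ \<open>cnj \<in> borel_measurable borel\<close>]) auto
  then show ?thesis using that by (simp add: gram_def)
  qed
  then have [measurable]: "(\<lambda>x. det (gram R k (c x))) \<in> borel_measurable M"
    by (intro borel_measurable_det[where n=k]) auto
  show "(\<lambda>x. cmod (det (gram R k (c x)))) \<in> borel_measurable M" by measurable
qed

text \<open>The columns of \<open>z - g\<close>.\<close>

definition shifted :: "complex \<Rightarrow> (nat \<times> nat \<Rightarrow> complex) \<Rightarrow> nat \<Rightarrow> nat \<Rightarrow> complex" where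
  "shifted z g j i = scaled_unit z j i - g (i, j)"

abbreviation gauss_array :: "nat \<Rightarrow> nat \<Rightarrow> (nat \<times> nat \<Rightarrow> complex) measure" where
  "gauss_array n k \<equiv> Pi\<^sub>M ({..<n} \<times> {..<k}) (\<lambda>_. gauss)"

lemma gauss_array_component:
  "i < n \<Longrightarrow> j < k \<Longrightarrow> (\<lambda>g. g (i, j)) \<in> borel_measurable (gauss_array n k)"
  using gauss_PiM_measurable_compose[of "(i, j)" "{..<n} \<times> {..<k}" "\<lambda>x. x"] by simp

lemma shifted_gdet_measurable:
  assumes "R \<subseteq> {..<n}" "k \<le> K"
  shows "(\<lambda>g. gdet R k (shifted z g)) \<in> borel_measurable (gauss_array n K)"
  using assms finite_subset[OF assms(1)]
  by (intro borel_measurable_gdet) (auto simp: shifted_def subset_eq intro!: borel_measurable_diff borel_measurable_const gauss_array_component)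

lemma nn_integral_gauss_array_Suc:
  assumes f: "f \<in> borel_measurable (gauss_array n (Suc k))"
  shows "(\<integral>\<^sup>+g. f g \<partial>gauss_array n (Suc k))
    = (\<integral>\<^sup>+g. \<integral>\<^sup>+x. f (\<lambda>p\<in>{..<n} \<times> {..<Suc k}. if snd p = k then x (fst p) else g p) \<partial>Pi\<^sub>M {..<n} (\<lambda>_. gauss) \<partial>gauss_array n k)"
proof -
  let ?I = "{..<n} \<times> {..<k}" and ?J = "{..<n} \<times> {k}" and ?P = "\<lambda>I :: (nat \<times> nat) set. Pi\<^sub>M I (\<lambda>_. gauss)"
  let ?t = "\<lambda>x. \<lambda>p\<in>?J. x (fst p)"
  have IJ: "{..<n} \<times> {..<Suc k} = ?I \<union> ?J" by auto
  have d: "distr (Pi\<^sub>M {..<n} (\<lambda>_. gauss)) (?P ?J) ?t = ?P ?J"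
    using distr_PiM_reindex[of "{..<n}" "\<lambda>_. gauss" fst ?J] prob_space_gauss by (auto simp: inj_on_def Pi_def)
  have t: "?t \<in> measurable (Pi\<^sub>M {..<n} (\<lambda>_. gauss)) (?P ?J)"
    by (rule measurable_restrict) auto
  have "(\<integral>\<^sup>+g. f g \<partial>gauss_array n (Suc k)) = (\<integral>\<^sup>+g. \<integral>\<^sup>+y. f (merge ?I ?J (g, y)) \<partial>?P ?J \<partial>?P ?I)"
    unfolding IJ using f by (intro gauss_prod.product_nn_integral_fold) (auto simp: IJ)
  also have "\<dots> = (\<integral>\<^sup>+g. \<integral>\<^sup>+x. f (\<lambda>p\<in>{..<n} \<times> {..<Suc k}. if snd p = k then x (fst p) else g p) \<partial>Pi\<^sub>M {..<n} (\<lambda>_. gauss) \<partial>?P ?I)"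
  proof (rule nn_integral_cong)
    fix g assume g: "g \<in> space (?P ?I)"
    have m: "(\<lambda>y. f (merge ?I ?J (g, y))) \<in> borel_measurable (?P ?J)"
      by (rule measurable_compose[OF measurable_compose[OF measurable_Pair1'[OF g] measurable_merge]])
        (use f in \<open>simp add: IJ\<close>)
    have "(\<integral>\<^sup>+y. f (merge ?I ?J (g, y)) \<partial>?P ?J) = (\<integral>\<^sup>+x. f (merge ?I ?J (g, ?t x)) \<partial>Pi\<^sub>M {..<n} (\<lambda>_. gauss))"
      by (subst d[symmetric], subst nn_integral_distr[OF t]) (use m in \<open>auto simp: d\<close>)
    also have "\<dots> = (\<integral>\<^sup>+x. f (\<lambda>p\<in>{..<n} \<times> {..<Suc k}. if snd p = k then x (fst p) else g p) \<partial>Pi\<^sub>M {..<n} (\<lambda>_. gauss))"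
      by (intro nn_integral_cong arg_cong[where f=f]) (auto simp: merge_def fun_eq_iff)
    finally show "(\<integral>\<^sup>+y. f (merge ?I ?J (g, y)) \<partial>?P ?J) = (\<integral>\<^sup>+x. f (\<lambda>p\<in>{..<n} \<times> {..<Suc k}. if snd p = k then x (fst p) else g p) \<partial>Pi\<^sub>M {..<n} (\<lambda>_. gauss))" .
  qed
  finally show ?thesis .
qed

lemma nn_integral_shifted_Suc:
  assumes R: "R \<subseteq> {..<n}" and [measurable]: "h \<in> borel_measurable borel"
  shows "(\<integral>\<^sup>+g. h (gdet R (Suc k) (shifted z g)) \<partial>gauss_array n (Suc k))
    = (\<integral>\<^sup>+g. \<integral>\<^sup>+x. h (gdet R (Suc k) ((shifted z g)(k := (\<lambda>i. scaled_unit z k i - x i)))) \<partial>Pi\<^sub>M {..<n} (\<lambda>_. gauss) \<partial>gauss_array n k)"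
proof -
  have "gdet R (Suc k) (shifted z (\<lambda>p\<in>{..<n} \<times> {..<Suc k}. if snd p = k then x (fst p) else g p))
    = gdet R (Suc k) ((shifted z g)(k := (\<lambda>i. scaled_unit z k i - x i)))" for x g
    using R by (intro gdet_cong) (auto simp: shifted_def)
  then show ?thesis
    using measurable_compose[OF shifted_gdet_measurable[OF R order_refl] assms(2)]
    by (subst nn_integral_gauss_array_Suc) auto
qed

text \<open>\<open>gin_moment z k M\<close> is the mean of the Gram determinant of the first \<open>k\<close> columns of \<open>z - G\<close>, for a
  matrix with \<open>k + M\<close> rows. The recursion integrates out one column; its two terms keep and
  delete the row of the diagonal entry of that column.\<close>

fun gin_moment :: "complex \<Rightarrow> nat \<Rightarrow> nat \<Rightarrow> real" where
  "gin_moment z 0 M = 1"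
| "gin_moment z (Suc k) M = (real M + 1) * gin_moment z k (Suc M) + (cmod z)\<^sup>2 * gin_moment z k M"

lemma gin_moment_pos: "gin_moment z k M > 0"
  by (induction k arbitrary: M) (auto intro!: add_pos_nonneg simp: less_imp_le)

theorem nn_integral_gdet_shifted:
  assumes "R \<subseteq> {..<n}" "{..<k} \<subseteq> R"
  shows "(\<integral>\<^sup>+g. ennreal (gdet R k (shifted z g)) \<partial>gauss_array n k) = ennreal (gin_moment z k (card R - k))"
  using assms
proof (induction k arbitrary: R)
  case 0
  interpret prob_space "gauss_array n 0" by (intro prob_space_PiM prob_space_gauss)
  show ?case using emeasure_space_1 by simp
next
  case (Suc k)
  have fR: "finite R" using Suc.prems finite_subset by auto
  have card: "card R \<ge> Suc k" using card_mono[OF fR Suc.prems(2)] by simp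
  have k: "k \<in> R" using Suc.prems by auto
  have sub: "R - {k} \<subseteq> {..<n}" using Suc.prems by auto
  have m[measurable]: "(\<lambda>g. gdet R k (shifted z g)) \<in> borel_measurable (gauss_array n k)"
    "(\<lambda>g. gdet (R - {k}) k (shifted z g)) \<in> borel_measurable (gauss_array n k)"
    using Suc.prems sub by (auto intro!: shifted_gdet_measurable)
  have "(\<integral>\<^sup>+g. ennreal (gdet R (Suc k) (shifted z g)) \<partial>gauss_array n (Suc k))
     = (\<integral>\<^sup>+g. ennreal (real (card R - k) * gdet R k (shifted z g) + (cmod z)\<^sup>2 * gdet (R - {k}) k (shifted z g)) \<partial>gauss_array n k)"
    using Suc.prems
    by (subst nn_integral_shifted_Suc[OF Suc.prems(1), of ennreal])
       (simp_all only: nn_integral_gdet_column(1) finite_lessThan measurable_ennreal)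
  also have "\<dots> = (\<integral>\<^sup>+g. ennreal (real (card R - k)) * ennreal (gdet R k (shifted z g)) + ennreal ((cmod z)\<^sup>2) * ennreal (gdet (R - {k}) k (shifted z g)) \<partial>gauss_array n k)"
    by (intro nn_integral_cong) (simp add: ennreal_mult)
  also have "\<dots> = ennreal (real (card R - k)) * (\<integral>\<^sup>+g. ennreal (gdet R k (shifted z g)) \<partial>gauss_array n k)
      + ennreal ((cmod z)\<^sup>2) * (\<integral>\<^sup>+g. ennreal (gdet (R - {k}) k (shifted z g)) \<partial>gauss_array n k)"
    by (subst nn_integral_add) (auto simp: nn_integral_cmult)
  also have "\<dots> = ennreal (real (card R - k)) * ennreal (gin_moment z k (card R - k)) + ennreal ((cmod z)\<^sup>2) * ennreal (gin_moment z k (card (R - {k}) - k))"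
    using Suc.prems by (subst (1 2) Suc.IH) auto
  also have "\<dots> = ennreal (gin_moment z (Suc k) (card R - Suc k))"
  proof -
    have "card R - k = Suc (card R - Suc k)" "card (R - {k}) - k = card R - Suc k"
      using card k fR by (auto simp: card_Diff_singleton)
    then show ?thesis
      by (simp add: ennreal_mult[symmetric] ennreal_plus[symmetric] less_imp_le[OF gin_moment_pos] del: ennreal_plus)
  qed
  finally show ?case .
qed

text \<open>Titu's inequality is what replaces Minkowski's inequality for the exponent \<open>-1\<close>: with the
  optimal weight, bounds on the means of \<open>1 / X\<close> and \<open>1 / Y\<close> give one on the mean of \<open>1 / (a X + b Y)\<close>.\<close>

lemma inverse_add_le_weighted:
  assumes "X \<ge> 0" "Y \<ge> 0" and a: "a > 0" and b: "b > 0" and t: "0 < t" "t < 1"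
  shows "inverse (ennreal (a * X + b * Y)) \<le> ennreal (t\<^sup>2 / a) * inverse (ennreal X) + ennreal ((1 - t)\<^sup>2 / b) * inverse (ennreal Y)"
proof (cases "X = 0 \<or> Y = 0")
  case True
  have "ennreal (t\<^sup>2 / a) \<noteq> 0" "ennreal ((1 - t)\<^sup>2 / b) \<noteq> 0" using a b t by auto
  then show ?thesis using True by (auto simp: ennreal_mult_top)
next
  case False
  then have XY: "X > 0" "Y > 0" using assms by auto
  define p q where "p = a * X" and "q = b * Y"
  have pq: "p > 0" "q > 0" using XY a b by (auto simp: p_def q_def)
  have "t\<^sup>2 / p + (1 - t)\<^sup>2 / q - 1 / (p + q) = (t * (p + q) - p)\<^sup>2 / (p * q * (p + q))"
    using pq by (simp add: field_simps power2_eq_square)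
  moreover have "\<dots> \<ge> 0" using pq by simp
  ultimately have "1 / (p + q) \<le> t\<^sup>2 / p + (1 - t)\<^sup>2 / q" by linarith
  also have "\<dots> = t\<^sup>2 / a * (1 / X) + (1 - t)\<^sup>2 / b * (1 / Y)" by (simp add: p_def q_def)
  finally have "ennreal (1 / (p + q)) \<le> ennreal (t\<^sup>2 / a * (1 / X) + (1 - t)\<^sup>2 / b * (1 / Y))" by (rule ennreal_leI)
  also have "\<dots> = ennreal (t\<^sup>2 / a * (1 / X)) + ennreal ((1 - t)\<^sup>2 / b * (1 / Y))"
    using XY a b by (intro ennreal_plus) auto
  also have "\<dots> = ennreal (t\<^sup>2 / a) * ennreal (1 / X) + ennreal ((1 - t)\<^sup>2 / b) * ennreal (1 / Y)"
    using XY a b by (simp only: ennreal_mult[symmetric] zero_le_divide_iff zero_le_power2 less_imp_le zero_le_one simp_thms)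
  also have "ennreal (1 / (p + q)) = inverse (ennreal (p + q))"
    using pq by (simp add: inverse_ennreal inverse_eq_divide del: ennreal_plus)
  finally show ?thesis using XY by (simp add: inverse_ennreal inverse_eq_divide p_def q_def del: ennreal_plus)
qed

text \<open>The negative moment obeys the same recursion as the mean, with the number of free rows
  lowered by two, the loss in \<open>E[1 / X] \<le> 1 / (E[X] - 2)\<close> for a noncentral gamma variable \<open>X\<close>.\<close>

theorem nn_integral_inverse_gdet_shifted:
  assumes "R \<subseteq> {..<n}" "{..<k} \<subseteq> R" "card R \<ge> k + 2" and z: "z \<noteq> 0"
  shows "(\<integral>\<^sup>+g. inverse (ennreal (gdet R k (shifted z g))) \<partial>gauss_array n k) \<le> ennreal (1 / gin_moment z k (card R - k - 2))"
  using assms(1-3)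
proof (induction k arbitrary: R)
  case 0
  interpret prob_space "gauss_array n 0" by (intro prob_space_PiM prob_space_gauss)
  show ?case using emeasure_space_1 by simp
next
  case (Suc k)
  have fR: "finite R" using Suc.prems finite_subset by auto
  have k: "k \<in> R" using Suc.prems by auto
  have sub: "R - {k} \<subseteq> {..<n}" using Suc.prems by auto
  have m[measurable]: "(\<lambda>g. gdet R k (shifted z g)) \<in> borel_measurable (gauss_array n k)"
    "(\<lambda>g. gdet (R - {k}) k (shifted z g)) \<in> borel_measurable (gauss_array n k)"
    using Suc.prems sub by (auto intro!: shifted_gdet_measurable)
  define M where "M = card R - Suc k - 2"
  have M: "card R - k = M + 3" "card R - k - 2 = Suc M" "card (R - {k}) - k - 2 = M" "card (R - {k}) \<ge> k + 2"
    using Suc.prems k fR by (auto simp: M_def card_Diff_singleton)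
  define x y where "x = gin_moment z k (Suc M)" and "y = gin_moment z k M"
  have xy: "x > 0" "y > 0" by (auto simp: x_def y_def gin_moment_pos)
  define a b where "a = real M + 1" and "b = (cmod z)\<^sup>2"
  have ab: "a > 0" "b > 0" using z by (auto simp: a_def b_def)
  define t where "t = a * x / (a * x + b * y)"
  have axby: "a * x > 0" "b * y > 0" using ab xy by auto
  then have t: "0 < t" "t < 1" by (auto simp: t_def field_simps)
  have "(\<integral>\<^sup>+g. inverse (ennreal (gdet R (Suc k) (shifted z g))) \<partial>gauss_array n (Suc k))
     \<le> (\<integral>\<^sup>+g. inverse (ennreal (a * gdet R k (shifted z g) + b * gdet (R - {k}) k (shifted z g))) \<partial>gauss_array n k)"
  proof (subst nn_integral_shifted_Suc[OF Suc.prems(1), of "\<lambda>t. inverse (ennreal t)"])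
    show "(\<integral>\<^sup>+g. \<integral>\<^sup>+x. inverse (ennreal (gdet R (Suc k) ((shifted z g)(k := (\<lambda>i. scaled_unit z k i - x i))))) \<partial>Pi\<^sub>M {..<n} (\<lambda>_. gauss) \<partial>gauss_array n k)
      \<le> (\<integral>\<^sup>+g. inverse (ennreal (a * gdet R k (shifted z g) + b * gdet (R - {k}) k (shifted z g))) \<partial>gauss_array n k)"
    proof (rule nn_integral_mono)
      fix g
      show "(\<integral>\<^sup>+x. inverse (ennreal (gdet R (Suc k) ((shifted z g)(k := (\<lambda>i. scaled_unit z k i - x i))))) \<partial>Pi\<^sub>M {..<n} (\<lambda>_. gauss))
        \<le> inverse (ennreal (a * gdet R k (shifted z g) + b * gdet (R - {k}) k (shifted z g)))"
        using nn_integral_gdet_column(2)[of "{..<n}" R k "shifted z g" z] Suc.prems M(1)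
        by (simp add: a_def b_def add.commute)
    qed
  qed measurable
  also have "\<dots> \<le> (\<integral>\<^sup>+g. ennreal (t\<^sup>2 / a) * inverse (ennreal (gdet R k (shifted z g))) + ennreal ((1 - t)\<^sup>2 / b) * inverse (ennreal (gdet (R - {k}) k (shifted z g))) \<partial>gauss_array n k)"
    using ab t by (intro nn_integral_mono inverse_add_le_weighted) auto
  also have "\<dots> = ennreal (t\<^sup>2 / a) * (\<integral>\<^sup>+g. inverse (ennreal (gdet R k (shifted z g))) \<partial>gauss_array n k)
      + ennreal ((1 - t)\<^sup>2 / b) * (\<integral>\<^sup>+g. inverse (ennreal (gdet (R - {k}) k (shifted z g))) \<partial>gauss_array n k)"
    by (subst nn_integral_add) (auto simp: nn_integral_cmult)
  also have "\<dots> \<le> ennreal (t\<^sup>2 / a) * ennreal (1 / x) + ennreal ((1 - t)\<^sup>2 / b) * ennreal (1 / y)"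
  proof (intro add_mono mult_left_mono)
    have "{..<k} \<subseteq> R" "{..<k} \<subseteq> R - {k}" "card R \<ge> k + 2" using Suc.prems by auto
    then show "(\<integral>\<^sup>+g. inverse (ennreal (gdet R k (shifted z g))) \<partial>gauss_array n k) \<le> ennreal (1 / x)"
      "(\<integral>\<^sup>+g. inverse (ennreal (gdet (R - {k}) k (shifted z g))) \<partial>gauss_array n k) \<le> ennreal (1 / y)"
      using Suc.IH[of R] Suc.IH[of "R - {k}"] Suc.prems(1) sub M(4) unfolding M(2,3) x_def y_def by blast+
  qed auto
  also have "\<dots> = ennreal (t\<^sup>2 / a * (1 / x) + (1 - t)\<^sup>2 / b * (1 / y))"
    using ab xy by (simp only: ennreal_mult[symmetric] ennreal_plus[symmetric] zero_le_divide_iff zero_le_power2 less_imp_le zero_le_one simp_thms mult_nonneg_nonneg)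
  also have "t\<^sup>2 / a * (1 / x) + (1 - t)\<^sup>2 / b * (1 / y) = 1 / (a * x + b * y)"
  proof -
    have e: "1 - t = b * y / (a * x + b * y)" using axby by (simp add: t_def field_simps)
    have p: "u\<^sup>2 / u = u" for u :: real by (simp add: power2_eq_square)
    have "t\<^sup>2 / a * (1 / x) + (1 - t)\<^sup>2 / b * (1 / y) = t\<^sup>2 / (a * x) + (1 - t)\<^sup>2 / (b * y)" by simp
    also have "\<dots> = ((a * x)\<^sup>2 / (a * x) + (b * y)\<^sup>2 / (b * y)) / (a * x + b * y)\<^sup>2"
      unfolding e by (simp add: t_def power_divide add_divide_distrib mult.commute)
    also have "\<dots> = 1 / (a * x + b * y)" unfolding p using axby by (simp add: power2_eq_square)
    finally show ?thesis .
  qed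
  also have "a * x + b * y = gin_moment z (Suc k) (card R - Suc k - 2)"
    by (simp add: x_def y_def a_def b_def M_def)
  finally show ?case .
qed

text \<open>The bound on the negative moment needs two free rows. The last two columns are integrated
  out at the cost of a constant factor each, for the exponent \<open>-1/2\<close>.\<close>

theorem nn_integral_inverse_sqrt_gdet_shifted:
  assumes z: "z \<noteq> 0"
  shows "(\<integral>\<^sup>+g. inverse (ennreal (sqrt (gdet {..<Suc (Suc n)} (Suc (Suc n)) (shifted z g)))) \<partial>gauss_array (Suc (Suc n)) (Suc (Suc n)))
    \<le> ennreal (9 / sqrt (gin_moment z n 0))"
proof -
  let ?R = "{..<Suc (Suc n)}" and ?h = "\<lambda>t. inverse (ennreal (sqrt t))"
  have step: "(\<integral>\<^sup>+g. ?h (gdet ?R (Suc k) (shifted z g)) \<partial>gauss_array (Suc (Suc n)) (Suc k)) \<le> 3 * (\<integral>\<^sup>+g. ?h (gdet ?R k (shifted z g)) \<partial>gauss_array (Suc (Suc n)) k)"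
    if k: "Suc k \<le> Suc (Suc n)" for k
  proof -
    have [measurable]: "(\<lambda>g. gdet ?R k (shifted z g)) \<in> borel_measurable (gauss_array (Suc (Suc n)) k)"
      by (intro shifted_gdet_measurable) auto
    have "(\<integral>\<^sup>+g. ?h (gdet ?R (Suc k) (shifted z g)) \<partial>gauss_array (Suc (Suc n)) (Suc k))
       = (\<integral>\<^sup>+g. \<integral>\<^sup>+x. ?h (gdet ?R (Suc k) ((shifted z g)(k := (\<lambda>i. scaled_unit z k i - x i)))) \<partial>Pi\<^sub>M ?R (\<lambda>_. gauss) \<partial>gauss_array (Suc (Suc n)) k)"
      by (rule nn_integral_shifted_Suc) auto
    also have "\<dots> \<le> (\<integral>\<^sup>+g. 3 * ?h (gdet ?R k (shifted z g)) \<partial>gauss_array (Suc (Suc n)) k)"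
      using k by (intro nn_integral_mono nn_integral_gdet_column(3)) auto
    also have "\<dots> = 3 * (\<integral>\<^sup>+g. ?h (gdet ?R k (shifted z g)) \<partial>gauss_array (Suc (Suc n)) k)"
      by (rule nn_integral_cmult) measurable
    finally show ?thesis .
  qed
  define s where "s = sqrt (gin_moment z n 0)"
  have s: "s > 0" "s\<^sup>2 = gin_moment z n 0" using gin_moment_pos[of z n 0] by (auto simp: s_def)
  have [measurable]: "(\<lambda>g. gdet ?R n (shifted z g)) \<in> borel_measurable (gauss_array (Suc (Suc n)) n)"
    by (intro shifted_gdet_measurable) auto
  interpret prob_space "gauss_array (Suc (Suc n)) n" by (intro prob_space_PiM prob_space_gauss)
  have "(\<integral>\<^sup>+g. ?h (gdet ?R n (shifted z g)) \<partial>gauss_array (Suc (Suc n)) n)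
    \<le> (\<integral>\<^sup>+g. ennreal (s / 2) * inverse (ennreal (gdet ?R n (shifted z g))) + ennreal (1 / (2 * s)) \<partial>gauss_array (Suc (Suc n)) n)"
  proof (rule nn_integral_mono)
    fix g
    let ?D = "gdet ?R n (shifted z g)"
    show "?h ?D \<le> ennreal (s / 2) * inverse (ennreal ?D) + ennreal (1 / (2 * s))"
    proof (cases "?D = 0")
      case True
      then show ?thesis using s by (simp add: ennreal_mult_top)
    next
      case False
      then have D: "?D > 0" using gdet_nonneg[of ?R n "shifted z g"] by linarith
      define d where "d = sqrt ?D"
      have d: "d > 0" "?D = d\<^sup>2" using D by (auto simp: d_def)
      have "s / 2 * (1 / d\<^sup>2) + 1 / (2 * s) - 1 / d = (s - d)\<^sup>2 / (2 * s * d\<^sup>2)"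
        using s d by (simp add: field_simps power2_eq_square)
      moreover have "\<dots> \<ge> 0" using s d by simp
      ultimately have "1 / d \<le> s / 2 * (1 / d\<^sup>2) + 1 / (2 * s)" by linarith
      then have "ennreal (1 / d) \<le> ennreal (s / 2) * ennreal (1 / d\<^sup>2) + ennreal (1 / (2 * s))"
        using s d by (simp add: ennreal_mult[symmetric] ennreal_plus[symmetric] del: ennreal_plus)
      then show ?thesis using d by (simp add: inverse_ennreal inverse_eq_divide)
    qed
  qed
  also have "\<dots> = ennreal (s / 2) * (\<integral>\<^sup>+g. inverse (ennreal (gdet ?R n (shifted z g))) \<partial>gauss_array (Suc (Suc n)) n) + ennreal (1 / (2 * s))"
    using emeasure_space_1 by (subst nn_integral_add) (auto simp: nn_integral_cmult)
  also have "\<dots> \<le> ennreal (s / 2) * ennreal (1 / s\<^sup>2) + ennreal (1 / (2 * s))"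
    using nn_integral_inverse_gdet_shifted[of ?R "Suc (Suc n)" n z] z s
    by (intro add_right_mono mult_left_mono) auto
  also have "\<dots> = ennreal (s / 2 * (1 / s\<^sup>2) + 1 / (2 * s))"
  proof -
    have "ennreal (s / 2) * ennreal (1 / s\<^sup>2) = ennreal (s / 2 * (1 / s\<^sup>2))"
      using s(1) by (intro ennreal_mult[symmetric]) auto
    then show ?thesis using s(1) by (subst ennreal_plus) (auto simp del: ennreal_plus)
  qed
  also have "s / 2 * (1 / s\<^sup>2) + 1 / (2 * s) = 1 / s" using s(1) by (simp add: field_simps power2_eq_square)
  finally have 0: "(\<integral>\<^sup>+g. ?h (gdet ?R n (shifted z g)) \<partial>gauss_array (Suc (Suc n)) n) \<le> ennreal (1 / s)" .
  have "(\<integral>\<^sup>+g. ?h (gdet ?R (Suc (Suc n)) (shifted z g)) \<partial>gauss_array (Suc (Suc n)) (Suc (Suc n))) \<le> 3 * (\<integral>\<^sup>+g. ?h (gdet ?R (Suc n) (shifted z g)) \<partial>gauss_array (Suc (Suc n)) (Suc n))"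
    using step[of "Suc n"] by simp
  also have "\<dots> \<le> 3 * (3 * ennreal (1 / s))"
    by (intro mult_left_mono order_trans[OF step[of n]] 0) auto
  also have "\<dots> = ennreal (9 / s)"
  proof -
    have "(3::ennreal) = ennreal 3" by simp
    then show ?thesis using s by (simp only: ennreal_mult[symmetric] zero_le_divide_iff zero_le_one zero_le_numeral less_imp_le simp_thms mult_nonneg_nonneg) simp
  qed
  finally show ?thesis by (simp add: s_def)
qed

lemma gdet_shifted_eq_det:
  "gdet {..<n} n (shifted z g) = (cmod (det (mat n n (\<lambda>(i, j). (if i = j then z else 0) - g (i, j)))))\<^sup>2"
  by (subst gdet_square) (auto simp: shifted_def scaled_unit_def)

text \<open>The defining recursion raises \<open>M\<close>. This identity eliminates the terms with \<open>M > 0\<close>, which leaves a recursion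
  among the values for \<open>M = 0\<close>.\<close>

lemma gin_moment_shift:
  "gin_moment z (Suc k) (Suc M) = gin_moment z (Suc k) M + (real k + 1) * gin_moment z k (Suc M)"
proof (induction k arbitrary: M)
  case (Suc k)
  have "gin_moment z (Suc (Suc k)) (Suc M) = (real M + 2) * gin_moment z (Suc k) (Suc (Suc M)) + (cmod z)\<^sup>2 * gin_moment z (Suc k) (Suc M)"
    by simp
  also have "\<dots> = (real M + 2) * (gin_moment z (Suc k) (Suc M) + (real k + 1) * gin_moment z k (Suc (Suc M)))
      + (cmod z)\<^sup>2 * (gin_moment z (Suc k) M + (real k + 1) * gin_moment z k (Suc M))"
    by (simp only: Suc.IH)
  also have "\<dots> = gin_moment z (Suc (Suc k)) M + (real (Suc k) + 1) * gin_moment z (Suc k) (Suc M)"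
    by (simp add: algebra_simps)
  finally show ?case .
qed simp

lemma gin_moment_Suc_0:
  "gin_moment z (Suc k) 0 = (cmod z) ^ (2 * Suc k) + (real k + 1) * gin_moment z k 0"
proof (induction k)
  case (Suc k)
  have "gin_moment z (Suc (Suc k)) 0 = gin_moment z (Suc k) 1 + (cmod z)\<^sup>2 * gin_moment z (Suc k) 0" by simp
  also have "\<dots> = gin_moment z (Suc k) 0 + (real k + 1) * gin_moment z k 1 + (cmod z)\<^sup>2 * ((cmod z) ^ (2 * Suc k) + (real k + 1) * gin_moment z k 0)"
    using gin_moment_shift[of z k 0] by (simp only: Suc.IH One_nat_def)
  also have "\<dots> = (cmod z) ^ (2 * Suc (Suc k)) + (real (Suc k) + 1) * gin_moment z (Suc k) 0"
    by (simp add: algebra_simps power2_eq_square)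
  finally show ?case .
qed (simp add: power2_eq_square)

definition exp_sum :: "nat \<Rightarrow> real \<Rightarrow> real" where
  "exp_sum n x = (\<Sum>i\<le>n. x ^ i / fact i)"

lemma gin_moment_eq_exp_sum: "gin_moment z n 0 = fact n * exp_sum n ((cmod z)\<^sup>2)"
proof (induction n)
  case (Suc n)
  have "gin_moment z (Suc n) 0 = ((cmod z)\<^sup>2) ^ Suc n + (real n + 1) * (fact n * exp_sum n ((cmod z)\<^sup>2))"
    by (simp only: gin_moment_Suc_0 Suc.IH power_mult)
  also have "\<dots> = fact (Suc n) * exp_sum (Suc n) ((cmod z)\<^sup>2)"
  proof -
    have "fact (Suc n) * (((cmod z)\<^sup>2) ^ Suc n / fact (Suc n)) = ((cmod z)\<^sup>2) ^ Suc n"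
      by (simp del: power_Suc fact_Suc)
    then show ?thesis unfolding exp_sum_def sum.atMost_Suc distrib_left
      by (simp add: algebra_simps del: power_Suc)
  qed
  finally show ?case .
qed (simp add: exp_sum_def)

lemma exp_sum_le_exp: "x \<ge> 0 \<Longrightarrow> exp_sum n x \<le> exp x"
  using sum_le_suminf[OF summable_exp[of x], of "{..n}"]
  by (simp add: exp_sum_def exp_def divide_inverse mult.commute)

lemma exp_sum_le_top_term:
  assumes "real n \<le> x"
  shows "fact n * exp_sum n x \<le> (real n + 1) * x ^ n"
proof -
  have "fact n * (x ^ i / fact i) \<le> x ^ n" if "i \<le> n" for i
  proof -
    have "fact n \<le> real n ^ (n - i) * fact i"
    proof -
      have "fact n div fact (n - (n - i)) \<le> n ^ (n - i)" by (rule fact_div_fact_le_pow) simp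
      moreover have "fact n = fact i * (fact n div fact i :: nat)" using that by (simp add: fact_dvd)
      ultimately have "fact n \<le> fact i * (n ^ (n - i))" using that
        by (metis diff_diff_cancel mult_le_mono2)
      then have "real (fact n) \<le> real (fact i * (n ^ (n - i)))" by (simp only: of_nat_le_iff)
      then show ?thesis by (simp add: mult.commute)
    qed
    also have "\<dots> \<le> x ^ (n - i) * fact i"
      using assms by (intro mult_right_mono power_mono) auto
    finally have "fact n * x ^ i \<le> (x ^ (n - i) * fact i) * x ^ i"
      using assms by (intro mult_right_mono) auto
    also have "\<dots> = x ^ n * fact i" using that by (simp add: power_add[symmetric] mult.commute mult.left_commute)
    finally show ?thesis by (simp add: field_simps)
  qed
  then have "fact n * exp_sum n x \<le> (\<Sum>i\<le>n. x ^ n)"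
    unfolding exp_sum_def sum_distrib_left by (intro sum_mono) auto
  then show ?thesis by (simp add: add.commute)
qed

lemma power_le_fact_exp_sum: "x \<ge> 0 \<Longrightarrow> x ^ n \<le> fact n * exp_sum n x"
proof -
  assume x: "x \<ge> 0"
  have "x ^ n / fact n \<le> exp_sum n x"
    unfolding exp_sum_def using x by (intro member_le_sum) auto
  then show ?thesis by (simp add: field_simps)
qed

lemma exp_sum_has_derivative:
  "(exp_sum n has_real_derivative (exp_sum n x - x ^ n / fact n)) (at x)"
proof (induction n)
  case 0 then show ?case by (simp add: exp_sum_def[abs_def])
next
  case (Suc n)
  have e: "exp_sum (Suc n) = (\<lambda>x. exp_sum n x + x ^ Suc n / fact (Suc n))"
    by (simp add: exp_sum_def fun_eq_iff)
  have "(exp_sum (Suc n) has_real_derivative ((exp_sum n x - x ^ n / fact n) + real (Suc n) * x ^ n / fact (Suc n))) (at x)"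
    unfolding e by (rule derivative_eq_intros Suc.IH refl | simp)+
  also have "real (Suc n) * x ^ n / fact (Suc n) = x ^ n / fact n"
    by (simp add: divide_simps del: of_nat_Suc)
  finally show ?case by (simp add: exp_sum_def)
qed

lemma exp_sum_decay:
  assumes "0 \<le> x" "x \<le> y"
  shows "exp (- y) * exp_sum n y \<le> exp (- x) * exp_sum n x"
proof (rule DERIV_nonpos_imp_nonincreasing[OF assms(2)])
  fix t assume t: "x \<le> t" "t \<le> y"
  have "((\<lambda>t. exp (- t) * exp_sum n t) has_real_derivative (- exp (- t) * (t ^ n / fact n))) (at t)"
    by (rule derivative_eq_intros exp_sum_has_derivative refl)+ (simp add: algebra_simps)
  moreover have "- exp (- t) * (t ^ n / fact n) \<le> 0" using t assms by simp
  ultimately show "\<exists>d. ((\<lambda>t. exp (- t) * exp_sum n t) has_real_derivative d) (at t) \<and> d \<le> 0" by blast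
qed

text \<open>By \<open>exp_sum_decay\<close>, the worst case is where the last term of the sum takes over.\<close>

lemma fact_exp_sum_lower:
  assumes x: "0 \<le> x" "x \<le> real n + 2"
  shows "real n ^ n * exp (x - real n - 2) \<le> fact n * exp_sum n x"
proof (cases "x \<le> real n")
  case True
  have "exp (- real n) * exp_sum n (real n) \<le> exp (- x) * exp_sum n x"
    using x True by (intro exp_sum_decay)
  then have "exp (x - real n) * exp_sum n (real n) \<le> exp_sum n x"
    by (simp add: exp_diff exp_minus field_simps)
  moreover have "real n ^ n / fact n \<le> exp_sum n (real n)"
    using power_le_fact_exp_sum[of "real n" n] by (simp add: field_simps)
  ultimately have "exp (x - real n) * (real n ^ n / fact n) \<le> exp_sum n x"
    by (meson exp_ge_zero mult_left_mono order_trans)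
  then have "exp (x - real n) * real n ^ n \<le> fact n * exp_sum n x"
    by (simp add: field_simps)
  moreover have "real n ^ n * exp (x - real n - 2) \<le> exp (x - real n) * real n ^ n"
    by (simp add: mult.commute mult_left_mono)
  ultimately show ?thesis by linarith
next
  case False
  have "real n ^ n * exp (x - real n - 2) \<le> real n ^ n * 1"
    using x by (intro mult_left_mono) auto
  also have "\<dots> \<le> x ^ n" using False by (simp add: power_mono)
  also have "\<dots> \<le> fact n * exp_sum n x" using x by (intro power_le_fact_exp_sum)
  finally show ?thesis .
qed

lemma fact_exp_le: "n \<ge> 1 \<Longrightarrow> fact n * exp (real n) \<le> exp 1 * real n ^ Suc n"
proof (induction n rule: nat_induct_at_least)
  case (Suc n)
  have n: "real n > 0" using Suc by simp
  have "1 - 1 / (1 + 1 / real n) \<le> ln (1 + 1 / real n)"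
  proof -
    have "1 + 1 / real n > 0" using n by (simp add: add_pos_pos)
    then show ?thesis using ln_le_minus_one[of "1 / (1 + 1 / real n)"] by (simp add: ln_div)
  qed
  moreover have "1 - 1 / (1 + 1 / real n) = 1 / (real n + 1)" using n by (simp add: field_simps)
  ultimately have "1 \<le> (real n + 1) * ln (1 + 1 / real n)" using n by (simp add: field_simps)
  then have "exp 1 \<le> exp (real (Suc n) * ln (1 + 1 / real n))" by (simp add: add.commute)
  also have "\<dots> = (1 + 1 / real n) ^ Suc n" using n by (subst exp_of_nat_mult) (simp add: add_pos_pos)
  also have "\<dots> = (real n + 1) ^ Suc n / real n ^ Suc n" 
  proof -
    have "1 + 1 / real n = (real n + 1) / real n" using n by (simp add: field_simps)
    then show ?thesis by (simp only: power_divide)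
  qed
  finally have *: "exp 1 * real n ^ Suc n \<le> (real n + 1) ^ Suc n" using n by (simp add: field_simps del: power_Suc)
  have "fact (Suc n) * exp (real (Suc n)) = (real n + 1) * exp 1 * (fact n * exp (real n))"
    by (simp add: exp_add algebra_simps)
  also have "\<dots> \<le> (real n + 1) * exp 1 * (exp 1 * real n ^ Suc n)"
    using Suc.IH by (intro mult_left_mono) auto
  also have "\<dots> \<le> (real n + 1) * exp 1 * (real n + 1) ^ Suc n"
    using * by (intro mult_left_mono) auto
  finally show ?case by (simp add: algebra_simps)
qed simp

text \<open>The logarithmic potential of the uniform measure on the unit disc is \<open>log_avg 1\<close>. At the
  scale of the normalised spectrum, both moments match it up to a factor polynomial in \<open>n\<close>.\<close>

lemma exp_log_avg:
  assumes "r \<ge> 0"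
  shows "exp (2 * real n * log_avg 1 r) = (if 1 \<le> r then r ^ (2 * n) else exp (real n * r\<^sup>2 - real n))"
proof (cases "1 \<le> r")
  case True
  have "exp (2 * real n * ln r) = exp (ln r) ^ (2 * n)"
    using exp_of_nat_mult[of "2 * n" "ln r"] by simp
  then show ?thesis using True by (simp add: log_avg_def)
qed (simp add: log_avg_def algebra_simps)

lemma gin_moment_upper:
  assumes n: "n \<ge> 1"
  shows "gin_moment (of_real (sqrt n) * u) n 0 / real n ^ n \<le> 4 * real n * exp (2 * real n * log_avg 1 (cmod u))"
proof -
  let ?x = "real n * (cmod u)\<^sup>2"
  have x: "(cmod (of_real (sqrt n) * u))\<^sup>2 = ?x" by (simp add: norm_mult power_mult_distrib)
  have x0: "?x \<ge> 0" by simp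
  show ?thesis
  proof (cases "1 \<le> cmod u")
    case True
    then have "real n * 1 \<le> ?x" by (intro mult_left_mono) auto
    then have "fact n * exp_sum n ?x \<le> (real n + 1) * ?x ^ n" by (intro exp_sum_le_top_term) auto
    also have "?x ^ n = real n ^ n * (cmod u) ^ (2 * n)" by (simp add: power_mult_distrib power_mult)
    finally have "fact n * exp_sum n ?x / real n ^ n \<le> (real n + 1) * (cmod u) ^ (2 * n)"
      using n by (simp add: field_simps)
    also have "\<dots> \<le> 4 * real n * (cmod u) ^ (2 * n)"
      using n by (intro mult_right_mono) auto
    finally show ?thesis using True by (simp add: gin_moment_eq_exp_sum x exp_log_avg)
  next
    case False
    have "fact n * exp_sum n ?x \<le> fact n * exp ?x" using exp_sum_le_exp[OF x0] by (intro mult_left_mono) auto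
    also have "\<dots> \<le> (exp 1 * real n ^ Suc n * exp (- real n)) * exp ?x"
    proof (intro mult_right_mono)
      have "fact n * exp (real n) * exp (- real n) \<le> exp 1 * real n ^ Suc n * exp (- real n)"
        using fact_exp_le[OF n] by (intro mult_right_mono) auto
      then show "fact n \<le> exp 1 * real n ^ Suc n * exp (- real n)" by (simp add: mult.assoc exp_minus)
    qed auto
    also have "\<dots> = exp 1 * real n * exp (?x - real n) * real n ^ n" by (simp add: exp_diff exp_minus field_simps)
    finally have "fact n * exp_sum n ?x / real n ^ n \<le> exp 1 * real n * exp (?x - real n)"
      using n by (simp add: divide_le_eq)
    also have "\<dots> \<le> 4 * real n * exp (?x - real n)"
      using n e_less_272 by (intro mult_right_mono) auto
    finally show ?thesis using False by (simp add: gin_moment_eq_exp_sum x exp_log_avg)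
  qed
qed

lemma gin_moment_lower:
  assumes n: "n \<ge> 1" and u: "cmod u \<le> 6"
  shows "sqrt (real (n + 2) ^ (n + 2) / gin_moment (of_real (sqrt (n + 2)) * u) n 0) \<le> 36 * real (n + 2) * exp (- real (n + 2) * log_avg 1 (cmod u))"
proof (rule real_le_lsqrt)
  let ?n = "real (n + 2)"
  let ?x = "?n * (cmod u)\<^sup>2"
  let ?m = "gin_moment (of_real (sqrt (n + 2)) * u) n 0"
  have x: "(cmod (of_real (sqrt (n + 2)) * u))\<^sup>2 = ?x" by (simp add: norm_mult power_mult_distrib)
  have m: "?m = fact n * exp_sum n ?x" by (simp only: gin_moment_eq_exp_sum x)
  have mpos: "?m > 0" by (rule gin_moment_pos)
  have "(36 * ?n * exp (- ?n * log_avg 1 (cmod u)))\<^sup>2 = (36 * ?n)\<^sup>2 / exp (2 * ?n * log_avg 1 (cmod u))"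
  proof -
    define a where "a = ?n * log_avg 1 (cmod u)"
    have "- ?n * log_avg 1 (cmod u) = - a" "2 * ?n * log_avg 1 (cmod u) = 2 * a" by (simp_all add: a_def algebra_simps)
    then show ?thesis by (simp add: power_mult_distrib exp_minus divide_inverse exp_double power_inverse)
  qed
  moreover have "?n ^ (n + 2) * exp (2 * ?n * log_avg 1 (cmod u)) \<le> (36 * ?n)\<^sup>2 * ?m"
  proof (cases "1 \<le> cmod u")
    case True
    have "?x ^ n \<le> ?m" unfolding m by (intro power_le_fact_exp_sum) auto
    have "?n ^ (n + 2) * exp (2 * ?n * log_avg 1 (cmod u)) = ?n ^ (n + 2) * (cmod u) ^ (2 * (n + 2))"
      using True exp_log_avg[of "cmod u" "n + 2"] by simp
    also have "\<dots> = ?n\<^sup>2 * (cmod u) ^ 4 * ?x ^ n"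
    proof -
      have "N ^ (n + 2) * r ^ (2 * (n + 2)) = N\<^sup>2 * r ^ 4 * (N * r\<^sup>2) ^ n" for N r :: real
      proof -
        have "2 * (n + 2) = 2 * n + 4" by simp
        then have "N ^ (n + 2) * r ^ (2 * (n + 2)) = N ^ n * N\<^sup>2 * (r ^ (2 * n) * r ^ 4)" by (simp only: power_add)
        moreover have "(N * r\<^sup>2) ^ n = N ^ n * r ^ (2 * n)" by (simp only: power_mult_distrib power_mult)
        ultimately show ?thesis by (simp only: ac_simps)
      qed
      then show ?thesis .
    qed
    also have "\<dots> \<le> ?n\<^sup>2 * 6 ^ 4 * ?m"
      using u \<open>?x ^ n \<le> ?m\<close> by (intro mult_mono power_mono) auto
    also have "?n\<^sup>2 * 6 ^ 4 = (36 * ?n)\<^sup>2" unfolding power_mult_distrib by simp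
    finally show ?thesis .
  next
    case False
    then have "?x \<le> ?n * 1" by (intro mult_left_mono) (auto simp: power_le_one)
    then have "?x \<le> real n + 2" by (simp only: of_nat_add of_nat_numeral mult_1_right)
    then have l: "real n ^ n * exp (?x - real n - 2) \<le> ?m" unfolding m by (intro fact_exp_sum_lower) auto
    have "(?n / real n) ^ n \<le> 9"
    proof -
      have "(?n / real n) ^ n = (1 + 2 / real n) ^ n" using n by (simp add: field_simps)
      also have "\<dots> \<le> exp (2 / real n) ^ n" using n by (intro power_mono exp_ge_add_one_self) auto
      also have "\<dots> = exp 1 ^ 2" using n by (simp add: exp_of_nat_mult[symmetric] exp_double[symmetric] flip: exp_of_nat_mult)
      also have "\<dots> \<le> 3 ^ 2" using e_less_272 by (intro power_mono) auto
      finally show ?thesis by simp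
    qed
    then have p: "?n ^ n \<le> 9 * real n ^ n" using n by (simp add: power_divide field_simps)
    have "?n ^ (n + 2) * exp (2 * ?n * log_avg 1 (cmod u)) = ?n\<^sup>2 * ?n ^ n * exp (?x - real n - 2)"
    proof -
      have "exp (2 * ?n * log_avg 1 (cmod u)) = exp (?x - ?n)" using False exp_log_avg[of "cmod u" "n + 2"] by simp
      moreover have "?x - ?n = ?x - real n - 2" by simp
      ultimately show ?thesis by (simp only: power_add mult.commute)
    qed
    also have "\<dots> \<le> ?n\<^sup>2 * (9 * real n ^ n) * exp (?x - real n - 2)"
      using p by (intro mult_right_mono mult_left_mono) auto
    also have "\<dots> = 9 * ?n\<^sup>2 * (real n ^ n * exp (?x - real n - 2))" by simp
    also have "\<dots> \<le> 9 * ?n\<^sup>2 * ?m" using l by (intro mult_left_mono) auto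
    also have "\<dots> \<le> (36 * ?n)\<^sup>2 * ?m"
    proof (rule mult_right_mono)
      show "9 * ?n\<^sup>2 \<le> (36 * ?n)\<^sup>2" unfolding power_mult_distrib by simp
    qed (use mpos in simp)
    finally show ?thesis .
  qed
  moreover have "a / m \<le> b / e" if "a * e \<le> b * m" "m > 0" "e > 0" for a b m e :: real
    using that by (simp add: field_simps)
  ultimately show "?n ^ (n + 2) / ?m \<le> (36 * ?n * exp (- ?n * log_avg 1 (cmod u)))\<^sup>2"
    using mpos by (simp only: exp_gt_zero)
qed auto

section \<open>The potential of the eigenvalues is uniformly controlled\<close>

text \<open>The squared modulus at \<open>u\<close> of the characteristic polynomial of \<open>g / \<surd>n\<close>.\<close>

definition char_sq :: "nat \<Rightarrow> (nat \<times> nat \<Rightarrow> complex) \<Rightarrow> complex \<Rightarrow> real" where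
  "char_sq n g u = gdet {..<n} n (shifted (of_real (sqrt n) * u) g) / real n ^ n"

lemma char_sq_nonneg [simp]: "char_sq n g u \<ge> 0"
  by (simp add: char_sq_def)

lemma char_sq_measurable:
  "(\<lambda>(g, u). char_sq n g u) \<in> borel_measurable (gauss_array n n \<Otimes>\<^sub>M borel)"
proof -
  have "(\<lambda>p. gdet {..<n} n (shifted (of_real (sqrt n) * snd p) (fst p))) \<in> borel_measurable (gauss_array n n \<Otimes>\<^sub>M borel)"
  proof (rule borel_measurable_gdet)
    fix i j assume "i \<in> {..<n}" "j < n"
    then have [measurable]: "(\<lambda>p. (fst p :: nat \<times> nat \<Rightarrow> complex) (i, j)) \<in> borel_measurable (gauss_array n n \<Otimes>\<^sub>M (borel :: complex measure))"
      by (intro measurable_compose[OF measurable_fst gauss_array_component]) auto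
    have [measurable]: "(\<lambda>p. scaled_unit (of_real (sqrt n) * snd p) j i) \<in> borel_measurable (gauss_array n n \<Otimes>\<^sub>M (borel :: complex measure))"
      by (cases "i = j") (simp_all add: scaled_unit_def)
    show "(\<lambda>p. shifted (of_real (sqrt n) * snd p) (fst p) j i) \<in> borel_measurable (gauss_array n n \<Otimes>\<^sub>M borel)"
      unfolding shifted_def by measurable
  qed simp
  then have [measurable]: "(\<lambda>p. gdet {..<n} n (shifted (of_real (sqrt n) * snd p) (fst p))) \<in> borel_measurable (gauss_array n n \<Otimes>\<^sub>M borel)" .
  show ?thesis unfolding char_sq_def split_beta' by measurable
qed

lemma log_avg_measurable [measurable]: "log_avg a \<in> borel_measurable borel"
  unfolding log_avg_def[abs_def] by measurable

lemma nn_integral_char_sq: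
  assumes n: "n \<ge> 1"
  shows "(\<integral>\<^sup>+g. ennreal (char_sq n g u) \<partial>gauss_array n n) \<le> ennreal (4 * real n * exp (2 * real n * log_avg 1 (cmod u)))"
proof -
  let ?z = "of_real (sqrt n) * u"
  have "(\<integral>\<^sup>+g. ennreal (char_sq n g u) \<partial>gauss_array n n) = (\<integral>\<^sup>+g. ennreal (1 / real n ^ n) * ennreal (gdet {..<n} n (shifted ?z g)) \<partial>gauss_array n n)"
    by (intro nn_integral_cong) (simp add: char_sq_def ennreal_mult'[symmetric])
  also have "\<dots> = ennreal (1 / real n ^ n) * (\<integral>\<^sup>+g. ennreal (gdet {..<n} n (shifted ?z g)) \<partial>gauss_array n n)"
    using shifted_gdet_measurable[of "{..<n}" n n n ?z] by (intro nn_integral_cmult) auto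
  also have "\<dots> = ennreal (gin_moment ?z n 0 / real n ^ n)"
    by (subst nn_integral_gdet_shifted) (auto simp: ennreal_mult'[symmetric])
  also have "\<dots> \<le> ennreal (4 * real n * exp (2 * real n * log_avg 1 (cmod u)))"
    by (intro ennreal_leI gin_moment_upper n)
  finally show ?thesis .
qed

lemma nn_integral_inverse_sqrt_char_sq:
  assumes n: "n \<ge> 3" and u: "u \<noteq> 0" "cmod u \<le> 6"
  shows "(\<integral>\<^sup>+g. inverse (ennreal (sqrt (char_sq n g u))) \<partial>gauss_array n n) \<le> ennreal (324 * real n * exp (- real n * log_avg 1 (cmod u)))"
proof -
  obtain k where k: "n = Suc (Suc k)" "k \<ge> 1" using n by (metis Suc_le_D Suc_le_mono numeral_3_eq_3 One_nat_def)
  let ?z = "of_real (sqrt n) * u"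
  have z: "?z \<noteq> 0" using u n by simp
  have meas: "(\<lambda>g. gdet {..<n} n (shifted ?z g)) \<in> borel_measurable (gauss_array n n)"
    by (intro shifted_gdet_measurable) auto
  note [measurable] = this
  have "(\<integral>\<^sup>+g. inverse (ennreal (sqrt (char_sq n g u))) \<partial>gauss_array n n)
     = (\<integral>\<^sup>+g. ennreal (sqrt (real n ^ n)) * inverse (ennreal (sqrt (gdet {..<n} n (shifted ?z g)))) \<partial>gauss_array n n)"
  proof (rule nn_integral_cong)
    fix g
    have p: "sqrt (real n ^ n) > 0" using n by simp
    have "sqrt (char_sq n g u) = inverse (sqrt (real n ^ n)) * sqrt (gdet {..<n} n (shifted ?z g))"
      by (simp add: char_sq_def divide_inverse real_sqrt_mult real_sqrt_inverse)
    then have "inverse (ennreal (sqrt (char_sq n g u))) = inverse (ennreal (inverse (sqrt (real n ^ n)))) * inverse (ennreal (sqrt (gdet {..<n} n (shifted ?z g))))"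
      using p by (simp add: ennreal_mult ennreal_inverse_mult)
    also have "inverse (ennreal (inverse (sqrt (real n ^ n)))) = ennreal (sqrt (real n ^ n))"
      using p by (simp add: inverse_ennreal)
    finally show "inverse (ennreal (sqrt (char_sq n g u))) = ennreal (sqrt (real n ^ n)) * inverse (ennreal (sqrt (gdet {..<n} n (shifted ?z g))))" .
  qed
  also have "\<dots> = ennreal (sqrt (real n ^ n)) * (\<integral>\<^sup>+g. inverse (ennreal (sqrt (gdet {..<n} n (shifted ?z g)))) \<partial>gauss_array n n)"
    by (rule nn_integral_cmult) measurable
  also have "\<dots> \<le> ennreal (sqrt (real n ^ n)) * ennreal (9 / sqrt (gin_moment ?z k 0))"
    using nn_integral_inverse_sqrt_gdet_shifted[OF z, of k] unfolding k(1) by (intro mult_left_mono) auto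
  also have "\<dots> = ennreal (9 * sqrt (real n ^ n / gin_moment ?z k 0))"
    using less_imp_le[OF gin_moment_pos[of ?z k 0]]
    by (subst ennreal_mult[symmetric]) (auto simp: real_sqrt_divide)
  also have "\<dots> \<le> ennreal (324 * real n * exp (- real n * log_avg 1 (cmod u)))"
  proof (rule ennreal_leI)
    have "n = k + 2" using k by simp
    then have "sqrt (real n ^ n / gin_moment ?z k 0) \<le> 36 * real n * exp (- real n * log_avg 1 (cmod u))"
      using gin_moment_lower[OF k(2) u(2)] by (simp only:)
    then show "9 * sqrt (real n ^ n / gin_moment ?z k 0) \<le> 324 * real n * exp (- real n * log_avg 1 (cmod u))"
      by linarith
  qed
  finally show ?thesis .
qed

text \<open>The single random quantity whose size controls the potential on all regions at once.\<close>

definition potential_defect :: "nat \<Rightarrow> (nat \<times> nat \<Rightarrow> complex) \<Rightarrow> ennreal" where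
  "potential_defect n g = (\<integral>\<^sup>+u. (ennreal (exp (- 2 * real n * log_avg 1 (cmod u))) * ennreal (char_sq n g u)
     + ennreal (exp (real n * log_avg 1 (cmod u))) * inverse (ennreal (sqrt (char_sq n g u)))) * indicator (ball 0 6) u \<partial>lborel)"

lemma potential_defect_measurable [measurable]:
  "potential_defect n \<in> borel_measurable (gauss_array n n)"
proof -
  note [measurable] = char_sq_measurable[unfolded split_beta']
  have [measurable]: "ball (0::complex) 6 \<in> sets borel" by simp
  show ?thesis unfolding potential_defect_def by measurable
qed

lemma nn_integral_potential_defect:
  assumes n: "n \<ge> 3"
  shows "(\<integral>\<^sup>+g. potential_defect n g \<partial>gauss_array n n) \<le> ennreal (11808 * pi * real n)"
proof -
  note [measurable] = char_sq_measurable[unfolded split_beta']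
  have B[measurable]: "ball (0::complex) 6 \<in> sets borel" by simp
  interpret P: prob_space "gauss_array n n" by (intro prob_space_PiM prob_space_gauss)
  interpret pair_sigma_finite "gauss_array n n" lborel ..
  let ?f = "\<lambda>u g. ennreal (exp (- 2 * real n * log_avg 1 (cmod u))) * ennreal (char_sq n g u)
     + ennreal (exp (real n * log_avg 1 (cmod u))) * inverse (ennreal (sqrt (char_sq n g u)))"
  have [measurable]: "(\<lambda>g. char_sq n g u) \<in> borel_measurable (gauss_array n n)" for u
    using shifted_gdet_measurable[of "{..<n}" n n n] unfolding char_sq_def by auto
  have "(\<integral>\<^sup>+g. potential_defect n g \<partial>gauss_array n n) = (\<integral>\<^sup>+u. \<integral>\<^sup>+g. ?f u g * indicator (ball 0 6) u \<partial>gauss_array n n \<partial>lborel)"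
    unfolding potential_defect_def by (rule Fubini'[symmetric]) measurable
  also have "\<dots> \<le> (\<integral>\<^sup>+u. ennreal (328 * real n) * indicator (ball 0 6) u \<partial>(lborel :: complex measure))"
  proof (rule nn_integral_mono_AE)
    have "AE u in lborel. u \<noteq> (0::complex)" by (rule AE_lborel_singleton)
    then show "AE u in lborel. (\<integral>\<^sup>+g. ?f u g * indicator (ball 0 6) u \<partial>gauss_array n n) \<le> ennreal (328 * real n) * indicator (ball 0 6) u"
    proof eventually_elim
      case (elim u)
      let ?L = "log_avg 1 (cmod u)"
      show ?case
      proof (cases "u \<in> ball 0 6")
        case True
        have "(\<integral>\<^sup>+g. ?f u g \<partial>gauss_array n n) = ennreal (exp (- 2 * real n * ?L)) * (\<integral>\<^sup>+g. ennreal (char_sq n g u) \<partial>gauss_array n n)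
          + ennreal (exp (real n * ?L)) * (\<integral>\<^sup>+g. inverse (ennreal (sqrt (char_sq n g u))) \<partial>gauss_array n n)"
          by (subst nn_integral_add) (auto simp: nn_integral_cmult)
        also have "\<dots> \<le> ennreal (exp (- 2 * real n * ?L)) * ennreal (4 * real n * exp (2 * real n * ?L))
          + ennreal (exp (real n * ?L)) * ennreal (324 * real n * exp (- real n * ?L))"
          using n elim True
          by (intro add_mono mult_left_mono nn_integral_char_sq nn_integral_inverse_sqrt_char_sq) auto
        also have "\<dots> = ennreal (328 * real n)"
          by (simp add: ennreal_mult'[symmetric] ennreal_plus[symmetric] exp_minus field_simps del: ennreal_plus)
        finally show ?thesis using True by simp
      qed simp
    qed
  qed
  also have "\<dots> = ennreal (328 * real n) * emeasure lborel (ball (0::complex) 6)"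
    by (rule nn_integral_cmult_indicator) simp
  also have "\<dots> = ennreal (11808 * pi * real n)"
    by (simp add: emeasure_lborel_disc ennreal_mult[symmetric] algebra_simps)
  finally show ?thesis .
qed

section \<open>From Gaussian arrays to Ginibre matrices\<close>

definition entries :: "nat \<Rightarrow> complex mat \<Rightarrow> nat \<times> nat \<Rightarrow> complex" where
  "entries n A = (\<lambda>p\<in>{..<n} \<times> {..<n}. A $$ p)"

lemma ginibre_distr:
  assumes G: "ginibre_matrix M n G" and n: "n \<ge> 1"
  shows "(\<lambda>\<omega>. entries n (G \<omega>)) \<in> measurable M (gauss_array n n)"
    and "distr M (gauss_array n n) (\<lambda>\<omega>. entries n (G \<omega>)) = gauss_array n n"
proof -
  interpret prob_space M using G by (simp add: ginibre_matrix_def)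
  let ?I = "{..<n} \<times> {..<n}"
  have d: "distributed M lborel (\<lambda>\<omega>. G \<omega> $$ p) std_complex_gaussian_density" if "p \<in> ?I" for p
    using G that by (auto simp: ginibre_matrix_def)
  have rv: "random_variable borel (\<lambda>\<omega>. G \<omega> $$ p)" if "p \<in> ?I" for p
    using distributed_measurable[OF d[OF that]] by simp
  have dg: "distr M borel (\<lambda>\<omega>. G \<omega> $$ p) = gauss" if "p \<in> ?I" for p
    using distributed_distr_eq_density[OF d[OF that]] by (simp add: gauss_def cong: distr_cong)
  show m: "(\<lambda>\<omega>. entries n (G \<omega>)) \<in> measurable M (gauss_array n n)"
    unfolding entries_def using rv by (intro measurable_restrict) (auto simp: measurable_cong_sets[OF refl sets_gauss])
  have "?I \<noteq> {}" using n by (auto simp: lessThan_empty_iff)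
  then have "distr M (\<Pi>\<^sub>M p\<in>?I. borel) (\<lambda>\<omega>. \<lambda>p\<in>?I. G \<omega> $$ p) = (\<Pi>\<^sub>M p\<in>?I. distr M borel (\<lambda>\<omega>. G \<omega> $$ p))"
    using G rv by (subst indep_vars_iff_distr_eq_PiM'[symmetric]) (auto simp: ginibre_matrix_def)
  also have "\<dots> = gauss_array n n" by (intro PiM_cong refl dg)
  finally show "distr M (gauss_array n n) (\<lambda>\<omega>. entries n (G \<omega>)) = gauss_array n n"
    unfolding entries_def
    by (subst distr_cong[OF refl _ refl, of _ "\<Pi>\<^sub>M p\<in>?I. borel"]) (auto intro!: sets_PiM_cong)
qed

lemma nn_integral_ginibre:
  assumes G: "ginibre_matrix M n G" and n: "n \<ge> 1" and f: "f \<in> borel_measurable (gauss_array n n)"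
  shows "(\<integral>\<^sup>+\<omega>. f (entries n (G \<omega>)) \<partial>M) = (\<integral>\<^sup>+g. f g \<partial>gauss_array n n)"
proof -
  have "(\<integral>\<^sup>+g. f g \<partial>gauss_array n n) = (\<integral>\<^sup>+g. f g \<partial>distr M (gauss_array n n) (\<lambda>\<omega>. entries n (G \<omega>)))"
    by (simp only: ginibre_distr(2)[OF G n])
  also have "\<dots> = (\<integral>\<^sup>+\<omega>. f (entries n (G \<omega>)) \<partial>M)"
    by (rule nn_integral_distr[OF ginibre_distr(1)[OF G n]]) (use f in simp)
  finally show ?thesis by simp
qed

text \<open>Markov's inequality and the Borel-Cantelli lemma. Both only see the laws of the single \<open>X n\<close>, which is why
  the matrices of different sizes may depend on each other in any way.\<close>

lemma (in prob_space) AE_eventually_le_of_summable: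
  fixes X :: "nat \<Rightarrow> 'a \<Rightarrow> ennreal"
  assumes X: "\<And>n. n \<ge> k \<Longrightarrow> X n \<in> borel_measurable M"
    and c: "\<And>n. n \<ge> k \<Longrightarrow> (\<integral>\<^sup>+\<omega>. X n \<omega> \<partial>M) \<le> ennreal (c n)"
    and b: "\<And>n. n \<ge> k \<Longrightarrow> b n > 0" "\<And>n. c n \<ge> 0" and sum: "summable (\<lambda>n. c n / b n)"
  shows "AE \<omega> in M. \<forall>\<^sub>F n in sequentially. X n \<omega> \<le> ennreal (b n)"
proof -
  define A where "A n = (if n \<ge> k then {\<omega> \<in> space M. ennreal (b n) < X n \<omega>} else {})" for n
  have A: "A n \<in> sets M" for n using X[of n] by (auto simp: A_def)
  have em: "emeasure M (A n) \<le> ennreal (c n / b n)" if n: "n \<ge> k" for n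
  proof -
    note [measurable] = X[OF n]
    have "ennreal (b n) * emeasure M (A n) = (\<integral>\<^sup>+\<omega>. ennreal (b n) * indicator (A n) \<omega> \<partial>M)"
      using A by (simp add: nn_integral_cmult_indicator)
    also have "\<dots> \<le> (\<integral>\<^sup>+\<omega>. X n \<omega> \<partial>M)"
      using n by (intro nn_integral_mono) (auto simp: A_def split: split_indicator)
    also have "\<dots> \<le> ennreal (c n)" by (rule c[OF n])
    finally have "ennreal (1 / b n) * (ennreal (b n) * emeasure M (A n)) \<le> ennreal (1 / b n) * ennreal (c n)"
      by (rule mult_left_mono) simp
    moreover have "ennreal (1 / b n) * ennreal (b n) = 1" using b(1)[OF n] by (simp add: ennreal_mult'[symmetric])
    moreover have "ennreal (1 / b n) * ennreal (c n) = ennreal (c n / b n)" using b(1)[OF n] by (simp add: ennreal_mult'[symmetric])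
    ultimately show ?thesis by (simp add: mult.assoc[symmetric])
  qed
  have "measure M (A n) \<le> c n / b n" if "n \<ge> k" for n
    using em[OF that] b(1)[OF that] b(2)[of n] by (simp add: emeasure_eq_measure)
  then have "summable (\<lambda>n. measure M (A n))"
    by (intro summable_comparison_test[OF _ sum] exI[of _ k]) auto
  then have "AE \<omega> in M. \<forall>\<^sub>F n in sequentially. \<omega> \<in> space M - A n"
    by (intro borel_cantelli_AE1 A) (auto simp: emeasure_eq_measure)
  then show ?thesis
  proof eventually_elim
    case (elim \<omega>)
    then show ?case using eventually_ge_at_top[of k]
      by eventually_elim (auto simp: A_def not_less)
  qed
qed

lemma AE_eventually_potential_defect:
  assumes M: "prob_space M" and G: "\<And>n. n \<ge> 1 \<Longrightarrow> ginibre_matrix M n (G n)"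
  shows "AE \<omega> in M. \<forall>\<^sub>F n in sequentially. potential_defect n (entries n (G n \<omega>)) \<le> ennreal (real n ^ 3)"
proof -
  interpret prob_space M by fact
  show ?thesis
  proof (rule AE_eventually_le_of_summable[where k=3 and c="\<lambda>n. 11808 * pi * real n"])
    fix n :: nat assume n: "n \<ge> 3"
    then have n1: "n \<ge> 1" by simp
    show "(\<lambda>\<omega>. potential_defect n (entries n (G n \<omega>))) \<in> borel_measurable M"
      by (rule measurable_compose[OF ginibre_distr(1)[OF G[OF n1] n1] potential_defect_measurable])
    show "(\<integral>\<^sup>+\<omega>. potential_defect n (entries n (G n \<omega>)) \<partial>M) \<le> ennreal (11808 * pi * real n)"
      using nn_integral_ginibre[OF G[OF n1] n1 potential_defect_measurable] nn_integral_potential_defect[OF n] by simp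
  next
    have "summable (\<lambda>n. 11808 * pi * (1 / real n ^ 2))"
      by (intro summable_mult) (use inverse_power_summable[of 2, where 'a=real] in \<open>simp add: divide_inverse power_inverse\<close>)
    then show "summable (\<lambda>n. 11808 * pi * real n / real n ^ 3)"
      by (rule summable_cong[THEN iffD1, rotated]) (auto simp: eventually_sequentially power2_eq_square power3_eq_cube intro!: exI[of _ 1])
  qed auto
qed

section \<open>The spectral radius\<close>

definition sqn :: "nat \<Rightarrow> (nat \<Rightarrow> complex) \<Rightarrow> real" where
  "sqn n x = (\<Sum>i<n. (cmod (x i))\<^sup>2)"

definition row_times :: "nat \<Rightarrow> (nat \<Rightarrow> complex) \<Rightarrow> (nat \<times> nat \<Rightarrow> complex) \<Rightarrow> nat \<Rightarrow> complex" where
  "row_times n h g j = (\<Sum>i<n. h i * g (i, j))"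

text \<open>A rotation taking the conjugate of \<open>v\<close> to the first axis.\<close>

lemma ex_rotation_bilinear:
  assumes n: "n \<ge> 1"
  shows "\<exists>T\<in>rotations {..<n}. (\<forall>x. sqn n (T x) = sqn n x) \<and>
    (\<forall>x. (cmod (\<Sum>i<n. v i * x i))\<^sup>2 = sqn n v * (cmod (T x 0))\<^sup>2)"
proof -
  let ?w = "\<lambda>i. cnj (v i)"
  have n0: "0 \<in> {..<n}" using n by auto
  obtain T where T: "T \<in> rotations {..<n}" "\<forall>i\<in>{..<n} - {0}. T ?w i = 0"
    using ex_rotation_annihilate[of "{..<n}" 0 ?w] n0 by auto
  have nrm: "sqn n (T x) = sqn n x" for x
    unfolding sqn_def by (rule rotations_norm[OF T(1)]) auto
  have w0: "(cmod (T ?w 0))\<^sup>2 = sqn n v"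
  proof -
    have "sqn n v = sqn n (T ?w)" unfolding nrm by (simp add: sqn_def)
    also have "\<dots> = (cmod (T ?w 0))\<^sup>2" using T(2) n0 unfolding sqn_def by (subst sum.remove[of _ 0]) auto
    finally show ?thesis by simp
  qed
  have "(\<Sum>i<n. v i * x i) = cnj (T ?w 0) * T x 0" for x
  proof -
    have "(\<Sum>i<n. v i * x i) = (\<Sum>i<n. cnj (?w i) * x i)" by simp
    also have "\<dots> = (\<Sum>i<n. cnj (T ?w i) * T x i)" by (rule rotations_inner[OF T(1), symmetric]) auto
    also have "\<dots> = cnj (T ?w 0) * T x 0" using T(2) n0 by (subst sum.remove[of _ 0]) auto
    finally show ?thesis .
  qed
  then have "(cmod (\<Sum>i<n. v i * x i))\<^sup>2 = sqn n v * (cmod (T x 0))\<^sup>2" for x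
    by (simp add: norm_mult power_mult_distrib w0)
  with T(1) nrm show ?thesis by auto
qed

lemma sqn_measurable:
  assumes "n \<le> m"
  shows "sqn n \<in> borel_measurable (Pi\<^sub>M {..<m} (\<lambda>_. gauss))"
  unfolding sqn_def[abs_def]
proof (rule borel_measurable_sum)
  fix i assume "i \<in> {..<n}"
  then show "(\<lambda>x. (cmod (x i))\<^sup>2) \<in> borel_measurable (Pi\<^sub>M {..<m} (\<lambda>_. gauss))"
    using assms by (intro gauss_PiM_measurable_compose[where f="\<lambda>z. (cmod z)\<^sup>2"]) auto
qed

lemma nn_integral_exp_linear_form:
  assumes n: "n \<ge> 1" and s: "s * sqn n h < 1"
  shows "(\<integral>\<^sup>+x. ennreal (exp (s * (cmod (\<Sum>i<n. h i * x i))\<^sup>2)) \<partial>Pi\<^sub>M {..<n} (\<lambda>_. gauss)) = ennreal (1 / (1 - s * sqn n h))"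
proof -
  obtain T where T: "T \<in> rotations {..<n}" "\<And>x. sqn n (T x) = sqn n x"
    "\<And>x. (cmod (\<Sum>i<n. h i * x i))\<^sup>2 = sqn n h * (cmod (T x 0))\<^sup>2"
    using ex_rotation_bilinear[OF n, of h] by auto
  let ?f = "\<lambda>z. ennreal (exp (s * sqn n h * (cmod z)\<^sup>2))"
  have n0: "0 \<in> {..<n}" using n by auto
  have "(\<integral>\<^sup>+x. ennreal (exp (s * (cmod (\<Sum>i<n. h i * x i))\<^sup>2)) \<partial>Pi\<^sub>M {..<n} (\<lambda>_. gauss)) = (\<integral>\<^sup>+x. ?f (T x 0) \<partial>Pi\<^sub>M {..<n} (\<lambda>_. gauss))"
    by (simp only: T(3) mult.assoc)
  also have "\<dots> = (\<integral>\<^sup>+x. ?f (x 0) \<partial>Pi\<^sub>M {..<n} (\<lambda>_. gauss))"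
    using n0 by (intro nn_integral_PiM_rotations(2)[OF T(1)] gauss_PiM_measurable_compose[where f="?f"]) auto
  also have "\<dots> = (\<integral>\<^sup>+z. ?f z \<partial>gauss)"
    using n0 by (intro nn_integral_PiM_gauss_component[where f="?f"]) auto
  also have "\<dots> = ennreal (1 / (1 - s * sqn n h))"
    using nn_integral_gauss_exp[of "- (s * sqn n h)" 0] s by simp
  finally show ?thesis .
qed

lemma row_times_measurable:
  assumes "j < k"
  shows "(\<lambda>p. row_times n (fst p) (snd p) j) \<in> borel_measurable (Pi\<^sub>M {..<n} (\<lambda>_. gauss) \<Otimes>\<^sub>M gauss_array n k)"
  unfolding row_times_def
proof (rule borel_measurable_sum)
  fix i assume i: "i \<in> {..<n}"
  have "(\<lambda>p. fst p i) \<in> borel_measurable (Pi\<^sub>M {..<n} (\<lambda>_. gauss) \<Otimes>\<^sub>M gauss_array n k)"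
    using i gauss_PiM_measurable_compose[of i "{..<n}" "\<lambda>x. x"] by (intro measurable_compose[OF measurable_fst]) auto
  moreover have "(\<lambda>p. snd p (i, j)) \<in> borel_measurable (Pi\<^sub>M {..<n} (\<lambda>_. gauss) \<Otimes>\<^sub>M gauss_array n k)"
    using i assms by (intro measurable_compose[OF measurable_snd gauss_array_component]) auto
  ultimately show "(\<lambda>p. fst p i * snd p (i, j)) \<in> borel_measurable (Pi\<^sub>M {..<n} (\<lambda>_. gauss) \<Otimes>\<^sub>M gauss_array n k)"
    by (rule borel_measurable_times)
qed

lemma exp_row_times_measurable:
  "(\<lambda>p. ennreal (exp (s * (\<Sum>j<k. (cmod (row_times n (fst p) (snd p) j))\<^sup>2)))) \<in> borel_measurable (Pi\<^sub>M {..<n} (\<lambda>_. gauss) \<Otimes>\<^sub>M gauss_array n k)"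
proof -
  have m: "(\<lambda>p. \<Sum>j<k. (cmod (row_times n (fst p) (snd p) j))\<^sup>2) \<in> borel_measurable (Pi\<^sub>M {..<n} (\<lambda>_. gauss) \<Otimes>\<^sub>M gauss_array n k)"
  proof (rule borel_measurable_sum)
    fix j assume "j \<in> {..<k}"
    then have "j < k" by simp
    have "(\<lambda>z :: complex. (cmod z)\<^sup>2) \<in> borel_measurable borel" by measurable
    from measurable_compose[OF row_times_measurable[OF \<open>j < k\<close>] this]
    show "(\<lambda>p. (cmod (row_times n (fst p) (snd p) j))\<^sup>2) \<in> borel_measurable (Pi\<^sub>M {..<n} (\<lambda>_. gauss) \<Otimes>\<^sub>M gauss_array n k)" .
  qed
  have "(\<lambda>t. ennreal (exp (s * t))) \<in> borel_measurable borel" by measurable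
  from measurable_compose[OF m this] show ?thesis .
qed

lemma exp_row_times_measurable1:
  "(\<lambda>g. ennreal (exp (s * (\<Sum>j<k. (cmod (row_times n h g j))\<^sup>2)))) \<in> borel_measurable (gauss_array n k)"
proof -
  have sq: "(\<lambda>z :: complex. (cmod z)\<^sup>2) \<in> borel_measurable borel" by measurable
  have m: "(\<lambda>g. \<Sum>j<k. (cmod (row_times n h g j))\<^sup>2) \<in> borel_measurable (gauss_array n k)"
  proof (rule borel_measurable_sum)
    fix j assume j: "j \<in> {..<k}"
    have "(\<lambda>g. row_times n h g j) \<in> borel_measurable (gauss_array n k)"
      unfolding row_times_def using j
      by (intro borel_measurable_sum borel_measurable_times borel_measurable_const gauss_array_component) auto
    from measurable_compose[OF this sq] show "(\<lambda>g. (cmod (row_times n h g j))\<^sup>2) \<in> borel_measurable (gauss_array n k)" .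
  qed
  have "(\<lambda>t. ennreal (exp (s * t))) \<in> borel_measurable borel" by measurable
  from measurable_compose[OF m this] show ?thesis .
qed

lemma nn_integral_exp_row_times:
  assumes n: "n \<ge> 1" and s: "s * sqn n h < 1"
  shows "(\<integral>\<^sup>+g. ennreal (exp (s * (\<Sum>j<k. (cmod (row_times n h g j))\<^sup>2))) \<partial>gauss_array n k) = ennreal (1 / (1 - s * sqn n h)) ^ k"
proof (induction k)
  case 0
  interpret prob_space "gauss_array n 0" by (intro prob_space_PiM prob_space_gauss)
  show ?case using emeasure_space_1 by simp
next
  case (Suc k)
  let ?c = "ennreal (1 / (1 - s * sqn n h))"
  let ?F = "\<lambda>k g. ennreal (exp (s * (\<Sum>j<k. (cmod (row_times n h g j))\<^sup>2)))"
  have split: "?F (Suc k) (\<lambda>p\<in>{..<n} \<times> {..<Suc k}. if snd p = k then x (fst p) else g p)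
      = ?F k g * ennreal (exp (s * (cmod (\<Sum>i<n. h i * x i))\<^sup>2))" for x g
    by (simp add: row_times_def distrib_left exp_add ennreal_mult)
  have "(\<integral>\<^sup>+g. ?F (Suc k) g \<partial>gauss_array n (Suc k)) = (\<integral>\<^sup>+g. \<integral>\<^sup>+x. ?F k g * ennreal (exp (s * (cmod (\<Sum>i<n. h i * x i))\<^sup>2)) \<partial>Pi\<^sub>M {..<n} (\<lambda>_. gauss) \<partial>gauss_array n k)"
    by (subst nn_integral_gauss_array_Suc) (simp_all only: split exp_row_times_measurable1)
  also have "\<dots> = (\<integral>\<^sup>+g. ?F k g * ?c \<partial>gauss_array n k)"
  proof (rule nn_integral_cong)
    fix g
    have "(\<lambda>x. \<Sum>i<n. h i * x i) \<in> borel_measurable (Pi\<^sub>M {..<n} (\<lambda>_. gauss))"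
    proof (rule borel_measurable_sum)
      fix i assume "i \<in> {..<n}"
      then show "(\<lambda>x. h i * x i) \<in> borel_measurable (Pi\<^sub>M {..<n} (\<lambda>_. gauss))"
        by (intro gauss_PiM_measurable_compose[where f="\<lambda>z. h i * z"]) auto
    qed
    then show "(\<integral>\<^sup>+x. ?F k g * ennreal (exp (s * (cmod (\<Sum>i<n. h i * x i))\<^sup>2)) \<partial>Pi\<^sub>M {..<n} (\<lambda>_. gauss)) = ?F k g * ?c"
      by (subst nn_integral_cmult) (simp_all add: nn_integral_exp_linear_form[OF n s])
  qed
  also have "\<dots> = ?c * ?c ^ k"
    by (subst nn_integral_multc) (simp_all only: exp_row_times_measurable1 Suc.IH mult.commute)
  finally show ?case by simp
qed

text \<open>Averaging \<open>exp (|h\<^sup>T g|\<^sup>2 / 4 n)\<close> over Gaussian vectors \<open>h\<close> of typical length replaces a net on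
  the sphere: an eigenvector for a large eigenvalue makes this average exponentially larger than its mean.\<close>

definition radius_defect :: "nat \<Rightarrow> (nat \<times> nat \<Rightarrow> complex) \<Rightarrow> ennreal" where
  "radius_defect n g = (\<integral>\<^sup>+h. ennreal (exp (1 / (4 * real n) * (\<Sum>j<n. (cmod (row_times n h g j))\<^sup>2))) * indicator {..2 * real n} (sqn n h)
      \<partial>Pi\<^sub>M {..<n} (\<lambda>_. gauss))"

lemma radius_defect_integrand_measurable:
  "(\<lambda>p. ennreal (exp (1 / (4 * real n) * (\<Sum>j<n. (cmod (row_times n (fst p) (snd p) j))\<^sup>2))) * indicator {..2 * real n} (sqn n (fst p)))
    \<in> borel_measurable (Pi\<^sub>M {..<n} (\<lambda>_. gauss) \<Otimes>\<^sub>M gauss_array n n)"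
proof -
  have "(\<lambda>p. indicator {..2 * real n} (sqn n (fst p)) :: ennreal) \<in> borel_measurable (Pi\<^sub>M {..<n} (\<lambda>_. gauss) \<Otimes>\<^sub>M gauss_array n n)"
    by (rule measurable_compose[OF measurable_compose[OF measurable_fst sqn_measurable[OF order_refl]]]) simp
  with exp_row_times_measurable show ?thesis by (rule borel_measurable_times_ennreal)
qed

lemma radius_defect_measurable: "radius_defect n \<in> borel_measurable (gauss_array n n)"
proof -
  interpret P: prob_space "Pi\<^sub>M {..<n} (\<lambda>_. gauss)" by (intro prob_space_PiM prob_space_gauss)
  have "(\<lambda>(g, h). ennreal (exp (1 / (4 * real n) * (\<Sum>j<n. (cmod (row_times n h g j))\<^sup>2))) * indicator {..2 * real n} (sqn n h))
    \<in> borel_measurable (gauss_array n n \<Otimes>\<^sub>M Pi\<^sub>M {..<n} (\<lambda>_. gauss))"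
    using measurable_compose[OF measurable_pair_swap' radius_defect_integrand_measurable[of n]]
    by (simp add: split_beta')
  then show ?thesis unfolding radius_defect_def by (rule P.borel_measurable_nn_integral)
qed

lemma nn_integral_radius_defect:
  assumes n: "n \<ge> 1"
  shows "(\<integral>\<^sup>+g. radius_defect n g \<partial>gauss_array n n) \<le> ennreal (2 ^ n)"
proof -
  let ?H = "Pi\<^sub>M {..<n} (\<lambda>_. gauss)"
  interpret P: prob_space ?H by (intro prob_space_PiM prob_space_gauss)
  interpret Q: prob_space "gauss_array n n" by (intro prob_space_PiM prob_space_gauss)
  interpret pair_sigma_finite ?H "gauss_array n n" ..
  let ?f = "\<lambda>h g. ennreal (exp (1 / (4 * real n) * (\<Sum>j<n. (cmod (row_times n h g j))\<^sup>2)))"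
  have "(\<integral>\<^sup>+g. radius_defect n g \<partial>gauss_array n n) = (\<integral>\<^sup>+h. \<integral>\<^sup>+g. ?f h g * indicator {..2 * real n} (sqn n h) \<partial>gauss_array n n \<partial>?H)"
    unfolding radius_defect_def
    using radius_defect_integrand_measurable[of n] by (intro Fubini') (simp add: split_beta')
  also have "\<dots> \<le> (\<integral>\<^sup>+h. ennreal (2 ^ n) \<partial>?H)"
  proof (rule nn_integral_mono)
    fix h
    show "(\<integral>\<^sup>+g. ?f h g * indicator {..2 * real n} (sqn n h) \<partial>gauss_array n n) \<le> ennreal (2 ^ n)"
    proof (cases "sqn n h \<le> 2 * real n")
      case True
      let ?s = "1 / (4 * real n)"
      have s: "?s * sqn n h \<le> 1 / 2" using True n by (simp add: field_simps)
      then have s1: "?s * sqn n h < 1" by linarith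
      have "1 / (1 - ?s * sqn n h) \<le> 1 / (1 / 2)" using s by (intro divide_left_mono mult_pos_pos) auto
      then have "ennreal (1 / (1 - ?s * sqn n h)) ^ n \<le> ennreal 2 ^ n"
        by (intro power_mono ennreal_leI) auto
      then show ?thesis using True nn_integral_exp_row_times[OF n s1, of n] by (simp add: ennreal_power[symmetric])
    qed simp
  qed
  also have "\<dots> = ennreal (2 ^ n)" using P.emeasure_space_1 by simp
  finally show ?thesis .
qed

lemma gauss_annulus_exp:
  assumes n: "n \<ge> 1"
  shows "ennreal (real n / 2 * exp (3 / 2 * real n)) \<le> (\<integral>\<^sup>+z. ennreal (exp (4 * (cmod z)\<^sup>2)) * indicator {real n / 2..real n} ((cmod z)\<^sup>2) \<partial>gauss)"
proof -
  have "(\<integral>\<^sup>+z. ennreal (exp (4 * (cmod z)\<^sup>2)) * indicator {real n / 2..real n} ((cmod z)\<^sup>2) \<partial>gauss)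
     = (\<integral>\<^sup>+z. (\<lambda>t. ennreal (exp (3 * t) / pi) * indicator {real n / 2..real n} t) ((cmod z)\<^sup>2) \<partial>lborel)"
  proof (subst nn_integral_gauss)
    show "(\<integral>\<^sup>+z. std_complex_gaussian_density z * (ennreal (exp (4 * (cmod z)\<^sup>2)) * indicator {real n / 2..real n} ((cmod z)\<^sup>2)) \<partial>lborel)
      = (\<integral>\<^sup>+z. (\<lambda>t. ennreal (exp (3 * t) / pi) * indicator {real n / 2..real n} t) ((cmod z)\<^sup>2) \<partial>lborel)"
    proof (rule nn_integral_cong)
      fix z
      have "exp (- (cmod z)\<^sup>2) * exp (4 * (cmod z)\<^sup>2) = exp (3 * (cmod z)\<^sup>2)"
        unfolding exp_add[symmetric] by simp
      then show "std_complex_gaussian_density z * (ennreal (exp (4 * (cmod z)\<^sup>2)) * indicator {real n / 2..real n} ((cmod z)\<^sup>2))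
        = (\<lambda>t. ennreal (exp (3 * t) / pi) * indicator {real n / 2..real n} t) ((cmod z)\<^sup>2)"
        by (simp add: std_complex_gaussian_density_def mult.assoc[symmetric] ennreal_mult'[symmetric])
    qed
  qed measurable
  also have "\<dots> = ennreal pi * (\<integral>\<^sup>+t. ennreal (exp (3 * t) / pi) * indicator {real n / 2..real n} t * indicator {0..} t \<partial>lborel)"
    by (rule nn_integral_lborel_radial) measurable
  also have "\<dots> \<ge> ennreal pi * (\<integral>\<^sup>+t. ennreal (exp (3 / 2 * real n) / pi) * indicator {real n / 2..real n} t \<partial>lborel)"
  proof (intro mult_left_mono nn_integral_mono)
    fix t :: real
    show "ennreal (exp (3 / 2 * real n) / pi) * indicator {real n / 2..real n} t \<le> ennreal (exp (3 * t) / pi) * indicator {real n / 2..real n} t * indicator {0..} t"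
      by (auto split: split_indicator intro!: ennreal_leI divide_right_mono)
  qed simp
  also have "(\<integral>\<^sup>+t. ennreal (exp (3 / 2 * real n) / pi) * indicator {real n / 2..real n} t \<partial>lborel) = ennreal (exp (3 / 2 * real n) / pi) * ennreal (real n / 2)"
    by (subst nn_integral_cmult_indicator) auto
  also have "ennreal pi * (ennreal (exp (3 / 2 * real n) / pi) * ennreal (real n / 2)) = ennreal (real n / 2 * exp (3 / 2 * real n))"
    by (simp add: ennreal_mult[symmetric] mult.commute)
  finally show ?thesis .
qed

text \<open>A chi-square type variable with mean \<open>n - 1\<close> is at most \<open>n\<close> with probability at least \<open>1 / n\<close>, by Markov's
  inequality. This crude bound is enough against an exponential.\<close>

lemma gauss_norm_prob_ge:
  assumes n: "n \<ge> 1"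
  shows "ennreal (1 / real n) \<le> (\<integral>\<^sup>+h. indicator {..real n} (\<Sum>i\<in>{1..<n}. (cmod (h i))\<^sup>2) \<partial>Pi\<^sub>M {1..<n} (\<lambda>_. gauss))"
proof -
  let ?P = "Pi\<^sub>M {1..<n} (\<lambda>_. gauss)" and ?X = "\<lambda>h. \<Sum>i\<in>{1..<n}. (cmod (h i))\<^sup>2"
  interpret P: prob_space ?P by (intro prob_space_PiM prob_space_gauss)
  have m[measurable]: "?X \<in> borel_measurable ?P" using noncentral_measurable[of "{1..<n}" "{1..<n}" "\<lambda>_. 0"] by simp
  have E: "(\<integral>\<^sup>+h. ennreal (?X h) \<partial>?P) = ennreal (real n - 1)"
    using nn_integral_noncentral_sum[of "{1..<n}" "{1..<n}" "\<lambda>_. 0"] n by (simp add: of_nat_diff)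
  let ?I = "\<integral>\<^sup>+h. indicator {..real n} (?X h) \<partial>?P"
  have "1 = (\<integral>\<^sup>+h. 1 \<partial>?P)" using P.emeasure_space_1 by simp
  also have "\<dots> \<le> (\<integral>\<^sup>+h. indicator {..real n} (?X h) + ennreal (1 / real n) * ennreal (?X h) \<partial>?P)"
  proof (rule nn_integral_mono)
    fix h
    show "1 \<le> indicator {..real n} (?X h) + ennreal (1 / real n) * ennreal (?X h)"
    proof (cases "?X h \<le> real n")
      case False
      then have "1 \<le> 1 / real n * ?X h" using n by (simp add: field_simps)
      then have "ennreal 1 \<le> ennreal (1 / real n * ?X h)" by (rule ennreal_leI)
      also have "\<dots> = ennreal (1 / real n) * ennreal (?X h)" by (rule ennreal_mult) (auto intro: sum_nonneg)
      also have "\<dots> \<le> indicator {..real n} (?X h) + ennreal (1 / real n) * ennreal (?X h)" by simp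
      finally show ?thesis by simp
    qed simp
  qed
  also have "\<dots> = ?I + ennreal (1 / real n) * ennreal (real n - 1)"
    by (subst nn_integral_add) (simp_all add: nn_integral_cmult E[unfolded One_nat_def])
  also have "ennreal (1 / real n) * ennreal (real n - 1) = ennreal (1 - 1 / real n)"
    using n by (subst ennreal_mult[symmetric]) (auto simp: field_simps)
  finally have le: "1 \<le> ?I + ennreal (1 - 1 / real n)" .
  have "?I \<le> (\<integral>\<^sup>+h. 1 \<partial>?P)" by (intro nn_integral_mono) (auto split: split_indicator)
  then have "?I < \<top>" using P.emeasure_space_1 by (auto simp: less_top[symmetric] top_unique)
  then obtain r where r: "?I = ennreal r" "r \<ge> 0" by (cases ?I) auto
  have "ennreal 1 \<le> ennreal (r + (1 - 1 / real n))" using le r n by (simp add: ennreal_plus[symmetric] del: ennreal_plus)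
  then have "1 \<le> r + (1 - 1 / real n)" using r n by (subst (asm) ennreal_le_iff) auto
  then show ?thesis unfolding r(1) by (intro ennreal_leI) simp
qed

text \<open>By the Cauchy-Schwarz inequality, \<open>|h\<^sup>T g|\<^sup>2 |v|\<^sup>2 \<ge> |l|\<^sup>2 |h\<^sup>T v|\<^sup>2\<close>. The vectors \<open>h\<close> whose squared component along
  \<open>v\<close> lies between \<open>n / 2\<close> and \<open>n\<close> are rare, but contribute more than their probability costs.\<close>

lemma radius_defect_lower:
  assumes n: "n \<ge> 1" and eig: "\<And>i. i < n \<Longrightarrow> (\<Sum>j<n. g (i, j) * v j) = l * v i"
    and v: "sqn n v > 0" and l: "(cmod l)\<^sup>2 \<ge> 16 * real n"
  shows "ennreal (exp (3 / 2 * real n) / 2) \<le> radius_defect n g"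
proof -
  let ?H = "Pi\<^sub>M {..<n} (\<lambda>_. gauss)"
  obtain T where T: "T \<in> rotations {..<n}" "\<And>x. sqn n (T x) = sqn n x"
    "\<And>x. (cmod (\<Sum>i<n. v i * x i))\<^sup>2 = sqn n v * (cmod (T x 0))\<^sup>2"
    using ex_rotation_bilinear[OF n, of v] by auto
  let ?q = "\<lambda>h. ennreal (exp (4 * (cmod (h 0))\<^sup>2)) * indicator {..2 * real n} (sqn n h)"
  have n0: "0 \<in> {..<n}" using n by auto
  have q: "?q \<in> borel_measurable ?H"
    using n0 by (intro borel_measurable_times_ennreal gauss_PiM_measurable_compose[where f="\<lambda>z. ennreal (exp (4 * (cmod z)\<^sup>2))"]
      measurable_compose[OF sqn_measurable]) auto
  have key: "4 * (cmod (T h 0))\<^sup>2 \<le> 1 / (4 * real n) * (\<Sum>j<n. (cmod (row_times n h g j))\<^sup>2)" for h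
  proof -
    have "(\<Sum>j<n. row_times n h g j * v j) = (\<Sum>j<n. \<Sum>i<n. h i * g (i, j) * v j)"
      by (simp add: row_times_def sum_distrib_right)
    also have "\<dots> = (\<Sum>i<n. \<Sum>j<n. h i * g (i, j) * v j)" by (rule sum.swap)
    also have "\<dots> = (\<Sum>i<n. h i * (\<Sum>j<n. g (i, j) * v j))" by (simp add: sum_distrib_left mult.assoc)
    also have "\<dots> = (\<Sum>i<n. h i * (l * v i))" by (intro sum.cong refl) (simp add: eig)
    also have "\<dots> = l * (\<Sum>i<n. v i * h i)" by (simp add: sum_distrib_left mult_ac)
    finally have e: "l * (\<Sum>i<n. v i * h i) = (\<Sum>j<n. row_times n h g j * v j)" by simp
    have "(cmod l)\<^sup>2 * (sqn n v * (cmod (T h 0))\<^sup>2) = (cmod (\<Sum>j<n. row_times n h g j * v j))\<^sup>2"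
      unfolding T(3)[symmetric] e[symmetric] by (simp add: norm_mult power_mult_distrib)
    also have "\<dots> \<le> (\<Sum>j<n. cmod (row_times n h g j) * cmod (v j))\<^sup>2"
      by (intro power_mono order_trans[OF norm_sum]) (auto simp: norm_mult)
    also have "\<dots> \<le> (\<Sum>j<n. (cmod (row_times n h g j))\<^sup>2) * sqn n v"
      unfolding sqn_def by (rule Cauchy_Schwarz_ineq_sum)
    finally have "sqn n v * ((cmod l)\<^sup>2 * (cmod (T h 0))\<^sup>2) \<le> sqn n v * (\<Sum>j<n. (cmod (row_times n h g j))\<^sup>2)"
      by (simp add: mult_ac)
    then have "(cmod l)\<^sup>2 * (cmod (T h 0))\<^sup>2 \<le> (\<Sum>j<n. (cmod (row_times n h g j))\<^sup>2)"
      using v by (simp only: mult_le_cancel_left_pos)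
    moreover have "16 * real n * (cmod (T h 0))\<^sup>2 \<le> (cmod l)\<^sup>2 * (cmod (T h 0))\<^sup>2"
      using l by (intro mult_right_mono) auto
    ultimately show ?thesis using n by (simp add: field_simps)
  qed
  have "ennreal (exp (3 / 2 * real n) / 2) = ennreal (real n / 2 * exp (3 / 2 * real n)) * ennreal (1 / real n)"
    using n by (subst ennreal_mult[symmetric]) auto
  also have "\<dots> \<le> (\<integral>\<^sup>+z. ennreal (exp (4 * (cmod z)\<^sup>2)) * indicator {real n / 2..real n} ((cmod z)\<^sup>2) \<partial>gauss)
      * (\<integral>\<^sup>+h. indicator {..real n} (\<Sum>i\<in>{1..<n}. (cmod (h i))\<^sup>2) \<partial>Pi\<^sub>M {1..<n} (\<lambda>_. gauss))"
    by (intro mult_mono gauss_annulus_exp gauss_norm_prob_ge n) auto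
  also have "\<dots> = (\<integral>\<^sup>+h. (\<integral>\<^sup>+z. ennreal (exp (4 * (cmod z)\<^sup>2)) * indicator {real n / 2..real n} ((cmod z)\<^sup>2) \<partial>gauss) * indicator {..real n} (\<Sum>i\<in>{1..<n}. (cmod (h i))\<^sup>2) \<partial>Pi\<^sub>M {1..<n} (\<lambda>_. gauss))"
  proof (rule nn_integral_cmult[symmetric])
    have m: "(\<lambda>h. \<Sum>i\<in>{1..<n}. (cmod (h i))\<^sup>2) \<in> borel_measurable (Pi\<^sub>M {1..<n} (\<lambda>_. gauss))"
      using noncentral_measurable[of "{1..<n}" "{1..<n}" "\<lambda>_. 0"] by simp
    have "(indicator {..real n} :: real \<Rightarrow> ennreal) \<in> borel_measurable borel" by measurable
    from measurable_compose[OF m this]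
    show "(\<lambda>h. indicator {..real n} (\<Sum>i\<in>{1..<n}. (cmod (h i))\<^sup>2) :: ennreal) \<in> borel_measurable (Pi\<^sub>M {1..<n} (\<lambda>_. gauss))" .
  qed
  also have "\<dots> = (\<integral>\<^sup>+h. \<integral>\<^sup>+z. ennreal (exp (4 * (cmod z)\<^sup>2)) * indicator {real n / 2..real n} ((cmod z)\<^sup>2) * indicator {..real n} (\<Sum>i\<in>{1..<n}. (cmod (h i))\<^sup>2) \<partial>gauss \<partial>Pi\<^sub>M {1..<n} (\<lambda>_. gauss))"
    by (rule nn_integral_cong, rule nn_integral_multc[symmetric]) measurable
  also have "\<dots> \<le> (\<integral>\<^sup>+h. \<integral>\<^sup>+z. ?q (h(0 := z)) \<partial>gauss \<partial>Pi\<^sub>M {1..<n} (\<lambda>_. gauss))"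
  proof (rule nn_integral_mono, rule nn_integral_mono)
    fix h :: "nat \<Rightarrow> complex" and z
    have "sqn n (h(0 := z)) = (cmod z)\<^sup>2 + (\<Sum>i\<in>{1..<n}. (cmod (h i))\<^sup>2)"
    proof -
      have "{..<n} = insert 0 {1..<n}" using n by auto
      then show ?thesis unfolding sqn_def by (simp add: sum.insert)
    qed
    then show "ennreal (exp (4 * (cmod z)\<^sup>2)) * indicator {real n / 2..real n} ((cmod z)\<^sup>2) * indicator {..real n} (\<Sum>i\<in>{1..<n}. (cmod (h i))\<^sup>2) \<le> ?q (h(0 := z))"
      by (auto split: split_indicator)
  qed
  also have "\<dots> = (\<integral>\<^sup>+h. ?q h \<partial>?H)"
  proof -
    have "{..<n} = insert 0 {1..<n}" using n by auto
    then show ?thesis using q gauss_prod.product_nn_integral_insert[of "{1..<n}" 0 ?q] by auto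
  qed
  also have "\<dots> = (\<integral>\<^sup>+h. ?q (T h) \<partial>?H)"
    by (rule nn_integral_PiM_rotations(2)[OF T(1) _ _ q, symmetric]) auto
  also have "\<dots> \<le> radius_defect n g"
    unfolding radius_defect_def T(2) using key
    by (intro nn_integral_mono mult_right_mono ennreal_leI) auto
  finally show ?thesis .
qed

lemma AE_eventually_radius_defect:
  assumes M: "prob_space M" and G: "\<And>n. n \<ge> 1 \<Longrightarrow> ginibre_matrix M n (G n)"
  shows "AE \<omega> in M. \<forall>\<^sub>F n in sequentially. radius_defect n (entries n (G n \<omega>)) \<le> ennreal (2 ^ n * real n ^ 2)"
proof -
  interpret prob_space M by fact
  show ?thesis
  proof (rule AE_eventually_le_of_summable[where k=1 and c="\<lambda>n. 2 ^ n"])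
    fix n :: nat assume n: "n \<ge> 1"
    show "(\<lambda>\<omega>. radius_defect n (entries n (G n \<omega>))) \<in> borel_measurable M"
      by (rule measurable_compose[OF ginibre_distr(1)[OF G[OF n] n] radius_defect_measurable])
    show "(\<integral>\<^sup>+\<omega>. radius_defect n (entries n (G n \<omega>)) \<partial>M) \<le> ennreal (2 ^ n)"
      using nn_integral_ginibre[OF G[OF n] n radius_defect_measurable] nn_integral_radius_defect[OF n] by simp
    show "2 ^ n * real n ^ 2 > 0" using n by simp
  next
    show "summable (\<lambda>n. 2 ^ n / (2 ^ n * real n ^ 2))"
      using inverse_power_summable[of 2, where 'a=real] by (simp add: inverse_eq_divide power_one_over)
  qed auto
qed

lemma eigenvalue_entries:
  assumes A: "A \<in> carrier_mat n n" and n: "n \<ge> 1"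
    and l: "l \<in># eigenvalues_mset (of_real (1 / sqrt n) \<cdot>\<^sub>m A)"
  shows "\<exists>v. sqn n v > 0 \<and> (\<forall>i<n. (\<Sum>j<n. entries n A (i, j) * v j) = (of_real (sqrt n) * l) * v i)"
proof -
  let ?B = "of_real (1 / sqrt n) \<cdot>\<^sub>m A"
  have B: "?B \<in> carrier_mat n n" using A by simp
  have "poly (char_poly ?B) l = 0"
  proof -
    have "char_poly ?B \<noteq> 0" using degree_monic_char_poly[OF B] by auto
    then show ?thesis using l by (simp add: eigenvalues_mset_def)
  qed
  then have "eigenvalue ?B l" using eigenvalue_root_char_poly[OF B] by simp
  then obtain w where w: "w \<in> carrier_vec n" "w \<noteq> 0\<^sub>v n" "?B *\<^sub>v w = l \<cdot>\<^sub>v w"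
    using B unfolding eigenvalue_def eigenvector_def by auto
  define v where "v i = w $ i" for i
  obtain i where i: "i < n" "w $ i \<noteq> 0" using w(1,2) by (metis carrier_vecD eq_vecI index_zero_vec)
  have "(cmod (v i))\<^sup>2 \<le> sqn n v" unfolding sqn_def using i by (intro member_le_sum) auto
  then have pos: "sqn n v > 0" using i by (auto simp: v_def intro: less_le_trans[of 0 "(cmod (w $ i))\<^sup>2"])
  have "(\<Sum>j<n. entries n A (i, j) * v j) = (of_real (sqrt n) * l) * v i" if i: "i < n" for i
  proof -
    have "(?B *\<^sub>v w) $ i = (\<Sum>j<n. of_real (1 / sqrt n) * A $$ (i, j) * w $ j)"
      using i A w(1) by (auto simp: scalar_prod_def atLeast0LessThan intro!: sum.cong)
    then have "l * v i = of_real (1 / sqrt n) * (\<Sum>j<n. A $$ (i, j) * v j)"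
      using w(3) i w(1) by (simp add: v_def sum_distrib_left mult.assoc)
    moreover have "of_real (sqrt n) * (of_real (1 / sqrt n) :: complex) = 1" using n by (simp flip: of_real_mult)
    ultimately have "of_real (sqrt n) * l * v i = (\<Sum>j<n. A $$ (i, j) * v j)"
      by (metis mult.assoc mult.left_neutral)
    then show ?thesis using i by (simp add: entries_def)
  qed
  with pos show ?thesis by auto
qed

theorem AE_eventually_eigenvalues_bounded:
  assumes M: "prob_space M" and G: "\<And>n. n \<ge> 1 \<Longrightarrow> ginibre_matrix M n (G n)"
  shows "AE \<omega> in M. \<forall>\<^sub>F n in sequentially. \<forall>l\<in>#eigenvalues_mset (of_real (1 / sqrt n) \<cdot>\<^sub>m G n \<omega>). cmod l < 4"
proof -
  have "AE \<omega> in M. \<forall>\<^sub>F n in sequentially. radius_defect n (entries n (G n \<omega>)) \<le> ennreal (2 ^ n * real n ^ 2)"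
    by (rule AE_eventually_radius_defect[OF M]) (rule G)
  then show ?thesis using AE_space
  proof eventually_elim
  case (elim \<omega>)
  have "\<forall>\<^sub>F n in sequentially. exp (real n) * real n ^ 2 < exp (3 / 2 * real n) / 2" by real_asymp
  then have "\<forall>\<^sub>F n in sequentially. 2 ^ n * real n ^ 2 < exp (3 / 2 * real n) / 2"
  proof eventually_elim
    case (elim n)
    have "(2::real) ^ n \<le> exp 1 ^ n" using exp_ge_add_one_self[of 1] by (intro power_mono) auto
    then have "2 ^ n * real n ^ 2 \<le> exp (real n) * real n ^ 2"
      by (intro mult_right_mono) (auto simp: exp_of_nat_mult[symmetric])
    with elim show ?case by linarith
  qed
  with elim(1) show ?case using eventually_ge_at_top[of 1]
  proof eventually_elim
    case (elim n)
    show ?case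
    proof (rule ballI, rule ccontr)
      fix l assume l: "l \<in># eigenvalues_mset (of_real (1 / sqrt n) \<cdot>\<^sub>m G n \<omega>)" and "\<not> cmod l < 4"
      then have l4: "4 \<le> cmod l" by simp
      have A: "G n \<omega> \<in> carrier_mat n n"
        using G[OF elim(3)] \<open>\<omega> \<in> space M\<close> by (auto simp: ginibre_matrix_def)
      obtain v where v: "sqn n v > 0" "\<And>i. i < n \<Longrightarrow> (\<Sum>j<n. entries n (G n \<omega>) (i, j) * v j) = (of_real (sqrt n) * l) * v i"
        using eigenvalue_entries[OF A elim(3) l] by auto
      have "4\<^sup>2 \<le> (cmod l)\<^sup>2" using l4 by (intro power_mono) auto
      then have "16 * real n \<le> (cmod (of_real (sqrt n) * l))\<^sup>2"
        using mult_left_mono[of "4\<^sup>2" "(cmod l)\<^sup>2" "real n"] by (simp add: norm_mult power_mult_distrib mult.commute)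
      from radius_defect_lower[OF elim(3) v(2) v(1) this] elim(1)
      have "ennreal (exp (3 / 2 * real n) / 2) \<le> ennreal (2 ^ n * real n ^ 2)" by (rule order_trans)
      then show False using elim(2) by (simp add: ennreal_le_iff)
    qed
  qed
  qed
qed

section \<open>From the potential to the number of eigenvalues in a region\<close>

lemma nn_integral_abs_ln_ball:
  assumes b: "cmod b \<le> 6"
  shows "(\<integral>\<^sup>+u. ennreal \<bar>ln (cmod (u - b))\<bar> * indicator (ball 0 6) u \<partial>lborel) \<le> ennreal (470 * pi)"
proof -
  have [measurable]: "ball (0::complex) 6 \<in> sets borel" by simp
  have "(\<integral>\<^sup>+u. ennreal \<bar>ln (cmod (u - b))\<bar> * indicator (ball 0 6) u \<partial>lborel)
     \<le> (\<integral>\<^sup>+u. ennreal 12 * indicator (ball 0 6) u + ennreal (1 / cmod (u - b)) * indicator (ball 0 6) u \<partial>lborel)"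
  proof (rule nn_integral_mono)
    fix u :: complex
    have "\<bar>ln (cmod (u - b))\<bar> \<le> 12 + 1 / cmod (u - b)" if "u \<in> ball 0 6"
      using abs_ln_le_add_inverse[of "cmod (u - b)"] norm_triangle_ineq4[of u b] that b by simp
    then show "ennreal \<bar>ln (cmod (u - b))\<bar> * indicator (ball 0 6) u \<le> ennreal 12 * indicator (ball 0 6) u + ennreal (1 / cmod (u - b)) * indicator (ball 0 6) u"
      by (auto split: split_indicator simp del: ennreal_plus simp: ennreal_plus[symmetric] intro!: ennreal_leI)
         (metis ennreal_leI ennreal_numeral ennreal_plus divide_nonneg_nonneg norm_ge_zero zero_le_numeral zero_le_one)
  qed
  also have "\<dots> = ennreal 12 * emeasure lborel (ball (0::complex) 6) + (\<integral>\<^sup>+u. ennreal (1 / cmod (u - b)) * indicator (ball 0 6) u \<partial>lborel)"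
    by (subst nn_integral_add) (measurable, simp add: nn_integral_cmult_indicator)
  also have "\<dots> \<le> ennreal 12 * ennreal (36 * pi) + (ennreal (2 * pi) + ennreal (36 * pi))"
    using nn_integral_inverse_norm_le[of "ball 0 6" b] by (intro add_mono) (auto simp: emeasure_lborel_disc mult.commute)
  also have "\<dots> = ennreal (470 * pi)"
    by (simp only: ennreal_mult[symmetric] ennreal_plus[symmetric] pi_ge_zero mult_nonneg_nonneg zero_le_numeral add_nonneg_nonneg) (simp add: algebra_simps)
  finally show ?thesis .
qed

lemma Fubini_log_kernel:
  assumes A[measurable]: "A \<in> sets borel" "emeasure lborel A < \<infinity>" and b: "b \<in> borel_measurable borel" "\<And>w. w \<in> A \<Longrightarrow> cmod (b w) \<le> 6"
    and \<phi>: "(\<lambda>(w, u). \<phi> w u) \<in> borel_measurable (borel \<Otimes>\<^sub>M borel)" "\<And>w u. \<bar>\<phi> w u\<bar> \<le> (1::real)"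
  shows "(LINT w|lborel. indicator A w * (LINT u|lborel. indicator (ball 0 6) u * (\<phi> w u * ln (cmod (u - b w)))))
    = (LINT u|lborel. indicator (ball 0 6) u * (LINT w|lborel. indicator A w * (\<phi> w u * ln (cmod (u - b w)))))"
proof -
  note [measurable] = b(1) \<phi>(1)[unfolded split_beta']
  have [measurable]: "ball (0::complex) 6 \<in> sets borel" by simp
  let ?f = "\<lambda>w u. indicator A w * (indicator (ball 0 6) u * (\<phi> w u * ln (cmod (u - b w))))"
  have meas[measurable]: "(\<lambda>p. ?f (fst p) (snd p)) \<in> borel_measurable (borel \<Otimes>\<^sub>M borel)" by measurable
  have "(\<integral>\<^sup>+p. ennreal (norm (?f (fst p) (snd p))) \<partial>(lborel \<Otimes>\<^sub>M lborel)) = (\<integral>\<^sup>+w. \<integral>\<^sup>+u. ennreal (norm (?f w u)) \<partial>lborel \<partial>lborel)"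
    by (subst lborel.nn_integral_fst[symmetric]) auto
  also have "\<dots> \<le> (\<integral>\<^sup>+w. ennreal (470 * pi) * indicator A w \<partial>lborel)"
  proof (rule nn_integral_mono)
    fix w
    show "(\<integral>\<^sup>+u. ennreal (norm (?f w u)) \<partial>lborel) \<le> ennreal (470 * pi) * indicator A w"
    proof (cases "w \<in> A")
      case True
      have "(\<integral>\<^sup>+u. ennreal (norm (?f w u)) \<partial>lborel) \<le> (\<integral>\<^sup>+u. ennreal \<bar>ln (cmod (u - b w))\<bar> * indicator (ball 0 6) u \<partial>lborel)"
        using \<phi>(2)[of w] by (intro nn_integral_mono) (auto split: split_indicator simp: abs_mult intro!: ennreal_leI mult_left_le_one_le)
      also have "\<dots> \<le> ennreal (470 * pi)" using b(2)[OF True] by (rule nn_integral_abs_ln_ball)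
      finally show ?thesis using True by simp
    qed simp
  qed
  also have "\<dots> < \<infinity>" using A by (simp add: nn_integral_cmult_indicator ennreal_mult_less_top)
  finally have "integrable (lborel \<Otimes>\<^sub>M lborel) (\<lambda>p. ?f (fst p) (snd p))"
    by (intro integrableI_bounded) auto
  then have "integrable (lborel \<Otimes>\<^sub>M lborel) (case_prod ?f)" by (simp add: split_beta')
  from lborel_pair.Fubini_integral[OF this]
  have "(LINT u|lborel. LINT w|lborel. ?f w u) = (LINT w|lborel. LINT u|lborel. ?f w u)" .
  moreover have "(LINT w|lborel. ?f w u) = indicator (ball 0 6) u * (LINT w|lborel. indicator A w * (\<phi> w u * ln (cmod (u - b w))))" for u
    by (subst integral_mult_right_zero[symmetric]) (simp add: mult_ac)
  ultimately show ?thesis by simp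
qed

definition disc_fraction :: "complex set \<Rightarrow> real \<Rightarrow> complex \<Rightarrow> real" where
  "disc_fraction E a u = measure lborel (E \<inter> ball u a) / (pi * a\<^sup>2)"

lemma measure_disc: "r \<ge> 0 \<Longrightarrow> measure lborel (ball (z::complex) r) = pi * r\<^sup>2"
  by (simp add: measure_def emeasure_lborel_disc)

lemma disc_fraction_bounds:
  assumes "a > 0" "E \<in> sets borel"
  shows "0 \<le> disc_fraction E a u" "disc_fraction E a u \<le> 1"
proof -
  have "measure lborel (E \<inter> ball u a) \<le> measure lborel (ball u a)"
    using assms emeasure_lborel_ball_finite[of u a] by (intro measure_mono_fmeasurable) (auto simp: fmeasurable_def)
  then show "0 \<le> disc_fraction E a u" "disc_fraction E a u \<le> 1"
    using assms by (auto simp: disc_fraction_def measure_disc divide_le_eq_1)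
qed

lemma disc_fraction_measurable:
  assumes [measurable]: "E \<in> sets borel"
  shows "disc_fraction E a \<in> borel_measurable borel"
proof -
  have [measurable]: "(\<lambda>p. indicator E (snd p) * indicator {..<a} (dist (fst p) (snd p)) :: ennreal) \<in> borel_measurable (borel \<Otimes>\<^sub>M (borel :: complex measure))"
    by measurable
  have "emeasure lborel (E \<inter> ball u a) = (\<integral>\<^sup>+w. indicator E w * indicator {..<a} (dist u w) \<partial>lborel)" for u
  proof -
    have "emeasure lborel (E \<inter> ball u a) = (\<integral>\<^sup>+w. indicator (E \<inter> ball u a) w \<partial>lborel)" by simp
    also have "\<dots> = (\<integral>\<^sup>+w. indicator E w * indicator {..<a} (dist u w) \<partial>lborel)"
      by (intro nn_integral_cong) (auto split: split_indicator)
    finally show ?thesis .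
  qed
  then show ?thesis unfolding disc_fraction_def[abs_def] measure_def by simp
qed

text \<open>By Newton's theorem, \<open>log_avg a\<close> is the average of the logarithmic kernel over a disc of radius \<open>a\<close>. Fubini's
  theorem moves the averaging from the kernel to the indicator function of \<open>E\<close>.\<close>

lemma log_avg_convolution:
  assumes E[measurable]: "E \<in> sets borel" and sub: "E \<subseteq> ball 0 r" "r + a \<le> 6" and a: "a > 0" and l: "cmod l \<le> 6"
  shows "(LINT w|lborel. indicator E w * log_avg a (cmod (l - w))) = (LINT u|lborel. ln (cmod (u - l)) * disc_fraction E a u)"
proof -
  let ?B = "ball (0::complex) 6"
  have [measurable]: "ball (z::complex) s \<in> sets borel" for z s by simp
  have finE: "emeasure lborel E < \<infinity>"
    using emeasure_bounded_finite[of E] bounded_subset[OF bounded_ball sub(1)] by auto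
  have pa: "pi * a\<^sup>2 > 0" using a by simp
  have inner: "log_avg a (cmod (l - w)) = (LINT u|lborel. indicator ?B u * (indicator (ball w a) u * ln (cmod (u - l)))) / (pi * a\<^sup>2)"
    if w: "w \<in> E" "w \<noteq> l" for w
  proof -
    have "pi * a\<^sup>2 * log_avg a (cmod (l - w)) = (LINT z|lborel. indicator (ball 0 a) z * ln (cmod (z - (l - w))))"
      using disc_average_ln[OF a, of "l - w"] w by (simp add: set_lebesgue_integral_def)
    also have "\<dots> = (LINT z|lborel. (\<lambda>u. indicator ?B u * (indicator (ball w a) u * ln (cmod (u - l)))) (w + z))"
    proof (rule Bochner_Integration.integral_cong[OF refl])
      fix z
      have "w + z \<in> ?B" if "z \<in> ball 0 a"
        using that w sub norm_triangle_ineq[of w z] by (auto simp: subset_eq)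
      moreover have "w + z \<in> ball w a \<longleftrightarrow> z \<in> ball 0 a" by (simp add: dist_norm)
      ultimately show "indicator (ball 0 a) z * ln (cmod (z - (l - w))) = (\<lambda>u. indicator ?B u * (indicator (ball w a) u * ln (cmod (u - l)))) (w + z)"
        by (auto split: split_indicator simp: algebra_simps)
    qed
    also have "\<dots> = (LINT u|lborel. indicator ?B u * (indicator (ball w a) u * ln (cmod (u - l))))"
      by (subst (2) lborel_distr_plus[of w, symmetric], subst integral_distr) auto
    finally show ?thesis using pa by (subst eq_divide_eq) (auto simp: mult.commute)
  qed
  have "(LINT w|lborel. indicator E w * log_avg a (cmod (l - w)))
      = (LINT w|lborel. indicator E w * (LINT u|lborel. indicator ?B u * (indicator (ball w a) u * ln (cmod (u - l)))) / (pi * a\<^sup>2))"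
  proof (rule integral_cong_AE)
    have [measurable]: "(\<lambda>p. indicator ?B (snd p) * (indicator {..<a} (dist (fst p) (snd p)) * ln (cmod (snd p - l))) :: real) \<in> borel_measurable (borel \<Otimes>\<^sub>M (borel :: complex measure))"
      by measurable
    have e: "indicator (ball w a) u = (indicator {..<a} (dist w u) :: real)" for w u :: complex by (simp add: indicator_def)
    show "(\<lambda>w. indicator E w * (LINT u|lborel. indicator ?B u * (indicator (ball w a) u * ln (cmod (u - l)))) / (pi * a\<^sup>2)) \<in> borel_measurable lborel"
      unfolding e by measurable
    have "AE w in lborel. w \<noteq> l" by (rule AE_lborel_singleton)
    then show "AE w in lborel. indicator E w * log_avg a (cmod (l - w)) = indicator E w * (LINT u|lborel. indicator ?B u * (indicator (ball w a) u * ln (cmod (u - l)))) / (pi * a\<^sup>2)"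
      by eventually_elim (auto split: split_indicator simp: inner)
  qed measurable
  also have "\<dots> = (LINT w|lborel. indicator E w * (LINT u|lborel. indicator ?B u * (indicator (ball w a) u * ln (cmod (u - l))))) / (pi * a\<^sup>2)"
    by simp
  also have "(LINT w|lborel. indicator E w * (LINT u|lborel. indicator ?B u * (indicator (ball w a) u * ln (cmod (u - l)))))
     = (LINT u|lborel. indicator ?B u * (LINT w|lborel. indicator E w * (indicator (ball w a) u * ln (cmod (u - l)))))"
  proof (rule Fubini_log_kernel[OF E finE, of "\<lambda>_. l" "\<lambda>w. indicator (ball w a)"])
    have "(\<lambda>p. indicator {..<a} (dist (fst p) (snd p)) :: real) \<in> borel_measurable (borel \<Otimes>\<^sub>M (borel :: complex measure))" by measurable
    moreover have e: "indicator (ball w a) u = (indicator {..<a} (dist w u) :: real)" for w u :: complex by (simp add: indicator_def)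
    ultimately show "(\<lambda>(w, u). indicator (ball w a) u :: real) \<in> borel_measurable (borel \<Otimes>\<^sub>M (borel :: complex measure))"
      unfolding e split_beta' by simp
  qed (use l in \<open>auto simp: indicator_def\<close>)
  also have "\<dots> / (pi * a\<^sup>2) = (LINT u|lborel. ln (cmod (u - l)) * disc_fraction E a u)"
  proof -
    have "indicator ?B u * (LINT w|lborel. indicator E w * (indicator (ball w a) u * ln (cmod (u - l)))) / (pi * a\<^sup>2) = ln (cmod (u - l)) * disc_fraction E a u" for u
    proof -
      have "(LINT w|lborel. indicator E w * (indicator (ball w a) u * ln (cmod (u - l)))) = (LINT w|lborel. indicator (E \<inter> ball u a) w * ln (cmod (u - l)))"
        by (intro Bochner_Integration.integral_cong) (auto split: split_indicator simp: dist_commute)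
      also have "\<dots> = measure lborel (E \<inter> ball u a) * ln (cmod (u - l))" by simp
      finally have 1: "(LINT w|lborel. indicator E w * (indicator (ball w a) u * ln (cmod (u - l)))) = measure lborel (E \<inter> ball u a) * ln (cmod (u - l))" .
      have "E \<inter> ball u a = {}" if "u \<notin> ?B"
      proof (rule ccontr)
        assume "E \<inter> ball u a \<noteq> {}"
        then obtain w where "w \<in> E" "dist u w < a" by auto
        then show False using that sub norm_triangle_ineq[of w "u - w"] by (auto simp: subset_eq dist_norm)
      qed
      then show ?thesis unfolding 1 disc_fraction_def by (auto split: split_indicator)
    qed
    then show ?thesis by (subst integral_divide_zero[symmetric]) simp
  qed
  finally show ?thesis .
qed

subsection \<open>A compactly supported mollifier with a bounded logarithmic charge\<close>

text \<open>The difference of two disc averages of the logarithm vanishes outside the larger disc, so test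
  functions mollified with it are logarithmic potentials of explicit bounded densities.\<close>

definition log_bump :: "real \<Rightarrow> real \<Rightarrow> real" where
  "log_bump \<eta> r = log_avg (2 * \<eta>) r - log_avg \<eta> r"

lemma log_bump_far: "\<eta> > 0 \<Longrightarrow> 2 * \<eta> \<le> r \<Longrightarrow> log_bump \<eta> r = 0"
  by (simp add: log_bump_def log_avg_def)

lemma log_bump_near:
  assumes "\<eta> > 0" "0 \<le> r" "r \<le> \<eta>"
  shows "log_bump \<eta> r \<ge> 1 / 4"
proof -
  have l2: "ln (2 * \<eta>) = ln 2 + ln \<eta>" using assms by (simp add: ln_mult_pos)
  have q: "r\<^sup>2 \<le> \<eta>\<^sup>2" using assms by (intro power_mono) auto
  have "log_bump \<eta> r = ln 2 - 3 * (r\<^sup>2 / \<eta>\<^sup>2) / 8"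
  proof (cases "r = \<eta>")
    case True
    then show ?thesis using assms l2 by (simp add: log_bump_def log_avg_def power_mult_distrib)
  next
    case False
    then show ?thesis using assms l2 by (simp add: log_bump_def log_avg_def power_mult_distrib field_simps)
  qed
  moreover define q where "q = r\<^sup>2 / \<eta>\<^sup>2"
  moreover have "q \<le> 1" using q assms by (simp add: q_def divide_le_eq_1)
  moreover have "2 / 3 \<le> ln (2::real)" by (rule ln2_ge_two_thirds)
  ultimately have "log_bump \<eta> r = ln 2 - 3 * q / 8" "q \<le> 1" "2 / 3 \<le> ln (2::real)" by auto
  then show ?thesis by linarith
qed

lemma log_bump_bounds:
  assumes "\<eta> > 0" "0 \<le> r"
  shows "0 \<le> log_bump \<eta> r" "log_bump \<eta> r \<le> 1"
proof -
  consider "r \<le> \<eta>" | "\<eta> < r" "r < 2 * \<eta>" | "2 * \<eta> \<le> r" by linarith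
  then have "0 \<le> log_bump \<eta> r \<and> log_bump \<eta> r \<le> 1"
  proof cases
    case 1
    have l2: "ln (2 * \<eta>) = ln 2 + ln \<eta>" using assms by (simp add: ln_mult_pos)
    have "log_bump \<eta> r \<le> ln 2"
    proof (cases "r = \<eta>")
      case True
      then show ?thesis using assms l2 by (simp add: log_bump_def log_avg_def power_mult_distrib)
    next
      case False
      have "r\<^sup>2 / (8 * \<eta>\<^sup>2) \<le> r\<^sup>2 / (2 * \<eta>\<^sup>2)" using assms by (intro divide_left_mono) auto
      then show ?thesis using False 1 assms l2 by (simp add: log_bump_def log_avg_def power_mult_distrib)
    qed
    then show ?thesis using log_bump_near[OF assms 1] ln_2_less_1 by linarith
  next
    case 2
    define q where "q = r / (2 * \<eta>)"
    have q: "0 < q" "q < 1" "1 / 2 < q" using 2 assms by (auto simp: q_def field_simps)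
    have r: "r = q * (2 * \<eta>)" using assms by (simp add: q_def)
    have "ln r = ln q + ln (2 * \<eta>)" unfolding r using q assms by (intro ln_mult_pos) auto
    moreover have "r\<^sup>2 / (2 * (2 * \<eta>)\<^sup>2) = q\<^sup>2 / 2" unfolding r power_mult_distrib using assms by simp
    ultimately have e: "log_bump \<eta> r = q\<^sup>2 / 2 - 1 / 2 - ln q"
      using 2 by (simp add: log_bump_def log_avg_def)
    have "(1 - q)\<^sup>2 / 2 \<ge> 0" by simp
    moreover have "ln q \<le> q - 1" using q by (intro ln_le_minus_one)
    moreover have "q\<^sup>2 \<le> 1" using q by (simp add: power_le_one)
    moreover have "ln (1 / 2) \<le> ln q" using q by (subst ln_le_cancel_iff) auto
    ultimately show ?thesis using e ln_2_less_1 by (simp add: power2_eq_square algebra_simps ln_div)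
  next
    case 3 then show ?thesis using log_bump_far[OF assms(1)] by simp
  qed
  then show "0 \<le> log_bump \<eta> r" "log_bump \<eta> r \<le> 1" by auto
qed

lemma log_bump_measurable [measurable]: "log_bump \<eta> \<in> borel_measurable borel"
  unfolding log_bump_def[abs_def] by measurable

definition log_bump_mass :: "real \<Rightarrow> real" where
  "log_bump_mass \<eta> = (LINT w|lborel. log_bump \<eta> (cmod (w :: complex)))"

lemma log_bump_integrable:
  assumes "\<eta> > 0"
  shows "integrable lborel (\<lambda>w :: complex. log_bump \<eta> (cmod w))"
proof (rule Bochner_Integration.integrable_bound)
  show "integrable lborel (indicat_real (ball (0::complex) (2 * \<eta>)))"
    using emeasure_lborel_ball_finite[of "0::complex" "2 * \<eta>"] by (intro integrable_real_indicator) auto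
  show "AE w :: complex in lborel. norm (log_bump \<eta> (cmod w)) \<le> norm (indicat_real (ball 0 (2 * \<eta>)) w)"
    using assms log_bump_bounds[OF assms] log_bump_far[OF assms] by (intro AE_I2) (auto split: split_indicator)
qed measurable

lemma log_bump_mass_ge:
  assumes "\<eta> > 0"
  shows "log_bump_mass \<eta> \<ge> pi * \<eta>\<^sup>2 / 4"
proof -
  have "pi * \<eta>\<^sup>2 / 4 = (LINT w|lborel. 1 / 4 * indicat_real (ball (0::complex) \<eta>) w)"
    using assms by (simp add: measure_disc)
  also have "\<dots> \<le> log_bump_mass \<eta>"
    unfolding log_bump_mass_def
  proof (rule integral_mono)
    show "integrable lborel (\<lambda>w::complex. 1 / 4 * indicat_real (ball 0 \<eta>) w)"
      using emeasure_lborel_ball_finite[of "0::complex" \<eta>] by (intro integrable_mult_right integrable_real_indicator) auto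
    show "1 / 4 * indicat_real (ball 0 \<eta>) w \<le> log_bump \<eta> (cmod w)" for w
      using log_bump_near[OF assms, of "cmod w"] log_bump_bounds[OF assms, of "cmod w"] by (auto split: split_indicator)
  qed (rule log_bump_integrable[OF assms])
  finally show ?thesis .
qed

text \<open>The density of the charge that represents the mollified indicator function of \<open>E\<close>.\<close>

definition bump_density :: "complex set \<Rightarrow> real \<Rightarrow> complex \<Rightarrow> real" where
  "bump_density E \<eta> u = disc_fraction E (2 * \<eta>) u - disc_fraction E \<eta> u"

text \<open>The boundary layer of \<open>E\<close>, where alone mollifying the indicator function has an effect.\<close>

definition layer :: "real \<Rightarrow> complex set \<Rightarrow> complex set" where
  "layer r E = (\<Union>x\<in>E. ball x r) \<inter> (\<Union>y\<in>-E. ball y r)"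

lemma open_layer: "open (layer r E)"
  by (auto simp: layer_def)

lemma layer_measurable [measurable]: "layer r E \<in> sets borel"
  using open_layer by simp

lemma bump_density_abs_le:
  assumes "\<eta> > 0" "E \<in> sets borel"
  shows "\<bar>bump_density E \<eta> u\<bar> \<le> 1"
  using disc_fraction_bounds[OF _ assms(2), of "2 * \<eta>" u] disc_fraction_bounds[OF assms, of u] assms(1)
  by (auto simp: bump_density_def)

lemma bump_density_eq_0:
  assumes \<eta>: "\<eta> > 0" and u: "u \<notin> layer (2 * \<eta>) E"
  shows "bump_density E \<eta> u = 0"
proof -
  have "(\<forall>x\<in>E. 2 * \<eta> \<le> dist x u) \<or> (\<forall>y. y \<notin> E \<longrightarrow> 2 * \<eta> \<le> dist y u)"
    using u by (auto simp: layer_def not_less)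
  then show ?thesis
  proof
    assume "\<forall>x\<in>E. 2 * \<eta> \<le> dist x u"
    then have "E \<inter> ball u (2 * \<eta>) = {}" "E \<inter> ball u \<eta> = {}" using \<eta> by (force simp: dist_commute)+
    then show ?thesis by (simp add: bump_density_def disc_fraction_def)
  next
    assume "\<forall>y. y \<notin> E \<longrightarrow> 2 * \<eta> \<le> dist y u"
    then have "ball u (2 * \<eta>) \<subseteq> E" "ball u \<eta> \<subseteq> E" using \<eta> by (force simp: dist_commute)+
    then have "E \<inter> ball u (2 * \<eta>) = ball u (2 * \<eta>)" "E \<inter> ball u \<eta> = ball u \<eta>" by auto
    then show ?thesis using \<eta> by (simp add: bump_density_def disc_fraction_def measure_disc)
  qed
qed

text \<open>The mollified indicator function, not normalised: its value on \<open>E\<close> is \<open>log_bump_mass \<eta>\<close>.\<close>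

definition smooth_ind :: "complex set \<Rightarrow> real \<Rightarrow> complex \<Rightarrow> real" where
  "smooth_ind E \<eta> l = (LINT w|lborel. indicator (\<Union>x\<in>E. ball x (2 * \<eta>)) w * log_bump \<eta> (cmod (l - w)))"

lemma log_bump_integrable_shift:
  assumes "\<eta> > 0"
  shows "integrable lborel (\<lambda>w :: complex. log_bump \<eta> (cmod (l - w)))"
    and "(LINT w|lborel. log_bump \<eta> (cmod (l - w))) = log_bump_mass \<eta>"
proof -
  have e: "cmod (l - w) = cmod (- l + w)" for w by (metis norm_minus_commute diff_conv_add_uminus add.commute)
  have d: "distr lborel borel (\<lambda>w. - l + w) = (lborel :: complex measure)"
    by (rule lborel_distr_plus)
  have "integrable (distr lborel borel (\<lambda>w. - l + w)) (\<lambda>w :: complex. log_bump \<eta> (cmod w))"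
    unfolding d by (rule log_bump_integrable[OF assms])
  then show "integrable lborel (\<lambda>w :: complex. log_bump \<eta> (cmod (l - w)))"
    unfolding e by (subst (asm) integrable_distr_eq) auto
  have "log_bump_mass \<eta> = (LINT w|distr lborel borel (\<lambda>w. - l + w). log_bump \<eta> (cmod (w :: complex)))"
    by (simp only: d log_bump_mass_def)
  also have "\<dots> = (LINT w|lborel. log_bump \<eta> (cmod (- l + w)))"
    by (rule integral_distr) auto
  finally show "(LINT w|lborel. log_bump \<eta> (cmod (l - w))) = log_bump_mass \<eta>" unfolding e by simp
qed

lemma smooth_ind_bounds:
  assumes \<eta>: "\<eta> > 0"
  shows "0 \<le> smooth_ind E \<eta> l" "smooth_ind E \<eta> l \<le> log_bump_mass \<eta>"
    and "l \<in> E \<Longrightarrow> smooth_ind E \<eta> l = log_bump_mass \<eta>"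
    and "l \<notin> E \<Longrightarrow> l \<notin> layer (4 * \<eta>) E \<Longrightarrow> smooth_ind E \<eta> l = 0"
proof -
  let ?E = "\<Union>x\<in>E. ball x (2 * \<eta>)"
  have oE: "?E \<in> sets borel" by (intro borel_open) auto
  have nn: "0 \<le> log_bump \<eta> (cmod (l - w))" for w using log_bump_bounds[OF \<eta>] by simp
  show "0 \<le> smooth_ind E \<eta> l" unfolding smooth_ind_def using nn
    by (intro integral_nonneg_AE) (auto split: split_indicator)
  show "smooth_ind E \<eta> l \<le> log_bump_mass \<eta>"
    unfolding smooth_ind_def log_bump_integrable_shift(2)[OF \<eta>, of l, symmetric]
  proof (rule integral_mono)
    show "integrable lborel (\<lambda>w. indicator ?E w * log_bump \<eta> (cmod (l - w)))"
      using integrable_real_mult_indicator[OF _ log_bump_integrable_shift(1)[OF \<eta>, of l], of ?E] oE by (simp add: mult.commute)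
    show "indicator ?E w * log_bump \<eta> (cmod (l - w)) \<le> log_bump \<eta> (cmod (l - w))" for w
      using nn[of w] by (auto split: split_indicator)
  qed (rule log_bump_integrable_shift(1)[OF \<eta>])
  show "smooth_ind E \<eta> l = log_bump_mass \<eta>" if "l \<in> E"
  proof -
    have "indicator ?E w * log_bump \<eta> (cmod (l - w)) = log_bump \<eta> (cmod (l - w))" for w
      using that log_bump_far[OF \<eta>, of "cmod (l - w)"] by (cases "2 * \<eta> \<le> cmod (l - w)") (auto split: split_indicator simp: dist_norm)
    then show ?thesis by (simp only: smooth_ind_def log_bump_integrable_shift(2)[OF \<eta>])
  qed
  show "smooth_ind E \<eta> l = 0" if l: "l \<notin> E" "l \<notin> layer (4 * \<eta>) E"
  proof -
    have "indicator ?E w * log_bump \<eta> (cmod (l - w)) = 0" for w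
    proof (cases "w \<in> ?E")
      case True
      then obtain x where x: "x \<in> E" "dist x w < 2 * \<eta>" by auto
      have "\<not> dist x l < 4 * \<eta>"
      proof
        assume "dist x l < 4 * \<eta>"
        then have "l \<in> ball x (4 * \<eta>)" "l \<in> ball l (4 * \<eta>)" using \<eta> by auto
        then have "l \<in> layer (4 * \<eta>) E" unfolding layer_def using l(1) x(1) by blast
        then show False using l(2) by simp
      qed
      then have "2 * \<eta> \<le> dist w l" using x(2) dist_triangle[of x l w] by linarith
      then show ?thesis using log_bump_far[OF \<eta>] by (simp add: dist_norm norm_minus_commute)
    qed simp
    then show ?thesis by (simp only: smooth_ind_def Bochner_Integration.integral_zero)
  qed
qed

lemma log_bump_density_integrable:
  assumes \<eta>: "\<eta> > 0" and E: "E \<in> sets borel" "E \<subseteq> ball 0 r" "r + 2 * \<eta> \<le> 6"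
  shows "integrable lborel (\<lambda>u. ln (cmod (u - l)) * bump_density E \<eta> u)"
    and "\<And>u. u \<notin> ball 0 6 \<Longrightarrow> bump_density E \<eta> u = 0"
    and "integrable lborel (\<lambda>u. ln (cmod (u - l)) * disc_fraction E (2 * \<eta>) u)"
    and "integrable lborel (\<lambda>u. ln (cmod (u - l)) * disc_fraction E \<eta> u)"
proof -
  have z: "disc_fraction E a u = 0" if "u \<notin> ball 0 6" "a \<le> 2 * \<eta>" for a u
  proof -
    have "E \<inter> ball u a = {}"
    proof (rule ccontr)
      assume "E \<inter> ball u a \<noteq> {}"
      then obtain w where "w \<in> E" "dist u w < a" by auto
      then show False using that E norm_triangle_ineq[of w "u - w"] by (auto simp: subset_eq dist_norm)
    qed
    then show ?thesis by (simp add: disc_fraction_def)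
  qed
  show "\<And>u. u \<notin> ball 0 6 \<Longrightarrow> bump_density E \<eta> u = 0" using z \<eta> by (simp add: bump_density_def)
  have i: "integrable lborel (\<lambda>u. ln (cmod (u - l)) * disc_fraction E a u)" if a: "0 < a" "a \<le> 2 * \<eta>" for a
  proof (rule Bochner_Integration.integrable_bound)
    show "integrable lborel (\<lambda>u. indicator (ball 0 6) u *\<^sub>R ln (cmod (u - l)))"
      using set_integrable_ln_norm_diff[of "ball 0 6" l] by (simp add: set_integrable_def)
    have [measurable]: "disc_fraction E a \<in> borel_measurable borel" by (rule disc_fraction_measurable[OF E(1)])
    show "(\<lambda>u. ln (cmod (u - l)) * disc_fraction E a u) \<in> borel_measurable lborel" by measurable
    show "AE u in lborel. norm (ln (cmod (u - l)) * disc_fraction E a u) \<le> norm (indicator (ball 0 6) u *\<^sub>R ln (cmod (u - l)))"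
    proof (rule AE_I2)
      fix u
      show "norm (ln (cmod (u - l)) * disc_fraction E a u) \<le> norm (indicator (ball 0 6) u *\<^sub>R ln (cmod (u - l)))"
        using z[of u a] a disc_fraction_bounds[OF a(1) E(1), of u]
        by (cases "u \<in> ball 0 6") (auto simp: abs_mult mult_left_le)
    qed
  qed
  show 1: "integrable lborel (\<lambda>u. ln (cmod (u - l)) * disc_fraction E (2 * \<eta>) u)"
    and 2: "integrable lborel (\<lambda>u. ln (cmod (u - l)) * disc_fraction E \<eta> u)" using i \<eta> by auto
  show "integrable lborel (\<lambda>u. ln (cmod (u - l)) * bump_density E \<eta> u)"
    unfolding bump_density_def right_diff_distrib using 1 2 by (rule Bochner_Integration.integrable_diff)
qed

lemma smooth_ind_eq_potential:
  assumes \<eta>: "\<eta> > 0" and E: "E \<subseteq> ball 0 r" "r + 4 * \<eta> \<le> 6" and l: "cmod l \<le> 6"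
  defines "E' \<equiv> \<Union>x\<in>E. ball x (2 * \<eta>)"
  shows "smooth_ind E \<eta> l = (LINT u|lborel. ln (cmod (u - l)) * bump_density E' \<eta> u)"
proof -
  have E'[measurable]: "E' \<in> sets borel" unfolding E'_def by (intro borel_open) auto
  have sub: "E' \<subseteq> ball 0 (r + 2 * \<eta>)"
  proof
    fix w assume "w \<in> E'"
    then obtain x where "x \<in> E" "dist x w < 2 * \<eta>" by (auto simp: E'_def)
    then show "w \<in> ball 0 (r + 2 * \<eta>)"
      using E(1) norm_triangle_ineq[of x "w - x"] by (auto simp: subset_eq dist_norm norm_minus_commute)
  qed
  have r6: "r + 2 * \<eta> + 2 * \<eta> \<le> 6" using E(2) by simp
  have finE: "emeasure lborel E' < \<infinity>" using emeasure_bounded_finite[of E'] bounded_subset[OF bounded_ball sub] by auto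
  have int: "integrable lborel (\<lambda>w. indicator E' w * log_avg a (cmod (l - w)))" if a: "a > 0" for a
  proof (rule Bochner_Integration.integrable_bound)
    have bE: "bounded E'" using bounded_subset[OF bounded_ball sub] .
    show "integrable lborel (\<lambda>w. indicator E' w *\<^sub>R ln (cmod (w - l)) * 1 + (\<bar>ln a\<bar> + 1) * indicator E' w *\<^sub>R 1 + 2 * \<bar>indicator E' w *\<^sub>R ln (cmod (w - l))\<bar>)"
      using set_integrable_ln_norm_diff[OF E' bE, of l] finE
      by (intro Bochner_Integration.integrable_add integrable_mult_left integrable_mult_right integrable_abs) (auto simp: set_integrable_def)
    show "AE w in lborel. norm (indicator E' w * log_avg a (cmod (l - w))) \<le> norm (indicator E' w *\<^sub>R ln (cmod (w - l)) * 1 + (\<bar>ln a\<bar> + 1) * indicator E' w *\<^sub>R 1 + 2 * \<bar>indicator E' w *\<^sub>R ln (cmod (w - l))\<bar>)"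
    proof (rule AE_I2)
      fix w
      have "\<bar>log_avg a (cmod (l - w))\<bar> \<le> \<bar>ln (cmod (w - l))\<bar> + (\<bar>ln a\<bar> + 1)"
      proof (cases "a \<le> cmod (l - w)")
        case True then show ?thesis by (simp add: log_avg_def norm_minus_commute)
      next
        case False
        have "(cmod (l - w))\<^sup>2 \<le> a\<^sup>2" using False by (intro power_mono) auto
        then have "(cmod (l - w))\<^sup>2 / (2 * a\<^sup>2) \<le> 1 / 2" using a by (simp add: field_simps)
        moreover have "0 \<le> (cmod (l - w))\<^sup>2 / (2 * a\<^sup>2)" by simp
        ultimately have "\<bar>log_avg a (cmod (l - w))\<bar> \<le> \<bar>ln a\<bar> + 1" using False unfolding log_avg_def by (simp only: if_False)
        then show ?thesis by linarith
      qed
      moreover have "\<bar>x\<bar> + c \<le> x + c + 2 * \<bar>x\<bar>" for x c :: real by linarith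
      ultimately show "norm (indicator E' w * log_avg a (cmod (l - w))) \<le> norm (indicator E' w *\<^sub>R ln (cmod (w - l)) * 1 + (\<bar>ln a\<bar> + 1) * indicator E' w *\<^sub>R 1 + 2 * \<bar>indicator E' w *\<^sub>R ln (cmod (w - l))\<bar>)"
        by (auto split: split_indicator)
    qed
  qed measurable
  have "smooth_ind E \<eta> l = (LINT w|lborel. indicator E' w * log_avg (2 * \<eta>) (cmod (l - w)) - indicator E' w * log_avg \<eta> (cmod (l - w)))"
    by (simp add: smooth_ind_def E'_def log_bump_def right_diff_distrib)
  also have "\<dots> = (LINT w|lborel. indicator E' w * log_avg (2 * \<eta>) (cmod (l - w))) - (LINT w|lborel. indicator E' w * log_avg \<eta> (cmod (l - w)))"
    using int \<eta> by (intro Bochner_Integration.integral_diff) auto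
  also have "\<dots> = (LINT u|lborel. ln (cmod (u - l)) * disc_fraction E' (2 * \<eta>) u) - (LINT u|lborel. ln (cmod (u - l)) * disc_fraction E' \<eta> u)"
    using log_avg_convolution[OF E' sub, of "2 * \<eta>" l] log_avg_convolution[OF E' sub, of "\<eta>" l] r6 \<eta> l by simp
  also have "\<dots> = (LINT u|lborel. ln (cmod (u - l)) * bump_density E' \<eta> u)"
    unfolding bump_density_def right_diff_distrib
    using log_bump_density_integrable(3,4)[OF \<eta> E' sub r6, of l]
    by (intro Bochner_Integration.integral_diff[symmetric]) auto
  finally show ?thesis .
qed

subsection \<open>Discrepancy bound\<close>

definition log_potential :: "complex multiset \<Rightarrow> complex \<Rightarrow> real" where
  "log_potential L u = (\<Sum>l\<in>#L. ln (cmod (u - l)))"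

lemma sum_smooth_ind:
  assumes \<eta>: "\<eta> > 0" and E: "E \<subseteq> ball 0 r" "r + 4 * \<eta> \<le> 6" and L: "\<And>l. l \<in># L \<Longrightarrow> cmod l \<le> 6"
  defines "E' \<equiv> \<Union>x\<in>E. ball x (2 * \<eta>)"
  shows "integrable lborel (\<lambda>u. log_potential L u * bump_density E' \<eta> u)"
    and "(\<Sum>l\<in>#L. smooth_ind E \<eta> l) = (LINT u|lborel. log_potential L u * bump_density E' \<eta> u)"
proof -
  have E': "E' \<in> sets borel" unfolding E'_def by (intro borel_open) auto
  have sub: "E' \<subseteq> ball 0 (r + 2 * \<eta>)"
  proof
    fix w assume "w \<in> E'"
    then obtain x where "x \<in> E" "dist x w < 2 * \<eta>" by (auto simp: E'_def)
    then show "w \<in> ball 0 (r + 2 * \<eta>)"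
      using E(1) norm_triangle_ineq[of x "w - x"] by (auto simp: subset_eq dist_norm norm_minus_commute)
  qed
  have int: "integrable lborel (\<lambda>u. ln (cmod (u - l)) * bump_density E' \<eta> u)" for l
    using E by (intro log_bump_density_integrable(1)[OF \<eta> E' sub]) auto
  have "integrable lborel (\<lambda>u. log_potential L u * bump_density E' \<eta> u) \<and> (\<Sum>l\<in>#L. smooth_ind E \<eta> l) = (LINT u|lborel. log_potential L u * bump_density E' \<eta> u)"
    using L
  proof (induction L)
    case empty then show ?case by (simp add: log_potential_def)
  next
    case (add l L)
    then have IH: "integrable lborel (\<lambda>u. log_potential L u * bump_density E' \<eta> u)"
      "(\<Sum>l\<in>#L. smooth_ind E \<eta> l) = (LINT u|lborel. log_potential L u * bump_density E' \<eta> u)" by auto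
    have e: "log_potential (add_mset l L) u * bump_density E' \<eta> u = ln (cmod (u - l)) * bump_density E' \<eta> u + log_potential L u * bump_density E' \<eta> u" for u
      by (simp add: log_potential_def distrib_right)
    have l: "cmod l \<le> 6" using add.prems by auto
    show ?case unfolding e using int[of l] IH smooth_ind_eq_potential[OF \<eta> E l]
      by (simp add: E'_def)
  qed
  then show "integrable lborel (\<lambda>u. log_potential L u * bump_density E' \<eta> u)"
    "(\<Sum>l\<in>#L. smooth_ind E \<eta> l) = (LINT u|lborel. log_potential L u * bump_density E' \<eta> u)" by auto
qed

text \<open>The counterpart of \<open>sum_smooth_ind\<close> for the uniform measure on the unit disc, whose potential is \<open>log_avg 1\<close>, again by Fubini's theorem.\<close>

lemma disc_smooth_ind:
  assumes \<eta>: "\<eta> > 0" and E: "E \<subseteq> ball 0 r" "r + 4 * \<eta> \<le> 6"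
  defines "E' \<equiv> \<Union>x\<in>E. ball x (2 * \<eta>)"
  shows "integrable lborel (\<lambda>u. log_avg 1 (cmod u) * bump_density E' \<eta> u)"
    and "(LINT l|lborel. indicator (ball 0 1) l * smooth_ind E \<eta> l) = pi * (LINT u|lborel. log_avg 1 (cmod u) * bump_density E' \<eta> u)"
proof -
  have E': "E' \<in> sets borel" unfolding E'_def by (intro borel_open) auto
  have sub: "E' \<subseteq> ball 0 (r + 2 * \<eta>)"
  proof
    fix w assume "w \<in> E'"
    then obtain x where "x \<in> E" "dist x w < 2 * \<eta>" by (auto simp: E'_def)
    then show "w \<in> ball 0 (r + 2 * \<eta>)"
      using E(1) norm_triangle_ineq[of x "w - x"] by (auto simp: subset_eq dist_norm norm_minus_commute)
  qed
  have r6: "r + 2 * \<eta> + 2 * \<eta> \<le> 6" using E(2) by simp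
  let ?g = "bump_density E' \<eta>"
  note gz = log_bump_density_integrable(2)[OF \<eta> E' sub r6]
  note gb = bump_density_abs_le[OF \<eta> E']
  have gm[measurable]: "?g \<in> borel_measurable borel"
    unfolding bump_density_def[abs_def] using disc_fraction_measurable[OF E'] by measurable
  have [measurable]: "ball (0::complex) s \<in> sets borel" for s by simp
  have "(LINT l|lborel. indicator (ball 0 1) l * smooth_ind E \<eta> l)
      = (LINT l|lborel. indicator (ball 0 1) l * (LINT u|lborel. indicator (ball 0 6) u * (?g u * ln (cmod (u - l)))))"
  proof (rule Bochner_Integration.integral_cong[OF refl])
    fix l :: complex
    have "smooth_ind E \<eta> l = (LINT u|lborel. indicator (ball 0 6) u * (?g u * ln (cmod (u - l))))" if "l \<in> ball 0 1"
    proof -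
      have "cmod l \<le> 6" using that by auto
      from smooth_ind_eq_potential[OF \<eta> E this] show ?thesis unfolding E'_def[symmetric]
        by (simp only:) (intro Bochner_Integration.integral_cong refl, auto split: split_indicator simp: gz mult.commute)
    qed
    then show "indicator (ball 0 1) l * smooth_ind E \<eta> l = indicator (ball 0 1) l * (LINT u|lborel. indicator (ball 0 6) u * (?g u * ln (cmod (u - l))))"
      by (auto split: split_indicator)
  qed
  also have "\<dots> = (LINT u|lborel. indicator (ball 0 6) u * (LINT l|lborel. indicator (ball 0 1) l * (?g u * ln (cmod (u - l)))))"
    using gb by (intro Fubini_log_kernel) (auto simp: emeasure_lborel_disc)
  also have "\<dots> = (LINT u|lborel. pi * (log_avg 1 (cmod u) * ?g u))"
  proof (rule integral_cong_AE)
    have "AE u in lborel. u \<noteq> (0::complex)" by (rule AE_lborel_singleton)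
    then show "AE u in lborel. indicator (ball 0 6) u * (LINT l|lborel. indicator (ball 0 1) l * (?g u * ln (cmod (u - l)))) = pi * (log_avg 1 (cmod u) * ?g u)"
    proof eventually_elim
      case (elim u)
      have "(LINT l|lborel. indicator (ball 0 1) l * (?g u * ln (cmod (u - l)))) = ?g u * (LINT l|lborel. indicator (ball 0 1) l * ln (cmod (l - u)))"
        by (subst integral_mult_right_zero[symmetric]) (simp add: mult_ac norm_minus_commute)
      also have "\<dots> = ?g u * (pi * log_avg 1 (cmod u))"
        using disc_average_ln[of 1 u] elim by (simp add: set_lebesgue_integral_def)
      finally show ?case using gz[of u] by (auto split: split_indicator)
    qed
  qed measurable
  finally show "(LINT l|lborel. indicator (ball 0 1) l * smooth_ind E \<eta> l) = pi * (LINT u|lborel. log_avg 1 (cmod u) * ?g u)" by simp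
  show "integrable lborel (\<lambda>u. log_avg 1 (cmod u) * ?g u)"
  proof (rule Bochner_Integration.integrable_bound)
    show "integrable lborel (\<lambda>u. 6 * indicat_real (ball (0::complex) 6) u)"
      using emeasure_lborel_ball_finite[of "0::complex" 6] by (intro integrable_mult_right integrable_real_indicator) auto
    show "AE u in lborel. norm (log_avg 1 (cmod u) * ?g u) \<le> norm (6 * indicat_real (ball (0::complex) 6) u)"
    proof (rule AE_I2)
      fix u :: complex
      have "\<bar>log_avg 1 (cmod u)\<bar> \<le> 6" if "u \<in> ball 0 6"
      proof (cases "1 \<le> cmod u")
        case True
        then have "cmod u > 0" by linarith
        then show ?thesis using True that ln_le_minus_one[of "cmod u"] by (simp add: log_avg_def)
      next
        case False
        then have "(cmod u)\<^sup>2 \<le> 1" by (simp add: power_le_one)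
        then show ?thesis using False by (simp add: log_avg_def, insert zero_le_power2[of "cmod u"], linarith)
      qed
      then show "norm (log_avg 1 (cmod u) * ?g u) \<le> norm (6 * indicat_real (ball (0::complex) 6) u)"
        using gb[of u] gz[of u] mult_mono[of "\<bar>log_avg 1 (cmod u)\<bar>" 6 "\<bar>?g u\<bar>" 1] by (auto split: split_indicator simp: abs_mult)
    qed
  qed measurable
qed

text \<open>Compare the numbers of eigenvalues and the area through the mollified indicator. The error is the
  defect of the potential, integrated over the boundary layer where the charge density lives.\<close>

theorem count_le_area:
  fixes L :: "complex multiset"
  assumes \<eta>: "\<eta> > 0" and E: "E \<in> sets borel" "E \<subseteq> ball 0 r" "r + 4 * \<eta> \<le> 6" and L: "\<And>l. l \<in># L \<Longrightarrow> cmod l \<le> 6"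
    and \<xi>: "(\<integral>\<^sup>+u. ennreal \<bar>log_potential L u - real n * log_avg 1 (cmod u)\<bar> * indicator (layer (4 * \<eta>) E) u \<partial>lborel) \<le> ennreal B"
    and B: "B \<ge> 0"
  shows "real (size (filter_mset (\<lambda>l. l \<in> E) L))
    \<le> real n * (measure lborel (ball 0 1 \<inter> E) / pi + measure lborel (layer (4 * \<eta>) E) / pi) + 4 * B / (pi * \<eta>\<^sup>2)"
proof -
  let ?E' = "\<Union>x\<in>E. ball x (2 * \<eta>)" and ?m = "log_bump_mass \<eta>"
  let ?g = "bump_density ?E' \<eta>"
  have E': "?E' \<in> sets borel" by (intro borel_open) auto
  have mpos: "?m > 0" using log_bump_mass_ge[OF \<eta>] \<eta> by (smt (verit) divide_pos_pos mult_pos_pos pi_gt_zero zero_less_power)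
  note sb = smooth_ind_bounds[OF \<eta>]
  have "?m * real (size (filter_mset (\<lambda>l. l \<in> E) L)) = (\<Sum>l\<in>#filter_mset (\<lambda>l. l \<in> E) L. smooth_ind E \<eta> l)"
  proof -
    have "(\<Sum>l\<in>#filter_mset (\<lambda>l. l \<in> E) L. smooth_ind E \<eta> l) = (\<Sum>l\<in>#filter_mset (\<lambda>l. l \<in> E) L. ?m)"
      by (intro arg_cong[where f=sum_mset] image_mset_cong) (auto simp: sb(3))
    then show ?thesis by simp
  qed
  also have "\<dots> \<le> (\<Sum>l\<in>#L. smooth_ind E \<eta> l)"
    by (induction L) (auto intro: add_mono simp: sb(1) add_increasing)
  also have "\<dots> = (LINT u|lborel. log_potential L u * ?g u)"
    by (rule sum_smooth_ind(2)[OF \<eta> E(2,3) L])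
  also have "\<dots> = real n * (LINT u|lborel. log_avg 1 (cmod u) * ?g u) + (LINT u|lborel. (log_potential L u - real n * log_avg 1 (cmod u)) * ?g u)"
  proof -
    have "(LINT u|lborel. (log_potential L u - real n * log_avg 1 (cmod u)) * ?g u) = (LINT u|lborel. log_potential L u * ?g u - real n * (log_avg 1 (cmod u) * ?g u))"
      by (intro Bochner_Integration.integral_cong) (auto simp: algebra_simps)
    also have "\<dots> = (LINT u|lborel. log_potential L u * ?g u) - real n * (LINT u|lborel. log_avg 1 (cmod u) * ?g u)"
      using sum_smooth_ind(1)[OF \<eta> E(2,3) L] disc_smooth_ind(1)[OF \<eta> E(2,3)]
      by (subst Bochner_Integration.integral_diff) auto
    finally show ?thesis by simp
  qed
  also have "(LINT u|lborel. log_avg 1 (cmod u) * ?g u) = (LINT l|lborel. indicator (ball 0 1) l * smooth_ind E \<eta> l) / pi"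
    by (simp add: disc_smooth_ind(2)[OF \<eta> E(2,3)])
  also have "(LINT l|lborel. indicator (ball 0 1) l * smooth_ind E \<eta> l) \<le> ?m * (measure lborel (ball 0 1 \<inter> E) + measure lborel (layer (4 * \<eta>) E))"
  proof -
    have bl: "bounded (layer (4 * \<eta>) E)"
    proof -
      have "layer (4 * \<eta>) E \<subseteq> ball 0 (r + 4 * \<eta>)"
      proof
        fix w assume "w \<in> layer (4 * \<eta>) E"
        then obtain x where "x \<in> E" "dist x w < 4 * \<eta>" by (auto simp: layer_def)
        then show "w \<in> ball 0 (r + 4 * \<eta>)"
          using E(2) norm_triangle_ineq[of x "w - x"] by (auto simp: subset_eq dist_norm norm_minus_commute)
      qed
      then show ?thesis by (rule bounded_subset[OF bounded_ball])
    qed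
    have f: "integrable lborel (indicat_real (ball (0::complex) 1 \<inter> E))" "integrable lborel (indicat_real (layer (4 * \<eta>) E))"
      using emeasure_bounded_finite[OF bounded_subset[OF bounded_ball Int_lower1[of "ball (0::complex) 1" E]]] emeasure_bounded_finite[OF bl] E(1)
      by (auto intro!: integrable_real_indicator)
    have "(LINT l|lborel. indicator (ball 0 1) l * smooth_ind E \<eta> l) \<le> (LINT l|lborel. ?m * (indicat_real (ball 0 1 \<inter> E) l + indicat_real (layer (4 * \<eta>) E) l))"
    proof (rule integral_mono')
      show "integrable lborel (\<lambda>l. ?m * (indicat_real (ball 0 1 \<inter> E) l + indicat_real (layer (4 * \<eta>) E) l))"
        using f by (intro integrable_mult_right Bochner_Integration.integrable_add)
      fix l
      show "indicator (ball 0 1) l * smooth_ind E \<eta> l \<le> ?m * (indicat_real (ball 0 1 \<inter> E) l + indicat_real (layer (4 * \<eta>) E) l)"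
        using sb[where E=E and l=l] mpos by (auto split: split_indicator)
      show "0 \<le> ?m * (indicat_real (ball 0 1 \<inter> E) l + indicat_real (layer (4 * \<eta>) E) l)"
        using mpos by simp
    qed
    also have "\<dots> = ?m * (measure lborel (ball 0 1 \<inter> E) + measure lborel (layer (4 * \<eta>) E))"
      using f E(1) by (simp add: Bochner_Integration.integral_add)
    finally show ?thesis .
  qed
  also have "(LINT u|lborel. (log_potential L u - real n * log_avg 1 (cmod u)) * ?g u) \<le> B"
  proof -
    have "\<bar>LINT u|lborel. (log_potential L u - real n * log_avg 1 (cmod u)) * ?g u\<bar> \<le> (LINT u|lborel. \<bar>(log_potential L u - real n * log_avg 1 (cmod u)) * ?g u\<bar>)"
      by (rule integral_abs_bound)
    also have "\<dots> \<le> B"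
    proof (rule integral_real_bounded[OF B])
      have "(\<integral>\<^sup>+u. ennreal \<bar>(log_potential L u - real n * log_avg 1 (cmod u)) * ?g u\<bar> \<partial>lborel)
        \<le> (\<integral>\<^sup>+u. ennreal \<bar>log_potential L u - real n * log_avg 1 (cmod u)\<bar> * indicator (layer (4 * \<eta>) E) u \<partial>lborel)"
      proof (rule nn_integral_mono)
        fix u
        have "?g u = 0" if "u \<notin> layer (4 * \<eta>) E"
        proof (rule bump_density_eq_0[OF \<eta>], rule notI)
          assume "u \<in> layer (2 * \<eta>) ?E'"
          then obtain x w y where x: "x \<in> E" "dist x w < 2 * \<eta>" "dist w u < 2 * \<eta>" and y: "y \<notin> ?E'" "dist y u < 2 * \<eta>"
            by (auto simp: layer_def)
          have "dist x u < 4 * \<eta>" using x dist_triangle[of x u w] by linarith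
          moreover have "y \<notin> E" using y(1) \<eta> by (auto intro: bexI[of _ y])
          moreover have "dist y u < 4 * \<eta>" using y \<eta> by linarith
          ultimately have "u \<in> layer (4 * \<eta>) E" using x(1) by (auto simp: layer_def)
          then show False using that by simp
        qed
        then show "ennreal \<bar>(log_potential L u - real n * log_avg 1 (cmod u)) * ?g u\<bar> \<le> ennreal \<bar>log_potential L u - real n * log_avg 1 (cmod u)\<bar> * indicator (layer (4 * \<eta>) E) u"
          using bump_density_abs_le[OF \<eta> E', of u]
          by (auto split: split_indicator simp: abs_mult intro!: ennreal_leI mult_left_le)
      qed
      then show "(\<integral>\<^sup>+u. ennreal \<bar>(log_potential L u - real n * log_avg 1 (cmod u)) * ?g u\<bar> \<partial>lborel) \<le> ennreal B"
        using \<xi> by (rule order_trans)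
    qed
    finally show ?thesis by linarith
  qed
  finally have "?m * real (size (filter_mset (\<lambda>l. l \<in> E) L)) \<le> real n * (?m * (measure lborel (ball 0 1 \<inter> E) + measure lborel (layer (4 * \<eta>) E)) / pi) + B"
    by (simp add: divide_right_mono mult_left_mono)
  then have "real (size (filter_mset (\<lambda>l. l \<in> E) L)) \<le> (real n * (?m * (measure lborel (ball 0 1 \<inter> E) + measure lborel (layer (4 * \<eta>) E)) / pi) + B) / ?m"
    using mpos by (simp add: pos_le_divide_eq mult.commute)
  also have "\<dots> = real n * (measure lborel (ball 0 1 \<inter> E) / pi + measure lborel (layer (4 * \<eta>) E) / pi) + B / ?m"
    using mpos by (simp add: add_divide_distrib distrib_left)
  also have "B / ?m \<le> B / (pi * \<eta>\<^sup>2 / 4)"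
    using log_bump_mass_ge[OF \<eta>] \<eta> B mpos by (intro divide_left_mono) auto
  finally show ?thesis by (simp add: mult.commute)
qed

lemma char_sq_eigenvalues:
  assumes A: "A \<in> carrier_mat n n" and n: "n \<ge> 1"
  shows "char_sq n (entries n A) u = (\<Prod>l\<in>#eigenvalues_mset (of_real (1 / sqrt n) \<cdot>\<^sub>m A). cmod (u - l))\<^sup>2"
proof -
  let ?B = "of_real (1 / sqrt n) \<cdot>\<^sub>m A" and ?s = "complex_of_real (sqrt n)"
  have B: "?B \<in> carrier_mat n n" using A by simp
  have s: "?s * of_real (1 / sqrt n) = 1" using n by (simp flip: of_real_mult)
  let ?M = "mat n n (\<lambda>(i, j). (if i = j then ?s * u else 0) - entries n A (i, j))"
  have "?M = ?s \<cdot>\<^sub>m (- (char_matrix ?B u))"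
  proof (rule eq_matI)
    fix i j assume "i < dim_row (?s \<cdot>\<^sub>m (- (char_matrix ?B u)))" "j < dim_col (?s \<cdot>\<^sub>m (- (char_matrix ?B u)))"
    then have ij: "i < n" "j < n" using A by (auto simp: char_matrix_def)
    have "?s * (of_real (1 / sqrt n) * A $$ (i, j)) = A $$ (i, j)" using s by (metis mult.assoc mult.left_neutral)
    then show "?M $$ (i, j) = (?s \<cdot>\<^sub>m (- (char_matrix ?B u))) $$ (i, j)"
      using ij A by (auto simp: char_matrix_def entries_def algebra_simps)
  qed (use A in \<open>auto simp: char_matrix_def\<close>)
  moreover have "dim_col (- (char_matrix ?B u)) = n" using A by (simp add: char_matrix_def)
  ultimately have "det ?M = ?s ^ n * poly (char_poly ?B) u"
    by (simp only: char_poly_matrix[OF B] det_smult)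
  then have "(cmod (det ?M))\<^sup>2 = real n ^ n * (cmod (poly (char_poly ?B) u))\<^sup>2"
    by (simp add: norm_mult norm_power power_mult_distrib power_mult[symmetric] mult.commute[of _ 2]) (simp add: power_mult)
  then have 1: "char_sq n (entries n A) u = (cmod (poly (char_poly ?B) u))\<^sup>2"
    using n unfolding char_sq_def gdet_shifted_eq_det by simp
  have "char_poly ?B = (\<Prod>l\<in>#eigenvalues_mset ?B. [:- l, 1:])"
    using complex_poly_decompose_multiset[of "char_poly ?B"] degree_monic_char_poly[OF B]
    by (simp add: eigenvalues_mset_def)
  then have "poly (char_poly ?B) u = (\<Prod>l\<in>#eigenvalues_mset ?B. u - l)"
    by (simp add: poly_prod_mset image_mset.compositionality comp_def)
  moreover have "cmod (\<Prod>l\<in>#L. u - l) = (\<Prod>l\<in>#L. cmod (u - l))" for L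
    by (induction L) (auto simp: norm_mult)
  ultimately show ?thesis using 1 by simp
qed

text \<open>A bound on the exponential moment of the defect of the potential is a bound on its integral over
  every region, by \<open>x \<le> T + exp (x - T)\<close>. Since it holds for all regions at once, they may be chosen after the matrix.\<close>

lemma nn_integral_potential_le:
  fixes L :: "complex multiset"
  assumes L: "\<And>u. char_sq n g u = (\<Prod>l\<in>#L. cmod (u - l))\<^sup>2"
    and Y: "potential_defect n g \<le> ennreal Y" "Y \<ge> 0" and Z: "Z \<in> sets borel" "Z \<subseteq> ball 0 6" and T: "T \<ge> 0"
  shows "(\<integral>\<^sup>+u. ennreal \<bar>log_potential L u - real n * log_avg 1 (cmod u)\<bar> * indicator Z u \<partial>lborel)
    \<le> ennreal (T * measure lborel Z + exp (- T) * (36 * pi + Y))"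
proof -
  let ?\<xi> = "\<lambda>u. log_potential L u - real n * log_avg 1 (cmod u)"
  let ?q = "\<lambda>u. ennreal (exp (- 2 * real n * log_avg 1 (cmod u))) * ennreal (char_sq n g u)
     + ennreal (exp (real n * log_avg 1 (cmod u))) * inverse (ennreal (sqrt (char_sq n g u)))"
  have [measurable]: "ball (0::complex) 6 \<in> sets borel" "Z \<in> sets borel" using Z by auto
  have lp[measurable]: "log_potential K \<in> borel_measurable borel" for K
  proof (induction K)
    case (add l K)
    have "log_potential (add_mset l K) = (\<lambda>u. ln (cmod (u - l)) + log_potential K u)" by (auto simp: log_potential_def)
    then show ?case using add by simp
  qed (simp add: log_potential_def[abs_def])
  have prod_pos: "(\<Prod>l\<in>#K. cmod (u - l)) = exp (log_potential K u)" if "u \<notin># K" for K u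
    using that by (induction K) (auto simp: log_potential_def exp_add)
  have [measurable]: "(\<lambda>u. char_sq n g u) \<in> borel_measurable borel"
  proof -
    have [measurable]: "(\<lambda>u :: complex. \<Prod>l\<in>#K. cmod (u - l)) \<in> borel_measurable borel" for K
      by (induction K) auto
    show ?thesis unfolding L by measurable
  qed
  have fin: "finite (set_mset L)" by simp
  have "AE u in lborel. u \<notin> set_mset L"
    using countable_imp_null_set_lborel[OF countable_finite[OF fin]] by (rule AE_not_in)
  then have "AE u in lborel. ennreal \<bar>?\<xi> u\<bar> * indicator Z u
      \<le> ennreal T * indicator Z u + ennreal (exp (- T)) * (indicator (ball 0 6) u + ?q u * indicator (ball 0 6) u)"
  proof eventually_elim
    case (elim u)
    show ?case
    proof (cases "u \<in> Z")
      case True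
      then have u6: "u \<in> ball 0 6" using Z by auto
      define x v where "x = ?\<xi> u" and "v = real n * log_avg 1 (cmod u)"
      have pot: "log_potential L u = x + v" by (simp add: x_def v_def)
      have c: "char_sq n g u = (exp (x + v))\<^sup>2" using L prod_pos[of u L] elim pot by simp
      have q: "?q u = ennreal (exp (2 * x) + exp (- x))"
      proof -
        have "ennreal (exp (- 2 * real n * log_avg 1 (cmod u))) * ennreal (char_sq n g u) = ennreal (exp (2 * x))"
          unfolding c by (simp add: ennreal_mult'[symmetric] v_def[symmetric] exp_double[symmetric] exp_add[symmetric] mult.assoc algebra_simps)
        moreover have "ennreal (exp (real n * log_avg 1 (cmod u))) * inverse (ennreal (sqrt (char_sq n g u))) = ennreal (exp (- x))"
          unfolding c by (simp add: inverse_ennreal ennreal_mult'[symmetric] v_def[symmetric] exp_minus[symmetric] exp_add[symmetric])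
        ultimately show ?thesis by (simp add: ennreal_plus)
      qed
      have "\<bar>x\<bar> - T + 1 \<le> exp (\<bar>x\<bar> - T)" using exp_ge_add_one_self[of "\<bar>x\<bar> - T"] by linarith
      also have "\<dots> = exp (- T) * exp \<bar>x\<bar>" by (simp add: exp_diff exp_minus field_simps)
      also have "exp \<bar>x\<bar> \<le> 1 + (exp (2 * x) + exp (- x))"
      proof (cases "x \<ge> 0")
        case True
        then have "exp x \<le> exp (2 * x)" by simp
        then show ?thesis using True exp_gt_zero[of "- x"] by linarith
      next
        case False
        then show ?thesis using exp_gt_zero[of "2 * x"] by (simp add: abs_if)
      qed
      finally have "\<bar>x\<bar> \<le> T + exp (- T) * (1 + (exp (2 * x) + exp (- x)))" by (simp add: mult_left_mono)
      then have "ennreal \<bar>x\<bar> \<le> ennreal (T + exp (- T) * (1 + (exp (2 * x) + exp (- x))))" by (rule ennreal_leI)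
      also have "\<dots> = ennreal T + ennreal (exp (- T)) * (1 + ennreal (exp (2 * x) + exp (- x)))"
        using T by (simp add: ennreal_plus ennreal_mult add_nonneg_nonneg)
      finally show ?thesis using True u6 q by (simp add: x_def)
    qed simp
  qed
  then have "(\<integral>\<^sup>+u. ennreal \<bar>?\<xi> u\<bar> * indicator Z u \<partial>lborel)
      \<le> (\<integral>\<^sup>+u. ennreal T * indicator Z u + ennreal (exp (- T)) * (indicator (ball 0 6) u + ?q u * indicator (ball 0 6) u) \<partial>lborel)"
    by (rule nn_integral_mono_AE)
  also have "\<dots> = ennreal T * emeasure lborel Z + ennreal (exp (- T)) * (emeasure lborel (ball (0::complex) 6) + potential_defect n g)"
    unfolding potential_defect_def
    by (subst nn_integral_add; (subst nn_integral_cmult)?; (subst nn_integral_add)?) (auto simp: nn_integral_cmult_indicator)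
  also have "\<dots> \<le> ennreal T * ennreal (measure lborel Z) + ennreal (exp (- T)) * (ennreal (36 * pi) + ennreal Y)"
  proof (intro add_mono mult_left_mono Y(1))
    have "emeasure lborel Z < \<infinity>" using emeasure_bounded_finite[OF bounded_subset[OF bounded_ball Z(2)]] .
    then show "emeasure lborel Z \<le> ennreal (measure lborel Z)" by (subst emeasure_eq_ennreal_measure) auto
  qed (auto simp: emeasure_lborel_disc mult.commute)
  also have "\<dots> = ennreal (T * measure lborel Z + exp (- T) * (36 * pi + Y))"
    using T Y(2) by (simp only: ennreal_mult[symmetric] ennreal_plus[symmetric] measure_nonneg exp_ge_zero pi_ge_zero mult_nonneg_nonneg zero_le_numeral add_nonneg_nonneg)
  finally show ?thesis .
qed

section \<open>Polar cells of equal area\<close>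

lemma Arg2pi_measurable [measurable]: "Arg2pi \<in> borel_measurable borel"
  unfolding borel_measurable_iff_greater using open_Arg2pi2pi_gt by (auto intro!: borel_open)

text \<open>A disc of radius \<open>r\<close>, with a sector of the surrounding annulus attached. The unions of initial
  segments of the cells below have this form.\<close>

definition spiral_region :: "real \<Rightarrow> real \<Rightarrow> real \<Rightarrow> complex set" where
  "spiral_region r r' \<theta> = {w. cmod w < r} \<union> {w. r \<le> cmod w \<and> cmod w < r' \<and> Arg2pi w < \<theta>}"

lemma spiral_region_measurable [measurable]: "spiral_region r r' \<theta> \<in> sets borel"
  unfolding spiral_region_def by measurable

lemma Im_rotate: "Im (w * cis (- \<theta>)) = cmod w * sin (Arg2pi w - \<theta>)"
proof -
  have "w = of_real (cmod w) * cis (Arg2pi w)" using Arg2pi_eq[of w] by (simp add: cis_conv_exp)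
  then have "w * cis (- \<theta>) = of_real (cmod w) * cis (Arg2pi w - \<theta>)" by (metis cis_mult mult.assoc diff_conv_add_uminus)
  then show ?thesis by simp
qed

text \<open>The angular condition is decided by the two signs of \<open>Im w\<close> and \<open>Im (w cis (- \<theta>))\<close>, so it can
  only change across the two rays.\<close>

lemma Arg2pi_less_cong:
  assumes \<theta>: "0 \<le> \<theta>" "\<theta> < 2 * pi" and s: "Im x * Im y > 0" "Im (x * cis (- \<theta>)) * Im (y * cis (- \<theta>)) > 0"
  shows "Arg2pi x < \<theta> \<longleftrightarrow> Arg2pi y < \<theta>"
proof -
  have r: "0 \<le> Arg2pi z" "Arg2pi z < 2 * pi" for z using Arg2pi_ge_0 Arg2pi_lt_2pi by auto
  have pos: "cmod x > 0" "cmod y > 0" using s by (auto simp: zero_less_mult_iff)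
  have s1: "sin (Arg2pi x) * sin (Arg2pi y) > 0"
  proof -
    have "Im x * Im y = (cmod x * cmod y) * (sin (Arg2pi x) * sin (Arg2pi y))"
      by (simp add: sin_Arg2pi[symmetric] mult_ac)
    then show ?thesis using s(1) pos by (metis mult_pos_pos zero_less_mult_pos)
  qed
  have s2: "sin (Arg2pi x - \<theta>) * sin (Arg2pi y - \<theta>) > 0"
  proof -
    have "Im (x * cis (- \<theta>)) * Im (y * cis (- \<theta>)) = (cmod x * cmod y) * (sin (Arg2pi x - \<theta>) * sin (Arg2pi y - \<theta>))"
      unfolding Im_rotate by (simp add: mult_ac)
    then show ?thesis using s(2) pos by (metis mult_pos_pos zero_less_mult_pos)
  qed
  have half: "sin t > 0 \<longleftrightarrow> 0 < t \<and> t < pi" "sin t < 0 \<longleftrightarrow> pi < t" if "0 \<le> t" "t < 2 * pi" for t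
    using that sin_gt_zero[of t] sin_lt_zero[of t] sin_ge_zero[of t] sin_le_zero[of t]
    by (smt (verit) sin_pi sin_zero)+
  have *: False if a: "0 \<le> a" "a < \<theta>" and b: "\<theta> \<le> b" "b < 2 * pi" and ab: "sin a * sin b > 0" "sin (a - \<theta>) * sin (b - \<theta>) > 0" for a b
  proof -
    have bneg: "b - \<theta> < pi \<or> b - \<theta> > pi \<or> b - \<theta> = pi" by linarith
    have "sin (b - \<theta>) \<noteq> 0" "sin (a - \<theta>) \<noteq> 0" using ab(2) by auto
    have b1: "sin (b - \<theta>) > 0 \<longleftrightarrow> b - \<theta> < pi" using half(1)[of "b - \<theta>"] \<open>sin (b - \<theta>) \<noteq> 0\<close> b \<theta> by (smt (verit) sin_zero)
    have a1: "sin (a - \<theta>) > 0 \<longleftrightarrow> \<theta> - a > pi"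
      using half(2)[of "\<theta> - a"] a \<theta> sin_minus[of "\<theta> - a"] by (simp add: algebra_simps)
    have ha: "sin a > 0 \<longleftrightarrow> 0 < a \<and> a < pi" "sin a < 0 \<longleftrightarrow> pi < a" using half[of a] a \<theta> by auto
    have hb: "sin b > 0 \<longleftrightarrow> 0 < b \<and> b < pi" "sin b < 0 \<longleftrightarrow> pi < b" using half[of b] b \<theta> by auto
    consider "sin a > 0" "sin b > 0" | "sin a < 0" "sin b < 0" using ab(1) by (auto simp: zero_less_mult_iff)
    then show False
    proof cases
      case 1
      then have "b < pi" "a > 0" using ha hb by auto
      then have "b - \<theta> < pi" using \<theta> by linarith
      then have "sin (b - \<theta>) > 0" using b1 by simp
      then have "\<theta> - a > pi" using a1 ab(2) by (simp add: zero_less_mult_iff)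
      then show False using \<open>b < pi\<close> \<open>a > 0\<close> b by linarith
    next
      case 2
      then have "a > pi" using ha by auto
      then have "\<not> \<theta> - a > pi" using \<theta> by linarith
      then have "\<not> sin (a - \<theta>) > 0" using a1 by simp
      then have "\<not> sin (b - \<theta>) > 0" using ab(2) by (auto simp: zero_less_mult_iff)
      then have "b - \<theta> \<ge> pi" using b1 by linarith
      then show False using \<open>a > pi\<close> a b by linarith
    qed
  qed
  show ?thesis using *[of "Arg2pi x" "Arg2pi y"] *[of "Arg2pi y" "Arg2pi x"] r[of x] r[of y] s1 s2
    by (smt (verit) mult.commute)
qed

lemma same_sign_near:
  assumes "\<bar>a - u\<bar> < s" "\<bar>b - u\<bar> < s" "\<bar>u\<bar> > s" shows "a * b > (0::real)"
  using assms by (smt (verit) mult_pos_pos mult_neg_neg)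

text \<open>The boundary consists of arcs of two circles and pieces of two rays, and a boundary layer is within the
  same distance of one of the circles or of one of the lines that contain the rays.\<close>

lemma layer_spiral_region:
  assumes r: "0 \<le> r" "r \<le> r'" "r' \<le> 2" and \<theta>: "0 \<le> \<theta>" "\<theta> < 2 * pi" and s: "0 < s" "s \<le> 1"
  shows "layer s (spiral_region r r' \<theta>) \<subseteq> {w. \<bar>cmod w - r\<bar> \<le> s} \<union> {w. \<bar>cmod w - r'\<bar> \<le> s}
    \<union> {w. cmod w \<le> 3 \<and> \<bar>Im w\<bar> \<le> s} \<union> {w. cmod w \<le> 3 \<and> \<bar>Im (w * cis (- \<theta>))\<bar> \<le> s}"
proof
  fix u assume "u \<in> layer s (spiral_region r r' \<theta>)"
  then obtain x y where x: "x \<in> spiral_region r r' \<theta>" "dist x u < s" and y: "y \<notin> spiral_region r r' \<theta>" "dist y u < s"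
    by (auto simp: layer_def)
  have nx: "\<bar>cmod x - cmod u\<bar> < s" "\<bar>cmod y - cmod u\<bar> < s"
    using x(2) y(2) norm_triangle_ineq3[of x u] norm_triangle_ineq3[of y u] by (auto simp: dist_norm)
  show "u \<in> {w. \<bar>cmod w - r\<bar> \<le> s} \<union> {w. \<bar>cmod w - r'\<bar> \<le> s}
    \<union> {w. cmod w \<le> 3 \<and> \<bar>Im w\<bar> \<le> s} \<union> {w. cmod w \<le> 3 \<and> \<bar>Im (w * cis (- \<theta>))\<bar> \<le> s}"
  proof (rule ccontr)
    assume "\<not> ?thesis"
    then have n: "\<bar>cmod u - r\<bar> > s" "\<bar>cmod u - r'\<bar> > s" "cmod u \<le> 3 \<Longrightarrow> \<bar>Im u\<bar> > s" "cmod u \<le> 3 \<Longrightarrow> \<bar>Im (u * cis (- \<theta>))\<bar> > s" by auto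
    have "cmod x < r'" using x(1) r by (auto simp: spiral_region_def)
    then have ur': "cmod u + s < r'" using nx n(2) by linarith
    then have u3: "cmod u \<le> 3" using r s by linarith
    have "r \<le> cmod y" using y(1) by (auto simp: spiral_region_def not_less)
    then have ur: "cmod u > r + s" using nx n(1) by linarith
    have xr: "r \<le> cmod x" "r \<le> cmod y" "cmod y < r'" using ur ur' nx by linarith+
    have im: "\<bar>Im x - Im u\<bar> < s" "\<bar>Im y - Im u\<bar> < s"
      using x(2) y(2) abs_Im_le_cmod[of "x - u"] abs_Im_le_cmod[of "y - u"] by (auto simp: dist_norm)
    have e: "cmod (z * cis (- \<theta>) - u * cis (- \<theta>)) = cmod (z - u)" for z
      by (simp add: left_diff_distrib[symmetric] norm_mult)
    have im2: "\<bar>Im (x * cis (- \<theta>)) - Im (u * cis (- \<theta>))\<bar> < s" "\<bar>Im (y * cis (- \<theta>)) - Im (u * cis (- \<theta>))\<bar> < s"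
      using x(2) y(2) abs_Im_le_cmod[of "x * cis (- \<theta>) - u * cis (- \<theta>)"] abs_Im_le_cmod[of "y * cis (- \<theta>) - u * cis (- \<theta>)"]
      unfolding e by (simp_all only: dist_norm minus_complex.sel)
    have "Arg2pi x < \<theta> \<longleftrightarrow> Arg2pi y < \<theta>"
      using \<theta> same_sign_near[OF im n(3)[OF u3]] same_sign_near[OF im2 n(4)[OF u3]] by (rule Arg2pi_less_cong)
    then show False using x(1) y(1) xr by (auto simp: spiral_region_def)
  qed
qed

lemma measure_annulus_le:
  assumes r: "0 \<le> r" "r \<le> 5" and s: "0 < s" "s \<le> 1"
  shows "measure lborel {w::complex. \<bar>cmod w - r\<bar> \<le> s} \<le> 20 * pi * s"
proof (cases "s \<le> r")
  case True
  have "{w::complex. \<bar>cmod w - r\<bar> \<le> s} = cball 0 (r + s) - ball 0 (r - s)" using True by auto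
  then have "emeasure lborel {w::complex. \<bar>cmod w - r\<bar> \<le> s} = ennreal (pi * (r + s)\<^sup>2) - ennreal (pi * (r - s)\<^sup>2)"
    using True s by (simp add: emeasure_Diff emeasure_lborel_disc subset_eq)
  also have "\<dots> = ennreal (pi * (r + s)\<^sup>2 - pi * (r - s)\<^sup>2)" by (rule ennreal_minus) simp
  also have "pi * (r + s)\<^sup>2 - pi * (r - s)\<^sup>2 = 4 * pi * r * s" by (simp add: power2_eq_square algebra_simps)
  finally have "measure lborel {w::complex. \<bar>cmod w - r\<bar> \<le> s} = 4 * pi * r * s" using r s by (simp add: measure_def)
  also have "\<dots> \<le> 4 * pi * 5 * s" using r s by (intro mult_right_mono mult_left_mono) auto
  finally show ?thesis by simp
next
  case False
  have "{w::complex. \<bar>cmod w - r\<bar> \<le> s} \<subseteq> cball 0 (2 * s)" using False by auto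
  then have "measure lborel {w::complex. \<bar>cmod w - r\<bar> \<le> s} \<le> measure lborel (cball (0::complex) (2 * s))"
    using emeasure_lborel_cball_finite[of "0::complex" "2 * s"] by (intro measure_mono_fmeasurable) (auto simp: fmeasurable_def)
  also have "\<dots> = 4 * pi * (s * s)" using s by (simp add: measure_def emeasure_lborel_disc power2_eq_square)
  also have "\<dots> \<le> 4 * pi * (s * 1)" using s by (intro mult_left_mono) auto
  also have "\<dots> \<le> 20 * pi * s" using s by simp
  finally show ?thesis .
qed

lemma emeasure_strip_le:
  assumes s: "0 < s"
  shows "emeasure lborel {w. cmod w \<le> 3 \<and> \<bar>Im (w * cis (- \<theta>))\<bar> \<le> s} \<le> ennreal (12 * s)"
proof -
  have [measurable]: "(\<lambda>w. indicator {w. cmod w \<le> 3 \<and> \<bar>Im w\<bar> \<le> s} w :: ennreal) \<in> borel_measurable borel" by measurable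
  have "emeasure lborel {w. cmod w \<le> 3 \<and> \<bar>Im (w * cis (- \<theta>))\<bar> \<le> s} = (\<integral>\<^sup>+w. indicator {w. cmod w \<le> 3 \<and> \<bar>Im (w * cis (- \<theta>))\<bar> \<le> s} w \<partial>lborel)"
    by (subst nn_integral_indicator) measurable
  also have "\<dots> = (\<integral>\<^sup>+w. indicator {w. cmod w \<le> 3 \<and> \<bar>Im w\<bar> \<le> s} (cis (- \<theta>) * w) \<partial>lborel)"
    by (intro nn_integral_cong) (auto split: split_indicator simp: norm_mult mult.commute)
  also have "\<dots> = (\<integral>\<^sup>+w. indicator {w. cmod w \<le> 3 \<and> \<bar>Im w\<bar> \<le> s} w \<partial>lborel)"
    by (rule nn_integral_lborel_rotate) auto
  also have "\<dots> \<le> (\<integral>\<^sup>+w. indicator (cbox (Complex (-3) (-s)) (Complex 3 s)) w \<partial>lborel)"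
    by (intro nn_integral_mono) (auto split: split_indicator simp: in_cbox_complex_iff intro: order_trans[OF abs_Re_le_cmod] dest: abs_le_D1 abs_le_D2, (smt (verit) abs_Re_le_cmod)+)
  also have "\<dots> = ennreal (12 * s)"
    using s by (simp add: emeasure_lborel_cbox_eq Basis_complex_def)
  finally show ?thesis .
qed

lemma measure_layer_spiral_region:
  assumes r: "0 \<le> r" "r \<le> r'" "r' \<le> 2" and \<theta>: "0 \<le> \<theta>" "\<theta> < 2 * pi" and s: "0 < s" "s \<le> 1"
  shows "measure lborel (layer s (spiral_region r r' \<theta>)) \<le> 264 * s"
    and "measure lborel (layer s (ball 0 5 - spiral_region r r' \<theta>)) \<le> 264 * s"
proof -
  let ?E = "spiral_region r r' \<theta>"
  let ?A = "\<lambda>r. {w::complex. \<bar>cmod w - r\<bar> \<le> s}" and ?S = "\<lambda>\<theta>. {w. cmod w \<le> 3 \<and> \<bar>Im (w * cis (- \<theta>))\<bar> \<le> s}"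
  have S0: "{w. cmod w \<le> 3 \<and> \<bar>Im w\<bar> \<le> s} = ?S 0" by simp
  have fmA: "?A r \<in> fmeasurable lborel" for r
  proof -
    have "bounded (?A r)" by (rule boundedI[of _ "r + s"]) auto
    then show ?thesis using emeasure_bounded_finite by (auto simp: fmeasurable_def)
  qed
  have fmS: "?S \<theta> \<in> fmeasurable lborel" for \<theta>
  proof -
    have "bounded (?S \<theta>)" by (rule boundedI[of _ 3]) auto
    then show ?thesis using emeasure_bounded_finite by (auto simp: fmeasurable_def)
  qed
  have mS: "measure lborel (?S \<theta>) \<le> 12 * s" for \<theta>
    using emeasure_strip_le[OF s(1), of \<theta>] s by (simp add: measure_def enn2real_leI)
  let ?U = "?A r \<union> ?A r' \<union> ?S 0 \<union> ?S \<theta>"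
  have fmU: "?U \<in> fmeasurable lborel" by (intro fmeasurable.Un fmA fmS)
  have "measure lborel ?U \<le> measure lborel (?A r) + measure lborel (?A r') + measure lborel (?S 0) + measure lborel (?S \<theta>)"
    using fmA fmS by (intro order_trans[OF measure_Un_le] add_mono) (auto intro: fmeasurableD)
  also have "\<dots> \<le> 20 * pi * s + 20 * pi * s + 12 * s + 12 * s"
    using r s by (intro add_mono measure_annulus_le mS) auto
  finally have mU: "measure lborel ?U \<le> 40 * (pi * s) + 24 * s" by simp
  have p4: "pi * s \<le> 4 * s" using s pi_less_4 by (intro mult_right_mono) auto
  have lE: "layer s ?E \<subseteq> ?U" using layer_spiral_region[OF assms] by simp
  have "measure lborel (layer s ?E) \<le> measure lborel ?U"
    using lE by (intro measure_mono_fmeasurable fmU) auto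
  then show "measure lborel (layer s ?E) \<le> 264 * s" using mU p4 s by linarith
  have "layer s (ball 0 5 - ?E) \<subseteq> ?U \<union> ?A 5"
  proof
    fix u assume "u \<in> layer s (ball 0 5 - ?E)"
    then have "\<exists>x y. x \<in> ball 0 5 - ?E \<and> y \<notin> ball 0 5 - ?E \<and> dist x u < s \<and> dist y u < s"
      by (simp only: layer_def Int_iff UN_iff mem_ball) blast
    then obtain x y where x: "x \<in> ball 0 5" "x \<notin> ?E" "dist x u < s" and y: "y \<in> ?E \<or> y \<notin> ball 0 5" "dist y u < s"
      by blast
    show "u \<in> ?U \<union> ?A 5"
    proof (cases "y \<in> ?E")
      case True
      then have "u \<in> layer s ?E" using x y by (auto simp: layer_def)
      then show ?thesis using lE by auto
    next
      case False
      then have "cmod y \<ge> 5" "cmod x < 5" using x y by auto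
      then have "\<bar>cmod u - 5\<bar> \<le> s"
        using x(3) y(2) norm_triangle_ineq3[of x u] norm_triangle_ineq3[of y u] by (auto simp: dist_norm)
      then show ?thesis by auto
    qed
  qed
  then have "measure lborel (layer s (ball 0 5 - ?E)) \<le> measure lborel (?U \<union> ?A 5)"
    by (intro measure_mono_fmeasurable fmeasurable.Un fmU fmA) auto
  also have "\<dots> \<le> measure lborel ?U + measure lborel (?A 5)"
    using fmU fmA by (intro measure_Un_le) (auto intro: fmeasurableD)
  also have "measure lborel (?A 5) \<le> 20 * pi * s" using s by (intro measure_annulus_le) auto
  finally show "measure lborel (layer s (ball 0 5 - ?E)) \<le> 264 * s" using mU p4 by linarith
qed

text \<open>The disc of radius \<open>(\<rho> + 1) / J\<close> minus that of radius \<open>\<rho> / J\<close> has \<open>2 \<rho> + 1\<close> times the area of the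
  disc of radius \<open>1 / J\<close>. It is cut into \<open>2 \<rho> + 1\<close> congruent sectors, so that all \<open>J\<^sup>2\<close> cells of the unit
  disc have the same area and a diameter of order \<open>1 / J\<close>. They are numbered along a spiral, hence cells
  with close numbers are close.\<close>

definition spiral_index :: "nat \<Rightarrow> complex \<Rightarrow> nat" where
  "spiral_index J w = (let \<rho> = nat \<lfloor>real J * cmod w\<rfloor> in
     if cmod w < 1 then \<rho>\<^sup>2 + nat \<lfloor>real (2 * \<rho> + 1) * Arg2pi w / (2 * pi)\<rfloor> else J\<^sup>2)"

lemma spiral_index_measurable [measurable]: "spiral_index J \<in> borel \<rightarrow>\<^sub>M count_space UNIV"
  unfolding spiral_index_def Let_def by measurable

lemma sector_number_le: "nat \<lfloor>real (2 * \<rho> + 1) * Arg2pi w / (2 * pi)\<rfloor> \<le> 2 * \<rho>"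
proof -
  have "real (2 * \<rho> + 1) * Arg2pi w / (2 * pi) < real (2 * \<rho> + 1)"
    using mult_strict_left_mono[of "Arg2pi w / (2 * pi)" 1 "real (2 * \<rho> + 1)"] Arg2pi_lt_2pi[of w] by simp
  then have "\<lfloor>real (2 * \<rho> + 1) * Arg2pi w / (2 * pi)\<rfloor> < int (2 * \<rho> + 1)"
    by (simp only: floor_less_iff of_int_of_nat_eq)
  then show ?thesis by linarith
qed

lemma square_plus_less_iff:
  fixes \<rho> \<rho>' l l' :: nat
  assumes "l \<le> 2 * \<rho>" "l' \<le> 2 * \<rho>'"
  shows "\<rho>\<^sup>2 + l < \<rho>'\<^sup>2 + l' \<longleftrightarrow> \<rho> < \<rho>' \<or> \<rho> = \<rho>' \<and> l < l'"
proof -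
  have *: "a\<^sup>2 + k < b\<^sup>2" if "k \<le> 2 * a" "a < b" for a b k :: nat
  proof -
    have "(a + 1)\<^sup>2 \<le> b\<^sup>2" using that by (intro power_mono) auto
    then show ?thesis using that by (simp add: power2_eq_square)
  qed
  show ?thesis using *[of l \<rho> \<rho>'] *[of l' \<rho>' \<rho>] assms by (cases \<rho> \<rho>' rule: linorder_cases) auto
qed

lemma spiral_index_le: "spiral_index J w \<le> J\<^sup>2"
proof (cases "cmod w < 1 \<and> J > 0")
  case True
  let ?\<rho> = "nat \<lfloor>real J * cmod w\<rfloor>"
  have "real J * cmod w < real J" using True by simp
  then have "?\<rho> < J" using True by (simp add: nat_less_iff floor_less_iff)
  then show ?thesis
    using square_plus_less_iff[OF sector_number_le, of 0 J ?\<rho> w] True by (simp add: spiral_index_def Let_def)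
qed (use sector_number_le[of 0 w] in \<open>auto simp: spiral_index_def\<close>)

lemma spiral_index_eq_outer: "J > 0 \<Longrightarrow> spiral_index J w = J\<^sup>2 \<longleftrightarrow> cmod w \<ge> 1"
proof (cases "cmod w < 1")
  case True
  let ?\<rho> = "nat \<lfloor>real J * cmod w\<rfloor>"
  assume J: "J > 0"
  have "real J * cmod w < real J" using True J by simp
  then have "?\<rho> < J" using J by (simp add: nat_less_iff floor_less_iff)
  then show ?thesis
    using square_plus_less_iff[OF sector_number_le, of 0 J ?\<rho> w] True by (simp add: spiral_index_def Let_def)
qed (auto simp: spiral_index_def)

lemma ex_square_plus: "\<exists>\<rho> l. k = \<rho>\<^sup>2 + l \<and> l \<le> 2 * (\<rho>::nat)"
proof (induction k)
  case (Suc k)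
  then obtain \<rho> l where *: "k = \<rho>\<^sup>2 + l" "l \<le> 2 * \<rho>" by blast
  show ?case
  proof (cases "l < 2 * \<rho>")
    case True
    then show ?thesis using * by (intro exI[of _ \<rho>] exI[of _ "Suc l"]) auto
  next
    case False
    then have "Suc k = (Suc \<rho>)\<^sup>2 + 0" using * by (simp add: power2_eq_square)
    then show ?thesis by (intro exI[of _ "Suc \<rho>"] exI[of _ 0]) auto
  qed
qed auto

lemma nat_floor_less_iff: "0 \<le> x \<Longrightarrow> nat \<lfloor>x\<rfloor> < k \<longleftrightarrow> x < real k"
  by (simp add: nat_less_iff floor_less_iff)

lemma spiral_index_less:
  fixes k \<rho> l :: nat
  assumes J: "J > 0" and k: "k = \<rho>\<^sup>2 + l" "l \<le> 2 * \<rho>" "k \<le> J\<^sup>2"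
  shows "{w. spiral_index J w < k} = spiral_region (\<rho> / J) ((\<rho> + 1) / J) (2 * pi * l / (2 * \<rho> + 1))"
proof (rule Set.set_eqI)
  fix w
  let ?r = "nat \<lfloor>real J * cmod w\<rfloor>" and ?t = "Arg2pi w"
  have kJ: "\<rho> < J \<or> \<rho> = J \<and> l = 0" using square_plus_less_iff[of 0 J l \<rho>] k by auto
  have c1: "?r < \<rho> \<longleftrightarrow> cmod w < \<rho> / J" using J by (simp add: nat_floor_less_iff field_simps)
  have c2: "?r < \<rho> + 1 \<longleftrightarrow> cmod w < (\<rho> + 1) / J" using J nat_floor_less_iff[of "real J * cmod w" "\<rho> + 1"] by (simp add: field_simps)
  have c3: "nat \<lfloor>real (2 * \<rho> + 1) * ?t / (2 * pi)\<rfloor> < l \<longleftrightarrow> ?t < 2 * pi * l / (2 * \<rho> + 1)"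
    using Arg2pi_ge_0[of w] by (subst nat_floor_less_iff) (auto simp: field_simps)
  show "w \<in> {w. spiral_index J w < k} \<longleftrightarrow> w \<in> spiral_region (\<rho> / J) ((\<rho> + 1) / J) (2 * pi * l / (2 * \<rho> + 1))"
  proof (cases "cmod w < 1")
    case True
    then have "spiral_index J w < k \<longleftrightarrow> ?r < \<rho> \<or> ?r = \<rho> \<and> nat \<lfloor>real (2 * \<rho> + 1) * ?t / (2 * pi)\<rfloor> < l"
      using square_plus_less_iff[OF sector_number_le k(2), of ?r w] k(1) by (auto simp: spiral_index_def Let_def)
    also have "?r = \<rho> \<longleftrightarrow> \<not> ?r < \<rho> \<and> ?r < \<rho> + 1" by auto
    finally show ?thesis unfolding c1 c2 c3 by (auto simp: spiral_region_def)
  next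
    case False
    have "\<rho> / J \<le> 1" using kJ J by auto
    then have "\<not> cmod w < \<rho> / J" using False by linarith
    moreover have "\<not> (cmod w < (\<rho> + 1) / J \<and> ?t < 2 * pi * l / (2 * \<rho> + 1))"
      using kJ
    proof
      assume "\<rho> < J"
      then have "real (\<rho> + 1) / J \<le> 1" using J by simp
      then show ?thesis using False by linarith
    qed (use Arg2pi_ge_0[of w] in auto)
    moreover have "spiral_index J w = J\<^sup>2" using False by (simp add: spiral_index_def)
    ultimately show ?thesis using k(3) by (auto simp: spiral_region_def)
  qed
qed

text \<open>The sectors of an annulus are rotations of each other. The origin, whose argument is a default value, is
  left out because it is not moved by rotations.\<close>

lemma emeasure_spiral_region:
  fixes l m :: nat
  assumes r: "0 \<le> r" "r \<le> r'" and l: "l \<le> m" "m > 0"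
  shows "emeasure lborel (spiral_region r r' (2 * pi * l / m)) = ennreal (pi * (r\<^sup>2 + (r'\<^sup>2 - r\<^sup>2) * l / m))"
proof -
  define q where "q u = nat \<lfloor>real m * Arg2pi u / (2 * pi)\<rfloor>" for u
  define S where "S i = {u. u \<noteq> 0 \<and> r \<le> cmod u \<and> cmod u < r' \<and> q u = i}" for i
  have [measurable]: "q \<in> borel \<rightarrow>\<^sub>M count_space UNIV" unfolding q_def by measurable
  have [measurable]: "S i \<in> sets borel" "ball (0::complex) r \<in> sets borel" for i unfolding S_def by measurable
  have q_less: "q u < k \<longleftrightarrow> Arg2pi u < 2 * pi * k / m" for u and k :: nat
    unfolding q_def using Arg2pi_ge_0[of u] l(2) by (subst nat_floor_less_iff) (auto simp: field_simps)
  define c where "c = emeasure lborel (S 0)"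
  have c: "emeasure lborel (S i) = c" if i: "i < m" for i
  proof -
    let ?\<alpha> = "2 * pi * i / m"
    have \<alpha>: "0 \<le> ?\<alpha>" "?\<alpha> < 2 * pi" using i by (auto simp: field_simps)
    have shift: "q (cis (- ?\<alpha>) * u) = 0 \<longleftrightarrow> q u = i" if u: "u \<noteq> 0" for u
    proof -
      let ?t = "Arg2pi u"
      have ut: "of_real (cmod u) * exp (\<i> * of_real ?t) = u" using Arg2pi_eq[of u] by simp
      have t: "0 \<le> ?t" "?t < 2 * pi" using Arg2pi_ge_0 Arg2pi_lt_2pi by auto
      have rot: "of_real (cmod u) * exp (\<i> * of_real (?t - ?\<alpha>)) = cis (- ?\<alpha>) * u"
      proof -
        have "cis (- ?\<alpha>) * u = cis (- ?\<alpha>) * (of_real (cmod u) * cis ?t)" using ut by (simp add: cis_conv_exp)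
        also have "\<dots> = of_real (cmod u) * cis (?t - ?\<alpha>)" by (simp add: cis_mult mult.left_commute add.commute)
        finally show ?thesis by (simp only: cis_conv_exp)
      qed
      have rot': "of_real (cmod u) * exp (\<i> * of_real (?t - ?\<alpha> + 2 * pi)) = cis (- ?\<alpha>) * u"
        unfolding rot[symmetric] cis_conv_exp[symmetric] cis_mult[symmetric] by simp
      have q0: "q v = 0 \<longleftrightarrow> Arg2pi v < 2 * pi / m" for v using q_less[of v 1] by simp
      have qi: "q u = i \<longleftrightarrow> ?\<alpha> \<le> ?t \<and> ?t < ?\<alpha> + 2 * pi / m"
      proof -
        have "q u = i \<longleftrightarrow> \<not> q u < i \<and> q u < i + 1" by auto
        then show ?thesis unfolding q_less using l(2) by (auto simp: field_simps)
      qed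
      show ?thesis
      proof (cases "?\<alpha> \<le> ?t")
        case True
        then have "0 \<le> ?t - ?\<alpha>" "?t - ?\<alpha> < 2 * pi" using t \<alpha> by linarith+
        then have "Arg2pi (cis (- ?\<alpha>) * u) = ?t - ?\<alpha>" using u by (intro Arg2pi_unique[OF rot]) auto
        then show ?thesis unfolding q0 qi using True by auto
      next
        case False
        then have "0 \<le> ?t - ?\<alpha> + 2 * pi" "?t - ?\<alpha> + 2 * pi < 2 * pi" using t \<alpha> by linarith+
        then have e: "Arg2pi (cis (- ?\<alpha>) * u) = ?t - ?\<alpha> + 2 * pi" using u by (intro Arg2pi_unique[OF rot']) auto
        have "?\<alpha> \<le> 2 * pi * (m - 1) / m" using i by (intro divide_right_mono mult_left_mono) auto
        also have "2 * pi * (m - 1) / m = 2 * pi - 2 * pi / m" using l(2) by (simp add: field_simps of_nat_diff)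
        finally show ?thesis unfolding q0 qi e using False t by auto
      qed
    qed
    have "emeasure lborel (S i) = (\<integral>\<^sup>+u. indicator (S i) u \<partial>lborel)" by (subst nn_integral_indicator) measurable
    also have "\<dots> = (\<integral>\<^sup>+u. indicator (S 0) (cis (- ?\<alpha>) * u) \<partial>lborel)"
    proof (rule nn_integral_cong)
      fix u show "indicator (S i) u = (indicator (S 0) (cis (- ?\<alpha>) * u) :: ennreal)"
        using shift[of u] by (cases "u = 0") (auto split: split_indicator simp: S_def norm_mult)
    qed
    also have "\<dots> = (\<integral>\<^sup>+u. indicator (S 0) u \<partial>lborel)" by (rule nn_integral_lborel_rotate) auto
    finally show ?thesis by (simp add: c_def)
  qed
  have sum: "emeasure lborel (spiral_region r r' (2 * pi * k / m)) = ennreal (pi * r\<^sup>2) + of_nat k * c" if k: "k \<le> m" for k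
  proof -
    have "AE u::complex in lborel. u \<noteq> 0" by (rule AE_lborel_singleton)
    then have "AE u in lborel. indicator (spiral_region r r' (2 * pi * k / m)) u
        = (indicator (ball 0 r) u + (\<Sum>i<k. indicator (S i) u) :: ennreal)"
    proof eventually_elim
      case (elim u)
      have "(\<Sum>i<k. indicator (S i) u :: ennreal) = (\<Sum>i<k. if i = q u then indicator {u. r \<le> cmod u \<and> cmod u < r'} u else 0)"
        using elim by (intro sum.cong) (auto split: split_indicator simp: S_def)
      also have "\<dots> = indicator {u. r \<le> cmod u \<and> cmod u < r' \<and> q u < k} u" by (auto split: split_indicator)
      finally show ?case unfolding q_less by (auto split: split_indicator simp: spiral_region_def)
    qed
    then have "(\<integral>\<^sup>+u. indicator (spiral_region r r' (2 * pi * k / m)) u \<partial>lborel)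
        = (\<integral>\<^sup>+u. indicator (ball 0 r) u + (\<Sum>i<k. indicator (S i) u) \<partial>lborel)" by (rule nn_integral_cong_AE)
    also have "\<dots> = emeasure lborel (ball (0::complex) r) + (\<Sum>i<k. emeasure lborel (S i))"
      by (subst nn_integral_add; (subst nn_integral_sum)?) auto
    also have "(\<Sum>i<k. emeasure lborel (S i)) = of_nat k * c" using k c by simp
    finally show ?thesis using r by (simp add: emeasure_lborel_disc)
  qed
  have "spiral_region r r' (2 * pi * m / m) = ball 0 r'"
    using r l(2) Arg2pi_lt_2pi by (auto simp: spiral_region_def)
  then have full: "ennreal (pi * r'\<^sup>2) = ennreal (pi * r\<^sup>2) + of_nat m * c"
    using sum[of m] r by (simp add: emeasure_lborel_disc)
  then have "c \<noteq> \<infinity>" using l(2) by (auto simp: ennreal_mult_top)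
  then obtain c' where c': "c = ennreal c'" "c' \<ge> 0" by (cases c) auto
  have "pi * r'\<^sup>2 = pi * r\<^sup>2 + m * c'"
    using full c' by (simp add: ennreal_of_nat_eq_real_of_nat ennreal_mult[symmetric] ennreal_plus[symmetric] del: ennreal_plus)
  then have "c' = pi * (r'\<^sup>2 - r\<^sup>2) / m" using l(2) by (simp add: field_simps)
  moreover have "emeasure lborel (spiral_region r r' (2 * pi * l / m)) = ennreal (pi * r\<^sup>2 + l * c')"
    using sum[OF l(1)] c' by (simp add: ennreal_of_nat_eq_real_of_nat ennreal_mult[symmetric] ennreal_plus[symmetric] del: ennreal_plus)
  ultimately show ?thesis by (simp add: algebra_simps)
qed

lemma measure_spiral_index_less:
  assumes J: "J > 0" and k: "k \<le> J\<^sup>2"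
  shows "measure lborel {w. spiral_index J w < k} = pi * k / J\<^sup>2"
proof -
  obtain \<rho> l where l: "k = \<rho>\<^sup>2 + l" "l \<le> 2 * \<rho>" using ex_square_plus by blast
  have "((\<rho> + 1) / J)\<^sup>2 - (\<rho> / J)\<^sup>2 = (2 * \<rho> + 1) / (real J)\<^sup>2"
    by (simp add: power_divide diff_divide_distrib[symmetric] power2_eq_square algebra_simps)
  note * = this
  have e: "(\<rho> / J)\<^sup>2 + (((\<rho> + 1) / J)\<^sup>2 - (\<rho> / J)\<^sup>2) * l / (2 * \<rho> + 1) = k / J\<^sup>2"
  proof -
    have "(2 * \<rho> + 1) / (real J)\<^sup>2 * l / (2 * \<rho> + 1) = l / (real J)\<^sup>2"
      using nonzero_mult_div_cancel_right[of "real (2 * \<rho> + 1)" "l / (real J)\<^sup>2"] by (simp add: mult_ac del: of_nat_add of_nat_mult)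
    with * show ?thesis using l(1) by (simp only:) (simp add: power_divide add_divide_distrib)
  qed
  have "emeasure lborel {w. spiral_index J w < k} = ennreal (pi * (k / J\<^sup>2))"
    using emeasure_spiral_region[of "\<rho> / J" "(\<rho> + 1) / J" l "2 * \<rho> + 1"] l J
    unfolding spiral_index_less[OF J l k] e[symmetric] by (simp add: divide_right_mono add.commute)
  then show ?thesis by (simp add: measure_def)
qed

lemma dist_cis_le: "cmod (cis a - cis b) \<le> \<bar>a - b\<bar>"
proof -
  have "cis a - cis b = cis b * (exp (\<i> * of_real (a - b)) - 1)"
    by (simp add: cis_conv_exp[symmetric] right_diff_distrib cis_mult del: of_real_diff)
  then have "cmod (cis a - cis b) = 2 * \<bar>sin ((a - b) / 2)\<bar>" by (simp only: norm_mult norm_cis mult_1 dist_exp_i_1)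
  also have "\<dots> \<le> \<bar>a - b\<bar>" using abs_sin_x_le_abs_x[of "(a - b) / 2"] by simp
  finally show ?thesis .
qed

text \<open>Cells of the same annulus are compared along its circle. Between consecutive annuli the spiral passes
  from the end of one turn to the beginning of the next. If a whole turn lies between two cells, then the
  difference of their numbers already exceeds their distance from the centre.\<close>

lemma dist_le_spiral_index_diff:
  assumes J: "J > 0" and w: "cmod w < 1" and z: "cmod z < 1" and le: "spiral_index J w \<le> spiral_index J z"
  shows "cmod (w - z) \<le> 10 * (real (spiral_index J z) - spiral_index J w + 1) / J"
proof -
  define \<rho> \<sigma> where "\<rho> = nat \<lfloor>J * cmod w\<rfloor>" and "\<sigma> = nat \<lfloor>J * cmod z\<rfloor>"
  define k l where "k = nat \<lfloor>real (2 * \<rho> + 1) * Arg2pi w / (2 * pi)\<rfloor>" and "l = nat \<lfloor>real (2 * \<sigma> + 1) * Arg2pi z / (2 * pi)\<rfloor>"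
  have i: "spiral_index J w = \<rho>\<^sup>2 + k" "spiral_index J z = \<sigma>\<^sup>2 + l"
    using w z by (auto simp: spiral_index_def Let_def \<rho>_def \<sigma>_def k_def l_def)
  have kl: "k \<le> 2 * \<rho>" "l \<le> 2 * \<sigma>" unfolding k_def l_def by (rule sector_number_le)+
  define \<Delta> where "\<Delta> = real (spiral_index J z) - spiral_index J w"
  have \<Delta>: "\<Delta> = (real \<sigma>)\<^sup>2 + l - (real \<rho>)\<^sup>2 - k" "\<Delta> \<ge> 0" using le of_nat_mono[OF le, where 'a = real] unfolding \<Delta>_def i by simp_all
  have fl: "real (nat \<lfloor>x\<rfloor>) \<le> x \<and> x < real (nat \<lfloor>x\<rfloor>) + 1" if "x \<ge> 0" for x :: real using that by linarith
  have r: "\<rho> \<le> J * cmod w" "J * cmod w < real \<rho> + 1" "\<sigma> \<le> J * cmod z" "J * cmod z < real \<sigma> + 1"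
    unfolding \<rho>_def \<sigma>_def of_nat_add of_nat_1 using fl[of "J * cmod w"] fl[of "J * cmod z"] by (simp_all del: of_nat_nat)
  let ?a = "Arg2pi w" and ?b = "Arg2pi z" and ?P = "2 * pi"
  have ab: "0 \<le> ?a" "?a < ?P" "0 \<le> ?b" "?b < ?P" using Arg2pi_ge_0 Arg2pi_lt_2pi by auto
  have a: "k \<le> real (2 * \<rho> + 1) * ?a / ?P" "real (2 * \<rho> + 1) * ?a / ?P < real k + 1"
    unfolding k_def using fl[of "real (2 * \<rho> + 1) * ?a / ?P"] ab by auto
  have b: "l \<le> real (2 * \<sigma> + 1) * ?b / ?P" "real (2 * \<sigma> + 1) * ?b / ?P < real l + 1"
    unfolding l_def using fl[of "real (2 * \<sigma> + 1) * ?b / ?P"] ab by auto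
  have polar: "w = of_real (cmod w) * cis ?a" "z = of_real (cmod z) * cis ?b"
    using Arg2pi_eq[of w] Arg2pi_eq[of z] by (auto simp: cis_conv_exp)
  have split: "cmod (w - z) \<le> \<bar>cmod w - cmod z\<bar> + cmod w * cmod (cis ?a - cis ?b)"
  proof -
    have "w - z = of_real (cmod w) * (cis ?a - cis ?b) + of_real (cmod w - cmod z) * cis ?b"
      by (subst (1) polar(1), subst (1) polar(2)) (simp add: algebra_simps)
    then show ?thesis
      using norm_triangle_ineq[of "of_real (cmod w) * (cis ?a - cis ?b)" "of_real (cmod w - cmod z) * cis ?b"]
      by (simp add: norm_mult del: of_real_diff)
  qed
  have "\<not> \<sigma> < \<rho>" using square_plus_less_iff[OF kl(2,1)] le i by auto
  then consider "\<sigma> = \<rho>" | "\<sigma> = \<rho> + 1" | "\<sigma> \<ge> \<rho> + 2" by linarith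
  then have "J * cmod (w - z) \<le> 10 * (\<Delta> + 1)"
  proof cases
    case 3
    have "(real \<rho> + 1 + 1) * (real \<sigma> + 1 + \<rho>) \<le> real \<sigma> * (real \<sigma> + 1 + \<rho>)"
      using 3 by (intro mult_right_mono) auto
    then have "real \<rho> + \<sigma> + 2 \<le> \<Delta> + 1"
      using kl(1) unfolding \<Delta>(1) by (simp add: power2_eq_square algebra_simps)
    moreover have "J * cmod (w - z) \<le> J * cmod w + J * cmod z"
      using norm_triangle_ineq4[of w z] J by (simp add: distrib_left[symmetric])
    moreover have "\<Delta> + 1 \<le> 10 * (\<Delta> + 1)" using \<Delta>(2) by simp
    ultimately show ?thesis using r(2,4) by argo
  next
    case 1
    have "real (2 * \<rho> + 1) * \<bar>?a - ?b\<bar> = ?P * \<bar>real (2 * \<rho> + 1) * ?a / ?P - real (2 * \<rho> + 1) * ?b / ?P\<bar>"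
      by (simp add: abs_mult[symmetric] diff_divide_distrib[symmetric] right_diff_distrib[symmetric] abs_mult)
    also have "\<dots> \<le> ?P * (\<Delta> + 1)" using a b 1 \<Delta> by (intro mult_left_mono) auto
    finally have *: "real (2 * \<rho> + 1) * \<bar>?a - ?b\<bar> \<le> ?P * (\<Delta> + 1)" .
    have "J * cmod w * cmod (cis ?a - cis ?b) \<le> real (2 * \<rho> + 1) * \<bar>?a - ?b\<bar>"
      using r dist_cis_le by (intro mult_mono) auto
    also have "\<dots> \<le> 8 * (\<Delta> + 1)" using * pi_less_4 \<Delta>(2) by (intro order_trans[OF *] mult_right_mono) auto
    finally have "J * cmod w * cmod (cis ?a - cis ?b) \<le> 8 * (\<Delta> + 1)" .
    moreover have "J * \<bar>cmod w - cmod z\<bar> \<le> 1"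
    proof -
      have "J * \<bar>cmod w - cmod z\<bar> = \<bar>J * cmod w - J * cmod z\<bar>" by (simp add: right_diff_distrib[symmetric] abs_mult)
      then show ?thesis using r 1 by linarith
    qed
    moreover have "J * cmod (w - z) \<le> J * \<bar>cmod w - cmod z\<bar> + J * cmod w * cmod (cis ?a - cis ?b)"
      using mult_left_mono[OF split, of "real J"] by (simp add: algebra_simps)
    ultimately show ?thesis using \<Delta>(2) by argo
  next
    case 2
    have "cmod (cis ?a - cis ?b) \<le> cmod (cis ?a - cis ?P) + cmod (cis 0 - cis ?b)"
      using norm_triangle_ineq[of "cis ?a - cis ?P" "cis 0 - cis ?b"] by simp
    also have "\<dots> \<le> (?P - ?a) + ?b" using dist_cis_le[of ?a ?P] dist_cis_le[of 0 ?b] ab by simp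
    finally have cis: "cmod (cis ?a - cis ?b) \<le> (?P - ?a) + ?b" .
    have "real (2 * \<rho> + 1) * (?P - ?a) = ?P * (real (2 * \<rho> + 1) - real (2 * \<rho> + 1) * ?a / ?P)" by (simp add: right_diff_distrib)
    also have "\<dots> \<le> ?P * (2 * real \<rho> + 1 - k)" using a by (intro mult_left_mono) auto
    finally have p1: "real (2 * \<rho> + 1) * (?P - ?a) \<le> ?P * (2 * real \<rho> + 1 - k)" .
    have "real (2 * \<rho> + 1) * ?b \<le> real (2 * \<sigma> + 1) * ?b" using 2 ab by (intro mult_right_mono) auto
    also have "\<dots> = ?P * (real (2 * \<sigma> + 1) * ?b / ?P)" by simp
    also have "\<dots> \<le> ?P * (real l + 1)" using b by (intro mult_left_mono) auto
    finally have p2: "real (2 * \<rho> + 1) * ?b \<le> ?P * (real l + 1)" .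
    have "\<Delta> = 2 * real \<rho> + 1 - k + l" unfolding \<Delta>(1) 2 by (simp add: power2_eq_square algebra_simps)
    then have e: "?P * (\<Delta> + 1) = ?P * (2 * real \<rho> + 1 - k) + ?P * (real l + 1)" by (simp only: distrib_left[symmetric]) simp
    have "real (2 * \<rho> + 1) * ((?P - ?a) + ?b) \<le> ?P * (\<Delta> + 1)"
      unfolding e distrib_left[of "real (2 * \<rho> + 1)"] using p1 p2 by (rule add_mono)
    also have "\<dots> \<le> 8 * (\<Delta> + 1)" using pi_less_4 \<Delta>(2) by (intro mult_right_mono) auto
    finally have "real (2 * \<rho> + 1) * ((?P - ?a) + ?b) \<le> 8 * (\<Delta> + 1)" .
    moreover have "J * cmod w * cmod (cis ?a - cis ?b) \<le> real (2 * \<rho> + 1) * ((?P - ?a) + ?b)"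
      using r cis by (intro mult_mono) auto
    moreover have "J * \<bar>cmod w - cmod z\<bar> \<le> 2"
    proof -
      have "J * \<bar>cmod w - cmod z\<bar> = \<bar>J * cmod w - J * cmod z\<bar>" by (simp add: right_diff_distrib[symmetric] abs_mult)
      then show ?thesis using r 2 by linarith
    qed
    moreover have "J * cmod (w - z) \<le> J * \<bar>cmod w - cmod z\<bar> + J * cmod w * cmod (cis ?a - cis ?b)"
      using mult_left_mono[OF split, of "real J"] by (simp add: algebra_simps)
    ultimately show ?thesis using \<Delta>(2) by argo
  qed
  then show ?thesis using J by (simp add: \<Delta>_def field_simps)
qed

section \<open>The quantile coupling\<close>

definition overlap :: "real \<Rightarrow> real \<Rightarrow> real \<Rightarrow> real \<Rightarrow> real" where
  "overlap a a' b b' = max 0 (min a' b' - max a b)"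

lemma overlap_commute: "overlap a a' b b' = overlap b b' a a'"
  by (auto simp: overlap_def)

lemma sum_overlap:
  fixes b :: "nat \<Rightarrow> real"
  assumes a: "0 \<le> a" "a \<le> a'" "a' \<le> 1" and b: "mono b" "b 0 = 0" "b N = 1"
  shows "(\<Sum>j<N. overlap a a' (b j) (b (Suc j))) = a' - a"
proof -
  let ?c = "\<lambda>x. max a (min a' x)"
  have "overlap a a' (b j) (b (Suc j)) = ?c (b (Suc j)) - ?c (b j)" for j
    using a monoD[OF b(1), of j "Suc j"] by (simp add: overlap_def)
  then have "(\<Sum>j<N. overlap a a' (b j) (b (Suc j))) = ?c (b N) - ?c (b 0)"
    by (simp only: sum_lessThan_telescope[of "\<lambda>j. ?c (b j)" N])
  then show ?thesis using a b by simp
qed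

lemma nn_integral_comp_bounded_nat:
  assumes [measurable]: "f \<in> M \<rightarrow>\<^sub>M count_space UNIV" and f: "\<And>x. x \<in> space M \<Longrightarrow> f x < (N::nat)"
  shows "(\<integral>\<^sup>+x. \<phi> (f x) \<partial>M) = (\<Sum>i<N. \<phi> i * emeasure M {x \<in> space M. f x = i})"
proof -
  have "(\<integral>\<^sup>+x. \<phi> (f x) \<partial>M) = (\<integral>\<^sup>+x. (\<Sum>i<N. \<phi> i * indicator {x \<in> space M. f x = i} x) \<partial>M)"
  proof (rule nn_integral_cong)
    fix x assume x: "x \<in> space M"
    have "(\<Sum>i<N. \<phi> i * indicator {x \<in> space M. f x = i} x) = (\<Sum>i<N. if i = f x then \<phi> i else 0)"
      using x by (intro sum.cong) (auto split: split_indicator)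
    then show "\<phi> (f x) = (\<Sum>i<N. \<phi> i * indicator {x \<in> space M. f x = i} x)" using f[OF x] by simp
  qed
  also have "\<dots> = (\<Sum>i<N. \<phi> i * emeasure M {x \<in> space M. f x = i})"
    by (subst nn_integral_sum) (auto simp: nn_integral_cmult_indicator)
  finally show ?thesis .
qed

text \<open>If \<open>f\<close> and \<open>g\<close> number the cells of two partitions, then the masses of the cells cut the unit interval
  into consecutive intervals. Mass is moved from one cell to another in the amount of the overlap of
  their intervals, and independently inside the cells. Hence it is only moved between cells whose intervals
  meet.\<close>

lemma ex_quantile_coupling:
  fixes \<mu> \<nu> :: "complex measure" and f g :: "complex \<Rightarrow> nat"
  assumes \<mu>: "prob_space \<mu>" "sets \<mu> = sets borel" and \<nu>: "prob_space \<nu>" "sets \<nu> = sets borel"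
    and f[measurable]: "f \<in> borel \<rightarrow>\<^sub>M count_space UNIV" and g[measurable]: "g \<in> borel \<rightarrow>\<^sub>M count_space UNIV"
    and bd: "\<And>w. f w < N" "\<And>w. g w < N"
  shows "\<exists>\<pi>\<in>couplings \<mu> \<nu>. AE (w, z) in \<pi>.
    measure \<mu> {x. f x < f w} < measure \<nu> {x. g x < Suc (g z)} \<and> measure \<nu> {x. g x < g z} < measure \<mu> {x. f x < Suc (f w)}"
proof -
  interpret \<mu>: prob_space \<mu> by fact
  interpret \<nu>: prob_space \<nu> by fact
  interpret pair_sigma_finite \<mu> \<nu> ..
  have [measurable_cong]: "sets \<mu> = sets borel" "sets \<nu> = sets borel" by fact+
  have sp: "space \<mu> = UNIV" "space \<nu> = UNIV" using sets_eq_imp_space_eq[OF \<mu>(2)] sets_eq_imp_space_eq[OF \<nu>(2)] by auto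
  have cells: "{x. f x < i} \<in> sets \<mu>" "{x. f x = i} \<in> sets \<mu>" "{x. g x < i} \<in> sets \<nu>" "{x. g x = i} \<in> sets \<nu>" for i
    unfolding \<mu>(2) \<nu>(2) by measurable
  define a where "a i = measure \<mu> {x. f x < i}" for i
  define b where "b i = measure \<nu> {x. g x < i}" for i
  have a: "mono a" "a 0 = 0" "a N = 1"
    using bd \<mu>.prob_space sp by (auto simp: a_def mono_def intro!: \<mu>.finite_measure_mono)
  have b: "mono b" "b 0 = 0" "b N = 1"
    using bd \<nu>.prob_space sp by (auto simp: b_def mono_def intro!: \<nu>.finite_measure_mono)
  have a01: "0 \<le> a i" "a i \<le> 1" "a i \<le> a (Suc i)" and b01: "0 \<le> b i" "b i \<le> 1" "b i \<le> b (Suc i)" for i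
    using a(1) b(1) by (auto simp: a_def b_def mono_def)
  have ma: "emeasure \<mu> {x. f x = i} = ennreal (a (Suc i) - a i)" for i
  proof -
    have "{x. f x = i} = {x. f x < Suc i} - {x. f x < i}" by auto
    then have "measure \<mu> {x. f x = i} = a (Suc i) - a i" unfolding a_def
      by (simp add: \<mu>.finite_measure_Diff cells subset_eq)
    then show ?thesis by (simp add: \<mu>.emeasure_eq_measure)
  qed
  have mb: "emeasure \<nu> {x. g x = i} = ennreal (b (Suc i) - b i)" for i
  proof -
    have "{x. g x = i} = {x. g x < Suc i} - {x. g x < i}" by auto
    then have "measure \<nu> {x. g x = i} = b (Suc i) - b i" unfolding b_def
      by (simp add: \<nu>.finite_measure_Diff cells subset_eq)
    then show ?thesis by (simp add: \<nu>.emeasure_eq_measure)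
  qed
  define t where "t i j = overlap (a i) (a (Suc i)) (b j) (b (Suc j))" for i j
  have t0: "t i j \<ge> 0" for i j by (simp add: t_def overlap_def)
  define h where "h i j = t i j / ((a (Suc i) - a i) * (b (Suc j) - b j))" for i j
  have h0: "h i j \<ge> 0" for i j using t0 a01 b01 by (simp add: h_def)
  \<comment> \<open>Cells of mass zero have no overlap with any other cell, so the quotient is harmless there.\<close>
  have h1: "h i j * (b (Suc j) - b j) * (a (Suc i) - a i) = t i j" for i j
    using a01[of i] b01[of j] by (auto simp: h_def t_def overlap_def)
  have pos_a: "AE w in \<mu>. a (f w) < a (Suc (f w))"
  proof (rule AE_I')
    show "(\<Union>i\<in>{i. a i = a (Suc i)}. {x. f x = i}) \<in> null_sets \<mu>"
      by (intro null_sets_UN') (auto simp: null_sets_def ma cells)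
    show "{w \<in> space \<mu>. \<not> a (f w) < a (Suc (f w))} \<subseteq> (\<Union>i\<in>{i. a i = a (Suc i)}. {x. f x = i})"
      using a01(3) by (auto simp: not_less intro: antisym)
  qed
  have pos_b: "AE z in \<nu>. b (g z) < b (Suc (g z))"
  proof (rule AE_I')
    show "(\<Union>i\<in>{i. b i = b (Suc i)}. {x. g x = i}) \<in> null_sets \<nu>"
      by (intro null_sets_UN') (auto simp: null_sets_def mb cells)
    show "{z \<in> space \<nu>. \<not> b (g z) < b (Suc (g z))} \<subseteq> (\<Union>i\<in>{i. b i = b (Suc i)}. {x. g x = i})"
      using b01(3) by (auto simp: not_less intro: antisym)
  qed
  have sum_a: "(\<integral>\<^sup>+z. ennreal (h i (g z)) \<partial>\<nu>) = 1" if i: "a i < a (Suc i)" for i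
  proof -
    have "(\<integral>\<^sup>+z. ennreal (h i (g z)) \<partial>\<nu>) = (\<Sum>j<N. ennreal (h i j) * emeasure \<nu> {x. g x = j})"
      by (subst nn_integral_comp_bounded_nat[where N = N and \<phi> = "\<lambda>j. ennreal (h i j)"]) (auto simp: bd sp)
    also have "\<dots> = (\<Sum>j<N. ennreal (t i j / (a (Suc i) - a i)))"
      unfolding mb using h0 b01 i by (intro sum.cong refl) (simp add: ennreal_mult[symmetric] h1[symmetric])
    also have "\<dots> = ennreal ((\<Sum>j<N. t i j) / (a (Suc i) - a i))"
      using t0 i by (simp add: sum_ennreal sum_divide_distrib)
    also have "(\<Sum>j<N. t i j) = a (Suc i) - a i"
      unfolding t_def using a01[of i] a01[of "Suc i"] by (intro sum_overlap b) auto
    finally show ?thesis using i by simp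
  qed
  have sum_b: "(\<integral>\<^sup>+w. ennreal (h (f w) j) \<partial>\<mu>) = 1" if j: "b j < b (Suc j)" for j
  proof -
    have "(\<integral>\<^sup>+w. ennreal (h (f w) j) \<partial>\<mu>) = (\<Sum>i<N. ennreal (h i j) * emeasure \<mu> {x. f x = i})"
      by (subst nn_integral_comp_bounded_nat[where N = N and \<phi> = "\<lambda>i. ennreal (h i j)"]) (auto simp: bd sp)
    also have "\<dots> = (\<Sum>i<N. ennreal (t i j / (b (Suc j) - b j)))"
      unfolding ma using h0 a01 j by (intro sum.cong refl) (simp add: ennreal_mult[symmetric] h1[symmetric])
    also have "\<dots> = ennreal ((\<Sum>i<N. t i j) / (b (Suc j) - b j))"
      using t0 j by (simp add: sum_ennreal sum_divide_distrib)
    also have "(\<Sum>i<N. t i j) = b (Suc j) - b j"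
      unfolding t_def overlap_commute[of "a _"] using b01[of j] b01[of "Suc j"] by (intro sum_overlap a) auto
    finally show ?thesis using j by simp
  qed
  let ?h = "\<lambda>(w, z). ennreal (h (f w) (g z))"
  have [measurable]: "(\<lambda>(i, j). ennreal (h i j)) \<in> count_space UNIV \<Otimes>\<^sub>M count_space UNIV \<rightarrow>\<^sub>M borel"
    by (simp add: pair_measure_countable)
  have hm[measurable]: "?h \<in> borel_measurable (\<mu> \<Otimes>\<^sub>M \<nu>)"
  proof -
    have "(\<lambda>p. (f (fst p), g (snd p))) \<in> \<mu> \<Otimes>\<^sub>M \<nu> \<rightarrow>\<^sub>M count_space UNIV \<Otimes>\<^sub>M count_space UNIV" by measurable
    from measurable_compose[OF this, of "\<lambda>(i, j). ennreal (h i j)" borel] show ?thesis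
      by (simp add: split_beta')
  qed
  define \<pi> where "\<pi> = density (\<mu> \<Otimes>\<^sub>M \<nu>) ?h"
  have sets_\<pi>: "sets \<pi> = sets borel"
    unfolding \<pi>_def sets_density sets_pair_measure_cong[OF \<mu>(2) \<nu>(2)] by (simp only: borel_prod)
  have fst: "distr \<pi> borel fst = \<mu>"
  proof (rule measure_eqI)
    fix A assume "A \<in> sets (distr \<pi> borel fst)"
    then have A[measurable]: "A \<in> sets borel" by simp
    have "emeasure (distr \<pi> borel fst) A = emeasure \<pi> (A \<times> UNIV)"
      using sets_eq_imp_space_eq[OF sets_\<pi>]
      by (subst emeasure_distr) (auto simp: measurable_cong_sets[OF sets_\<pi> refl] borel_measurable_continuous_onI continuous_on_fst intro!: arg_cong[where f = "emeasure \<pi>"])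
    also have "\<dots> = (\<integral>\<^sup>+p. ?h p * indicator (A \<times> UNIV) p \<partial>(\<mu> \<Otimes>\<^sub>M \<nu>))"
      unfolding \<pi>_def by (rule emeasure_density) auto
    also have "\<dots> = (\<integral>\<^sup>+w. \<integral>\<^sup>+z. indicator A w * ennreal (h (f w) (g z)) \<partial>\<nu> \<partial>\<mu>)"
      by (subst \<nu>.nn_integral_fst[symmetric]) (auto split: split_indicator intro!: nn_integral_cong)
    also have "\<dots> = (\<integral>\<^sup>+w. indicator A w * (\<integral>\<^sup>+z. ennreal (h (f w) (g z)) \<partial>\<nu>) \<partial>\<mu>)"
      by (intro nn_integral_cong nn_integral_cmult) measurable
    also have "\<dots> = (\<integral>\<^sup>+w. indicator A w \<partial>\<mu>)"
      using pos_a by (intro nn_integral_cong_AE) (auto elim!: eventually_mono simp: sum_a)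
    finally show "emeasure (distr \<pi> borel fst) A = emeasure \<mu> A" by (simp add: \<mu>(2))
  qed (simp add: \<mu>(2))
  have snd: "distr \<pi> borel snd = \<nu>"
  proof (rule measure_eqI)
    fix A assume "A \<in> sets (distr \<pi> borel snd)"
    then have A[measurable]: "A \<in> sets borel" by simp
    have "emeasure (distr \<pi> borel snd) A = emeasure \<pi> (UNIV \<times> A)"
      using sets_eq_imp_space_eq[OF sets_\<pi>]
      by (subst emeasure_distr) (auto simp: measurable_cong_sets[OF sets_\<pi> refl] borel_measurable_continuous_onI continuous_on_snd intro!: arg_cong[where f = "emeasure \<pi>"])
    also have "\<dots> = (\<integral>\<^sup>+p. ?h p * indicator (UNIV \<times> A) p \<partial>(\<mu> \<Otimes>\<^sub>M \<nu>))"
      unfolding \<pi>_def by (rule emeasure_density) auto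
    also have "\<dots> = (\<integral>\<^sup>+z. \<integral>\<^sup>+w. indicator A z * ennreal (h (f w) (g z)) \<partial>\<mu> \<partial>\<nu>)"
      by (subst nn_integral_snd[symmetric]) (auto split: split_indicator intro!: nn_integral_cong)
    also have "\<dots> = (\<integral>\<^sup>+z. indicator A z * (\<integral>\<^sup>+w. ennreal (h (f w) (g z)) \<partial>\<mu>) \<partial>\<nu>)"
      by (intro nn_integral_cong nn_integral_cmult) measurable
    also have "\<dots> = (\<integral>\<^sup>+z. indicator A z \<partial>\<nu>)"
      using pos_b by (intro nn_integral_cong_AE) (auto elim!: eventually_mono simp: sum_b)
    finally show "emeasure (distr \<pi> borel snd) A = emeasure \<nu> A" by (simp add: \<nu>(2))
  qed (simp add: \<nu>(2))
  have "prob_space \<pi>"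
    by (rule prob_space_distrD[of fst \<pi> borel])
      (auto simp: fst \<mu>(1) measurable_cong_sets[OF sets_\<pi> refl] borel_measurable_continuous_onI continuous_on_fst)
  then have "\<pi> \<in> couplings \<mu> \<nu>" using sets_\<pi> fst snd by (simp add: couplings_def)
  moreover have "AE p in \<pi>. a (f (fst p)) < b (Suc (g (snd p))) \<and> b (g (snd p)) < a (Suc (f (fst p)))"
    unfolding \<pi>_def
  proof (subst AE_density[OF hm], intro AE_I2 impI)
    fix p assume "p \<in> space (\<mu> \<Otimes>\<^sub>M \<nu>)" "0 < ?h p"
    then have "h (f (fst p)) (g (snd p)) > 0" by (simp add: split_beta)
    then have "t (f (fst p)) (g (snd p)) \<noteq> 0" by (auto simp: h_def)
    then show "a (f (fst p)) < b (Suc (g (snd p))) \<and> b (g (snd p)) < a (Suc (f (fst p)))"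
      by (auto simp: t_def overlap_def max_def min_def split: if_splits)
  qed
  ultimately show ?thesis unfolding a_def b_def by (intro bexI[of _ \<pi>]) (simp_all add: split_beta')
qed

section \<open>The rate of convergence\<close>

text \<open>The boundary layer of a region of this kind has area of order \<open>\<eta>\<close>, and the potential has a defect of
  order \<open>ln n\<close> there. The defect is multiplied by \<open>1 / (n \<eta>\<^sup>2)\<close>, and \<open>\<eta>\<^sup>2 = ln n / n\<close> is the choice for which
  both sources of error are of order \<open>\<eta>\<close>.\<close>

lemma count_le_area_of_thin_boundary:
  fixes L :: "complex multiset" and n :: nat
  defines "\<eta> \<equiv> sqrt (ln n / n)"
  assumes n: "n \<ge> 3" and \<eta>: "\<eta> \<le> 1 / 4"
    and L: "\<And>u. char_sq n g u = (\<Prod>l\<in>#L. cmod (u - l))\<^sup>2" "\<And>l. l \<in># L \<Longrightarrow> cmod l < 4"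
    and Y: "potential_defect n g \<le> ennreal (real n ^ 3)"
    and E: "E \<in> sets borel" "E \<subseteq> ball 0 5" "measure lborel (layer (4 * \<eta>) E) \<le> 264 * (4 * \<eta>)"
  shows "size (filter_mset (\<lambda>l. l \<in> E) L) \<le> n * (measure lborel (ball 0 1 \<inter> E) / pi + 6200 * \<eta>)"
proof -
  have ln1: "ln n \<ge> 1" using n exp_le by (subst ln_ge_iff) (auto intro: order_trans)
  have \<eta>2: "\<eta>\<^sup>2 = ln n / n" using ln1 by (simp add: \<eta>_def)
  have \<eta>0: "\<eta> > 0" using ln1 n by (simp add: \<eta>_def)
  have "1 / real n \<le> ln n / n" using ln1 by (intro divide_right_mono) auto
  also have "\<dots> = \<eta> * \<eta>" using \<eta>2 by (simp add: power2_eq_square)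
  also have "\<dots> \<le> \<eta> * 1" using \<eta>0 \<eta> by (intro mult_left_mono) auto
  finally have n\<eta>: "1 / real n \<le> \<eta>" by simp
  let ?Z = "layer (4 * \<eta>) E"
  let ?B = "4 * ln n * measure lborel ?Z + exp (- (4 * ln n)) * (36 * pi + real n ^ 3)"
  have Z: "?Z \<subseteq> ball 0 6"
  proof
    fix u assume "u \<in> ?Z"
    then obtain x where "x \<in> E" "dist x u < 4 * \<eta>" by (auto simp: layer_def)
    then have "cmod x < 5" "cmod (u - x) < 1" using E(2) \<eta> by (auto simp: dist_norm norm_minus_commute)
    then show "u \<in> ball 0 6" using norm_triangle_ineq[of x "u - x"] by simp
  qed
  have "(\<integral>\<^sup>+u. ennreal \<bar>log_potential L u - n * log_avg 1 (cmod u)\<bar> * indicator ?Z u \<partial>lborel) \<le> ennreal ?B"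
    using Y Z ln1 by (intro nn_integral_potential_le[OF L(1)]) auto
  moreover have "cmod l \<le> 6" if "l \<in># L" for l using L(2)[OF that] by simp
  ultimately have count: "size (filter_mset (\<lambda>l. l \<in> E) L)
      \<le> n * (measure lborel (ball 0 1 \<inter> E) / pi + measure lborel ?Z / pi) + 4 * ?B / (pi * \<eta>\<^sup>2)"
    using \<eta>0 \<eta> E ln1 by (intro count_le_area[where r = 5]) auto
  have "exp (- (4 * ln n)) * (36 * pi + real n ^ 3) \<le> 145 / n"
  proof -
    have e: "exp (- (4 * ln n)) = 1 / real n ^ 4"
      using n exp_of_nat_mult[of 4 "ln n"] by (simp add: exp_minus inverse_eq_divide)
    have "36 * pi + real n ^ 3 \<le> 144 * real n ^ 3 + real n ^ 3"
      using pi_less_4 one_le_power[of "real n" 3] n by (intro add_right_mono) linarith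
    then have "exp (- (4 * ln n)) * (36 * pi + real n ^ 3) \<le> 1 / real n ^ 4 * (145 * real n ^ 3)"
      unfolding e by (intro mult_left_mono) auto
    also have "\<dots> = 145 / n" using n by (simp add: power_numeral_reduce field_simps)
    finally show ?thesis .
  qed
  also have "145 / n \<le> 145 * \<eta> * ln n"
    using mult_left_mono[OF n\<eta>, of 145] mult_left_mono[OF ln1, of "145 * \<eta>"] \<eta>0 by linarith
  finally have "?B \<le> 4 * ln n * (264 * (4 * \<eta>)) + 145 * \<eta> * ln n"
    using E(3) ln1 by (intro add_mono mult_left_mono) auto
  then have B: "?B \<le> 4369 * \<eta> * ln n" by (simp add: algebra_simps)
  have "4 * ?B / (pi * \<eta>\<^sup>2) \<le> 4 * (4369 * \<eta> * ln n) / (3 * \<eta>\<^sup>2)"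
    using B \<eta>0 pi_gt3 by (intro frac_le mult_left_mono mult_right_mono mult_nonneg_nonneg) (use ln1 in auto)
  also have "\<dots> = n * (4 * 4369 / 3 * \<eta>)"
    unfolding \<eta>2 using ln1 n by (simp add: field_simps)
  finally have 1: "4 * ?B / (pi * \<eta>\<^sup>2) \<le> n * (4 * 4369 / 3 * \<eta>)" .
  have "measure lborel ?Z / pi \<le> 264 * (4 * \<eta>) / 3" using E(3) pi_gt3 \<eta>0 by (intro frac_le) auto
  then have "n * (measure lborel (ball 0 1 \<inter> E) / pi + measure lborel ?Z / pi)
      \<le> n * (measure lborel (ball 0 1 \<inter> E) / pi + 264 * (4 * \<eta>) / 3)" by (intro mult_left_mono add_left_mono) auto
  with count 1 have "size (filter_mset (\<lambda>l. l \<in> E) L)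
      \<le> n * (measure lborel (ball 0 1 \<inter> E) / pi + 264 * (4 * \<eta>) / 3) + n * (4 * 4369 / 3 * \<eta>)" by linarith
  also have "\<dots> = n * (measure lborel (ball 0 1 \<inter> E) / pi + (264 * (4 * \<eta>) / 3 + 4 * 4369 / 3 * \<eta>))"
    by (simp only: distrib_left[symmetric] add.assoc)
  also have "\<dots> \<le> n * (measure lborel (ball 0 1 \<inter> E) / pi + 6200 * \<eta>)"
    using \<eta>0 by (intro mult_left_mono add_left_mono) auto
  finally show ?thesis .
qed

text \<open>The region and its complement in a disc that contains all eigenvalues have the same boundary layer inside
  that disc. The upper bound for the number of eigenvalues in the complement is a lower bound for the region.\<close>

lemma spiral_discrepancy:
  fixes A :: "complex mat" and n :: nat
  defines "\<eta> \<equiv> sqrt (ln n / n)" and "B \<equiv> complex_of_real (1 / sqrt n) \<cdot>\<^sub>m A"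
  assumes A: "A \<in> carrier_mat n n" and n: "n \<ge> 3" and \<eta>: "\<eta> \<le> 1 / 4"
    and L: "\<And>l. l \<in># eigenvalues_mset B \<Longrightarrow> cmod l < 4"
    and Y: "potential_defect n (entries n A) \<le> ennreal (real n ^ 3)"
    and J: "J > 0" and k: "k \<le> J\<^sup>2"
  shows "\<bar>measure (empirical_spectral_measure B) {w. spiral_index J w < k} - k / J\<^sup>2\<bar> \<le> 6200 * \<eta>"
proof -
  let ?L = "eigenvalues_mset B"
  have B: "B \<in> carrier_mat n n" using A by (simp add: B_def)
  obtain \<rho> l where l: "k = \<rho>\<^sup>2 + l" "l \<le> 2 * \<rho>" using ex_square_plus by blast
  let ?E = "{w. spiral_index J w < k}"
  have E: "?E = spiral_region (\<rho> / J) ((\<rho> + 1) / J) (2 * pi * l / (2 * \<rho> + 1))"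
    by (rule spiral_index_less[OF J l k])
  have [measurable]: "?E \<in> sets borel" "ball (0::complex) 5 \<in> sets borel" unfolding E by auto
  have disc: "?E \<subseteq> ball 0 1" using k by (auto simp: spiral_index_def Let_def split: if_splits)
  have s: "0 < 4 * \<eta>" "4 * \<eta> \<le> 1" using n \<eta> by (auto simp: \<eta>_def)
  have "\<rho>\<^sup>2 \<le> J\<^sup>2" using l k by linarith
  then have \<rho>: "\<rho> \<le> J" by (rule power2_le_imp_le) simp
  have ang: "0 \<le> 2 * pi * l / (2 * \<rho> + 1)" "2 * pi * l / (2 * \<rho> + 1) < 2 * pi"
    using l(2) mult_strict_left_mono[of "l / real (2 * \<rho> + 1)" 1 "2 * pi"] by auto
  have rad: "0 \<le> \<rho> / real J" "\<rho> / real J \<le> (\<rho> + 1) / real J" "(\<rho> + 1) / real J \<le> 2"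
    using \<rho> J by (auto simp: field_simps)
  note lay = measure_layer_spiral_region[OF rad ang s, folded E]
  note count = count_le_area_of_thin_boundary[OF n, folded \<eta>_def, OF \<eta> char_sq_eigenvalues[OF A] _ Y]
  have n1: "n \<ge> 1" using n by simp
  have cE: "size (filter_mset (\<lambda>l. l \<in> ?E) ?L) \<le> n * (measure lborel (ball 0 1 \<inter> ?E) / pi + 6200 * \<eta>)"
    unfolding B_def using lay(1) disc L n1 by (intro count) (auto simp: B_def)
  have cC: "size (filter_mset (\<lambda>l. l \<in> ball 0 5 - ?E) ?L) \<le> n * (measure lborel (ball 0 1 \<inter> (ball 0 5 - ?E)) / pi + 6200 * \<eta>)"
    unfolding B_def using lay(2) L n1 by (intro count) (auto simp: B_def)
  have mE: "measure lborel (ball 0 1 \<inter> ?E) / pi = k / J\<^sup>2"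
    using measure_spiral_index_less[OF J k] disc by (simp add: Int_absorb1)
  have "ball 0 1 \<inter> (ball 0 5 - ?E) = ball 0 1 - ?E" by auto
  then have "measure lborel (ball 0 1 \<inter> (ball 0 5 - ?E)) = measure lborel (ball (0::complex) 1) - measure lborel ?E"
    using disc by (simp add: measure_Diff emeasure_lborel_disc)
  then have mC: "measure lborel (ball 0 1 \<inter> (ball 0 5 - ?E)) / pi = 1 - k / J\<^sup>2"
    by (simp add: measure_disc measure_spiral_index_less[OF J k] diff_divide_distrib)
  have "filter_mset (\<lambda>l. l \<in> ball 0 5 - ?E) ?L = filter_mset (\<lambda>l. \<not> l \<in> ?E) ?L"
    using L by (intro filter_mset_cong refl) force
  then have "size (filter_mset (\<lambda>l. l \<in> ?E) ?L) + size (filter_mset (\<lambda>l. l \<in> ball 0 5 - ?E) ?L) = size ?L"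
    by (metis multiset_partition size_union)
  then have tot: "real (size (filter_mset (\<lambda>l. l \<in> ball 0 5 - ?E) ?L)) = n - real (size (filter_mset (\<lambda>l. l \<in> ?E) ?L))"
    using size_eigenvalues_mset[OF B] by linarith
  let ?m = "measure (empirical_spectral_measure B) ?E"
  have m: "real (size (filter_mset (\<lambda>l. l \<in> ?E) ?L)) = n * ?m"
    using measure_empirical_spectral_measure[OF B n1, of ?E] n by simp
  have "real n * ?m \<le> real n * (k / J\<^sup>2 + 6200 * \<eta>)" using cE unfolding m mE .
  then have "?m \<le> k / J\<^sup>2 + 6200 * \<eta>" using n by (simp add: mult_le_cancel_left_pos)
  moreover have "real n * (1 - ?m) \<le> real n * (1 - k / J\<^sup>2 + 6200 * \<eta>)"
    using cC unfolding tot m mC by (simp add: right_diff_distrib)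
  then have "1 - ?m \<le> 1 - k / J\<^sup>2 + 6200 * \<eta>" using n by (simp add: mult_le_cancel_left_pos)
  ultimately show ?thesis by (simp add: abs_le_iff)
qed

lemma prob_space_empirical_spectral_measure: "prob_space (empirical_spectral_measure A)"
  unfolding empirical_spectral_measure_def by (intro prob_space.prob_space_distr prob_space_measure_pmf) simp

lemma AE_empirical_spectral_measure:
  assumes A: "A \<in> carrier_mat n n" and n: "n \<ge> 1" and P: "Measurable.pred borel P" "\<And>l. l \<in># eigenvalues_mset A \<Longrightarrow> P l"
  shows "AE w in empirical_spectral_measure A. P w"
proof -
  have "eigenvalues_mset A \<noteq> {#}" using size_eigenvalues_mset[OF A] n by auto
  then show ?thesis
    unfolding empirical_spectral_measure_def using P by (subst AE_distr_iff) (auto simp: AE_measure_pmf_iff)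
qed

lemma prob_space_uniform_disc_measure: "prob_space uniform_disc_measure"
  unfolding uniform_disc_measure_def by (intro prob_space_uniform_measure) (auto simp: emeasure_lborel_disc)

lemma measure_uniform_disc_measure:
  assumes "S \<in> sets borel" "S \<subseteq> cball 0 1"
  shows "measure uniform_disc_measure S = measure lborel S / pi"
  using assms unfolding uniform_disc_measure_def
  by (subst measure_uniform_measure) (auto simp: emeasure_lborel_disc measure_def Int_absorb1)

lemma AE_uniform_disc_measure: "AE z in uniform_disc_measure. cmod z < 1"
proof -
  have "AE z::complex in lborel. z \<notin> sphere 0 1"
    using negligible_sphere[of "0::complex" 1] by (intro AE_not_in) (simp add: negligible_iff_null_sets null_sets_completion_iff)
  then show ?thesis
    unfolding uniform_disc_measure_def by (intro AE_uniform_measureI) (auto elim!: eventually_mono)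
qed

text \<open>The quantile coupling moves mass between cells whose numbers differ by at most \<open>J\<^sup>2 d + 1\<close>. The mass
  outside the disc is at most \<open>d\<close>, and it is moved by at most 5.\<close>

lemma transport_cost_le:
  fixes \<mu> :: "complex measure"
  assumes \<mu>: "prob_space \<mu>" "sets \<mu> = sets borel" "AE w in \<mu>. cmod w < 4" and J: "J > 0" and p: "p \<ge> 1"
    and d: "\<And>k. k \<le> J\<^sup>2 \<Longrightarrow> \<bar>measure \<mu> {w. spiral_index J w < k} - k / J\<^sup>2\<bar> \<le> d"
  shows "transport_cost p \<mu> uniform_disc_measure \<le> ennreal ((10 * (J\<^sup>2 * d + 2) / J) powr p + 5 powr p * d)"
proof -
  let ?\<nu> = uniform_disc_measure and ?f = "spiral_index J" and ?N = "J\<^sup>2"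
  interpret \<mu>: prob_space \<mu> by fact
  interpret \<nu>: prob_space ?\<nu> by (rule prob_space_uniform_disc_measure)
  have s\<nu>: "sets ?\<nu> = sets borel" by (simp add: uniform_disc_measure_def)
  have sp: "space \<mu> = UNIV" using sets_eq_imp_space_eq[OF \<mu>(2)] by simp
  have d0: "d \<ge> 0" using d[of 0] by simp
  have cell[measurable]: "{w. ?f w < k} \<in> sets borel" for k by measurable
  have \<nu>k: "measure ?\<nu> {w. ?f w < k} = k / ?N" if k: "k \<le> ?N" for k
  proof -
    have "{w. ?f w < k} \<subseteq> cball 0 1" using k by (auto simp: spiral_index_def Let_def split: if_splits)
    then show ?thesis using measure_uniform_disc_measure[OF cell] measure_spiral_index_less[OF J k] by simp
  qed
  have fN: "?f w < Suc ?N" for w using spiral_index_le[of J w] by simp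
  obtain \<pi> where \<pi>: "\<pi> \<in> couplings \<mu> ?\<nu>" and ae: "AE (w, z) in \<pi>.
    measure \<mu> {x. ?f x < ?f w} < measure ?\<nu> {x. ?f x < Suc (?f z)} \<and> measure ?\<nu> {x. ?f x < ?f z} < measure \<mu> {x. ?f x < Suc (?f w)}"
    using ex_quantile_coupling[OF \<mu>(1,2) \<nu>.prob_space_axioms s\<nu> spiral_index_measurable spiral_index_measurable fN fN] by blast
  have sets_\<pi>: "sets \<pi> = sets borel" and marg: "distr \<pi> borel fst = \<mu>" "distr \<pi> borel snd = ?\<nu>" and prob_\<pi>: "prob_space \<pi>"
    using \<pi> by (auto simp: couplings_def)
  have fm: "fst \<in> \<pi> \<rightarrow>\<^sub>M borel" "snd \<in> \<pi> \<rightarrow>\<^sub>M borel"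
    by (auto simp: measurable_cong_sets[OF sets_\<pi> refl] borel_measurable_continuous_onI continuous_on_fst continuous_on_snd)
  have ae1: "AE p in \<pi>. cmod (fst p) < 4" using \<mu>(3) unfolding marg(1)[symmetric] by (rule AE_distrD[OF fm(1)])
  have ae2: "AE p in \<pi>. cmod (snd p) < 1" using AE_uniform_disc_measure unfolding marg(2)[symmetric] by (rule AE_distrD[OF fm(2)])
  define outer where "outer = {w::complex. cmod w \<ge> 1}"
  have [measurable]: "outer \<in> sets borel" unfolding outer_def by measurable
  define C where "C = (10 * (?N * d + 2) / J) powr p"
  have bound: "AE q in \<pi>. ennreal (cmod (fst q - snd q) powr p) \<le> ennreal C + ennreal (5 powr p) * indicator outer (fst q)"
    using ae1 ae2 ae
  proof eventually_elim
    case (elim q)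
    obtain w z where q: "q = (w, z)" by force
    note e = elim[unfolded q, simplified]
    have fz: "?f z < ?N" using spiral_index_le[of J z] spiral_index_eq_outer[OF J, of z] e(2) by (auto simp: less_le)
    show ?case
    proof (cases "cmod w < 1")
      case False
      have "cmod (w - z) \<le> 5" using norm_triangle_ineq4[of w z] e by simp
      then have "ennreal (cmod (w - z) powr p) \<le> ennreal (5 powr p)" using p by (intro ennreal_leI powr_mono2) auto
      then show ?thesis using False q by (simp add: outer_def add_increasing)
    next
      case True
      have fw: "?f w < ?N" using spiral_index_le[of J w] spiral_index_eq_outer[OF J, of w] True by (auto simp: less_le)
      have N0: "real ?N > 0" using J by simp
      have "?f w / ?N - d < Suc (?f z) / ?N"
        using d[of "?f w"] \<nu>k[of "Suc (?f z)"] e(3) fw fz by (simp add: abs_le_iff)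
      then have 1: "real (?f w) - ?f z \<le> ?N * d + 1"
        using N0 by (simp add: field_simps del: of_nat_power)
      have "?f z / ?N < Suc (?f w) / ?N + d"
        using d[of "Suc (?f w)"] \<nu>k[of "?f z"] e(3) fw fz by (simp add: abs_le_iff)
      then have 2: "real (?f z) - ?f w \<le> ?N * d + 1"
        using N0 by (simp add: field_simps del: of_nat_power)
      have "cmod (w - z) \<le> 10 * (?N * d + 2) / J"
      proof (cases "?f w \<le> ?f z")
        case le: True
        have "cmod (w - z) \<le> 10 * (real (?f z) - ?f w + 1) / J"
          by (rule dist_le_spiral_index_diff[OF J True e(2) le])
        also have "\<dots> \<le> 10 * (?N * d + 2) / J" using 2 by (intro divide_right_mono mult_left_mono) auto
        finally show ?thesis .
      next
        case False
        have "cmod (w - z) = cmod (z - w)" by (rule norm_minus_commute)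
        also have "\<dots> \<le> 10 * (real (?f w) - ?f z + 1) / J"
          using False by (intro dist_le_spiral_index_diff[OF J e(2) True]) simp
        also have "\<dots> \<le> 10 * (?N * d + 2) / J" using 1 by (intro divide_right_mono mult_left_mono) auto
        finally show ?thesis .
      qed
      then have "ennreal (cmod (w - z) powr p) \<le> ennreal C" unfolding C_def using p by (intro ennreal_leI powr_mono2) auto
      then show ?thesis using q by (simp add: add_increasing2)
    qed
  qed
  have "(\<integral>\<^sup>+q. ennreal (cmod (fst q - snd q) powr p) \<partial>\<pi>) \<le> (\<integral>\<^sup>+q. ennreal C + ennreal (5 powr p) * indicator outer (fst q) \<partial>\<pi>)"
    using bound by (rule nn_integral_mono_AE)
  also have "\<dots> = (\<integral>\<^sup>+w. ennreal C + ennreal (5 powr p) * indicator outer w \<partial>distr \<pi> borel fst)"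
    using fm(1) by (subst nn_integral_distr) auto
  also have "\<dots> = ennreal C + ennreal (5 powr p) * emeasure \<mu> outer"
    unfolding marg using \<mu>.emeasure_space_1 by (subst nn_integral_add) (auto simp: \<mu>(2) nn_integral_cmult_indicator measurable_cong_sets[OF \<mu>(2) refl])
  also have "emeasure \<mu> outer \<le> ennreal d"
  proof -
    have "outer = space \<mu> - {w. ?f w < ?N}"
      using spiral_index_eq_outer[OF J] spiral_index_le[of J] sp by (auto simp: outer_def less_le)
    then have "measure \<mu> outer = 1 - measure \<mu> {w. ?f w < ?N}" using cell \<mu>(2) by (simp add: \<mu>.prob_compl)
    then have "measure \<mu> outer \<le> d" using d[of ?N] J by (simp add: abs_le_iff)
    then show ?thesis by (simp add: \<mu>.emeasure_eq_measure ennreal_leI)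
  qed
  then have "ennreal C + ennreal (5 powr p) * emeasure \<mu> outer \<le> ennreal C + ennreal (5 powr p) * ennreal d"
    by (intro add_left_mono mult_left_mono) auto
  also have "\<dots> = ennreal (C + 5 powr p * d)" using d0 by (simp add: ennreal_mult C_def)
  finally have "(\<integral>\<^sup>+(w, z). ennreal (cmod (w - z) powr p) \<partial>\<pi>) \<le> ennreal (C + 5 powr p * d)" by (simp add: split_beta')
  then show ?thesis unfolding transport_cost_def C_def of_nat_power by (rule INF_lower2[OF \<pi>])
qed

lemma wasserstein_le:
  assumes "transport_cost p \<mu> \<rho> \<le> ennreal c" "c \<ge> 0" "p \<ge> 1"
  shows "wasserstein p \<mu> \<rho> \<le> ennreal (c powr (1 / p))"
proof -
  have "transport_cost p \<mu> \<rho> \<noteq> \<infinity>" using assms(1) by (auto simp: top_unique)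
  moreover have "enn2real (transport_cost p \<mu> \<rho>) \<le> c" using assms by (simp add: enn2real_leI)
  ultimately show ?thesis using assms by (auto simp: wasserstein_def intro!: ennreal_leI powr_mono2)
qed

text \<open>With \<open>d\<close> of order \<open>\<eta>\<close>, the choice \<open>J\<^sup>2 \<approx> 1 / \<eta>\<close> keeps \<open>J\<^sup>2 d\<close> bounded, so that the
  displacement inside the disc is of order \<open>1 / J \<approx> sqrt \<eta>\<close>. For \<open>p \<le> 2\<close> its contribution to the cost dominates. For \<open>p > 2\<close>
  the mass outside the disc dominates: it is of order \<open>\<eta>\<close>, and it is only known to lie at a bounded distance.\<close>

lemma wasserstein_empirical_spectral_measure_le:
  fixes A :: "complex mat" and n :: nat and p :: real
  defines "\<eta> \<equiv> sqrt (ln n / n)" and "B \<equiv> complex_of_real (1 / sqrt n) \<cdot>\<^sub>m A"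
  assumes A: "A \<in> carrier_mat n n" and n: "n \<ge> 3" and \<eta>: "\<eta> \<le> 1 / 4" and p: "p \<ge> 1"
    and L: "\<And>l. l \<in># eigenvalues_mset B \<Longrightarrow> cmod l < 4"
    and Y: "potential_defect n (entries n A) \<le> ennreal (real n ^ 3)"
  shows "wasserstein p (empirical_spectral_measure B) uniform_disc_measure
    \<le> ennreal (248080 * \<eta> powr (min (p / 2) 1 / p))"
proof -
  have B: "B \<in> carrier_mat n n" using A by (simp add: B_def)
  have \<eta>0: "\<eta> > 0" using n by (simp add: \<eta>_def)
  define s where "s = sqrt \<eta>"
  have s: "s > 0" "s \<le> 1 / 2" "s * s = \<eta>" using \<eta>0 \<eta> real_sqrt_le_mono[OF \<eta>] by (auto simp: s_def real_sqrt_divide)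
  define J where "J = nat \<lfloor>1 / s\<rfloor>"
  have s2: "2 \<le> 1 / s" using s by (simp add: field_simps)
  have J: "real J \<le> 1 / s" "1 / s - 1 < real J" unfolding J_def using s2 by linarith+
  have J0: "J > 0" using J s2 by linarith
  have "1 / (2 * s) \<le> 1 / s - 1" using s by (simp add: field_simps)
  then have J': "1 / (2 * s) \<le> real J" using J by linarith
  have "(real J)\<^sup>2 \<le> (1 / s)\<^sup>2" using J by (intro power_mono) auto
  also have "\<dots> = 1 / \<eta>" using s(3) by (simp add: power2_eq_square)
  finally have N\<eta>: "(real J)\<^sup>2 * (6200 * \<eta>) \<le> 6200" using \<eta>0 by (simp add: field_simps)
  have "10 * ((real J)\<^sup>2 * (6200 * \<eta>) + 2) / J \<le> 10 * (6200 + 2) / (1 / (2 * s))"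
    using N\<eta> J' s by (intro frac_le) auto
  then have disp: "10 * ((real J)\<^sup>2 * (6200 * \<eta>) + 2) / J \<le> 124040 * s" by simp
  define e where "e = min (p / 2) 1"
  have e: "e \<le> p / 2" "e \<le> 1" "e > 0" using p by (auto simp: e_def)
  have "(10 * ((real J)\<^sup>2 * (6200 * \<eta>) + 2) / J) powr p \<le> (124040 * s) powr p"
    using disp p \<eta>0 by (intro powr_mono2) auto
  also have "\<dots> = 124040 powr p * \<eta> powr (p / 2)"
    using s \<eta>0 by (simp add: powr_mult s_def powr_half_sqrt[symmetric] powr_powr)
  also have "\<dots> \<le> 124040 powr p * \<eta> powr e" using e \<eta> \<eta>0 by (intro mult_left_mono powr_mono') auto
  finally have inner: "(10 * ((real J)\<^sup>2 * (6200 * \<eta>) + 2) / J) powr p \<le> 124040 powr p * \<eta> powr e" .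
  have "5 powr p * (6200 * \<eta>) \<le> 5 powr p * (6200 powr p * \<eta> powr e)"
    using p e \<eta> \<eta>0 powr_mono[of 1 p "6200 :: real"] powr_mono'[of e 1 \<eta>] by (intro mult_left_mono mult_mono) auto
  also have "\<dots> = (5 * 6200) powr p * \<eta> powr e" by (simp only: powr_mult mult.assoc)
  also have "\<dots> \<le> 124040 powr p * \<eta> powr e" using p by (intro mult_right_mono powr_mono2) auto
  finally have "(10 * ((real J)\<^sup>2 * (6200 * \<eta>) + 2) / J) powr p + 5 powr p * (6200 * \<eta>) \<le> 2 * 124040 powr p * \<eta> powr e"
    using inner by linarith
  also have "\<dots> \<le> 2 powr p * 124040 powr p * \<eta> powr e"
    using powr_mono[of 1 p "2 :: real"] p by (intro mult_right_mono) auto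
  also have "\<dots> = (2 * 124040) powr p * \<eta> powr e" by (simp only: powr_mult)
  finally have cost: "(10 * ((real J)\<^sup>2 * (6200 * \<eta>) + 2) / J) powr p + 5 powr p * (6200 * \<eta>) \<le> 248080 powr p * \<eta> powr e"
    by simp
  have "transport_cost p (empirical_spectral_measure B) uniform_disc_measure
      \<le> ennreal ((10 * ((real J)\<^sup>2 * (6200 * \<eta>) + 2) / J) powr p + 5 powr p * (6200 * \<eta>))"
  proof (rule transport_cost_le[OF prob_space_empirical_spectral_measure _ _ J0 p])
    show "sets (empirical_spectral_measure B) = sets borel" by (simp add: empirical_spectral_measure_def)
    show "AE w in empirical_spectral_measure B. cmod w < 4"
      using n L by (intro AE_empirical_spectral_measure[OF B]) auto
    show "\<bar>measure (empirical_spectral_measure B) {w. spiral_index J w < k} - k / (real J)\<^sup>2\<bar> \<le> 6200 * \<eta>" if "k \<le> J\<^sup>2" for k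
      unfolding \<eta>_def B_def using spiral_discrepancy[OF A n \<eta>[unfolded \<eta>_def] L[unfolded B_def] Y J0 that] by simp
  qed
  also have "\<dots> \<le> ennreal (248080 powr p * \<eta> powr e)" using cost by (intro ennreal_leI) simp
  finally have "wasserstein p (empirical_spectral_measure B) uniform_disc_measure
      \<le> ennreal ((248080 powr p * \<eta> powr e) powr (1 / p))" using p by (intro wasserstein_le) auto
  also have "(248080 powr p * \<eta> powr e) powr (1 / p) = 248080 * \<eta> powr (e / p)"
    using p by (simp add: powr_mult powr_powr)
  finally show ?thesis by (simp add: e_def)
qed

theorem theorem2:
  fixes p :: real
  assumes "p \<ge> 1"
  shows "\<exists>K>0. \<forall>(M :: 'a measure) (G :: nat \<Rightarrow> 'a \<Rightarrow> complex mat).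
    prob_space M \<longrightarrow> (\<forall>n\<ge>1. ginibre_matrix M n (G n)) \<longrightarrow>
    (AE \<omega> in M. \<forall>\<^sub>F n in sequentially.
       (p \<le> 2 \<longrightarrow>
          wasserstein p
            (empirical_spectral_measure (complex_of_real (1 / sqrt (real n)) \<cdot>\<^sub>m G n \<omega>))
            uniform_disc_measure
          \<le> ennreal (K * (sqrt (ln (real n)) / real n powr (1 / 4)))) \<and>
       (p > 2 \<longrightarrow>
          wasserstein p
            (empirical_spectral_measure (complex_of_real (1 / sqrt (real n)) \<cdot>\<^sub>m G n \<omega>))
            uniform_disc_measure
          \<le> ennreal (K * (ln (real n) / real n) powr (1 / (2 * p)))))"
proof (intro exI[of _ 248080] conjI allI impI)
  fix M :: "'a measure" and G :: "nat \<Rightarrow> 'a \<Rightarrow> complex mat"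
  assume M: "prob_space M" and "\<forall>n\<ge>1. ginibre_matrix M n (G n)"
  then have G: "ginibre_matrix M n (G n)" if "n \<ge> 1" for n using that by blast
  have defect: "AE \<omega> in M. \<forall>\<^sub>F n in sequentially. potential_defect n (entries n (G n \<omega>)) \<le> ennreal (real n ^ 3)"
    by (rule AE_eventually_potential_defect[OF M G])
  have radius: "AE \<omega> in M. \<forall>\<^sub>F n in sequentially. \<forall>l\<in>#eigenvalues_mset (of_real (1 / sqrt n) \<cdot>\<^sub>m G n \<omega>). cmod l < 4"
    by (rule AE_eventually_eigenvalues_bounded[OF M G])
  let ?W = "\<lambda>n \<omega>. wasserstein p (empirical_spectral_measure (complex_of_real (1 / sqrt (real n)) \<cdot>\<^sub>m G n \<omega>))
    uniform_disc_measure"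
  have small: "\<forall>\<^sub>F n::nat in sequentially. sqrt (ln n / n) \<le> 1 / 4"
  proof -
    have "(\<lambda>n::nat. sqrt (ln n / n)) \<longlonglongrightarrow> 0" by real_asymp
    from order_tendstoD(2)[OF this, of "1 / 4"] show ?thesis by (auto elim: eventually_mono)
  qed
  show "AE \<omega> in M. \<forall>\<^sub>F n in sequentially.
      (p \<le> 2 \<longrightarrow> ?W n \<omega> \<le> ennreal (248080 * (sqrt (ln (real n)) / real n powr (1 / 4)))) \<and>
      (p > 2 \<longrightarrow> ?W n \<omega> \<le> ennreal (248080 * (ln (real n) / real n) powr (1 / (2 * p))))"
    using defect radius AE_space
  proof eventually_elim
    case (elim \<omega>)
    from elim(1,2) small eventually_ge_at_top[of 3] show ?case
    proof eventually_elim
      case (elim n)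
      let ?\<eta> = "sqrt (ln n / n)"
      have A: "G n \<omega> \<in> carrier_mat n n" using G[of n] \<open>n \<ge> 3\<close> \<open>\<omega> \<in> space M\<close> by (auto simp: ginibre_matrix_def)
      have W: "?W n \<omega> \<le> ennreal (248080 * ?\<eta> powr (min (p / 2) 1 / p))"
        using elim assms by (intro wasserstein_empirical_spectral_measure_le[OF A]) auto
      have ln1: "ln n \<ge> 1" using \<open>n \<ge> 3\<close> exp_le by (subst ln_ge_iff) (auto intro: order_trans)
      have \<eta>: "?\<eta> powr x = (ln n / n) powr (x / 2)" for x
        using ln1 by (simp add: powr_half_sqrt[symmetric] powr_powr)
      show ?case
      proof (intro conjI impI)
        assume "p \<le> 2"
        then have e: "min (p / 2) 1 / p = 1 / 2" using assms by simp
        have "(ln n / n) powr (1 / 4) = ln n powr (1 / 4) / n powr (1 / 4)" using ln1 by (simp add: powr_divide)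
        also have "\<dots> \<le> ln n powr (1 / 2) / n powr (1 / 4)" using ln1 by (intro divide_right_mono powr_mono) auto
        also have "\<dots> = sqrt (ln n) / n powr (1 / 4)" using ln1 by (simp add: powr_half_sqrt)
        finally show "?W n \<omega> \<le> ennreal (248080 * (sqrt (ln (real n)) / real n powr (1 / 4)))"
          using W unfolding e \<eta> by (elim order_trans) (auto intro!: ennreal_leI)
      next
        assume "p > 2"
        then show "?W n \<omega> \<le> ennreal (248080 * (ln (real n) / real n) powr (1 / (2 * p)))"
          using W unfolding \<eta> by (simp add: mult.commute)
      qed
    qed
  qed
qed simp

end
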